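(* Let $\Omega\subset\mathbb{R}^N$, $N\ge 2$, be an open bounded domain, let $1<q<p<s<p^*$, and let $A:\Omega\times\mathbb{R}\times\mathbb{R}^N\to\mathbb{R}$, with $A_t=\partial A/\partial t$ and $a=\nabla_\xi A$, satisfy the following conditions. $(H_0)$ $A(\cdot,t,\xi)$ is measurable for all $(t,\xi)\in\mathbb{R}\times\mathbb{R}^N$ and $A(x,\cdot,\cdot)$ is $C^1$ for a.e. $x\in\Omega$. $(H_1)$ There exist positive continuous functions $\Phi_1,\phi_1,\Phi_2,\phi_2:\mathbb{R}\to\mathbb{R}$ such that for a.e. $x\in\Omega$ and all $(t,\xi)\in\mathbb{R}\times\mathbb{R}^N$: $|A_t(x,t,\xi)|\le \Phi_1(t)+\phi_1(t)|\xi|^p$ and $|a(x,t,\xi)|\le\Phi_2(t)+\phi_2(t)|\xi|^{p-1}$. $(H_2)$ There is $\alpha_1>0$ such that $A(x,t,\xi)\ge\alpha_1|\xi|^p$ for a.e. $x\in\Omega$ and all $(t,\xi)\in\mathbb{R}\times\mathbb{R}^N$. $(H_3)$ There is $\eta_1>0$ such that $A(x,t,\xi)\le\eta_1\,a(x,t,\xi)\cdot\xi$ for a.e. $x\in\Omega$ and all $(t,\xi)\in\mathbb{R}\times\mathbb{R}^N$. $(H_4)$ There is $\alpha_2>0$ such that $a(x,t,\xi)\cdot\xi+A_t(x,t,\xi)t\ge\alpha_2\,a(x,t,\xi)\cdot\xi$ for a.e. $x\in\Omega$ and all $(t,\xi)\in\mathbb{R}\times\mathbb{R}^N$. $(H_5)$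 There are $\eta_2,\delta>0$ such that $A(x,t,\xi)\le\eta_2|\xi|^p$ for a.e. $x\in\Omega$ and all $(t,\xi)\in\mathbb{R}\times\mathbb{R}^N$ with $|t|\le\delta$. $(H_6)$ For all $\xi,\xi^*\in\mathbb{R}^N$ with $\xi\ne\xi^*$, $[a(x,t,\xi)-a(x,t,\xi^* )]\cdot[\xi-\xi^*]>0$ for a.e. $x\in\Omega$ and all $t\in\mathbb{R}$. Then there exists $\lambda_1>0$ such that for every $\lambda\in(0,\lambda_1]$ the problem $$-\operatorname{div}(a(x,u,\nabla u))+A_t(x,u,\nabla u)=\lambda|u|^{q-2}u+|u|^{s-2}u\ \text{ in }\Omega,\qquad u=0\ \text{ on }\partial\Omega,$$ has at least two weak bounded solutions, one positive and one negative.
   Context: Here $p^*=\frac{Np}{N-p}$ if $N>p$ and $p^*=+\infty$ if $N\le p$. Set $X=W_0^{1,p}(\Omega)\cap L^\infty(\Omega)$. A weak bounded solution of the problem is a function $u\in X$ such that for all $v\in X$ $$\int_\Omega a(x,u,\nabla u)\cdot\nabla v\,dx+\int_\Omega A_t(x,u,\nabla u)v\,dx-\lambda\int_\Omega|u|^{q-2}uv\,dx-\int_\Omega|u|^{s-2}uv\,dx=0 .$$ A solution is called positive (resp. negative) if $u\not\equiv0$ and $u\ge0$ (resp. $u\le 0$) a.e. in $\Omega$. *)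

theory Defs
  imports "HOL-Analysis.Analysis"
begin

text \<open>Functions on \<open>\<Omega>\<close> are total functions on \<open>real ^ 'n\<close>. Measurability, integrals and
  almost-everywhere statements refer to \<open>lebesgue_on \<Omega>\<close>, so values outside \<open>\<Omega>\<close> are irrelevant.\<close>

definition grad :: "(real ^ 'n \<Rightarrow> real) \<Rightarrow> real ^ 'n \<Rightarrow> real ^ 'n" where
  "grad f x = (\<chi> i. frechet_derivative f (at x) (axis i 1))"

fun C_k :: "nat \<Rightarrow> (real ^ 'n \<Rightarrow> real) \<Rightarrow> bool" where
  "C_k 0 f \<longleftrightarrow> continuous_on UNIV f"
| "C_k (Suc k) f \<longleftrightarrow> (\<forall>x. f differentiable (at x)) \<and> (\<forall>i. C_k k (\<lambda>x. grad f x $ i))"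

definition test_function :: "(real ^ 'n) set \<Rightarrow> (real ^ 'n \<Rightarrow> real) \<Rightarrow> bool" where
  "test_function \<Omega> \<phi> \<longleftrightarrow>
     (\<forall>k. C_k k \<phi>) \<and> compact (closure {x. \<phi> x \<noteq> 0}) \<and> closure {x. \<phi> x \<noteq> 0} \<subseteq> \<Omega>"

definition loc_integrable ::
    "(real ^ 'n) set \<Rightarrow> (real ^ 'n \<Rightarrow> 'b::{banach, second_countable_topology}) \<Rightarrow> bool" where
  "loc_integrable \<Omega> f \<longleftrightarrow> (\<forall>K. compact K \<and> K \<subseteq> \<Omega> \<longrightarrow> integrable (lebesgue_on K) f)"

definition has_weak_grad ::
    "(real ^ 'n) set \<Rightarrow> (real ^ 'n \<Rightarrow> real) \<Rightarrow> (real ^ 'n \<Rightarrow> real ^ 'n) \<Rightarrow> bool" where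
  "has_weak_grad \<Omega> u g \<longleftrightarrow>
     loc_integrable \<Omega> u \<and> loc_integrable \<Omega> g \<and>
     (\<forall>\<phi>. test_function \<Omega> \<phi> \<longrightarrow>
        (LINT x|lebesgue_on \<Omega>. u x *\<^sub>R grad \<phi> x) = - (LINT x|lebesgue_on \<Omega>. \<phi> x *\<^sub>R g x))"

text \<open>Weak gradients are unique only almost everywhere on \<open>\<Omega>\<close>; this picks a representative.\<close>

definition weak_grad :: "(real ^ 'n) set \<Rightarrow> (real ^ 'n \<Rightarrow> real) \<Rightarrow> real ^ 'n \<Rightarrow> real ^ 'n" where
  "weak_grad \<Omega> u = (SOME g. has_weak_grad \<Omega> u g)"

definition Lp :: "(real ^ 'n) set \<Rightarrow> real \<Rightarrow> (real ^ 'n \<Rightarrow> 'b::real_normed_vector) set" where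
  "Lp \<Omega> p = {f. f \<in> borel_measurable (lebesgue_on \<Omega>) \<and>
                 integrable (lebesgue_on \<Omega>) (\<lambda>x. norm (f x) powr p)}"

definition L_infty :: "(real ^ 'n) set \<Rightarrow> (real ^ 'n \<Rightarrow> real) set" where
  "L_infty \<Omega> = {f. f \<in> borel_measurable (lebesgue_on \<Omega>) \<and>
                    (\<exists>C. AE x in lebesgue_on \<Omega>. \<bar>f x\<bar> \<le> C)}"

definition W1p :: "(real ^ 'n) set \<Rightarrow> real \<Rightarrow> (real ^ 'n \<Rightarrow> real) set" where
  "W1p \<Omega> p = {u \<in> Lp \<Omega> p. \<exists>g \<in> Lp \<Omega> p. has_weak_grad \<Omega> u g}"

definition W1p_norm :: "(real ^ 'n) set \<Rightarrow> real \<Rightarrow> (real ^ 'n \<Rightarrow> real) \<Rightarrow> real" where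
  "W1p_norm \<Omega> p u =
     ((LINT x|lebesgue_on \<Omega>. \<bar>u x\<bar> powr p)
      + (LINT x|lebesgue_on \<Omega>. norm (weak_grad \<Omega> u x) powr p)) powr (1 / p)"

definition W1p_0 :: "(real ^ 'n) set \<Rightarrow> real \<Rightarrow> (real ^ 'n \<Rightarrow> real) set" where
  "W1p_0 \<Omega> p =
     {u \<in> W1p \<Omega> p. \<forall>\<epsilon>>0. \<exists>\<phi>. test_function \<Omega> \<phi> \<and> W1p_norm \<Omega> p (\<lambda>x. u x - \<phi> x) < \<epsilon>}"

definition X_space :: "(real ^ 'n) set \<Rightarrow> real \<Rightarrow> (real ^ 'n \<Rightarrow> real) set" where
  "X_space \<Omega> p = W1p_0 \<Omega> p \<inter> L_infty \<Omega>"

definition critical_exponent :: "nat \<Rightarrow> real \<Rightarrow> ereal" where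
  "critical_exponent N p = (if real N > p then ereal (real N * p / (real N - p)) else \<infinity>)"

definition C1 :: "('a::real_normed_vector \<Rightarrow> real) \<Rightarrow> bool" where
  "C1 f \<longleftrightarrow> (\<exists>f' :: 'a \<Rightarrow> 'a \<Rightarrow>\<^sub>L real.
     (\<forall>z. (f has_derivative blinfun_apply (f' z)) (at z)) \<and> continuous_on UNIV f')"

definition A_t :: "(real ^ 'n \<Rightarrow> real \<Rightarrow> real ^ 'n \<Rightarrow> real) \<Rightarrow> real ^ 'n \<Rightarrow> real \<Rightarrow> real ^ 'n \<Rightarrow> real" where
  "A_t A x t \<xi> = deriv (\<lambda>\<tau>. A x \<tau> \<xi>) t"

definition A_xi ::
    "(real ^ 'n \<Rightarrow> real \<Rightarrow> real ^ 'n \<Rightarrow> real) \<Rightarrow> real ^ 'n \<Rightarrow> real \<Rightarrow> real ^ 'n \<Rightarrow> real ^ 'n" where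
  "A_xi A x t \<xi> = grad (\<lambda>\<zeta>. A x t \<zeta>) \<xi>"

text \<open>Since the Bochner integral of a non-integrable function is \<open>0\<close>, integrability of the four
  integrands is required explicitly.\<close>

definition weak_bounded_solution ::
    "(real ^ 'n) set \<Rightarrow> real \<Rightarrow> real \<Rightarrow> real \<Rightarrow> (real ^ 'n \<Rightarrow> real \<Rightarrow> real ^ 'n \<Rightarrow> real) \<Rightarrow> real
      \<Rightarrow> (real ^ 'n \<Rightarrow> real) \<Rightarrow> bool" where
  "weak_bounded_solution \<Omega> p q s A lam u \<longleftrightarrow>
     u \<in> X_space \<Omega> p \<and>
     (\<forall>v \<in> X_space \<Omega> p.
        integrable (lebesgue_on \<Omega>) (\<lambda>x. A_xi A x (u x) (weak_grad \<Omega> u x) \<bullet> weak_grad \<Omega> v x) \<and>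
        integrable (lebesgue_on \<Omega>) (\<lambda>x. A_t A x (u x) (weak_grad \<Omega> u x) * v x) \<and>
        integrable (lebesgue_on \<Omega>) (\<lambda>x. \<bar>u x\<bar> powr (q - 2) * u x * v x) \<and>
        integrable (lebesgue_on \<Omega>) (\<lambda>x. \<bar>u x\<bar> powr (s - 2) * u x * v x) \<and>
        (LINT x|lebesgue_on \<Omega>. A_xi A x (u x) (weak_grad \<Omega> u x) \<bullet> weak_grad \<Omega> v x)
        + (LINT x|lebesgue_on \<Omega>. A_t A x (u x) (weak_grad \<Omega> u x) * v x)
        - lam * (LINT x|lebesgue_on \<Omega>. \<bar>u x\<bar> powr (q - 2) * u x * v x)
        - (LINT x|lebesgue_on \<Omega>. \<bar>u x\<bar> powr (s - 2) * u x * v x) = 0)"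

definition positive_on :: "(real ^ 'n) set \<Rightarrow> (real ^ 'n \<Rightarrow> real) \<Rightarrow> bool" where
  "positive_on \<Omega> u \<longleftrightarrow>
     \<not> (AE x in lebesgue_on \<Omega>. u x = 0) \<and> (AE x in lebesgue_on \<Omega>. u x \<ge> 0)"

definition negative_on :: "(real ^ 'n) set \<Rightarrow> (real ^ 'n \<Rightarrow> real) \<Rightarrow> bool" where
  "negative_on \<Omega> u \<longleftrightarrow>
     \<not> (AE x in lebesgue_on \<Omega>. u x = 0) \<and> (AE x in lebesgue_on \<Omega>. u x \<le> 0)"

end

theory Submission
  imports Defs "HOL-Computational_Algebra.Polynomial" "HOL-Complex_Analysis.Great_Picard"
begin

text \<open>No mountain pass is needed. Minimise \<open>\<integral> A(x, u, \<nabla>u) - \<lambda>/q \<integral> (u\<^sup>+)\<^sup>q - 1/s \<integral> (u\<^sup>+)\<^sup>s\<close> over all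
  \<open>u \<in> W\<^sub>0\<close> with \<open>\<bar>u\<bar> \<le> K\<close>. A minimiser exists by compactness and convexity in the gradient. Pulling
  \<open>u\<close> towards its truncations stays admissible, so \<open>(H\<^sub>4)\<close> gives
  \<open>c \<integral> \<bar>\<nabla>(u - k)\<^sup>+\<bar>\<^sup>p \<le> F \<integral> (u - k)\<^sup>+\<close> with \<open>F = \<lambda>K\<^sup>q\<^sup>-\<^sup>1 + K\<^sup>s\<^sup>-\<^sup>1\<close>, and Stampacchia's argument yields
  \<open>u \<le> C F\<^sup>1\<^sup>/\<^sup>(\<^sup>p\<^sup>-\<^sup>1\<^sup>)\<close>. As \<open>p < s\<close>, this is less than \<open>K\<close> for small \<open>K\<close> and then small \<open>\<lambda>\<close>, so the
  constraint is inactive and the Euler-Lagrange equation holds. Testing with \<open>u\<^sup>-\<close> shows \<open>u \<ge> 0\<close>, and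
  \<open>q < p\<close> makes the energy negative at small bumps, so \<open>u \<noteq> 0\<close>. The negative solution comes from the
  same functional with \<open>u\<^sup>+\<close> replaced by \<open>(-u)\<^sup>+\<close>.\<close>

section \<open>Smooth functions\<close>

text \<open>The obstacle is that \<open>A_t\<close> may grow like the p-th power of the gradient,
  with coefficients depending on u: on all of \<open>W0\<close> the energy need not be finite, and
  it can be differentiated only along bounded functions. The bound |u| <= K repairs both, at a
  price: minimality yields one-sided inequalities until the constraint is known to be inactive.
  Truncation directions can be used before that because they lower |u|, and where they act they are
  theta * u with 0 <= theta <= 1, the form that (H4) controls. Several classical tools are replaced
  by elementary estimates. Averages over small cubes stand for the inequalities of Sobolev and
  Poincare and drive the compactness argument; near-minimisers of the gradient norm over iterated
  midpoints of tails stand for weak compactness; the inequality a <= c + c^(1-p) a^p with a free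
  threshold c stands for Hoelder's inequality. The constants balance because the supremum bound
  scales like F^(1/(p-1)): K makes K^(s-1) a small multiple of K^(p-1), and the range of \<lambda>
  does the same for \<lambda> K^(q-1).\<close>

definition smooth_real :: "(real \<Rightarrow> real) \<Rightarrow> bool" where
  "smooth_real f \<longleftrightarrow> (\<exists>D. D 0 = f \<and> (\<forall>k x. (D k has_real_derivative D (Suc k) x) (at x)))"

lemma smooth_real_antiderivative:
  assumes "smooth_real f'" "\<And>x. (f has_real_derivative f' x) (at x)"
  shows "smooth_real f"
proof -
  obtain D where D: "D 0 = f'" "\<And>k x. (D k has_real_derivative D (Suc k) x) (at x)"
    using assms(1) unfolding smooth_real_def by blast
  show ?thesis
    unfolding smooth_real_def
    by (rule exI[of _ "case_nat f D"]) (auto simp: D assms(2) split: nat.split)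
qed

lemma smooth_real_derivative:
  assumes "smooth_real f"
  obtains f' where "smooth_real f'" "\<And>x. (f has_real_derivative f' x) (at x)"
proof -
  obtain D where D: "D 0 = f" "\<And>k x. (D k has_real_derivative D (Suc k) x) (at x)"
    using assms unfolding smooth_real_def by blast
  have "smooth_real (D 1)"
    unfolding smooth_real_def by (rule exI[of _ "\<lambda>k. D (Suc k)"]) (auto simp: D)
  thus thesis using D(2)[of 0] D(1) that by auto
qed

lemma smooth_real_affine:
  assumes "smooth_real f"
  shows "smooth_real (\<lambda>t. c * f (a * t + b))"
proof -
  obtain D where D: "D 0 = f" "\<And>k x. (D k has_real_derivative D (Suc k) x) (at x)"
    using assms unfolding smooth_real_def by blast
  have "((\<lambda>t. c * a ^ k * D k (a * t + b)) has_real_derivative c * a ^ Suc k * D (Suc k) (a * x + b)) (at x)"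
    for k x
    by (rule derivative_eq_intros DERIV_chain2[OF D(2)] refl | simp)+
  thus ?thesis
    unfolding smooth_real_def
    by (intro exI[of _ "\<lambda>k t. c * a ^ k * D k (a * t + b)"]) (auto simp: D(1))
qed

section \<open>The flat functions P(1/t) exp(-1/t)\<close>

definition flat :: "real poly \<Rightarrow> real \<Rightarrow> real" where
  "flat P t = (if t > 0 then poly P (1 / t) * exp (- (1 / t)) else 0)"

lemma poly_exp_tendsto_0: "((\<lambda>y. poly P y * exp (- y)) \<longlongrightarrow> 0) (at_top :: real filter)"
proof -
  have "((\<lambda>y::real. \<Sum>i\<le>degree P. coeff P i * (y ^ i / exp y)) \<longlongrightarrow> (\<Sum>i\<le>degree P. coeff P i * 0)) at_top"
    by (intro tendsto_sum tendsto_mult tendsto_const tendsto_power_div_exp_0)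
  thus ?thesis
    by (simp add: poly_altdef sum_distrib_right sum_divide_distrib exp_minus field_simps)
qed

lemma flat_tendsto_0: "(flat P \<longlongrightarrow> 0) (at 0)"
proof -
  have "((\<lambda>y. poly P (inverse y) * exp (- inverse y)) \<longlongrightarrow> 0) (at_right 0)"
    using filterlim_compose[OF poly_exp_tendsto_0[of P] filterlim_inverse_at_top_right] .
  hence r: "(flat P \<longlongrightarrow> 0) (at_right 0)"
    by (rule Lim_transform_eventually)
      (auto simp: flat_def inverse_eq_divide eventually_at_right_less intro!: eventually_at_rightI[of _ 1])
  have l: "(flat P \<longlongrightarrow> 0) (at_left 0)"
    by (rule Lim_transform_eventually[OF tendsto_const])
      (auto simp: flat_def intro!: eventually_at_leftI[of "-1"])
  show ?thesis using l r by (simp add: filterlim_split_at)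
qed

text \<open>With y = 1/t, differentiation multiplies by y^2 and replaces P by P - P'. The family is
  therefore closed under differentiation, and iterating this operator on polynomials lists all
  derivatives at once.\<close>

lemma DERIV_flat: "(flat P has_real_derivative flat ([:0, 0, 1:] * (P - pderiv P)) t) (at t)"
proof -
  consider "t > 0" | "t < 0" | "t = 0" by linarith
  thus ?thesis
  proof cases
    case 1
    have "((\<lambda>t. poly P (1 / t) * exp (- (1 / t))) has_real_derivative
        flat ([:0, 0, 1:] * (P - pderiv P)) t) (at t)"
      using 1
      by (auto intro!: derivative_eq_intros DERIV_chain2[OF poly_DERIV]
          simp: flat_def field_simps power2_eq_square)
    thus ?thesis
      by (rule has_field_derivative_transform_within_open[of _ _ _ "{0<..}"]) (use 1 in \<open>auto simp: flat_def\<close>)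
  next
    case 2
    show ?thesis
      by (rule has_field_derivative_transform_within_open[of "\<lambda>_. 0" _ _ "{..<0}"])
        (use 2 in \<open>auto simp: flat_def\<close>)
  next
    case 3
    \<comment> \<open>The difference quotient at 0 is again a flat function, with P multiplied by
      its variable, so it tends to 0.\<close>
    have "(\<lambda>h. (flat P (0 + h) - flat P 0) / h) = flat (pCons 0 P)"
      by (auto simp: fun_eq_iff flat_def)
    hence "(flat P has_real_derivative 0) (at 0)"
      unfolding DERIV_def using flat_tendsto_0[of "pCons 0 P"] by simp
    thus ?thesis using 3 by (simp add: flat_def)
  qed
qed

lemma smooth_real_flat: "smooth_real (flat P)"
  unfolding smooth_real_def
  by (rule exI[of _ "\<lambda>k. flat (((\<lambda>P. [:0, 0, 1:] * (P - pderiv P)) ^^ k) P)"])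
    (auto intro: DERIV_flat simp del: mult_pCons_left)

section \<open>Smooth approximations of the positive part\<close>

definition ramp :: "real \<Rightarrow> real" where
  "ramp t = t * flat 1 t"

lemma DERIV_ramp: "(ramp has_real_derivative flat [:1, 1:] t) (at t)"
proof -
  have "(ramp has_real_derivative flat 1 t + t * flat ([:0, 0, 1:] * (1 - pderiv 1)) t) (at t)"
    unfolding ramp_def by (rule derivative_eq_intros DERIV_flat refl | simp)+
  thus ?thesis by (rule back_subst[of "\<lambda>d. (ramp has_real_derivative d) (at t)"])
      (auto simp: flat_def field_simps)
qed

lemma flat_one_bounds: "0 \<le> flat 1 t" "flat 1 t \<le> 1"
  by (auto simp: flat_def)

lemma flat_one_pos_iff: "flat 1 t \<noteq> 0 \<longleftrightarrow> t > 0"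
  by (auto simp: flat_def)

lemma flat_ramp_bounds: "0 \<le> flat [:1, 1:] t" "flat [:1, 1:] t \<le> 2"
proof -
  have "(1 + 1 / t) * exp (- (1 / t)) \<le> 1" if "t > 0"
    using exp_ge_add_one_self[of "1 / t"] that by (simp add: exp_minus field_simps)
  thus "flat [:1, 1:] t \<le> 2" by (force simp: flat_def)
qed (auto simp: flat_def)

text \<open>For t > 0 the argument 1 / ((n+1) t) tends to 0, so only the constant coefficient of P
  survives. At t = 0 the value is 0 for every n, which fixes the strict inequality in the limit and
  later the strict inequality in the gradient of a truncation.\<close>

lemma flat_scaled_tendsto:
  assumes "poly P 0 = 1"
  shows "(\<lambda>n. flat P (real (Suc n) * t)) \<longlonglongrightarrow> (if t > 0 then 1 else 0)"
proof (cases "t > 0")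
  case True
  have "(\<lambda>n. (1 / t) * (1 / real (Suc n))) \<longlonglongrightarrow> (1 / t) * 0"
    using LIMSEQ_inverse_real_of_nat by (intro tendsto_intros) (simp add: inverse_eq_divide)
  hence *: "(\<lambda>n. 1 / (real (Suc n) * t)) \<longlonglongrightarrow> 0" by (simp add: mult.commute)
  have "(\<lambda>n. poly P (1 / (real (Suc n) * t)) * exp (- (1 / (real (Suc n) * t)))) \<longlonglongrightarrow> poly P 0 * exp (- 0)"
    by (intro tendsto_intros * isCont_tendsto_compose[OF poly_isCont])
  moreover have "flat P (real (Suc n) * t) = poly P (1 / (real (Suc n) * t)) * exp (- (1 / (real (Suc n) * t)))" for n
    using True by (simp add: flat_def)
  ultimately show ?thesis using assms True by simp
next
  case False
  hence "\<not> real (Suc n) * t > 0" for n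
    by (simp add: mult_le_0_iff not_less del: of_nat_Suc)
  hence "flat P (real (Suc n) * t) = 0" for n
    unfolding flat_def by presburger
  thus ?thesis using False by simp
qed

text \<open>Shrinking the graph of \<open>ramp\<close> by the factor n + 1 in both directions keeps
  the derivative within the same bounds while the profile sharpens to (t - k)^+. The argument is
  written as a * t + b to match \<open>smooth_real_affine\<close>.\<close>

definition smooth_ramp :: "real \<Rightarrow> nat \<Rightarrow> real \<Rightarrow> real" where
  "smooth_ramp k n t = (1 / real (Suc n)) * ramp (real (Suc n) * t + (- real (Suc n) * k))"

definition smooth_ramp' :: "real \<Rightarrow> nat \<Rightarrow> real \<Rightarrow> real" where
  "smooth_ramp' k n t = flat [:1, 1:] (real (Suc n) * (t - k))"

lemma smooth_real_smooth_ramp: "smooth_real (smooth_ramp k n)"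
proof -
  have "smooth_real ramp" by (rule smooth_real_antiderivative[OF smooth_real_flat DERIV_ramp])
  from smooth_real_affine[OF this] show ?thesis unfolding smooth_ramp_def .
qed

lemma DERIV_smooth_ramp: "(smooth_ramp k n has_real_derivative smooth_ramp' k n t) (at t)"
  unfolding smooth_ramp_def smooth_ramp'_def
  by (rule derivative_eq_intros DERIV_chain2[OF DERIV_ramp] refl | simp del: of_nat_Suc add: algebra_simps)+

lemma smooth_ramp_alt: "smooth_ramp k n t = (t - k) * flat 1 (real (Suc n) * (t - k))"
  by (simp add: smooth_ramp_def ramp_def algebra_simps del: of_nat_Suc)

lemma smooth_ramp'_bounds: "0 \<le> smooth_ramp' k n t" "smooth_ramp' k n t \<le> 2"
  using flat_ramp_bounds by (auto simp: smooth_ramp'_def)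

lemma smooth_ramp_tendsto: "(\<lambda>n. smooth_ramp k n t) \<longlonglongrightarrow> max 0 (t - k)"
proof -
  have "(\<lambda>n. (t - k) * flat 1 (real (Suc n) * (t - k))) \<longlonglongrightarrow> (t - k) * (if t - k > 0 then 1 else 0)"
    by (intro tendsto_intros flat_scaled_tendsto) simp
  thus ?thesis unfolding smooth_ramp_alt by (auto simp: max_def split: if_splits)
qed

lemma smooth_ramp'_tendsto: "(\<lambda>n. smooth_ramp' k n t) \<longlonglongrightarrow> (if t > k then 1 else 0)"
  using flat_scaled_tendsto[of "[:1, 1:]" "t - k"] by (simp add: smooth_ramp'_def)

lemma smooth_ramp_bounds:
  assumes "k \<ge> 0" shows "0 \<le> smooth_ramp k n t" "smooth_ramp k n t \<le> \<bar>t\<bar>"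
proof -
  have "flat 1 (real (Suc n) * (t - k)) = 0" if "t \<le> k"
    using that flat_one_pos_iff[of "real (Suc n) * (t - k)"] by (auto simp: zero_less_mult_iff simp del: of_nat_Suc)
  thus "0 \<le> smooth_ramp k n t" using flat_one_bounds(1)[of "real (Suc n) * (t - k)"]
    unfolding smooth_ramp_alt by (cases "t \<le> k") auto
  show "smooth_ramp k n t \<le> \<bar>t\<bar>"
  proof (cases "t \<le> k")
    case True
    thus ?thesis using \<open>t \<le> k \<Longrightarrow> flat 1 (real (Suc n) * (t - k)) = 0\<close> unfolding smooth_ramp_alt by simp
  next
    case False
    hence "(t - k) * flat 1 (real (Suc n) * (t - k)) \<le> (t - k) * 1"
      using flat_one_bounds by (intro mult_left_mono) auto
    also have "\<dots> \<le> \<bar>t\<bar>" using assms by simp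
    finally show ?thesis unfolding smooth_ramp_alt .
  qed
qed

lemma smooth_ramp_0: "k \<ge> 0 \<Longrightarrow> smooth_ramp k n 0 = 0"
  using smooth_ramp_bounds[of k n 0] by simp

section \<open>Gradients and C^k functions of several variables\<close>

lemma grad_eqI:
  assumes "(f has_derivative (\<lambda>h. v \<bullet> h)) (at x)"
  shows "grad f x = v"
  by (simp add: grad_def frechet_derivative_at[OF assms, symmetric] inner_axis vec_eq_iff)

lemma has_derivative_grad:
  assumes "f differentiable (at x)"
  shows "(f has_derivative (\<lambda>h. grad f x \<bullet> h)) (at x)"
proof -
  obtain f' where f': "(f has_derivative f') (at x)" using assms by (auto simp: differentiable_def)
  have e: "frechet_derivative f (at x) = f'" using frechet_derivative_at[OF f'] by simp
  have lin: "linear f'" using f' has_derivative_linear by blast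
  have "f' h = grad f x \<bullet> h" for h
  proof -
    have "h = (\<Sum>i\<in>UNIV. h $ i *\<^sub>R axis i 1)"
      by (simp add: vec_eq_iff axis_def if_distrib cong: if_cong)
    hence "f' h = f' (\<Sum>i\<in>UNIV. h $ i *\<^sub>R axis i 1)" by simp
    also have "\<dots> = (\<Sum>i\<in>UNIV. h $ i *\<^sub>R f' (axis i 1))"
      by (simp add: linear_sum[OF lin] linear_cmul[OF lin])
    also have "\<dots> = grad f x \<bullet> h"
      by (simp add: inner_vec_def grad_def e mult.commute)
    finally show ?thesis .
  qed
  hence "f' = (\<lambda>h. grad f x \<bullet> h)" by blast
  thus ?thesis using f' by simp
qed

text \<open>Lets a candidate gradient be certified by its inner-product form, so that the product
  and chain rules never unfold the coordinatewise \<open>grad\<close>.\<close>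

lemma C_k_SucI:
  assumes "\<And>x. (f has_derivative (\<lambda>h. v x \<bullet> h)) (at x)" "\<And>i. C_k k (\<lambda>x. v x $ i)"
  shows "C_k (Suc k) f"
proof -
  have "grad f x = v x" for x using grad_eqI assms(1) by blast
  thus ?thesis using assms by (auto simp: differentiable_def)
qed

lemma C_k_Suc_imp: "C_k (Suc k) f \<Longrightarrow> C_k k f"
proof (induction k arbitrary: f)
  case 0
  thus ?case by (auto intro!: continuous_at_imp_continuous_on differentiable_imp_continuous_within)
qed auto

lemma C_k_const: "C_k k (\<lambda>x. c)"
proof (induction k arbitrary: c)
  case (Suc k)
  show ?case by (rule C_k_SucI[of _ "\<lambda>x. 0"]) (use Suc in auto)
qed auto

lemma C_k_coord: "C_k k (\<lambda>x :: real ^ 'n. x $ j)"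
proof (cases k)
  case (Suc m)
  have "((\<lambda>x :: real ^ 'n. x $ j) has_derivative (\<lambda>h. axis j 1 \<bullet> h)) (at x)" for x
    by (rule has_derivative_eq_rhs[OF bounded_linear_imp_has_derivative[OF bounded_linear_vec_nth]])
      (auto simp: inner_axis inner_commute)
  thus ?thesis unfolding Suc by (rule C_k_SucI) (simp add: C_k_const)
qed (auto intro!: continuous_intros)

lemma C_k_add: "C_k k f \<Longrightarrow> C_k k g \<Longrightarrow> C_k k (\<lambda>x. f x + g x)"
proof (induction k arbitrary: f g)
  case (Suc k)
  show ?case
  proof (rule C_k_SucI[of _ "\<lambda>x. grad f x + grad g x"])
    fix x
    show "((\<lambda>x. f x + g x) has_derivative (\<bullet>) (grad f x + grad g x)) (at x)"
      using has_derivative_add[OF has_derivative_grad[of f x] has_derivative_grad[of g x]] Suc.prems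
      by (simp add: inner_add_left[abs_def])
  qed (use Suc in auto)
qed (auto intro!: continuous_intros)

lemma C_k_mult: "C_k k f \<Longrightarrow> C_k k g \<Longrightarrow> C_k k (\<lambda>x. f x * g x)"
proof (induction k arbitrary: f g)
  case (Suc k)
  note fg = C_k_Suc_imp[OF Suc.prems(1)] C_k_Suc_imp[OF Suc.prems(2)]
  show ?case
  proof (rule C_k_SucI[of _ "\<lambda>x. f x *\<^sub>R grad g x + g x *\<^sub>R grad f x"])
    fix x
    show "((\<lambda>x. f x * g x) has_derivative (\<bullet>) (f x *\<^sub>R grad g x + g x *\<^sub>R grad f x)) (at x)"
      using has_derivative_mult[OF has_derivative_grad[of f x] has_derivative_grad[of g x]] Suc.prems
      by (auto elim!: has_derivative_eq_rhs simp: fun_eq_iff inner_add_left)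
  next
    fix i
    show "C_k k (\<lambda>x. (f x *\<^sub>R grad g x + g x *\<^sub>R grad f x) $ i)"
      using Suc fg by (auto intro!: C_k_add)
  qed
qed (auto intro!: continuous_intros)

lemma C_k_comp: "smooth_real G \<Longrightarrow> C_k k f \<Longrightarrow> C_k k (\<lambda>x. G (f x))"
proof (induction k arbitrary: f G)
  case 0
  obtain G' where "\<And>x. (G has_real_derivative G' x) (at x)" using smooth_real_derivative[OF 0(1)] by metis
  hence "continuous_on UNIV G" by (intro DERIV_continuous_on) auto
  thus ?case using 0 by (auto intro: continuous_on_compose2)
next
  case (Suc k)
  obtain G' where G': "smooth_real G'" "\<And>x. (G has_real_derivative G' x) (at x)"
    using smooth_real_derivative[OF Suc.prems(1)] by metis
  show ?case
  proof (rule C_k_SucI[of _ "\<lambda>x. G' (f x) *\<^sub>R grad f x"])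
    fix x
    show "((\<lambda>x. G (f x)) has_derivative (\<bullet>) (G' (f x) *\<^sub>R grad f x)) (at x)"
      using has_derivative_compose[OF has_derivative_grad[of f x]
          G'(2)[of "f x", unfolded has_field_derivative_def]] Suc.prems
      by (auto elim!: has_derivative_eq_rhs simp: fun_eq_iff)
  next
    fix i
    show "C_k k (\<lambda>x. (G' (f x) *\<^sub>R grad f x) $ i)"
      using Suc.IH[OF G'(1) C_k_Suc_imp[OF Suc.prems(2)]] Suc.prems by (auto intro!: C_k_mult)
  qed
qed

lemma C_k_prod: "finite I \<Longrightarrow> (\<And>i. i \<in> I \<Longrightarrow> C_k k (f i)) \<Longrightarrow> C_k k (\<lambda>x. \<Prod>i\<in>I. f i x)"
  by (induction I rule: finite_induct) (auto intro!: C_k_const C_k_mult)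

section \<open>Auxiliary facts on \<open>L\<^sup>p\<close>\<close>

lemma continuous_bounded_on_interval:
  fixes f :: "real \<Rightarrow> real"
  assumes "continuous_on UNIV f"
  obtains c where "c \<ge> 0" "\<And>t. \<bar>t\<bar> \<le> R \<Longrightarrow> \<bar>f t\<bar> \<le> c"
proof -
  have "bounded (f ` {-R..R})"
    by (intro compact_imp_bounded compact_continuous_image continuous_on_subset[OF assms]) auto
  then obtain c where "\<forall>y\<in>f ` {-R..R}. norm y \<le> c" unfolding bounded_iff by blast
  hence c: "\<bar>f t\<bar> \<le> c" if "t \<in> {-R..R}" for t using that by simp
  show thesis
  proof (rule that[of "\<bar>c\<bar>"])
    show "\<bar>f t\<bar> \<le> \<bar>c\<bar>" if "\<bar>t\<bar> \<le> R" for t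
      using c[of t] that by (simp add: abs_le_iff)
  qed simp
qed

text \<open>Serves to pass from countably many parameters to all of them by continuity: corners of
  cubes in the compactness argument, pairs of gradients in the monotonicity argument.\<close>

lemma countable_dense_sequences:
  obtains D :: "'a::{metric_space, second_countable_topology} set"
  where "countable D" "\<And>y. \<exists>d. (\<forall>j::nat. d j \<in> D) \<and> d \<longlonglongrightarrow> y"
proof -
  obtain D :: "'a set" where D: "countable D" "\<And>X. open X \<Longrightarrow> X \<noteq> {} \<Longrightarrow> \<exists>d\<in>D. d \<in> X"
    using countable_dense_setE by metis
  have "\<exists>d. (\<forall>j::nat. d j \<in> D) \<and> d \<longlonglongrightarrow> y" for y
  proof -
    have "\<exists>d. \<forall>j. d j \<in> D \<and> dist (d j) y < inverse (real (Suc j))"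
    proof (rule choice, rule allI)
      fix j :: nat
      show "\<exists>z. z \<in> D \<and> dist z y < inverse (real (Suc j))"
        using D(2)[of "ball y (inverse (real (Suc j)))"] by (auto simp: dist_commute)
    qed
    then obtain d where d: "\<And>j. d j \<in> D" "\<And>j. dist (d j) y < inverse (real (Suc j))" by blast
    have "d \<longlonglongrightarrow> y"
    proof (rule tendsto_dist_iff[THEN iffD2], rule tendsto_sandwich[OF _ _ tendsto_const LIMSEQ_inverse_real_of_nat])
      show "\<forall>\<^sub>F j in sequentially. dist (d j) y \<le> inverse (real (Suc j))"
        using d(2) by (intro always_eventually allI less_imp_le)
    qed simp
    thus ?thesis using d(1) by blast
  qed
  thus thesis using that D(1) by blast
qed

text \<open>Passing through the nonnegative integral makes integrability of the limit a conclusion.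
  It is used where no dominating function is available: for completeness of L^p and for limits of
  energies.\<close>

lemma Fatou_real:
  fixes f :: "nat \<Rightarrow> 'a \<Rightarrow> real"
  assumes int: "\<And>n. integrable M (f n)" and nonneg: "\<And>n. AE x in M. 0 \<le> f n x"
    and lim: "AE x in M. (\<lambda>n. f n x) \<longlonglongrightarrow> g x" and g: "g \<in> borel_measurable M"
    and bound: "\<And>n. integral\<^sup>L M (f n) \<le> C"
  shows "integrable M g" "integral\<^sup>L M g \<le> C" "AE x in M. 0 \<le> g x"
proof -
  have nn: "AE x in M. \<forall>n. 0 \<le> f n x" using nonneg by (simp add: AE_all_countable)
  show pos: "AE x in M. 0 \<le> g x"
    using nn lim by eventually_elim (blast intro: LIMSEQ_le_const)
  have C: "0 \<le> C" using integral_nonneg_AE[OF nonneg[of 0]] bound[of 0] by linarith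
  have "(\<integral>\<^sup>+x. ennreal (g x) \<partial>M) = (\<integral>\<^sup>+x. liminf (\<lambda>n. ennreal (f n x)) \<partial>M)"
  proof (rule nn_integral_cong_AE, use lim in eventually_elim)
    case (elim x)
    hence "(\<lambda>n. ennreal (f n x)) \<longlonglongrightarrow> ennreal (g x)" by (rule tendsto_ennrealI)
    thus ?case by (simp add: lim_imp_Liminf)
  qed
  also have "\<dots> \<le> liminf (\<lambda>n. \<integral>\<^sup>+x. ennreal (f n x) \<partial>M)"
    using borel_measurable_integrable[OF int] by (intro nn_integral_liminf) simp
  also have "\<dots> \<le> ennreal C"
  proof -
    have "(\<integral>\<^sup>+x. ennreal (f n x) \<partial>M) \<le> ennreal C" for n
      using nn_integral_eq_integral[OF int nonneg, of n] bound[of n] by (simp add: ennreal_leI)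
    hence "liminf (\<lambda>n. \<integral>\<^sup>+x. ennreal (f n x) \<partial>M) \<le> liminf (\<lambda>n. ennreal C)"
      by (intro Liminf_mono) simp
    thus ?thesis by (simp add: Liminf_const)
  qed
  finally have le: "(\<integral>\<^sup>+x. ennreal (g x) \<partial>M) \<le> ennreal C" .
  show ig: "integrable M g"
    by (rule integrableI_nonneg[OF g pos]) (use le in \<open>simp add: le_less_trans\<close>)
  show "integral\<^sup>L M g \<le> C"
    using le nn_integral_eq_integral[OF ig pos] C by simp
qed

section \<open>p-th powers of L^p norms\<close>

definition memLp :: "'a measure \<Rightarrow> real \<Rightarrow> ('a \<Rightarrow> 'b::real_normed_vector) \<Rightarrow> bool" where
  "memLp M p f \<longleftrightarrow> f \<in> borel_measurable M \<and> integrable M (\<lambda>x. norm (f x) powr p)"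

text \<open>The p-th power of the L^p norm, left without its root: all convergence statements are
  convergence to 0, where the root changes nothing, and the factor \<open>2 powr p\<close> of a
  quasi-triangle inequality takes the place of Minkowski's inequality.\<close>

definition pint :: "'a measure \<Rightarrow> real \<Rightarrow> ('a \<Rightarrow> 'b::real_normed_vector) \<Rightarrow> real" where
  "pint M p f = (LINT x|M. norm (f x) powr p)"

lemma memLp_measurable: "memLp M p f \<Longrightarrow> f \<in> borel_measurable M"
  by (simp add: memLp_def)

lemma memLp_integrable: "memLp M p f \<Longrightarrow> integrable M (\<lambda>x. norm (f x) powr p)"
  by (simp add: memLp_def)

lemma pint_nonneg: "0 \<le> pint M p f"
  by (simp add: pint_def)

lemma pint_cong_AE:
  assumes "f \<in> borel_measurable M" "g \<in> borel_measurable M" "AE x in M. f x = g x"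
  shows "pint M p f = pint M p g"
  unfolding pint_def by (rule integral_cong_AE) (use assms in auto)

lemma powr_add_le:
  fixes a b :: real
  assumes "0 \<le> a" "0 \<le> b" "0 \<le> p"
  shows "(a + b) powr p \<le> 2 powr p * (a powr p + b powr p)"
proof -
  have "(a + b) powr p \<le> (2 * max a b) powr p" using assms by (intro powr_mono2) auto
  also have "\<dots> = 2 powr p * max a b powr p" using assms by (simp add: powr_mult)
  also have "\<dots> \<le> 2 powr p * (a powr p + b powr p)" by (intro mult_left_mono) (auto simp: max_def)
  finally show ?thesis .
qed

lemma norm_add_powr_le:
  assumes "0 \<le> p"
  shows "norm (a + b) powr p \<le> 2 powr p * (norm a powr p + norm b powr p)"
  using order_trans[OF powr_mono2[OF assms norm_ge_zero norm_triangle_ineq] powr_add_le[of "norm a" "norm b"]]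
    assms by simp

lemma memLp_dominated:
  fixes f :: "'a \<Rightarrow> 'b::{real_normed_vector}" and g :: "'a \<Rightarrow> 'c::{real_normed_vector}"
  assumes "f \<in> borel_measurable M" "memLp M p g" "AE x in M. norm (f x) \<le> norm (g x)" "0 \<le> p"
  shows "memLp M p f" "pint M p f \<le> pint M p g"
proof -
  have *: "AE x in M. norm (f x) powr p \<le> norm (g x) powr p"
    using assms(3) by eventually_elim (simp add: assms powr_mono2)
  show 1: "memLp M p f"
    unfolding memLp_def
    by (intro conjI assms Bochner_Integration.integrable_bound[OF memLp_integrable[OF assms(2)]])
      (use assms(1) * in auto)
  show "pint M p f \<le> pint M p g"
    unfolding pint_def using memLp_integrable[OF 1] memLp_integrable[OF assms(2)] *
    by (rule integral_mono_AE)
qed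

lemma memLp_add:
  fixes f g :: "'a \<Rightarrow> 'b::{real_normed_vector, second_countable_topology}"
  assumes "memLp M p f" "memLp M p g" "0 \<le> p"
  shows "memLp M p (\<lambda>x. f x + g x)" "pint M p (\<lambda>x. f x + g x) \<le> 2 powr p * (pint M p f + pint M p g)"
proof -
  note m[measurable] = memLp_measurable[OF assms(1)] memLp_measurable[OF assms(2)]
  have i: "integrable M (\<lambda>x. 2 powr p * (norm (f x) powr p + norm (g x) powr p))"
    using assms by (auto simp: memLp_def)
  show 1: "memLp M p (\<lambda>x. f x + g x)"
    unfolding memLp_def
  proof (intro conjI Bochner_Integration.integrable_bound[OF i] AE_I2)
    fix x
    have "norm (norm (f x + g x) powr p) = norm (f x + g x) powr p" by simp
    also have "\<dots> \<le> 2 powr p * (norm (f x) powr p + norm (g x) powr p)"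
      by (rule norm_add_powr_le[OF assms(3)])
    also have "\<dots> \<le> norm (2 powr p * (norm (f x) powr p + norm (g x) powr p))"
      unfolding real_norm_def by (rule abs_ge_self)
    finally show "norm (norm (f x + g x) powr p) \<le> norm (2 powr p * (norm (f x) powr p + norm (g x) powr p))" .
  qed simp_all
  have "pint M p (\<lambda>x. f x + g x) \<le> (LINT x|M. 2 powr p * (norm (f x) powr p + norm (g x) powr p))"
    unfolding pint_def using memLp_integrable[OF 1] i by (rule integral_mono) (simp add: norm_add_powr_le assms)
  thus "pint M p (\<lambda>x. f x + g x) \<le> 2 powr p * (pint M p f + pint M p g)"
    unfolding pint_def using assms by (simp add: memLp_def)
qed

lemma memLp_scaleR:
  fixes f :: "'a \<Rightarrow> 'b::{real_normed_vector, second_countable_topology}"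
  assumes "memLp M p f"
  shows "memLp M p (\<lambda>x. c *\<^sub>R f x)" "pint M p (\<lambda>x. c *\<^sub>R f x) = \<bar>c\<bar> powr p * pint M p f"
  using assms by (auto simp: memLp_def pint_def powr_mult)

lemma memLp_minus:
  fixes f :: "'a \<Rightarrow> 'b::{real_normed_vector, second_countable_topology}"
  assumes "memLp M p f"
  shows "memLp M p (\<lambda>x. - f x)"
  using memLp_scaleR(1)[OF assms, of "-1"] by simp

lemma memLp_scaled_bound:
  fixes g :: "'a \<Rightarrow> 'b::{real_normed_vector, second_countable_topology}" and f :: "'a \<Rightarrow> 'c::real_normed_vector"
  assumes "f \<in> borel_measurable M" "memLp M p g" "\<And>x. norm (f x) \<le> C * norm (g x)" "0 \<le> p"
  shows "memLp M p f" "pint M p f \<le> \<bar>C\<bar> powr p * pint M p g"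
proof -
  have "norm (f x) \<le> norm (C *\<^sub>R g x)" for x
    using order_trans[OF assms(3)[of x] mult_right_mono[OF abs_ge_self norm_ge_zero]] by simp
  hence "AE x in M. norm (f x) \<le> norm (C *\<^sub>R g x)" by simp
  from memLp_dominated[OF assms(1) memLp_scaleR(1)[OF assms(2)] this assms(4)]
  show "memLp M p f" "pint M p f \<le> \<bar>C\<bar> powr p * pint M p g" by (simp_all add: memLp_scaleR(2)[OF assms(2)])
qed

lemma pint_scaled_bound_tendsto_0:
  fixes w :: "nat \<Rightarrow> 'a \<Rightarrow> 'b::{real_normed_vector, second_countable_topology}" and f :: "nat \<Rightarrow> 'a \<Rightarrow> 'c::real_normed_vector"
  assumes "\<And>n. f n \<in> borel_measurable M" "\<And>n. memLp M p (w n)" "\<And>n x. norm (f n x) \<le> C * norm (w n x)"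
    and "0 \<le> p" "(\<lambda>n. pint M p (w n)) \<longlonglongrightarrow> 0"
  shows "(\<lambda>n. pint M p (f n)) \<longlonglongrightarrow> 0"
proof (rule tendsto_sandwich[OF _ _ tendsto_const])
  show "\<forall>\<^sub>F n in sequentially. pint M p (f n) \<le> \<bar>C\<bar> powr p * pint M p (w n)"
    by (intro always_eventually allI memLp_scaled_bound(2) assms)
  show "(\<lambda>n. \<bar>C\<bar> powr p * pint M p (w n)) \<longlonglongrightarrow> 0"
    using tendsto_mult_left[OF assms(5), of "\<bar>C\<bar> powr p"] by simp
qed (simp add: pint_nonneg)

lemma pint_commute: "pint M p (\<lambda>x. f x - g x) = pint M p (\<lambda>x. g x - f x)"
  by (simp add: pint_def norm_minus_commute)

lemma memLp_diff:
  fixes f g :: "'a \<Rightarrow> 'b::{real_normed_vector, second_countable_topology}"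
  assumes "memLp M p f" "memLp M p g" "0 \<le> p"
  shows "memLp M p (\<lambda>x. f x - g x)" "pint M p (\<lambda>x. f x - g x) \<le> 2 powr p * (pint M p f + pint M p g)"
  using memLp_add[OF assms(1) memLp_minus[OF assms(2)] assms(3)] by (simp_all add: pint_def)

lemma pint_triangle:
  fixes f g h :: "'a \<Rightarrow> 'b::{real_normed_vector, second_countable_topology}"
  assumes "memLp M p f" "memLp M p g" "memLp M p h" "0 \<le> p"
  shows "pint M p (\<lambda>x. f x - h x) \<le> 2 powr p * (pint M p (\<lambda>x. f x - g x) + pint M p (\<lambda>x. g x - h x))"
  using memLp_add(2)[OF memLp_diff(1)[OF assms(1,2,4)] memLp_diff(1)[OF assms(2,3,4)] assms(4)] by simp

text \<open>Below the threshold c use c itself; above it use (a/c)^(p-1) >= 1. Keeping c free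
  preserves the strength of Hoelder's inequality: it is optimised only in
  \<open>sup_bound\<close>.\<close>

lemma norm_le_powr:
  fixes a c :: real
  assumes "0 \<le> a" "0 < c" "1 \<le> p"
  shows "a \<le> c + c powr (1 - p) * a powr p"
proof (cases "a \<le> c")
  case False
  have "a = a powr (1 - p) * a powr p" using assms False by (simp add: powr_add[symmetric])
  also have "\<dots> \<le> c powr (1 - p) * a powr p"
    using assms False by (intro mult_right_mono powr_mono2') auto
  finally show ?thesis using assms by linarith
qed (use assms in \<open>simp add: add_increasing2\<close>)

lemma memLp_L1:
  fixes f :: "'a \<Rightarrow> 'b::{banach, second_countable_topology}"
  assumes "finite_measure M" "memLp M p f" "1 \<le> p"
  shows "integrable M f"
    and "\<And>S c. S \<in> sets M \<Longrightarrow> c > 0 \<Longrightarrow>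
      (LINT x|M. indicator S x * norm (f x)) \<le> c * measure M S + c powr (1 - p) * pint M p f"
proof -
  interpret finite_measure M by fact
  note [measurable] = memLp_measurable[OF assms(2)] and i = memLp_integrable[OF assms(2)]
  have ii: "integrable M (\<lambda>x. 1 + 1 powr (1 - p) * norm (f x) powr p)" using i by auto
  show int: "integrable M f"
    by (rule Bochner_Integration.integrable_bound[OF ii])
      (use norm_le_powr[of _ 1 p] assms in \<open>auto intro!: AE_I2\<close>)
  fix S and c :: real assume S[measurable]: "S \<in> sets M" and c: "c > 0"
  have indS: "integrable M (indicat_real S)"
    by (rule integrable_real_indicator[OF S]) (simp add: emeasure_eq_measure)
  have "(LINT x|M. indicator S x * norm (f x)) \<le>
        (LINT x|M. indicator S x * c + c powr (1 - p) * norm (f x) powr p)"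
  proof (rule integral_mono)
    show "integrable M (\<lambda>x. indicat_real S x * norm (f x))"
      by (rule Bochner_Integration.integrable_bound[OF integrable_norm[OF int]])
        (auto intro!: AE_I2 simp: indicator_def)
    show "integrable M (\<lambda>x. indicat_real S x * c + c powr (1 - p) * norm (f x) powr p)"
      using i indS by simp
    fix x
    show "indicat_real S x * norm (f x) \<le> indicat_real S x * c + c powr (1 - p) * norm (f x) powr p"
      using norm_le_powr[of "norm (f x)" c p] c assms(3) by (auto simp: indicator_def)
  qed
  also have "\<dots> = c * measure M S + c powr (1 - p) * pint M p f"
    using i indS by (simp add: pint_def)
  finally show "(LINT x|M. indicator S x * norm (f x)) \<le> c * measure M S + c powr (1 - p) * pint M p f" .
qed

lemma memLp_bounded:
  fixes f :: "'a \<Rightarrow> 'b::{banach, second_countable_topology}"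
  assumes "finite_measure M" "f \<in> borel_measurable M" "AE x in M. norm (f x) \<le> C" "0 \<le> p"
  shows "memLp M p f"
proof -
  interpret finite_measure M by fact
  have "memLp M p (\<lambda>_. C)" by (simp add: memLp_def)
  thus ?thesis using assms by (intro memLp_dominated(1)[of f M p "\<lambda>_. C"]) auto
qed

lemma L1_norm_tendsto_0:
  fixes f :: "nat \<Rightarrow> 'a \<Rightarrow> 'b::{banach, second_countable_topology}"
  assumes finite_M: "finite_measure M" and f: "\<And>n. memLp M p (f n)" and p: "1 < p"
    and lim: "(\<lambda>n. pint M p (f n)) \<longlonglongrightarrow> 0"
  shows "(\<lambda>n. LINT x|M. norm (f n x)) \<longlonglongrightarrow> 0"
proof (rule LIMSEQ_I)
  interpret finite_measure M by fact
  fix e :: real assume e: "e > 0"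
  \<comment> \<open>The summand 1 keeps the denominator positive for a space of measure 0 and makes
    the first error term strictly smaller than e / 2.\<close>
  define c where "c = e / (2 * (measure M (space M) + 1))"
  have m: "measure M (space M) \<ge> 0" by simp
  have c: "c > 0" unfolding c_def using e m by (intro divide_pos_pos mult_pos_pos) linarith+
  have c2: "c * measure M (space M) < e / 2"
  proof -
    have "c * measure M (space M) < c * (measure M (space M) + 1)" using c by simp
    also have "\<dots> = e / 2"
    proof -
      have "x \<noteq> 0 \<Longrightarrow> e / (2 * x) * x = e / 2" for x :: real by simp
      thus ?thesis unfolding c_def using add_nonneg_pos[OF m zero_less_one] by (metis less_irrefl)
    qed
    finally show ?thesis .
  qed
  have "(\<lambda>n. c powr (1 - p) * pint M p (f n)) \<longlonglongrightarrow> c powr (1 - p) * 0"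
    by (intro tendsto_intros lim)
  then obtain N where N: "\<And>n. n \<ge> N \<Longrightarrow> norm (c powr (1 - p) * pint M p (f n) - 0) < e / 2"
    using LIMSEQ_D[of _ "c powr (1 - p) * 0" "e/2"] e by auto
  have "norm ((LINT x|M. norm (f n x)) - 0) < e" if "n \<ge> N" for n
  proof -
    have "(LINT x|M. norm (f n x)) = (LINT x|M. indicator (space M) x * norm (f n x))"
      by (rule Bochner_Integration.integral_cong) auto
    also have "\<dots> \<le> c * measure M (space M) + c powr (1 - p) * pint M p (f n)"
      using memLp_L1(2)[OF finite_M f _ sets.top c] p by simp
    also have "\<dots> < e" using c2 N[OF that] by auto
    finally show ?thesis by (simp add: integral_nonneg)
  qed
  thus "\<exists>N. \<forall>n\<ge>N. norm ((LINT x|M. norm (f n x)) - 0) < e" by blast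
qed

lemma pint_dominated_tendsto_0:
  fixes f :: "nat \<Rightarrow> 'a \<Rightarrow> 'b::{banach, second_countable_topology}"
    and w :: "'a \<Rightarrow> 'c::{real_normed_vector}"
  assumes f: "\<And>n. f n \<in> borel_measurable M" and w: "memLp M p w" and p: "0 < p"
    and bound: "\<And>n. AE x in M. norm (f n x) \<le> norm (w x)"
    and lim: "AE x in M. (\<lambda>n. f n x) \<longlonglongrightarrow> 0"
  shows "(\<lambda>n. pint M p (f n)) \<longlonglongrightarrow> 0"
proof -
  have "(\<lambda>n. LINT x|M. norm (f n x) powr p) \<longlonglongrightarrow> (LINT x|M. 0)"
  proof (rule integral_dominated_convergence)
    show "integrable M (\<lambda>x. norm (w x) powr p)" using w by (simp add: memLp_def)
    show "AE x in M. (\<lambda>n. norm (f n x) powr p) \<longlonglongrightarrow> 0"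
      using lim
    proof eventually_elim
      case (elim x)
      have "(\<lambda>n. norm (f n x) powr p) \<longlonglongrightarrow> 0 powr p"
        by (intro tendsto_powr' tendsto_norm_zero elim tendsto_const) (use p in auto)
      thus ?case by simp
    qed
    fix n
    show "AE x in M. norm (norm (f n x) powr p) \<le> norm (w x) powr p"
      using bound[of n] by eventually_elim (use p in \<open>auto intro!: powr_mono2\<close>)
  qed (use f in auto)
  thus ?thesis by (simp add: pint_def)
qed

lemma pint_tendsto_0_AE_subseq:
  fixes f :: "nat \<Rightarrow> 'a \<Rightarrow> 'b::{banach, second_countable_topology}"
  assumes f: "\<And>n. memLp M p (f n)" and lim: "(\<lambda>n. pint M p (f n)) \<longlonglongrightarrow> 0" and p: "0 < p"
  obtains r where "strict_mono r" "AE x in M. (\<lambda>n. f (r n) x) \<longlonglongrightarrow> 0"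
proof -
  have "(\<lambda>n. LINT x|M. norm (norm (f n x) powr p)) \<longlonglongrightarrow> 0"
    using lim by (simp add: pint_def)
  from tendsto_L1_AE_subseq[OF memLp_integrable[OF f] this]
  obtain r where r: "strict_mono r" "AE x in M. (\<lambda>n. norm (f (r n) x) powr p) \<longlonglongrightarrow> 0" by auto
  have "AE x in M. (\<lambda>n. f (r n) x) \<longlonglongrightarrow> 0"
    using r(2)
  proof eventually_elim
    case (elim x)
    have "(\<lambda>n. (norm (f (r n) x) powr p) powr (1 / p)) \<longlonglongrightarrow> 0 powr (1 / p)"
      by (intro tendsto_powr' elim tendsto_const) (use p in auto)
    thus ?case using p by (simp add: powr_powr tendsto_norm_zero_iff)
  qed
  thus ?thesis using r that by blast
qed

text \<open>On a finite measure space a sequence that is Cauchy for \<open>pint\<close> is Cauchy in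
  L^1, hence has a subsequence that is Cauchy almost everywhere. Fatou's lemma brings the pointwise
  limit back to \<open>pint\<close>.\<close>

lemma memLp_complete:
  fixes f :: "nat \<Rightarrow> 'a \<Rightarrow> 'b::{banach, second_countable_topology}"
  assumes finite_M: "finite_measure M" and f: "\<And>n. memLp M p (f n)" and p: "1 < p"
    and C: "\<And>e. e > 0 \<Longrightarrow> \<exists>N. \<forall>m\<ge>N. \<forall>n\<ge>N. pint M p (\<lambda>x. f m x - f n x) < e"
  obtains g where "memLp M p g" "(\<lambda>n. pint M p (\<lambda>x. f n x - g x)) \<longlonglongrightarrow> 0"
proof -
  interpret finite_measure M by fact
  have p_bounds: "0 \<le> p" "1 \<le> p" using p by auto
  note [measurable] = memLp_measurable[OF f]
  \<comment> \<open>Otherwise, pairs of indices beyond each N at L^1 distance at least e form a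
    single sequence of differences whose \<open>pint\<close> tends to 0, against
    \<open>L1_norm_tendsto_0\<close>.\<close>
  have "\<exists>N. \<forall>i\<ge>N. \<forall>j\<ge>N. (LINT x|M. norm (f i x - f j x)) < e" if "e > 0" for e
  proof (rule ccontr)
    assume "\<not> ?thesis"
    hence "\<forall>N. \<exists>ij. fst ij \<ge> N \<and> snd ij \<ge> N \<and> (LINT x|M. norm (f (fst ij) x - f (snd ij) x)) \<ge> e"
      by (auto simp: not_less)
    hence "\<exists>ij. \<forall>N. fst (ij N) \<ge> N \<and> snd (ij N) \<ge> N \<and>
        (LINT x|M. norm (f (fst (ij N)) x - f (snd (ij N)) x)) \<ge> e"
      by (rule choice)
    then obtain ij where "\<forall>N. fst (ij N) \<ge> N \<and> snd (ij N) \<ge> N \<and>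
        (LINT x|M. norm (f (fst (ij N)) x - f (snd (ij N)) x)) \<ge> e"
      by blast
    hence ij: "fst (ij N) \<ge> N" "snd (ij N) \<ge> N"
      "(LINT x|M. norm (f (fst (ij N)) x - f (snd (ij N)) x)) \<ge> e" for N by auto
    have "(\<lambda>N. pint M p (\<lambda>x. f (fst (ij N)) x - f (snd (ij N)) x)) \<longlonglongrightarrow> 0"
    proof (rule LIMSEQ_I)
      fix e' :: real assume "e' > 0"
      then obtain N where N: "\<forall>m\<ge>N. \<forall>n\<ge>N. pint M p (\<lambda>x. f m x - f n x) < e'" using C by blast
      have "norm (pint M p (\<lambda>x. f (fst (ij n)) x - f (snd (ij n)) x) - 0) < e'" if "n \<ge> N" for n
      proof -
        have "N \<le> fst (ij n)" "N \<le> snd (ij n)" using ij(1,2)[of n] that by linarith+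
        thus ?thesis using N pint_nonneg[of M p "\<lambda>x. f (fst (ij n)) x - f (snd (ij n)) x"] by simp
      qed
      thus "\<exists>no. \<forall>n\<ge>no. norm (pint M p (\<lambda>x. f (fst (ij n)) x - f (snd (ij n)) x) - 0) < e'" by blast
    qed
    from L1_norm_tendsto_0[OF finite_M memLp_diff(1)[OF f f p_bounds(1)] p this]
    have "(\<lambda>N. LINT x|M. norm (f (fst (ij N)) x - f (snd (ij N)) x)) \<longlonglongrightarrow> 0" .
    hence "e \<le> 0" by (rule LIMSEQ_le_const) (use ij(3) in auto)
    thus False using that by simp
  qed
  then obtain r where r: "strict_mono r" "AE x in M. Cauchy (\<lambda>i. f (r i) x)"
    using cauchy_L1_AE_cauchy_subseq[of M f] memLp_L1(1)[OF finite_M f p_bounds(2)] by blast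
  define g where "g x = lim (\<lambda>i. f (r i) x)" for x
  have [measurable]: "g \<in> borel_measurable M"
    unfolding g_def by (rule borel_measurable_lim_metric) simp
  have lim: "AE x in M. (\<lambda>i. f (r i) x) \<longlonglongrightarrow> g x"
    using r(2) by eventually_elim (simp add: g_def Cauchy_convergent_iff convergent_LIMSEQ_iff)
  \<comment> \<open>The first index stays fixed while the second runs along the subsequence.
    Starting it at N keeps every difference below e.\<close>
  have key: "integrable M (\<lambda>x. norm (f m x - g x) powr p) \<and> (LINT x|M. norm (f m x - g x) powr p) \<le> e"
    if N: "\<forall>m\<ge>N. \<forall>n\<ge>N. pint M p (\<lambda>x. f m x - f n x) < e" and m: "m \<ge> N" for N m e
  proof -
    have a: "integrable M (\<lambda>x. norm (f m x - f (r (n + N)) x) powr p)" for n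
      using memLp_integrable[OF memLp_diff(1)[OF f f p_bounds(1)]] .
    have b: "AE x in M. (\<lambda>n. norm (f m x - f (r (n + N)) x) powr p) \<longlonglongrightarrow> norm (f m x - g x) powr p"
      using lim
    proof eventually_elim
      case (elim x)
      show ?case
        by (intro tendsto_powr' tendsto_norm tendsto_diff tendsto_const LIMSEQ_ignore_initial_segment[OF elim])
          (use p in auto)
    qed
    have c: "(LINT x|M. norm (f m x - f (r (n + N)) x) powr p) \<le> e" for n
      using N m le_trans[of N "n + N" "r (n + N)"] seq_suble[OF r(1), of "n + N"]
      by (auto simp: pint_def less_imp_le)
    show ?thesis using Fatou_real(1,2)[OF a _ b _ c] by auto
  qed
  obtain N where N: "\<forall>m\<ge>N. \<forall>n\<ge>N. pint M p (\<lambda>x. f m x - f n x) < 1" using C[of 1] by auto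
  have "memLp M p (\<lambda>x. f N x - g x)" using key[OF N, of N] by (simp add: memLp_def)
  from memLp_diff(1)[OF f[of N] this p_bounds(1)] have "memLp M p g" by simp
  moreover have "(\<lambda>n. pint M p (\<lambda>x. f n x - g x)) \<longlonglongrightarrow> 0"
  proof (rule LIMSEQ_I)
    fix e :: real assume "e > 0"
    then obtain N where N: "\<forall>m\<ge>N. \<forall>n\<ge>N. pint M p (\<lambda>x. f m x - f n x) < e / 2" using C[of "e/2"] by auto
    show "\<exists>no. \<forall>n\<ge>no. norm (pint M p (\<lambda>x. f n x - g x) - 0) < e"
      using key[OF N] \<open>e > 0\<close> pint_nonneg by (intro exI[of _ N]) (fastforce simp: pint_def)
  qed
  ultimately show ?thesis using that by blast
qed

text \<open>Two preimages differ only inside a null set, and by completeness of Lebesgue measure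
  every part of a null set is measurable. This is what makes the arbitrary representative chosen by
  \<open>weak_grad\<close> measurable.\<close>

lemma borel_measurable_AE_cong_lebesgue_on:
  fixes f g :: "'a::euclidean_space \<Rightarrow> 'b::topological_space"
  assumes f: "f \<in> borel_measurable (lebesgue_on S)" and S: "S \<in> sets lebesgue"
    and ae: "AE x in lebesgue_on S. f x = g x"
  shows "g \<in> borel_measurable (lebesgue_on S)"
proof (rule measurableI)
  obtain N where N: "N \<in> null_sets (lebesgue_on S)" "{x \<in> space (lebesgue_on S). f x \<noteq> g x} \<subseteq> N"
    using ae by (auto elim!: AE_E simp: null_sets_def)
  have N0: "N \<in> null_sets lebesgue" using N(1) S by (simp add: null_sets_restrict_space)
  fix A :: "'b set" assume A: "A \<in> sets borel"
  let ?F = "f -` A \<inter> space (lebesgue_on S)" and ?G = "g -` A \<inter> space (lebesgue_on S)"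
  have F: "?F \<in> sets lebesgue"
    using measurable_sets[OF f A] S by (auto simp: sets_restrict_space_iff)
  have "?G = (?F - N) \<union> (?G \<inter> N)" using N(2) by auto
  moreover have "?G \<inter> N \<in> sets lebesgue"
    using N0 by (meson completion.complete2 inf_le2 null_setsD2)
  moreover have "?F - N \<in> sets lebesgue" using F N0 by auto
  ultimately have "?G \<in> sets lebesgue" by (metis sets.Un)
  thus "?G \<in> sets (lebesgue_on S)" using S by (auto simp: sets_restrict_space_iff)
qed simp

lemma lborel_integral_shift:
  fixes f :: "'a::euclidean_space \<Rightarrow> 'b::{banach, second_countable_topology}"
  assumes "f \<in> borel_measurable borel"
  shows "integral\<^sup>L lborel (\<lambda>x. f (c + x)) = integral\<^sup>L lborel f"
  using integral_distr[of "(+) c" lborel borel f] assms by (simp add: lborel_distr_plus)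

lemma lborel_integrable_shift:
  fixes f :: "'a::euclidean_space \<Rightarrow> 'b::{banach, second_countable_topology}"
  assumes "integrable lborel f"
  shows "integrable lborel (\<lambda>x. f (c + x))"
  using integrable_distr_eq[of "(+) c" lborel borel f] assms by (simp add: lborel_distr_plus)

text \<open>Moves integrals of test functions from the domain to \<open>lborel\<close> on the whole
  space, where translation invariance and Fubini's theorem are at hand.\<close>

lemma lebesgue_on_vanishing:
  fixes f :: "'a::euclidean_space \<Rightarrow> 'b::euclidean_space"
  assumes "f \<in> borel_measurable borel" "\<And>x. x \<notin> S \<Longrightarrow> f x = 0" "S \<in> sets lebesgue"
  shows "integral\<^sup>L (lebesgue_on S) f = integral\<^sup>L lborel f"
    and "integrable (lebesgue_on S) f \<longleftrightarrow> integrable lborel f"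
proof -
  have *: "(\<lambda>x. if x \<in> S then f x else 0) = f" using assms(2) by auto
  show "integral\<^sup>L (lebesgue_on S) f = integral\<^sup>L lborel f"
    using Lebesgue_Measure.integral_restrict_UNIV[OF assms(3), of f] assms(1) by (simp add: * integral_completion)
  show "integrable (lebesgue_on S) f \<longleftrightarrow> integrable lborel f"
    using Lebesgue_Measure.integrable_restrict_UNIV[OF assms(3), of f] assms(1) by (simp add: * integrable_completion)
qed

text \<open>The steps are 1/(n+1) instead of a real parameter because the limit is later taken under
  integral signs by dominated convergence for sequences.\<close>

lemma derivative_sequence:
  fixes f :: "'a::real_normed_vector \<Rightarrow> real"
  assumes "(f has_derivative f') (at z)"
  shows "(\<lambda>n. real (Suc n) * (f (z + (1 / real (Suc n)) *\<^sub>R w) - f z)) \<longlonglongrightarrow> f' w"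
proof -
  interpret bounded_linear f' using assms by (rule has_derivative_bounded_linear)
  have "((\<lambda>t. f (z + t *\<^sub>R w)) has_derivative (\<lambda>t. f' (t *\<^sub>R w))) (at 0)"
  proof (rule has_derivative_compose[of "\<lambda>t. z + t *\<^sub>R w"])
    show "((\<lambda>t. z + t *\<^sub>R w) has_derivative (\<lambda>t. t *\<^sub>R w)) (at 0)" by (auto intro!: derivative_eq_intros)
  qed (use assms in simp)
  hence "((\<lambda>t. f (z + t *\<^sub>R w)) has_real_derivative f' w) (at 0)"
    unfolding has_field_derivative_def by (rule has_derivative_eq_rhs) (auto simp: scale mult.commute)
  hence l: "((\<lambda>t. (f (z + t *\<^sub>R w) - f z) / t) \<longlongrightarrow> f' w) (at 0)" by (simp add: DERIV_def)
  have "filterlim (\<lambda>n. 1 / real (Suc n)) (at 0) sequentially"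
    using LIMSEQ_inverse_real_of_nat by (auto simp: filterlim_at inverse_eq_divide)
  from filterlim_compose[OF l this] show ?thesis by (simp add: mult.commute del: of_nat_Suc)
qed

section \<open>Test functions\<close>

lemma test_function_derivative:
  assumes "test_function \<Omega> \<phi>"
  shows "(\<phi> has_derivative (\<bullet>) (grad \<phi> x)) (at x)"
proof -
  have "C_k (Suc 0) \<phi>" using assms unfolding test_function_def by blast
  thus ?thesis using has_derivative_grad[of \<phi> x] by simp
qed

lemma test_function_continuous:
  assumes "test_function \<Omega> \<phi>"
  shows "continuous_on UNIV \<phi>" "continuous_on UNIV (grad \<phi>)"
proof -
  have "C_k 0 \<phi>" "C_k (Suc 0) \<phi>" using assms unfolding test_function_def by blast+
  thus "continuous_on UNIV \<phi>" "continuous_on UNIV (grad \<phi>)"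
    using continuous_on_vec_lambda[of UNIV "\<lambda>i x. grad \<phi> x $ i"] by simp_all
qed

lemma test_function_measurable:
  assumes "test_function \<Omega> \<phi>"
  shows "\<phi> \<in> borel_measurable borel" "grad \<phi> \<in> borel_measurable borel"
  using test_function_continuous[OF assms] by (auto intro: borel_measurable_continuous_onI)

lemma test_function_support:
  assumes "test_function \<Omega> \<phi>"
  obtains K where "compact K" "K \<subseteq> \<Omega>" "\<And>x. x \<notin> K \<Longrightarrow> \<phi> x = 0" "\<And>x. x \<notin> K \<Longrightarrow> grad \<phi> x = 0"
proof
  let ?K = "closure {x. \<phi> x \<noteq> 0}"
  show "compact ?K" "?K \<subseteq> \<Omega>" using assms by (auto simp: test_function_def)
  show z: "\<phi> x = 0" if "x \<notin> ?K" for x using that closure_subset[of "{x. \<phi> x \<noteq> 0}"] by auto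
  show "grad \<phi> x = 0" if "x \<notin> ?K" for x
  proof (rule grad_eqI)
    have "(\<phi> has_derivative (\<lambda>h. 0)) (at x)"
    proof (rule has_derivative_transform_within_open)
      show "((\<lambda>_. 0 :: real) has_derivative (\<lambda>h. 0)) (at x)" by simp
      show "open (- ?K)" "x \<in> - ?K" using that by auto
      show "0 = \<phi> y" if "y \<in> - ?K" for y using z[of y] that by simp
    qed
    thus "(\<phi> has_derivative (\<bullet>) 0) (at x)" by (rule has_derivative_eq_rhs) auto
  qed
qed

lemma test_function_vanish:
  assumes "test_function \<Omega> \<phi>" "x \<notin> \<Omega>"
  shows "\<phi> x = 0" "grad \<phi> x = 0"
  using test_function_support[OF assms(1)] assms(2) by (metis subsetD)+

lemma test_function_bounded:
  assumes "test_function \<Omega> \<phi>"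
  obtains C where "C \<ge> 0" "\<And>x. \<bar>\<phi> x\<bar> \<le> C" "\<And>x. norm (grad \<phi> x) \<le> C"
proof -
  obtain K where K: "compact K" "K \<subseteq> \<Omega>" "\<And>x. x \<notin> K \<Longrightarrow> \<phi> x = 0" "\<And>x. x \<notin> K \<Longrightarrow> grad \<phi> x = 0"
    using test_function_support[OF assms] by metis
  note c = test_function_continuous[OF assms]
  have "bounded (\<phi> ` K)" "bounded (grad \<phi> ` K)"
    using c K(1) by (meson compact_continuous_image compact_imp_bounded continuous_on_subset subset_UNIV)+
  then obtain C1 C2 where C: "\<And>x. x \<in> K \<Longrightarrow> \<bar>\<phi> x\<bar> \<le> C1" "\<And>x. x \<in> K \<Longrightarrow> norm (grad \<phi> x) \<le> C2"
    unfolding bounded_iff by auto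
  show thesis
  proof (rule that[of "max 0 (max C1 C2)"])
    fix x
    show "\<bar>\<phi> x\<bar> \<le> max 0 (max C1 C2)" "norm (grad \<phi> x) \<le> max 0 (max C1 C2)"
      using C[of x] K(3,4)[of x] by (cases "x \<in> K"; auto)+
  qed simp
qed

lemma test_function_lipschitz:
  assumes "test_function \<Omega> \<phi>" "\<And>x. norm (grad \<phi> x) \<le> C"
  shows "\<bar>\<phi> x - \<phi> y\<bar> \<le> C * norm (x - y)"
proof -
  have C: "C \<ge> 0" using assms(2)[of 0] norm_ge_zero order_trans by blast
  have "norm (\<phi> x - \<phi> y) \<le> C * norm (x - y)"
  proof (rule differentiable_bound[of UNIV _ "\<lambda>x. (\<bullet>) (grad \<phi> x)"])
    fix z
    show "onorm ((\<bullet>) (grad \<phi> z)) \<le> C"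
    proof (rule onorm_bound[OF C])
      fix h
      show "norm (grad \<phi> z \<bullet> h) \<le> C * norm h"
        using Cauchy_Schwarz_ineq2[of "grad \<phi> z" h] mult_right_mono[OF assms(2)[of z] norm_ge_zero[of h]]
        by auto
    qed
  qed (use test_function_derivative[OF assms(1)] in auto)
  thus ?thesis by simp
qed

lemma test_function_add: "test_function \<Omega> \<phi> \<Longrightarrow> test_function \<Omega> \<psi> \<Longrightarrow> test_function \<Omega> (\<lambda>x. \<phi> x + \<psi> x)"
  and test_function_mult: "test_function \<Omega> \<phi> \<Longrightarrow> (\<And>k. C_k k f) \<Longrightarrow> test_function \<Omega> (\<lambda>x. f x * \<phi> x)"
  for \<phi> :: "real ^ 'n \<Rightarrow> real"
proof -
  assume a: "test_function \<Omega> \<phi>" "test_function \<Omega> \<psi>"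
  have "{x. \<phi> x + \<psi> x \<noteq> 0} \<subseteq> {x. \<phi> x \<noteq> 0} \<union> {x. \<psi> x \<noteq> 0}" by auto
  from closure_mono[OF this] have
    s: "closure {x. \<phi> x + \<psi> x \<noteq> 0} \<subseteq> closure {x. \<phi> x \<noteq> 0} \<union> closure {x. \<psi> x \<noteq> 0}"
    by (simp add: closure_Un)
  moreover have "compact (closure {x. \<phi> x + \<psi> x \<noteq> 0})"
    using a bounded_subset[OF _ \<open>{x. \<phi> x + \<psi> x \<noteq> 0} \<subseteq> {x. \<phi> x \<noteq> 0} \<union> {x. \<psi> x \<noteq> 0}\<close>]
    by (simp add: test_function_def)
  ultimately show "test_function \<Omega> (\<lambda>x. \<phi> x + \<psi> x)"
    using a unfolding test_function_def by (auto intro!: C_k_add)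
next
  assume a: "test_function \<Omega> \<phi>" "\<And>k. C_k k f"
  have "{x. f x * \<phi> x \<noteq> 0} \<subseteq> {x. \<phi> x \<noteq> 0}" by auto
  from closure_mono[OF this] have s: "closure {x. f x * \<phi> x \<noteq> 0} \<subseteq> closure {x. \<phi> x \<noteq> 0}" .
  moreover have "compact (closure {x. f x * \<phi> x \<noteq> 0})"
    using a bounded_subset[OF _ \<open>{x. f x * \<phi> x \<noteq> 0} \<subseteq> {x. \<phi> x \<noteq> 0}\<close>]
    by (simp add: test_function_def)
  ultimately show "test_function \<Omega> (\<lambda>x. f x * \<phi> x)"
    using a unfolding test_function_def by (auto intro!: C_k_mult simp del: mult_eq_0_iff)
qed

lemma test_function_comp:
  assumes "test_function \<Omega> \<phi>" "smooth_real G" "G 0 = 0"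
  shows "test_function \<Omega> (\<lambda>x. G (\<phi> x))"
proof -
  have "{x. G (\<phi> x) \<noteq> 0} \<subseteq> {x. \<phi> x \<noteq> 0}" using assms(3) by auto
  from closure_mono[OF this] have s: "closure {x. G (\<phi> x) \<noteq> 0} \<subseteq> closure {x. \<phi> x \<noteq> 0}" .
  moreover have "compact (closure {x. G (\<phi> x) \<noteq> 0})"
    using assms bounded_subset[OF _ \<open>{x. G (\<phi> x) \<noteq> 0} \<subseteq> {x. \<phi> x \<noteq> 0}\<close>]
    by (simp add: test_function_def)
  ultimately show ?thesis
    using assms C_k_comp[OF assms(2)] unfolding test_function_def by blast
qed

lemma grad_add:
  assumes "test_function \<Omega> \<phi>" "test_function \<Omega> \<psi>"
  shows "grad (\<lambda>x. \<phi> x + \<psi> x) x = grad \<phi> x + grad \<psi> x"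
  by (rule grad_eqI, rule has_derivative_eq_rhs[OF has_derivative_add[OF
    test_function_derivative[OF assms(1)] test_function_derivative[OF assms(2)]]])
    (auto simp: fun_eq_iff inner_add_left)

lemma grad_mult:
  assumes "test_function \<Omega> \<phi>" "test_function \<Omega>' \<psi>"
  shows "grad (\<lambda>x. \<phi> x * \<psi> x) x = \<phi> x *\<^sub>R grad \<psi> x + \<psi> x *\<^sub>R grad \<phi> x"
  by (rule grad_eqI, rule has_derivative_eq_rhs[OF has_derivative_mult[OF
    test_function_derivative[OF assms(1)] test_function_derivative[OF assms(2)]]])
    (auto simp: fun_eq_iff inner_add_left)

lemma grad_cmult:
  assumes "test_function \<Omega> \<phi>"
  shows "grad (\<lambda>x. c * \<phi> x) x = c *\<^sub>R grad \<phi> x"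
  by (rule grad_eqI, rule has_derivative_eq_rhs[OF has_derivative_mult_right[OF
    test_function_derivative[OF assms]]]) (auto simp: fun_eq_iff)

lemma grad_comp:
  assumes "test_function \<Omega> \<phi>" "\<And>t. (G has_real_derivative G' t) (at t)"
  shows "grad (\<lambda>x. G (\<phi> x)) x = G' (\<phi> x) *\<^sub>R grad \<phi> x"
  by (rule grad_eqI, rule has_derivative_eq_rhs[OF has_derivative_compose[OF
    test_function_derivative[OF assms(1)] assms(2)[unfolded has_field_derivative_def]]])
    (auto simp: fun_eq_iff)

lemma test_function_cmult: "test_function \<Omega> \<phi> \<Longrightarrow> test_function \<Omega> (\<lambda>x. c * \<phi> x)"
  using test_function_mult[of \<Omega> \<phi> "\<lambda>x. c"] C_k_const by auto

lemma test_function_zero: "test_function \<Omega> (\<lambda>x. 0)"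
  by (simp add: test_function_def C_k_const)

text \<open>The free F covers the function itself, the norm of its gradient and its directional
  derivatives with one proof.\<close>

lemma test_function_integrable:
  assumes "test_function \<Omega> \<phi>" "bounded \<Omega>" "open \<Omega>" and F: "continuous_on UNIV F" "F (0, 0) = 0"
  shows "integrable lborel (\<lambda>x. F (\<phi> x, grad \<phi> x) :: real)"
proof -
  obtain K where K: "compact K" "K \<subseteq> \<Omega>" "\<And>x. x \<notin> K \<Longrightarrow> \<phi> x = 0" "\<And>x. x \<notin> K \<Longrightarrow> grad \<phi> x = 0"
    using test_function_support[OF assms(1)] by metis
  have c: "continuous_on UNIV (\<lambda>x. F (\<phi> x, grad \<phi> x))"
    by (rule continuous_on_compose2[OF F(1)]) (use test_function_continuous[OF assms(1)] in \<open>auto intro!: continuous_intros\<close>)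
  have "set_integrable lborel K (\<lambda>x. F (\<phi> x, grad \<phi> x))"
    unfolding set_integrable_def
    by (rule borel_integrable_compact[OF K(1)]) (use c continuous_on_subset in blast)
  moreover have "(\<lambda>x. indicator K x *\<^sub>R F (\<phi> x, grad \<phi> x)) = (\<lambda>x. F (\<phi> x, grad \<phi> x))"
    using K(3,4) F(2) by (auto simp: fun_eq_iff indicator_def)
  ultimately show ?thesis unfolding set_integrable_def by simp
qed

lemma test_function_quotient_tendsto:
  assumes "test_function \<Omega> \<phi>"
  shows "(\<lambda>n. real (Suc n) * (\<phi> ((1 / real (Suc n)) *\<^sub>R h + x) - \<phi> x)) \<longlonglongrightarrow> grad \<phi> x \<bullet> h"
  using derivative_sequence[OF test_function_derivative[OF assms], of x h] by (simp add: add.commute)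

text \<open>Supplies the dominating function for difference quotients. The step never exceeds h, so
  the supports stay in one ball, and the Lipschitz constant bounds the height.\<close>

lemma test_function_quotient_bound:
  assumes "test_function \<Omega> \<phi>"
  obtains R C where "C \<ge> 0" "\<And>n x. \<bar>real (Suc n) * (\<phi> ((1 / real (Suc n)) *\<^sub>R h + x) - \<phi> x)\<bar> \<le> C * indicator (cball 0 R) x"
proof -
  obtain C where C: "C \<ge> 0" "\<And>x. norm (grad \<phi> x) \<le> C" using test_function_bounded[OF assms] by metis
  obtain K where K: "compact K" "\<And>x. x \<notin> K \<Longrightarrow> \<phi> x = 0"
    using test_function_support[OF assms] by metis
  obtain r where r: "\<And>x. x \<in> K \<Longrightarrow> norm x \<le> r"
    using compact_imp_bounded[OF K(1)] unfolding bounded_iff by auto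
  have out: "\<phi> x = 0" if "norm x > r" for x using r[of x] that K(2)[of x] by auto
  show thesis
  proof (rule that[of "C * norm h" "r + norm h"])
    fix n x
    have n1: "norm ((1 / real (Suc n)) *\<^sub>R h) \<le> norm h"
      using mult_right_mono[of "1 / real (Suc n)" 1 "norm h"] by (simp del: of_nat_Suc)
    show "\<bar>real (Suc n) * (\<phi> ((1 / real (Suc n)) *\<^sub>R h + x) - \<phi> x)\<bar> \<le> C * norm h * indicator (cball 0 (r + norm h)) x"
    proof (cases "x \<in> cball 0 (r + norm h)")
      case True
      have "\<bar>\<phi> ((1 / real (Suc n)) *\<^sub>R h + x) - \<phi> x\<bar> \<le> C * norm ((1 / real (Suc n)) *\<^sub>R h)"
        using test_function_lipschitz[OF assms C(2), of "(1 / real (Suc n)) *\<^sub>R h + x" x] by simp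
      hence "real (Suc n) * \<bar>\<phi> ((1 / real (Suc n)) *\<^sub>R h + x) - \<phi> x\<bar> \<le> real (Suc n) * (C * norm ((1 / real (Suc n)) *\<^sub>R h))"
        by (intro mult_left_mono) auto
      also have "\<dots> = C * norm h" by (simp del: of_nat_Suc)
      finally show ?thesis using True by (simp add: abs_mult del: of_nat_Suc)
    next
      case False
      hence x: "norm x > r + norm h" by simp
      have "norm ((1 / real (Suc n)) *\<^sub>R h + x) \<ge> norm x - norm ((1 / real (Suc n)) *\<^sub>R h)"
        using norm_triangle_ineq2[of x "- ((1 / real (Suc n)) *\<^sub>R h)"]
        unfolding norm_minus_cancel diff_minus_eq_add by (simp only: add.commute)
      hence "norm ((1 / real (Suc n)) *\<^sub>R h + x) > r" using n1 x by linarith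
      moreover have "norm x > r" using x norm_ge_zero[of h] by linarith
      ultimately show ?thesis using out False by simp
    qed
  qed (use C in auto)
qed

text \<open>Translation invariance gives every difference quotient the integral 0, and dominated
  convergence passes this to the directional derivative.\<close>

lemma integral_grad_test_function:
  assumes "test_function \<Omega> \<phi>" "bounded \<Omega>" "open \<Omega>"
  shows "(LINT x|lborel. grad \<phi> x \<bullet> h) = 0"
proof -
  note [measurable] = test_function_measurable[OF assms(1)]
  have int: "integrable lborel \<phi>"
    using test_function_integrable[OF assms, of fst] by (simp add: continuous_on_fst)
  obtain R C where C: "C \<ge> 0"
    "\<And>n x. \<bar>real (Suc n) * (\<phi> ((1 / real (Suc n)) *\<^sub>R h + x) - \<phi> x)\<bar> \<le> C * indicator (cball 0 R) x"
    using test_function_quotient_bound[OF assms(1)] by metis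
  have "(\<lambda>n. LINT x|lborel. real (Suc n) * (\<phi> ((1 / real (Suc n)) *\<^sub>R h + x) - \<phi> x)) \<longlonglongrightarrow>
      (LINT x|lborel. grad \<phi> x \<bullet> h)"
  proof (rule integral_dominated_convergence)
    show "integrable lborel (\<lambda>x. C * indicator (cball 0 R) x)"
      by (intro integrable_mult_right integrable_real_indicator emeasure_lborel_cball_finite) simp
  qed (use C(2) test_function_quotient_tendsto[OF assms(1)] in auto)
  moreover have "(LINT x|lborel. real (Suc n) * (\<phi> ((1 / real (Suc n)) *\<^sub>R h + x) - \<phi> x)) = 0" for n
    using int lborel_integrable_shift[OF int, of "(1 / real (Suc n)) *\<^sub>R h"]
      lborel_integral_shift[of \<phi> "(1 / real (Suc n)) *\<^sub>R h"]
    by (simp del: of_nat_Suc)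
  ultimately show ?thesis by (simp add: LIMSEQ_const_iff)
qed

section \<open>Bumps on boxes and the fundamental lemma of the calculus of variations\<close>

definition box_bump :: "real ^ 'n \<Rightarrow> real ^ 'n \<Rightarrow> nat \<Rightarrow> real ^ 'n \<Rightarrow> real" where
  "box_bump a b m x = (\<Prod>i\<in>UNIV. flat 1 (real (Suc m) * (x $ i - a $ i)) * flat 1 (real (Suc m) * (b $ i - x $ i)))"

lemma box_bump_nonzero_iff: "box_bump a b m x \<noteq> 0 \<longleftrightarrow> x \<in> box a b"
  by (auto simp: box_bump_def flat_one_pos_iff mem_box_cart zero_less_mult_iff simp del: of_nat_Suc)

lemma box_bump_bounds: "0 \<le> box_bump a b m x" "box_bump a b m x \<le> 1"
  unfolding box_bump_def
  by (auto intro!: prod_nonneg prod_le_1 mult_nonneg_nonneg mult_le_one simp: flat_one_bounds)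

lemma box_bump_tendsto: "(\<lambda>m. box_bump a b m x) \<longlonglongrightarrow> indicator (box a b) x"
proof -
  have "(\<lambda>m. box_bump a b m x) \<longlonglongrightarrow>
     (\<Prod>i\<in>UNIV. (if x $ i - a $ i > 0 then 1 else 0) * (if b $ i - x $ i > 0 then 1 else 0))"
    unfolding box_bump_def by (intro tendsto_prod tendsto_mult flat_scaled_tendsto) simp_all
  moreover have "(\<Prod>i\<in>UNIV. (if x $ i - a $ i > 0 then 1 else 0) * (if b $ i - x $ i > 0 then 1 else 0))
     = (indicator (box a b) x :: real)"
    by (auto simp: indicator_def mem_box_cart intro!: prod.neutral prod_zero)
  ultimately show ?thesis by simp
qed

lemma test_function_box_bump:
  assumes "closure (box a b) \<subseteq> \<Omega>"
  shows "test_function \<Omega> (box_bump a b m)"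
proof -
  have e: "{x. box_bump a b m x \<noteq> 0} = box a b" by (simp add: box_bump_nonzero_iff)
  have "C_k k (\<lambda>x. flat 1 (real (Suc m) * (x $ i - a $ i)))" for k i
  proof -
    have "C_k k (\<lambda>x. 1 * flat 1 (real (Suc m) * (x $ i) + (- real (Suc m) * a $ i)))"
      by (rule C_k_comp[OF smooth_real_affine[OF smooth_real_flat] C_k_coord])
    thus ?thesis by (simp add: algebra_simps del: of_nat_Suc)
  qed
  moreover have "C_k k (\<lambda>x. flat 1 (real (Suc m) * (b $ i - x $ i)))" for k i
  proof -
    have "C_k k (\<lambda>x. 1 * flat 1 ((- real (Suc m)) * (x $ i) + (real (Suc m) * b $ i)))"
      by (rule C_k_comp[OF smooth_real_affine[OF smooth_real_flat] C_k_coord])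
    thus ?thesis by (simp add: algebra_simps del: of_nat_Suc)
  qed
  ultimately have "C_k k (box_bump a b m)" for k
    unfolding box_bump_def[abs_def] by (intro C_k_prod C_k_mult) auto
  thus ?thesis using assms by (auto simp: test_function_def e)
qed

text \<open>Boxes are stable under intersection and generate the Borel sets, so induction over
  disjoint unions and complements makes the integral of G vanish on every Borel set. The sets {G >
  0} and {G < 0} then give the integral of |G|.\<close>

lemma AE_zero_if_box_integrals_zero:
  fixes G :: "'a::euclidean_space \<Rightarrow> real"
  assumes G: "integrable lborel G" and z: "\<And>c d. (LINT x|lborel. indicator (box c d) x * G x) = 0"
  shows "AE x in lborel. G x = 0"
proof -
  have Gm[measurable]: "G \<in> borel_measurable borel" using G by auto
  have iA: "integrable lborel (\<lambda>x. indicator A x * G x)" if "A \<in> sets borel" for A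
    using integrable_mult_indicator[of A lborel G] that G by simp
  have Aux: "(LINT x|lborel. indicator A x * G x) = 0" if A: "A \<in> sets borel" for A
  proof -
    let ?G = "range (\<lambda>(a, b). box a b :: 'a set)"
    have sA: "A \<in> sigma_sets UNIV ?G" using A unfolding borel_eq_box by (simp add: sets_measure_of)
    have sub: "B \<in> sets borel" if "B \<in> sigma_sets UNIV ?G" for B
      using that unfolding borel_eq_box by (simp add: sets_measure_of)
    have "Int_stable ?G"
      by (auto simp: Int_stable_def box_Int_box)
    from sA show ?thesis
    proof (rule sigma_sets_induct_disjoint[OF \<open>Int_stable ?G\<close>, of UNIV A, rotated])
      fix B assume compl: "B \<in> sigma_sets UNIV ?G" "(LINT x|lborel. indicator B x * G x) = 0"
      \<comment> \<open>The case of complements needs the whole space, which is exhausted by boxes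
        centred at the origin.\<close>
      have "(LINT x|lborel. G x) = 0"
      proof -
        have "(\<lambda>n. LINT x|lborel. indicator (box (- real n *\<^sub>R One) (real n *\<^sub>R One)) x * G x) \<longlonglongrightarrow> (LINT x|lborel. G x)"
        proof (rule integral_dominated_convergence[where w="\<lambda>x. norm (G x)"])
          have "(\<lambda>n. indicator (box (- real n *\<^sub>R One) (real n *\<^sub>R One)) x * G x) \<longlonglongrightarrow> G x" for x
          proof -
            obtain N :: nat where N: "real N > norm x" using reals_Archimedean2 by blast
            have "x \<in> box (- real n *\<^sub>R One) (real n *\<^sub>R One)" if "n \<ge> N" for n
            proof -
              have "\<bar>x \<bullet> i\<bar> < real n" if "i \<in> Basis" for i
                using Basis_le_norm[OF that, of x] N \<open>n \<ge> N\<close> by (meson of_nat_le_iff order.strict_trans1 order.strict_trans2)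
              hence "- real n < x \<bullet> i \<and> x \<bullet> i < real n" if "i \<in> Basis" for i
                using that by (auto simp: abs_less_iff minus_less_iff)
              thus ?thesis by (simp add: mem_box)
            qed
            thus ?thesis by (intro tendsto_eventually) (auto simp: eventually_sequentially intro!: exI[of _ N])
          qed
          thus "AE x in lborel. (\<lambda>n. indicator (box (- real n *\<^sub>R One) (real n *\<^sub>R One)) x * G x) \<longlonglongrightarrow> G x" by simp
        qed (use G in \<open>auto simp: indicator_def\<close>)
        thus ?thesis by (simp add: z LIMSEQ_const_iff)
      qed
      moreover have "(\<lambda>x. indicator (UNIV - B) x * G x) = (\<lambda>x. G x - indicator B x * G x)"
        by (auto simp: indicator_def)
      ultimately show "(LINT x|lborel. indicator (UNIV - B) x * G x) = 0"
        using compl G iA[OF sub[OF compl(1)]] by simp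
    next
      fix B :: "nat \<Rightarrow> 'a set"
      assume union: "disjoint_family B" "range B \<subseteq> sigma_sets UNIV ?G"
        "\<And>i. (LINT x|lborel. indicator (B i) x * G x) = 0"
      have Bs[measurable]: "B i \<in> sets borel" for i by (rule sub) (use union(2) in blast)
      have "(\<lambda>n. LINT x|lborel. (\<Sum>i<n. indicator (B i) x * G x)) \<longlonglongrightarrow> (LINT x|lborel. indicator (\<Union>i. B i) x * G x)"
      proof (rule integral_dominated_convergence[where w="\<lambda>x. norm (G x)"])
        have e: "(\<Sum>i<n. indicator (B i) x * G x) = indicator (\<Union>i<n. B i) x * G x" for n x
        proof -
          have "(\<Sum>i<n. indicator (B i) x) = (indicator (\<Union>i<n. B i) x :: real)"
            by (rule indicator_UN_disjoint[symmetric]) (use union(1) in \<open>auto simp: disjoint_family_on_def\<close>)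
          thus ?thesis by (simp only: sum_distrib_right[symmetric])
        qed
        show "AE x in lborel. norm (\<Sum>i<n. indicator (B i) x * G x) \<le> norm (G x)" for n
          unfolding e by (auto simp: indicator_def)
        have "(\<lambda>n. (\<Sum>i<n. indicator (B i) x * G x)) \<longlonglongrightarrow> indicator (\<Union>i. B i) x * G x" for x
          using sums_mult2[OF indicator_sums[of B x], of "G x"] union(1)
          unfolding sums_def disjoint_family_on_def by auto
        thus "AE x in lborel. (\<lambda>n. (\<Sum>i<n. indicator (B i) x * G x)) \<longlonglongrightarrow> indicator (\<Union>i. B i) x * G x" by simp
        show "(\<lambda>x. \<Sum>i<n. indicator (B i) x * G x) \<in> borel_measurable lborel" for n
          using Bs by simp
        show "(\<lambda>x. indicator (\<Union>i. B i) x * G x) \<in> borel_measurable lborel"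
          using Bs by simp
      qed (use G in auto)
      moreover have "(LINT x|lborel. (\<Sum>i<n. indicator (B i) x * G x)) = 0" for n
        using union(3) iA[OF Bs] by (subst Bochner_Integration.integral_sum) auto
      ultimately show "(LINT x|lborel. indicator (\<Union>i. B i) x * G x) = 0" by (simp add: LIMSEQ_const_iff)
    qed (auto simp: z)
  qed
  have "(LINT x|lborel. \<bar>G x\<bar>) = 0"
  proof -
    have "\<bar>G x\<bar> = indicator {x. G x > 0} x * G x - indicator {x. G x < 0} x * G x" for x
      by (auto simp: indicator_def)
    thus ?thesis using Aux iA by simp
  qed
  thus ?thesis using integral_nonneg_eq_0_iff_AE[of lborel "\<lambda>x. \<bar>G x\<bar>"] G by auto
qed

text \<open>As g is only locally integrable, the argument runs inside one closed box of the domain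
  at a time; countably many of these cover the domain. Inside a box, bumps converge boundedly to the
  indicators of its subboxes.\<close>

lemma AE_zero_if_test_integrals_zero:
  fixes g :: "real ^ 'n \<Rightarrow> real"
  assumes op: "open \<Omega>" and g: "loc_integrable \<Omega> g"
    and z: "\<And>\<phi>. test_function \<Omega> \<phi> \<Longrightarrow> (LINT x|lebesgue_on \<Omega>. \<phi> x * g x) = 0"
  shows "AE x in lebesgue_on \<Omega>. g x = 0"
proof -
  have O: "\<Omega> \<in> sets lebesgue" using op by auto
  have main: "AE x in lebesgue. x \<in> cbox a b \<longrightarrow> g x = 0" if ab: "cbox a b \<subseteq> \<Omega>" for a b
  proof -
    define G where "G x = (if x \<in> cbox a b then g x else 0)" for x
    have G: "integrable lebesgue G"
      using g ab unfolding loc_integrable_def G_def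
      by (subst Lebesgue_Measure.integrable_restrict_UNIV) (auto simp: compact_cbox)
    \<comment> \<open>A Borel representative is taken because the lemma on box integrals speaks of
      \<open>lborel\<close>.\<close>
    obtain G' where G': "G' \<in> borel_measurable lborel" "AE x in lborel. G x = G' x"
      using completion_ex_borel_measurable_real[of G lborel] G by auto
    have ae: "AE x in lebesgue. G x = G' x" using G'(2) by (rule AE_completion)
    have iG': "integrable lborel G'"
      using integrable_cong_AE_imp[OF G _ ae] G'(1) by (simp add: integrable_completion measurable_completion)
    have "(LINT x|lborel. indicator (box c d) x * (indicator (box a b) x * G' x)) = 0" for c d
    proof -
      \<comment> \<open>Cutting the arbitrary box down to the given one yields a box whose closure
        lies in the domain, so that its bumps are admissible test functions.\<close>
      obtain c' d' where cd: "box c' d' = box c d \<inter> box a b" using that[OF box_Int_box[symmetric]] .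
      have "closure (box c' d') \<subseteq> cbox a b"
        unfolding cd by (meson closed_cbox closure_minimal inf.coboundedI2 box_subset_cbox)
      with ab have cl: "closure (box c' d') \<subseteq> \<Omega>" by blast
      have sub: "box c' d' \<subseteq> cbox a b" using cd box_subset_cbox by blast
      have eq: "(LINT x|lebesgue_on \<Omega>. box_bump c' d' m x * g x) = (LINT x|lebesgue. box_bump c' d' m x * G x)" for m
      proof -
        have "(LINT x|lebesgue_on \<Omega>. box_bump c' d' m x * g x) =
            (LINT x|lebesgue. (if x \<in> \<Omega> then box_bump c' d' m x * g x else 0))"
          by (rule Lebesgue_Measure.integral_restrict_UNIV[OF O, symmetric])
        also have "(\<lambda>x. if x \<in> \<Omega> then box_bump c' d' m x * g x else 0) = (\<lambda>x. box_bump c' d' m x * G x)"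
          using box_bump_nonzero_iff[of c' d' m] sub ab by (auto simp: G_def fun_eq_iff)
        finally show ?thesis .
      qed
      have [measurable]: "box_bump c' d' m \<in> borel_measurable lebesgue" for m
        using test_function_measurable[OF test_function_box_bump[OF cl]] by (auto intro: measurable_completion)
      have Gm: "G \<in> borel_measurable lebesgue" using G by auto
      have "(\<lambda>m. LINT x|lebesgue. box_bump c' d' m x * G x) \<longlonglongrightarrow> (LINT x|lebesgue. indicator (box c' d') x * G x)"
      proof (rule integral_dominated_convergence[where w="\<lambda>x. norm (G x)"])
        show "AE x in lebesgue. norm (box_bump c' d' m x * G x) \<le> norm (G x)" for m
          using box_bump_bounds[of c' d' m] by (auto simp: abs_mult mult_left_le_one_le)
        show "AE x in lebesgue. (\<lambda>m. box_bump c' d' m x * G x) \<longlonglongrightarrow> indicator (box c' d') x * G x"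
          by (intro AE_I2 tendsto_mult box_bump_tendsto tendsto_const)
        show "(\<lambda>x. indicator (box c' d') x * G x) \<in> borel_measurable lebesgue"
          using Gm by (intro borel_measurable_times borel_measurable_indicator) auto
      qed (use G Gm in auto)
      hence "(LINT x|lebesgue. indicator (box c' d') x * G x) = 0"
        using z[OF test_function_box_bump[OF cl]] by (simp add: eq[symmetric] LIMSEQ_const_iff)
      moreover have "(LINT x|lebesgue. indicator (box c' d') x * G x) = (LINT x|lebesgue. indicator (box c' d') x * G' x)"
      proof (rule integral_cong_AE)
        show "(\<lambda>x. indicator (box c' d') x * G x) \<in> borel_measurable lebesgue"
          using Gm by (intro borel_measurable_times borel_measurable_indicator) auto
        show "(\<lambda>x. indicator (box c' d') x * G' x) \<in> borel_measurable lebesgue"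
          using G'(1) by (intro measurable_completion) simp
      qed (use ae in auto)
      moreover have "\<dots> = (LINT x|lborel. indicator (box c' d') x * G' x)"
        using G'(1) by (intro integral_completion) auto
      moreover have "indicator (box c' d') x * G' x = indicator (box c d) x * (indicator (box a b) x * G' x)" for x
        unfolding cd by (simp add: indicator_def)
      ultimately show ?thesis by simp
    qed
    moreover have "integrable lborel (\<lambda>x. indicator (box a b) x * G' x)"
      using integrable_mult_indicator[of "box a b" lborel G'] iG' by simp
    ultimately have "AE x in lborel. indicator (box a b) x * G' x = 0"
      by (rule AE_zero_if_box_integrals_zero[rotated])
    hence "AE x in lebesgue. indicator (box a b) x * G' x = 0" by (rule AE_completion)
    moreover have "AE x in lebesgue. x \<notin> cbox a b - box a b"
    proof (rule AE_not_in)
      have "negligible (cbox a b - box a b)" by (metis negligible_frontier_interval)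
      thus "cbox a b - box a b \<in> null_sets lebesgue" by (simp add: negligible_iff_null_sets)
    qed
    ultimately show ?thesis using ae by eventually_elim (auto simp: G_def indicator_def)
  qed
  obtain D where D: "countable D" "D \<subseteq> Pow \<Omega>" "\<And>X. X \<in> D \<Longrightarrow> \<exists>a b. X = cbox a b" "\<Union>D = \<Omega>"
    using open_countable_Union_open_cbox[OF op] by metis
  have "AE x in lebesgue. \<forall>X\<in>D. x \<in> X \<longrightarrow> g x = 0"
    unfolding AE_ball_countable[OF D(1)] using main D(2,3) by blast
  hence "AE x in lebesgue. x \<in> \<Omega> \<longrightarrow> g x = 0" by eventually_elim (use D(4) in auto)
  thus ?thesis using O by (simp add: AE_restrict_space_iff)
qed

section \<open>The space \<open>W\<^sub>0\<^sup>1\<^sup>,\<^sup>p\<close> as pairs of a function and its gradient\<close>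

text \<open>The gradient is carried along, which avoids the choice made by \<open>weak_grad\<close> and turns closedness
  into plain \<open>L\<^sup>p\<close> convergence of pairs.\<close>

definition W0 :: "(real ^ 'n) set \<Rightarrow> real \<Rightarrow> (real ^ 'n \<Rightarrow> real) \<Rightarrow> (real ^ 'n \<Rightarrow> real ^ 'n) \<Rightarrow> bool" where
  "W0 \<Omega> p u g \<longleftrightarrow> memLp (lebesgue_on \<Omega>) p u \<and> memLp (lebesgue_on \<Omega>) p g \<and>
     (\<forall>e>0. \<exists>\<phi>. test_function \<Omega> \<phi> \<and> pint (lebesgue_on \<Omega>) p (\<lambda>x. u x - \<phi> x)
        + pint (lebesgue_on \<Omega>) p (\<lambda>x. g x - grad \<phi> x) < e)"

lemma Lp_iff: "f \<in> Lp \<Omega> p \<longleftrightarrow> memLp (lebesgue_on \<Omega>) p f"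
  by (simp add: Lp_def memLp_def)

locale sobolev_domain =
  fixes \<Omega> :: "(real ^ 'n) set" and p :: real
  assumes open_domain: "open \<Omega>" and bounded_domain: "bounded \<Omega>" and p_gt_1: "1 < p"
begin

abbreviation "M \<equiv> lebesgue_on \<Omega>"

lemma p_bounds: "0 \<le> p" "0 < p" "1 \<le> p" using p_gt_1 by auto

lemma domain_sets: "\<Omega> \<in> sets lebesgue" using open_domain by auto

lemma finite_M: "finite_measure M"
  by (intro finite_measure_lebesgue_on lmeasurable_open bounded_domain open_domain)

lemma borel_measurable_M: "f \<in> borel_measurable borel \<Longrightarrow> f \<in> borel_measurable M"
  by (intro measurable_restrict_space1 measurable_completion) simp

lemma test_function_memLp:
  assumes "test_function \<Omega> \<phi>"
  shows "memLp M p \<phi>" "memLp M p (grad \<phi>)"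
proof -
  obtain C where C: "\<And>x. \<bar>\<phi> x\<bar> \<le> C" "\<And>x. norm (grad \<phi> x) \<le> C" using test_function_bounded[OF assms] by metis
  note m = test_function_measurable[OF assms]
  show "memLp M p \<phi>" "memLp M p (grad \<phi>)"
    by (rule memLp_bounded[OF finite_M borel_measurable_M _ p_bounds(1), where C=C]; use m C in simp)+
qed

lemma W0_memLp: "W0 \<Omega> p u g \<Longrightarrow> memLp M p u" "W0 \<Omega> p u g \<Longrightarrow> memLp M p g"
  by (auto simp: W0_def)

lemma W0_measurable: "W0 \<Omega> p u g \<Longrightarrow> u \<in> borel_measurable M" "W0 \<Omega> p u g \<Longrightarrow> g \<in> borel_measurable M"
  by (auto simp: W0_def memLp_def)

lemma W0_seq:
  assumes "W0 \<Omega> p u g"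
  obtains \<phi> where "\<And>n. test_function \<Omega> (\<phi> n)"
    "(\<lambda>n. pint M p (\<lambda>x. u x - \<phi> n x)) \<longlonglongrightarrow> 0" "(\<lambda>n. pint M p (\<lambda>x. g x - grad (\<phi> n) x)) \<longlonglongrightarrow> 0"
proof -
  have "\<exists>\<phi>. test_function \<Omega> \<phi> \<and> pint M p (\<lambda>x. u x - \<phi> x) + pint M p (\<lambda>x. g x - grad \<phi> x) < inverse (real (Suc n))" for n
    using assms unfolding W0_def by simp
  hence "\<exists>\<phi>. \<forall>n. test_function \<Omega> (\<phi> n) \<and> pint M p (\<lambda>x. u x - \<phi> n x) + pint M p (\<lambda>x. g x - grad (\<phi> n) x) < inverse (real (Suc n))"
    by (intro choice allI)
  then obtain \<phi> where \<phi>: "\<And>n. test_function \<Omega> (\<phi> n)"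
    "\<And>n. pint M p (\<lambda>x. u x - \<phi> n x) + pint M p (\<lambda>x. g x - grad (\<phi> n) x) < inverse (real (Suc n))" by blast
  have "(\<lambda>n. pint M p (\<lambda>x. u x - \<phi> n x)) \<longlonglongrightarrow> 0" "(\<lambda>n. pint M p (\<lambda>x. g x - grad (\<phi> n) x)) \<longlonglongrightarrow> 0"
  proof -
    have le: "pint M p (\<lambda>x. u x - \<phi> n x) \<le> inverse (real (Suc n))"
      "pint M p (\<lambda>x. g x - grad (\<phi> n) x) \<le> inverse (real (Suc n))" for n
      using \<phi>(2)[of n] pint_nonneg[of M p "\<lambda>x. u x - \<phi> n x"] pint_nonneg[of M p "\<lambda>x. g x - grad (\<phi> n) x"]
      by linarith+
    show "(\<lambda>n. pint M p (\<lambda>x. u x - \<phi> n x)) \<longlonglongrightarrow> 0"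
      by (rule tendsto_sandwich[OF _ _ tendsto_const LIMSEQ_inverse_real_of_nat];
          intro always_eventually allI le pint_nonneg)
    show "(\<lambda>n. pint M p (\<lambda>x. g x - grad (\<phi> n) x)) \<longlonglongrightarrow> 0"
      by (rule tendsto_sandwich[OF _ _ tendsto_const LIMSEQ_inverse_real_of_nat];
          intro always_eventually allI le pint_nonneg)
  qed
  thus thesis using that \<phi>(1) by blast
qed

lemma W0_limit:
  assumes W: "\<And>n. W0 \<Omega> p (u n) (g n)" and uv: "memLp M p v" "memLp M p h"
    and lim: "(\<lambda>n. pint M p (\<lambda>x. u n x - v x)) \<longlonglongrightarrow> 0" "(\<lambda>n. pint M p (\<lambda>x. g n x - h x)) \<longlonglongrightarrow> 0"
  shows "W0 \<Omega> p v h"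
  unfolding W0_def
proof (intro conjI uv allI impI)
  fix e :: real assume e: "e > 0"
  \<comment> \<open>Three error terms, each below d, share the factor \<open>2 powr p\<close> of the
    quasi-triangle inequality; the fourth d is slack.\<close>
  define d where "d = e / (4 * 2 powr p)"
  have d: "d > 0" using e by (simp add: d_def)
  have "\<forall>\<^sub>F n in sequentially. pint M p (\<lambda>x. u n x - v x) < d \<and> pint M p (\<lambda>x. g n x - h x) < d"
    using order_tendstoD(2)[OF lim(1) d] order_tendstoD(2)[OF lim(2) d] by eventually_elim simp
  then obtain n where n: "pint M p (\<lambda>x. u n x - v x) < d" "pint M p (\<lambda>x. g n x - h x) < d"
    by (auto simp: eventually_sequentially)
  obtain \<phi> where \<phi>: "test_function \<Omega> \<phi>" "pint M p (\<lambda>x. u n x - \<phi> x) + pint M p (\<lambda>x. g n x - grad \<phi> x) < d"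
    using W[of n] d unfolding W0_def by blast
  note t = test_function_memLp[OF \<phi>(1)] and w = W0_memLp[OF W[of n]]
  have "pint M p (\<lambda>x. v x - \<phi> x) + pint M p (\<lambda>x. h x - grad \<phi> x)
    \<le> 2 powr p * (pint M p (\<lambda>x. v x - u n x) + pint M p (\<lambda>x. u n x - \<phi> x))
      + 2 powr p * (pint M p (\<lambda>x. h x - g n x) + pint M p (\<lambda>x. g n x - grad \<phi> x))"
    by (intro add_mono pint_triangle uv t w p_bounds)
  also have "\<dots> = 2 powr p * (pint M p (\<lambda>x. u n x - v x) + pint M p (\<lambda>x. g n x - h x)
      + (pint M p (\<lambda>x. u n x - \<phi> x) + pint M p (\<lambda>x. g n x - grad \<phi> x)))"
    by (simp add: pint_commute[of _ _ v] pint_commute[of _ _ h] algebra_simps)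
  also have "\<dots> < 2 powr p * (4 * d)"
    using n \<phi>(2) d by (intro mult_strict_left_mono) auto
  also have "\<dots> = e" by (simp add: d_def)
  finally show "\<exists>\<phi>. test_function \<Omega> \<phi> \<and> pint M p (\<lambda>x. v x - \<phi> x) + pint M p (\<lambda>x. h x - grad \<phi> x) < e"
    using \<phi>(1) by blast
qed

lemma W0_test: "test_function \<Omega> \<phi> \<Longrightarrow> W0 \<Omega> p \<phi> (grad \<phi>)"
  unfolding W0_def using test_function_memLp[of \<phi>] p_bounds by (auto simp: pint_def intro!: exI[of _ \<phi>])

lemma W0_seqI:
  assumes "\<And>n. test_function \<Omega> (\<phi> n)" "memLp M p u" "memLp M p g"
    "(\<lambda>n. pint M p (\<lambda>x. u x - \<phi> n x)) \<longlonglongrightarrow> 0" "(\<lambda>n. pint M p (\<lambda>x. g x - grad (\<phi> n) x)) \<longlonglongrightarrow> 0"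
  shows "W0 \<Omega> p u g"
  by (rule W0_limit[OF W0_test[OF assms(1)] assms(2,3)]) (use assms(4,5) in \<open>simp_all add: pint_commute[of _ _ u] pint_commute[of _ _ g]\<close>)

lemma pint_lincomb_tendsto_0:
  fixes f h :: "nat \<Rightarrow> real ^ 'n \<Rightarrow> 'b::{real_normed_vector, second_countable_topology}"
  assumes "\<And>n. memLp M p (f n)" "\<And>n. memLp M p (h n)"
    "(\<lambda>n. pint M p (f n)) \<longlonglongrightarrow> 0" "(\<lambda>n. pint M p (h n)) \<longlonglongrightarrow> 0"
  shows "(\<lambda>n. pint M p (\<lambda>x. a *\<^sub>R f n x + b *\<^sub>R h n x)) \<longlonglongrightarrow> 0"
proof (rule tendsto_sandwich[OF _ _ tendsto_const])
  show "\<forall>\<^sub>F n in sequentially. pint M p (\<lambda>x. a *\<^sub>R f n x + b *\<^sub>R h n x) \<le>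
     2 powr p * (\<bar>a\<bar> powr p * pint M p (f n) + \<bar>b\<bar> powr p * pint M p (h n))"
    using memLp_add(2)[OF memLp_scaleR(1)[OF assms(1)] memLp_scaleR(1)[OF assms(2)] p_bounds(1)]
    by (auto simp: memLp_scaleR(2)[OF assms(1)] memLp_scaleR(2)[OF assms(2)])
  have "(\<lambda>n. 2 powr p * (\<bar>a\<bar> powr p * pint M p (f n) + \<bar>b\<bar> powr p * pint M p (h n)))
      \<longlonglongrightarrow> 2 powr p * (\<bar>a\<bar> powr p * 0 + \<bar>b\<bar> powr p * 0)"
    by (intro tendsto_intros assms)
  thus "(\<lambda>n. 2 powr p * (\<bar>a\<bar> powr p * pint M p (f n) + \<bar>b\<bar> powr p * pint M p (h n))) \<longlonglongrightarrow> 0" by simp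
qed (simp add: pint_nonneg)

lemma W0_lincomb:
  assumes "W0 \<Omega> p u g" "W0 \<Omega> p v h"
  shows "W0 \<Omega> p (\<lambda>x. a * u x + b * v x) (\<lambda>x. a *\<^sub>R g x + b *\<^sub>R h x)"
proof -
  obtain \<phi> where \<phi>: "\<And>n. test_function \<Omega> (\<phi> n)"
    "(\<lambda>n. pint M p (\<lambda>x. u x - \<phi> n x)) \<longlonglongrightarrow> 0" "(\<lambda>n. pint M p (\<lambda>x. g x - grad (\<phi> n) x)) \<longlonglongrightarrow> 0"
    by (rule W0_seq[OF assms(1)], rule that, assumption+)
  obtain \<psi> where \<psi>: "\<And>n. test_function \<Omega> (\<psi> n)"
    "(\<lambda>n. pint M p (\<lambda>x. v x - \<psi> n x)) \<longlonglongrightarrow> 0" "(\<lambda>n. pint M p (\<lambda>x. h x - grad (\<psi> n) x)) \<longlonglongrightarrow> 0"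
    by (rule W0_seq[OF assms(2)], rule that, assumption+)
  note mem = W0_memLp[OF assms(1)] W0_memLp[OF assms(2)]
  note tm = test_function_memLp[OF \<phi>(1)] test_function_memLp[OF \<psi>(1)]
  show ?thesis
  proof (rule W0_seqI[of "\<lambda>n x. a * \<phi> n x + b * \<psi> n x"])
    show "test_function \<Omega> (\<lambda>x. a * \<phi> n x + b * \<psi> n x)" for n
      by (intro test_function_add test_function_cmult \<phi> \<psi>)
    show "memLp M p (\<lambda>x. a * u x + b * v x)" "memLp M p (\<lambda>x. a *\<^sub>R g x + b *\<^sub>R h x)"
      using memLp_add(1)[OF memLp_scaleR(1)[OF mem(1)] memLp_scaleR(1)[OF mem(3)] p_bounds(1)]
        memLp_add(1)[OF memLp_scaleR(1)[OF mem(2)] memLp_scaleR(1)[OF mem(4)] p_bounds(1)] by simp_all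
    show "(\<lambda>n. pint M p (\<lambda>x. a * u x + b * v x - (a * \<phi> n x + b * \<psi> n x))) \<longlonglongrightarrow> 0"
      using pint_lincomb_tendsto_0[OF memLp_diff(1)[OF mem(1) tm(1) p_bounds(1)] memLp_diff(1)[OF mem(3) tm(3) p_bounds(1)] \<phi>(2) \<psi>(2), of a b]
      by (simp add: algebra_simps)
    have e: "grad (\<lambda>x. a * \<phi> n x + b * \<psi> n x) x = a *\<^sub>R grad (\<phi> n) x + b *\<^sub>R grad (\<psi> n) x" for n x
      by (simp add: grad_add[OF test_function_cmult[OF \<phi>(1)] test_function_cmult[OF \<psi>(1)]]
          grad_cmult[OF \<phi>(1)] grad_cmult[OF \<psi>(1)])
    show "(\<lambda>n. pint M p (\<lambda>x. a *\<^sub>R g x + b *\<^sub>R h x - grad (\<lambda>x. a * \<phi> n x + b * \<psi> n x) x)) \<longlonglongrightarrow> 0"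
      using pint_lincomb_tendsto_0[OF memLp_diff(1)[OF mem(2) tm(2) p_bounds(1)] memLp_diff(1)[OF mem(4) tm(4) p_bounds(1)] \<phi>(3) \<psi>(3), of a b]
      unfolding e by (simp add: algebra_simps)
  qed
qed

lemma W0_zero: "W0 \<Omega> p (\<lambda>x. 0) (\<lambda>x. 0)"
proof -
  have "grad (\<lambda>x :: real ^ 'n. 0) x = 0" for x by (rule grad_eqI) simp
  hence "grad (\<lambda>x :: real ^ 'n. 0) = (\<lambda>x. 0)" by (rule ext)
  thus ?thesis using W0_test[OF test_function_zero] by metis
qed

lemma W0_add: "W0 \<Omega> p u g \<Longrightarrow> W0 \<Omega> p v h \<Longrightarrow> W0 \<Omega> p (\<lambda>x. u x + c * v x) (\<lambda>x. g x + c *\<^sub>R h x)"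
  using W0_lincomb[of u g v h 1 c] by simp

lemma W0_uminus: "W0 \<Omega> p u g \<Longrightarrow> W0 \<Omega> p (\<lambda>x. - u x) (\<lambda>x. - g x)"
  using W0_lincomb[of u g "\<lambda>x. 0" "\<lambda>x. 0" "-1" 0] W0_zero by simp

lemma pairing_integrable:
  fixes f v :: "real ^ 'n \<Rightarrow> real"
  assumes "memLp M p f" "v \<in> borel_measurable M" "\<And>x. \<bar>v x\<bar> \<le> C"
  shows "integrable M (\<lambda>x. f x * v x)"
proof (rule Bochner_Integration.integrable_bound)
  show "integrable M (\<lambda>x. C * f x)" using memLp_L1(1)[OF finite_M assms(1) p_bounds(3)] by simp
  have "\<bar>v x\<bar> \<le> \<bar>C\<bar>" for x using assms(3)[of x] by linarith
  thus "AE x in M. norm (f x * v x) \<le> norm (C * f x)"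
    by (intro AE_I2) (simp add: abs_mult mult.commute[of "\<bar>C\<bar>"] mult_left_mono)
qed (use assms memLp_measurable[OF assms(1)] in auto)

lemma pairing_tendsto:
  fixes f :: "nat \<Rightarrow> real ^ 'n \<Rightarrow> real"
  assumes f: "\<And>n. memLp M p (f n)" and g: "memLp M p g" and v: "v \<in> borel_measurable M" "\<And>x. \<bar>v x\<bar> \<le> C"
    and lim: "(\<lambda>n. pint M p (\<lambda>x. f n x - g x)) \<longlonglongrightarrow> 0"
  shows "(\<lambda>n. LINT x|M. f n x * v x) \<longlonglongrightarrow> (LINT x|M. g x * v x)"
proof (rule Lim_null[THEN iffD2], rule tendsto_rabs_zero_cancel, rule tendsto_sandwich[OF _ _ tendsto_const])
  have d: "memLp M p (\<lambda>x. f n x - g x)" for n using memLp_diff(1)[OF f g p_bounds(1)] .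
  have C: "C \<ge> 0" using v(2)[of 0] by linarith
  show "\<forall>\<^sub>F n in sequentially. \<bar>(LINT x|M. f n x * v x) - (LINT x|M. g x * v x)\<bar> \<le> C * (LINT x|M. norm (f n x - g x))"
  proof (intro always_eventually allI)
    fix n
    have "\<bar>(LINT x|M. f n x * v x) - (LINT x|M. g x * v x)\<bar> = \<bar>LINT x|M. (f n x - g x) * v x\<bar>"
      using pairing_integrable[OF f v] pairing_integrable[OF g v] by (simp add: left_diff_distrib)
    also have "\<dots> \<le> (LINT x|M. \<bar>(f n x - g x) * v x\<bar>)" by (rule integral_abs_bound)
    also have "\<dots> \<le> (LINT x|M. C * norm (f n x - g x))"
    proof (rule integral_mono)
      show "integrable M (\<lambda>x. \<bar>(f n x - g x) * v x\<bar>)" using pairing_integrable[OF d v] by auto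
      show "integrable M (\<lambda>x. C * norm (f n x - g x))" using memLp_L1(1)[OF finite_M d p_bounds(3)] by auto
      show "\<bar>(f n x - g x) * v x\<bar> \<le> C * norm (f n x - g x)" for x
        using mult_right_mono[OF v(2)[of x], of "\<bar>f n x - g x\<bar>"] by (simp add: abs_mult mult.commute)
    qed
    finally show "\<bar>(LINT x|M. f n x * v x) - (LINT x|M. g x * v x)\<bar> \<le> C * (LINT x|M. norm (f n x - g x))" by simp
  qed
  have "(\<lambda>n. C * (LINT x|M. norm (f n x - g x))) \<longlonglongrightarrow> C * 0"
    by (intro tendsto_intros L1_norm_tendsto_0[OF finite_M d p_gt_1 lim])
  thus "(\<lambda>n. C * (LINT x|M. norm (f n x - g x))) \<longlonglongrightarrow> 0" by simp
qed simp

section \<open>Integration by parts and agreement with weak gradients\<close>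

lemma test_by_parts:
  assumes "test_function \<Omega> \<phi>" "test_function \<Omega> \<psi>"
  shows "(LINT x|M. \<phi> x * (grad \<psi> x \<bullet> e)) = - (LINT x|M. (grad \<phi> x \<bullet> e) * \<psi> x)"
proof -
  have tm: "test_function \<Omega> (\<lambda>x. \<phi> x * \<psi> x)"
    using test_function_mult[OF assms(2), of \<phi>] assms(1) by (auto simp: test_function_def)
  note [measurable] = test_function_measurable[OF assms(1)] test_function_measurable[OF assms(2)]
  obtain C where C: "\<And>x. \<bar>\<psi> x\<bar> \<le> C" using test_function_bounded[OF assms(2)] by metis
  obtain C' where C': "\<And>x. \<bar>\<phi> x\<bar> \<le> C'" using test_function_bounded[OF assms(1)] by metis
  have gm: "memLp M p (\<lambda>x. grad \<zeta> x \<bullet> e)" if t: "test_function \<Omega> \<zeta>" for \<zeta>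
  proof (rule memLp_scaled_bound(1)[OF _ test_function_memLp(2)[OF t] _ p_bounds(1), of _ "norm e"])
    show "(\<lambda>x. grad \<zeta> x \<bullet> e) \<in> borel_measurable M"
      by (rule borel_measurable_M) (use test_function_measurable[OF t] in simp)
  qed (simp add: Cauchy_Schwarz_ineq2 mult.commute[of "norm e"])
  have i1: "integrable M (\<lambda>x. \<phi> x * (grad \<psi> x \<bullet> e))"
    using pairing_integrable[OF gm[OF assms(2)] borel_measurable_M C'] by (simp add: mult.commute)
  have i2: "integrable M (\<lambda>x. (grad \<phi> x \<bullet> e) * \<psi> x)"
    using pairing_integrable[OF gm[OF assms(1)] borel_measurable_M C] by simp
  have "0 = (LINT x|lborel. grad (\<lambda>x. \<phi> x * \<psi> x) x \<bullet> e)"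
    by (rule integral_grad_test_function[OF tm bounded_domain open_domain, symmetric])
  also have "\<dots> = (LINT x|M. grad (\<lambda>x. \<phi> x * \<psi> x) x \<bullet> e)"
    by (rule lebesgue_on_vanishing(1)[symmetric])
      (use domain_sets test_function_vanish[OF tm] test_function_measurable[OF tm] in auto)
  also have "\<dots> = (LINT x|M. \<phi> x * (grad \<psi> x \<bullet> e) + (grad \<phi> x \<bullet> e) * \<psi> x)"
    by (simp add: grad_mult[OF assms] inner_add_left mult.commute)
  also have "\<dots> = (LINT x|M. \<phi> x * (grad \<psi> x \<bullet> e)) + (LINT x|M. (grad \<phi> x \<bullet> e) * \<psi> x)"
    by (rule Bochner_Integration.integral_add[OF i1 i2])
  finally show ?thesis by simp
qed

lemma W0_by_parts:
  assumes "W0 \<Omega> p u g" "test_function \<Omega> \<psi>"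
  shows "(LINT x|M. u x * (grad \<psi> x \<bullet> e)) = - (LINT x|M. (g x \<bullet> e) * \<psi> x)"
proof -
  obtain \<phi> where \<phi>: "\<And>n. test_function \<Omega> (\<phi> n)"
    "(\<lambda>n. pint M p (\<lambda>x. u x - \<phi> n x)) \<longlonglongrightarrow> 0" "(\<lambda>n. pint M p (\<lambda>x. g x - grad (\<phi> n) x)) \<longlonglongrightarrow> 0"
    by (rule W0_seq[OF assms(1)], rule that, assumption+)
  note mem = W0_memLp[OF assms(1)] and tm = test_function_memLp[OF \<phi>(1)]
  note [measurable] = test_function_measurable[OF assms(2)]
  obtain C where C: "\<And>x. \<bar>\<psi> x\<bar> \<le> C" "\<And>x. norm (grad \<psi> x) \<le> C" using test_function_bounded[OF assms(2)] by metis
  have cs: "norm (w \<bullet> e) \<le> norm e * norm w" for w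
    using Cauchy_Schwarz_ineq2[of w e] by (simp add: mult.commute)
  have dom: "memLp M p (\<lambda>x. f x \<bullet> e)" if f: "memLp M p f" for f
    by (rule memLp_scaled_bound(1)[OF _ f cs p_bounds(1)]) (use memLp_measurable[OF f] in simp)
  have b: "\<bar>grad \<psi> x \<bullet> e\<bar> \<le> C * norm e" for x
    using Cauchy_Schwarz_ineq2[of "grad \<psi> x" e] mult_right_mono[OF C(2)[of x] norm_ge_zero[of e]] by linarith
  have 1: "(\<lambda>n. LINT x|M. \<phi> n x * (grad \<psi> x \<bullet> e)) \<longlonglongrightarrow> (LINT x|M. u x * (grad \<psi> x \<bullet> e))"
    by (rule pairing_tendsto[OF tm(1) mem(1) borel_measurable_M b])
      (use \<phi>(2) in \<open>simp_all add: pint_commute[of _ _ u]\<close>)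
  have 2: "(\<lambda>n. LINT x|M. (grad (\<phi> n) x \<bullet> e) * \<psi> x) \<longlonglongrightarrow> (LINT x|M. (g x \<bullet> e) * \<psi> x)"
  proof (rule pairing_tendsto[OF _ _ borel_measurable_M C(1)])
    show "(\<lambda>n. pint M p (\<lambda>x. grad (\<phi> n) x \<bullet> e - g x \<bullet> e)) \<longlonglongrightarrow> 0"
      unfolding inner_diff_left[symmetric]
      by (rule pint_scaled_bound_tendsto_0[OF _ memLp_diff(1)[OF tm(2) mem(2) p_bounds(1)] cs p_bounds(1)])
        (use memLp_measurable[OF mem(2)] memLp_measurable[OF tm(2)] \<phi>(3) in \<open>simp_all add: pint_commute[of _ _ g]\<close>)
  qed (use dom mem tm in auto)
  from tendsto_minus[OF 2] 1 show ?thesis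
    unfolding test_by_parts[OF \<phi>(1) assms(2), of _ e] by (rule LIMSEQ_unique[rotated])
qed

lemma integrable_loc_integrable:
  assumes "integrable M f"
  shows "loc_integrable \<Omega> f"
  unfolding loc_integrable_def
proof (intro allI impI)
  fix K assume K: "compact K \<and> K \<subseteq> \<Omega>"
  have Ks: "K \<in> sets lebesgue" using K by (simp add: borel_compact)
  have "set_integrable lebesgue \<Omega> f"
    using assms integrable_restrict_space[of \<Omega> lebesgue f] domain_sets by (simp add: set_integrable_def)
  hence "set_integrable lebesgue K f"
    by (rule set_integrable_subset[OF _ Ks]) (use K in blast)
  thus "integrable (lebesgue_on K) f"
    using integrable_restrict_space[of K lebesgue f] Ks by (simp add: set_integrable_def)
qed

lemma test_pairing_integrable:
  fixes u :: "real ^ 'n \<Rightarrow> real" and g :: "real ^ 'n \<Rightarrow> real ^ 'n"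
  assumes t: "test_function \<Omega> \<psi>"
  shows "integrable M u \<Longrightarrow> integrable M (\<lambda>x. u x *\<^sub>R grad \<psi> x)"
    and "integrable M g \<Longrightarrow> integrable M (\<lambda>x. \<psi> x *\<^sub>R g x)"
proof -
  note [measurable] = borel_measurable_M[OF test_function_measurable(1)[OF t]] borel_measurable_M[OF test_function_measurable(2)[OF t]]
  obtain C where C: "C \<ge> 0" "\<And>x. \<bar>\<psi> x\<bar> \<le> C" "\<And>x. norm (grad \<psi> x) \<le> C" using test_function_bounded[OF t] by metis
  show "integrable M (\<lambda>x. u x *\<^sub>R grad \<psi> x)" if i: "integrable M u"
    by (rule Bochner_Integration.integrable_bound[OF integrable_scaleR_right[OF i, of C]])
      (use C borel_measurable_integrable[OF i] in \<open>auto simp: abs_mult mult.commute[of C] intro!: AE_I2 mult_left_mono\<close>)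
  show "integrable M (\<lambda>x. \<psi> x *\<^sub>R g x)" if i: "integrable M g"
    by (rule Bochner_Integration.integrable_bound[OF integrable_scaleR_right[OF i, of C]])
      (use C borel_measurable_integrable[OF i] in \<open>auto intro!: AE_I2 mult_right_mono\<close>)
qed

lemma W0_has_weak_grad:
  assumes W: "W0 \<Omega> p u g"
  shows "has_weak_grad \<Omega> u g"
  unfolding has_weak_grad_def
proof (intro conjI allI impI)
  note mem = W0_memLp[OF W]
  note i = memLp_L1(1)[OF finite_M mem(1) p_bounds(3)] memLp_L1(1)[OF finite_M mem(2) p_bounds(3)]
  show "loc_integrable \<Omega> u" "loc_integrable \<Omega> g" using i integrable_loc_integrable by auto
  fix \<psi> assume t: "test_function \<Omega> \<psi>"
  note i1 = test_pairing_integrable(1)[OF t i(1)] and i2 = test_pairing_integrable(2)[OF t i(2)]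
  show "(LINT x|M. u x *\<^sub>R grad \<psi> x) = - (LINT x|M. \<psi> x *\<^sub>R g x)"
  proof (rule vector_eq_rdot[THEN iffD1], rule allI)
    fix e
    have "(LINT x|M. u x *\<^sub>R grad \<psi> x) \<bullet> e = (LINT x|M. u x * (grad \<psi> x \<bullet> e))"
      using i1 by (subst integral_inner_left[symmetric]) auto
    also have "\<dots> = - (LINT x|M. (g x \<bullet> e) * \<psi> x)" by (rule W0_by_parts[OF W t])
    also have "\<dots> = - (LINT x|M. \<psi> x *\<^sub>R g x) \<bullet> e"
      using i2 unfolding inner_minus_left by (subst integral_inner_left[symmetric]) (auto simp: mult.commute)
    finally show "(LINT x|M. u x *\<^sub>R grad \<psi> x) \<bullet> e = - (LINT x|M. \<psi> x *\<^sub>R g x) \<bullet> e" .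
  qed
qed

text \<open>The fundamental lemma is applied to each component of the difference. The gradients are
  only locally integrable, so pairings with a test function are first shown integrable on its
  support and then extended by zero to the domain.\<close>

lemma has_weak_grad_unique:
  assumes "has_weak_grad \<Omega> u g" "has_weak_grad \<Omega> u h"
  shows "AE x in M. g x = h x"
proof -
  have "AE x in M. (g x - h x) $ i = 0" for i
  proof (rule AE_zero_if_test_integrals_zero[OF open_domain])
    show "loc_integrable \<Omega> (\<lambda>x. (g x - h x) $ i)"
      using assms unfolding has_weak_grad_def loc_integrable_def
      by (intro allI impI integrable_bounded_linear[OF bounded_linear_vec_nth] Bochner_Integration.integrable_diff) blast+
  next
    fix \<phi> assume t: "test_function \<Omega> \<phi>"
    obtain C where C: "\<And>x. \<bar>\<phi> x\<bar> \<le> C" using test_function_bounded[OF t] by metis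
    obtain K where K: "compact K" "K \<subseteq> \<Omega>" "\<And>x. x \<notin> K \<Longrightarrow> \<phi> x = 0"
      using test_function_support[OF t] by metis
    have int: "integrable M (\<lambda>x. \<phi> x *\<^sub>R f x)" if "loc_integrable \<Omega> f" for f :: "real ^ 'n \<Rightarrow> real ^ 'n"
    proof -
      have f: "integrable (lebesgue_on K) f" using that K unfolding loc_integrable_def by blast
      have Ks: "K \<in> sets lebesgue" using K(1) by (simp add: borel_compact)
      have "integrable (lebesgue_on K) (\<lambda>x. \<phi> x *\<^sub>R f x)"
      proof (rule Bochner_Integration.integrable_bound[OF integrable_scaleR_right[OF f, of C]])
        have "\<phi> \<in> borel_measurable (lebesgue_on K)"
          using test_function_measurable(1)[OF t] by (intro measurable_restrict_space1 measurable_completion) simp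
        thus "(\<lambda>x. \<phi> x *\<^sub>R f x) \<in> borel_measurable (lebesgue_on K)"
          using borel_measurable_integrable[OF f] by simp
        have "\<bar>\<phi> x\<bar> \<le> \<bar>C\<bar>" for x using C[of x] by linarith
        thus "AE x in lebesgue_on K. norm (\<phi> x *\<^sub>R f x) \<le> norm (C *\<^sub>R f x)"
          by (intro AE_I2) (simp add: mult_right_mono)
      qed
      hence "integrable lebesgue (\<lambda>x. if x \<in> K then \<phi> x *\<^sub>R f x else 0)"
        by (subst Lebesgue_Measure.integrable_restrict_UNIV[OF Ks])
      also have "(\<lambda>x. if x \<in> K then \<phi> x *\<^sub>R f x else 0) = (\<lambda>x. if x \<in> \<Omega> then \<phi> x *\<^sub>R f x else 0)"
        using K by (auto simp: fun_eq_iff)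
      finally show ?thesis by (subst (asm) Lebesgue_Measure.integrable_restrict_UNIV[OF domain_sets])
    qed
    have "(LINT x|M. \<phi> x *\<^sub>R g x) = (LINT x|M. \<phi> x *\<^sub>R h x)"
      using assms[unfolded has_weak_grad_def, THEN conjunct2, THEN conjunct2, rule_format, OF t]
      by simp
    hence "(LINT x|M. \<phi> x *\<^sub>R (g x - h x)) = 0"
      using int assms unfolding has_weak_grad_def by (simp add: scaleR_diff_right)
    moreover have "integrable M (\<lambda>x. \<phi> x *\<^sub>R (g x - h x))"
      using int assms unfolding has_weak_grad_def by (simp add: scaleR_diff_right)
    ultimately show "(LINT x|M. \<phi> x * (g x - h x) $ i) = 0"
      using integral_bounded_linear[OF bounded_linear_vec_nth[of i], of M "\<lambda>x. \<phi> x *\<^sub>R (g x - h x)"]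
      by (simp del: vector_minus_component)
  qed
  hence "AE x in M. \<forall>i. (g x - h x) $ i = 0" by (simp add: AE_all_countable del: vector_minus_component)
  thus ?thesis by eventually_elim (simp add: vec_eq_iff)
qed

lemma W0_weak_grad:
  assumes "W0 \<Omega> p u g"
  shows "AE x in M. weak_grad \<Omega> u x = g x"
proof -
  have "has_weak_grad \<Omega> u (weak_grad \<Omega> u)"
    unfolding weak_grad_def using W0_has_weak_grad[OF assms] by (rule someI[of "has_weak_grad \<Omega> u"])
  thus ?thesis using has_weak_grad_unique W0_has_weak_grad[OF assms] by blast
qed

lemma pint_weak_grad:
  assumes "W0 \<Omega> p u g"
  shows "pint M p (weak_grad \<Omega> u) = pint M p g"
proof (rule pint_cong_AE)
  have ae: "AE x in M. g x = weak_grad \<Omega> u x"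
    using W0_weak_grad[OF assms] by eventually_elim simp
  show "weak_grad \<Omega> u \<in> borel_measurable M"
    by (rule borel_measurable_AE_cong_lebesgue_on[OF W0_measurable(2)[OF assms] domain_sets ae])
qed (use W0_weak_grad[OF assms] W0_measurable(2)[OF assms] in auto)

lemma W1p_norm_eq: "W1p_norm \<Omega> p u = (pint M p u + pint M p (weak_grad \<Omega> u)) powr (1 / p)"
  by (simp add: W1p_norm_def pint_def)

lemma W0_imp_W1p_0:
  assumes W: "W0 \<Omega> p u g"
  shows "u \<in> W1p_0 \<Omega> p"
  unfolding W1p_0_def W1p_def
proof (intro CollectI conjI allI impI)
  show "u \<in> Lp \<Omega> p" "\<exists>g\<in>Lp \<Omega> p. has_weak_grad \<Omega> u g"
    using W0_memLp[OF W] W0_has_weak_grad[OF W] by (auto simp: Lp_iff)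
  fix e :: real assume e: "e > 0"
  obtain \<phi> where \<phi>: "test_function \<Omega> \<phi>"
    "pint M p (\<lambda>x. u x - \<phi> x) + pint M p (\<lambda>x. g x - grad \<phi> x) < e powr p"
  proof -
    have "e powr p > 0" using e by simp
    thus ?thesis using W that unfolding W0_def by blast
  qed
  have "W0 \<Omega> p (\<lambda>x. u x - \<phi> x) (\<lambda>x. g x - grad \<phi> x)"
    using W0_add[OF W W0_test[OF \<phi>(1)], of "-1"] by simp
  hence "W1p_norm \<Omega> p (\<lambda>x. u x - \<phi> x) = (pint M p (\<lambda>x. u x - \<phi> x) + pint M p (\<lambda>x. g x - grad \<phi> x)) powr (1 / p)"
    by (simp add: W1p_norm_eq pint_weak_grad)
  also have "\<dots> < (e powr p) powr (1 / p)"
    using \<phi>(2) p_bounds by (intro powr_less_mono2) (auto simp: pint_nonneg)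
  also have "\<dots> = e" using e p_bounds by (simp add: powr_powr)
  finally show "\<exists>\<phi>. test_function \<Omega> \<phi> \<and> W1p_norm \<Omega> p (\<lambda>x. u x - \<phi> x) < e" using \<phi>(1) by blast
qed

text \<open>Together with \<open>W0_imp_W1p_0\<close> this translates between the space of the
  problem and the pairs. The norm in \<open>W1p_0\<close> involves the representative chosen for u -
  \<phi>, which has no built-in relation to the one chosen for u; uniqueness of weak gradients
  identifies it almost everywhere with \<open>weak_grad\<close> of u minus \<open>grad\<close> of
  \<phi>.\<close>

lemma W1p_0_imp_W0:
  assumes "u \<in> W1p_0 \<Omega> p"
  shows "W0 \<Omega> p u (weak_grad \<Omega> u)"
proof -
  obtain g where g: "memLp M p g" "has_weak_grad \<Omega> u g" and u: "memLp M p u"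
    using assms by (auto simp: W1p_0_def W1p_def Lp_iff)
  have wg: "has_weak_grad \<Omega> u (weak_grad \<Omega> u)" unfolding weak_grad_def using g(2) by (rule someI[of "has_weak_grad \<Omega> u"])
  have ae: "AE x in M. g x = weak_grad \<Omega> u x" using has_weak_grad_unique[OF g(2) wg] .
  have G: "weak_grad \<Omega> u \<in> borel_measurable M"
    by (rule borel_measurable_AE_cong_lebesgue_on[OF memLp_measurable[OF g(1)] domain_sets ae])
  have mG: "memLp M p (weak_grad \<Omega> u)"
    by (rule memLp_dominated(1)[OF G g(1) _ p_bounds(1)]) (use ae in auto)
  have approx: "\<exists>\<phi>. test_function \<Omega> \<phi> \<and> pint M p (\<lambda>x. u x - \<phi> x) + pint M p (\<lambda>x. weak_grad \<Omega> u x - grad \<phi> x) < e"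
    if e: "e > 0" for e
  proof -
    obtain \<phi> where \<phi>: "test_function \<Omega> \<phi>" "W1p_norm \<Omega> p (\<lambda>x. u x - \<phi> x) < e powr (1 / p)"
    proof -
      have "e powr (1 / p) > 0" using e by simp
      thus ?thesis using assms that unfolding W1p_0_def by blast
    qed
    note W\<phi> = W0_has_weak_grad[OF W0_test[OF \<phi>(1)]] and tm = test_function_memLp[OF \<phi>(1)]
    have li: "loc_integrable \<Omega> (\<lambda>x. u x - \<phi> x)" "loc_integrable \<Omega> (\<lambda>x. weak_grad \<Omega> u x - grad \<phi> x)"
      using wg W\<phi> unfolding has_weak_grad_def loc_integrable_def by auto
    have "has_weak_grad \<Omega> (\<lambda>x. u x - \<phi> x) (\<lambda>x. weak_grad \<Omega> u x - grad \<phi> x)"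
      unfolding has_weak_grad_def
    proof (intro conjI li allI impI)
      fix \<psi> assume t: "test_function \<Omega> \<psi>"
      note i = test_pairing_integrable[OF t memLp_L1(1)[OF finite_M _ p_bounds(3)]]
      have "(LINT x|M. u x *\<^sub>R grad \<psi> x) = - (LINT x|M. \<psi> x *\<^sub>R weak_grad \<Omega> u x)"
        "(LINT x|M. \<phi> x *\<^sub>R grad \<psi> x) = - (LINT x|M. \<psi> x *\<^sub>R grad \<phi> x)"
        using wg W\<phi> t unfolding has_weak_grad_def by blast+
      thus "(LINT x|M. (u x - \<phi> x) *\<^sub>R grad \<psi> x) = - (LINT x|M. \<psi> x *\<^sub>R (weak_grad \<Omega> u x - grad \<phi> x))"
        using i(1)[OF u] i(1)[OF tm(1)] i(2)[OF mG] i(2)[OF tm(2)]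
        by (simp add: scaleR_diff_left scaleR_diff_right)
    qed
    moreover from this have "has_weak_grad \<Omega> (\<lambda>x. u x - \<phi> x) (weak_grad \<Omega> (\<lambda>x. u x - \<phi> x))"
      unfolding weak_grad_def by (rule someI[of "has_weak_grad \<Omega> (\<lambda>x. u x - \<phi> x)"])
    ultimately have ae2: "AE x in M. weak_grad \<Omega> u x - grad \<phi> x = weak_grad \<Omega> (\<lambda>x. u x - \<phi> x) x"
      by (rule has_weak_grad_unique)
    have dm: "(\<lambda>x. weak_grad \<Omega> u x - grad \<phi> x) \<in> borel_measurable M"
      using G memLp_measurable[OF tm(2)] by simp
    have "pint M p (weak_grad \<Omega> (\<lambda>x. u x - \<phi> x)) = pint M p (\<lambda>x. weak_grad \<Omega> u x - grad \<phi> x)"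
      by (rule pint_cong_AE[symmetric, OF dm borel_measurable_AE_cong_lebesgue_on[OF dm domain_sets ae2] ae2])
    hence lt: "(pint M p (\<lambda>x. u x - \<phi> x) + pint M p (\<lambda>x. weak_grad \<Omega> u x - grad \<phi> x)) powr (1 / p) < e powr (1 / p)"
      using \<phi>(2) by (simp add: W1p_norm_eq)
    have "pint M p (\<lambda>x. u x - \<phi> x) + pint M p (\<lambda>x. weak_grad \<Omega> u x - grad \<phi> x) < e"
    proof (rule ccontr)
      assume "\<not> ?thesis"
      hence "e powr (1 / p) \<le> (pint M p (\<lambda>x. u x - \<phi> x) + pint M p (\<lambda>x. weak_grad \<Omega> u x - grad \<phi> x)) powr (1 / p)"
        using e p_bounds by (intro powr_mono2) auto
      thus False using lt by simp
    qed
    thus ?thesis using \<phi>(1) by blast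
  qed
  show ?thesis unfolding W0_def using u mG approx by blast
qed

end

section \<open>Chain rule and truncations\<close>

context sobolev_domain
begin

text \<open>G is applied to approximating test functions. The gradient error splits into (G'(u) -
  G'(\<phi>_n)) g, which tends to 0 by dominated convergence along an almost everywhere convergent
  subsequence, and G'(\<phi>_n) (g - grad \<phi>_n), which is small because G' is bounded.\<close>

lemma W0_comp:
  assumes W: "W0 \<Omega> p u g" and G: "smooth_real G" "G 0 = 0" "\<And>t. (G has_real_derivative G' t) (at t)"
    and bound: "\<And>t. \<bar>G' t\<bar> \<le> C"
  shows "W0 \<Omega> p (\<lambda>x. G (u x)) (\<lambda>x. G' (u x) *\<^sub>R g x)"
proof -
  obtain f' where f': "smooth_real f'" "\<And>x. (G has_real_derivative f' x) (at x)" by (rule smooth_real_derivative[OF G(1)], rule that, assumption+)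
  \<comment> \<open>Smoothness of G provides some smooth derivative; uniqueness identifies it with
    the given G', which is thereby continuous.\<close>
  have "f' = G'" using DERIV_unique[OF f'(2) G(3)] by auto
  with f'(1) obtain G'' where "\<And>x. (G' has_real_derivative G'' x) (at x)" by (metis smooth_real_derivative)
  hence G'c: "isCont G' t" for t using DERIV_isCont by blast
  have Gc: "isCont G t" for t using G(3) DERIV_isCont by blast
  have [measurable]: "G \<in> borel_measurable borel" "G' \<in> borel_measurable borel"
    using Gc G'c by (auto intro!: borel_measurable_continuous_onI continuous_at_imp_continuous_on)
  have C: "C \<ge> 0" using bound[of 0] by linarith
  have lip: "\<bar>G s - G t\<bar> \<le> C * \<bar>s - t\<bar>" for s t
    using field_differentiable_bound[of UNIV G G' C s t] G(3) bound by auto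
  obtain \<phi> where \<phi>: "\<And>n. test_function \<Omega> (\<phi> n)"
    "(\<lambda>n. pint M p (\<lambda>x. u x - \<phi> n x)) \<longlonglongrightarrow> 0" "(\<lambda>n. pint M p (\<lambda>x. g x - grad (\<phi> n) x)) \<longlonglongrightarrow> 0"
    by (rule W0_seq[OF W], rule that, assumption+)
  note mem = W0_memLp[OF W] and tm = test_function_memLp[OF \<phi>(1)]
  note [measurable] = W0_measurable[OF W] memLp_measurable[OF tm(1)] memLp_measurable[OF tm(2)]
  obtain r where r: "strict_mono r" "AE x in M. (\<lambda>n. u x - \<phi> (r n) x) \<longlonglongrightarrow> 0"
    using pint_tendsto_0_AE_subseq[OF memLp_diff(1)[OF mem(1) tm(1) p_bounds(1)] \<phi>(2) p_bounds(2)] by blast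
  have lr: "(\<lambda>n. pint M p (\<lambda>x. u x - \<phi> (r n) x)) \<longlonglongrightarrow> 0" "(\<lambda>n. pint M p (\<lambda>x. g x - grad (\<phi> (r n)) x)) \<longlonglongrightarrow> 0"
    using LIMSEQ_subseq_LIMSEQ[OF \<phi>(2) r(1)] LIMSEQ_subseq_LIMSEQ[OF \<phi>(3) r(1)] by (simp_all add: o_def)
  have conv: "AE x in M. (\<lambda>n. \<phi> (r n) x) \<longlonglongrightarrow> u x"
    using r(2)
  proof eventually_elim
    case (elim x)
    from tendsto_diff[OF tendsto_const[of "u x"] this] show ?case by simp
  qed
  show ?thesis
  proof (rule W0_seqI[of "\<lambda>n x. G (\<phi> (r n) x)"])
    show "test_function \<Omega> (\<lambda>x. G (\<phi> (r n) x))" for n by (rule test_function_comp[OF \<phi>(1) G(1,2)])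
    show "memLp M p (\<lambda>x. G (u x))"
      by (rule memLp_scaled_bound(1)[OF _ mem(1) _ p_bounds(1), of _ C]) (use lip[of _ 0] G(2) in simp_all)
    show "memLp M p (\<lambda>x. G' (u x) *\<^sub>R g x)"
      by (rule memLp_scaled_bound(1)[OF _ mem(2) _ p_bounds(1), of _ C]) (simp_all add: bound mult_right_mono)
    show "(\<lambda>n. pint M p (\<lambda>x. G (u x) - G (\<phi> (r n) x))) \<longlonglongrightarrow> 0"
      by (rule pint_scaled_bound_tendsto_0[OF _ memLp_diff(1)[OF mem(1) tm(1) p_bounds(1)] _ p_bounds(1) lr(1), of _ C])
        (simp_all add: lip)
    have two: "\<bar>G' s - G' t\<bar> \<le> 2 * C" for s t using bound[of s] bound[of t] by linarith
    have m1: "memLp M p (\<lambda>x. (G' (u x) - G' (\<phi> (r n) x)) *\<^sub>R g x)" for n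
      by (rule memLp_scaled_bound(1)[OF _ mem(2) _ p_bounds(1), of _ "2 * C"]) (simp_all add: two mult_right_mono)
    have m2: "memLp M p (\<lambda>x. G' (\<phi> (r n) x) *\<^sub>R (g x - grad (\<phi> (r n)) x))" for n
      by (rule memLp_scaled_bound(1)[OF _ memLp_diff(1)[OF mem(2) tm(2)[of "r n"] p_bounds(1)] _ p_bounds(1), of _ C])
        (simp_all add: bound mult_right_mono)
    have l1: "(\<lambda>n. pint M p (\<lambda>x. (G' (u x) - G' (\<phi> (r n) x)) *\<^sub>R g x)) \<longlonglongrightarrow> 0"
    proof (rule pint_dominated_tendsto_0[OF memLp_measurable[OF m1] memLp_scaleR(1)[OF mem(2), of "2 * C"] p_bounds(2)])
      show "AE x in M. norm ((G' (u x) - G' (\<phi> (r n) x)) *\<^sub>R g x) \<le> norm ((2 * C) *\<^sub>R g x)" for n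
        using two C by (auto intro!: AE_I2 mult_right_mono)
      show "AE x in M. (\<lambda>n. (G' (u x) - G' (\<phi> (r n) x)) *\<^sub>R g x) \<longlonglongrightarrow> 0"
        using conv
      proof eventually_elim
        case (elim x)
        have "(\<lambda>n. (G' (u x) - G' (\<phi> (r n) x)) *\<^sub>R g x) \<longlonglongrightarrow> (G' (u x) - G' (u x)) *\<^sub>R g x"
          by (intro tendsto_intros isCont_tendsto_compose[OF G'c] elim)
        thus ?case by simp
      qed
    qed
    have l2: "(\<lambda>n. pint M p (\<lambda>x. G' (\<phi> (r n) x) *\<^sub>R (g x - grad (\<phi> (r n)) x))) \<longlonglongrightarrow> 0"
      by (rule pint_scaled_bound_tendsto_0[OF _ memLp_diff(1)[OF mem(2) tm(2) p_bounds(1)] _ p_bounds(1) lr(2), of _ C])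
        (simp_all add: bound mult_right_mono)
    have "G' (u x) *\<^sub>R g x - grad (\<lambda>x. G (\<phi> (r n) x)) x =
      1 *\<^sub>R ((G' (u x) - G' (\<phi> (r n) x)) *\<^sub>R g x) + 1 *\<^sub>R (G' (\<phi> (r n) x) *\<^sub>R (g x - grad (\<phi> (r n)) x))" for n x
      by (simp add: grad_comp[OF \<phi>(1) G(3)] algebra_simps)
    thus "(\<lambda>n. pint M p (\<lambda>x. G' (u x) *\<^sub>R g x - grad (\<lambda>x. G (\<phi> (r n) x)) x)) \<longlonglongrightarrow> 0"
      using pint_lincomb_tendsto_0[OF m1 m2 l1 l2, of 1 1] by simp
  qed
qed

text \<open>A limit of the chain rule along \<open>smooth_ramp\<close>. The condition k >= 0 makes
  each ramp vanish at 0, so that composition preserves compact support, and the bounds on the ramps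
  allow dominated convergence for both components.\<close>

lemma W0_pos_part:
  assumes W: "W0 \<Omega> p u g" and k: "k \<ge> 0"
  shows "W0 \<Omega> p (\<lambda>x. max 0 (u x - k)) (\<lambda>x. (if u x > k then 1 else 0) *\<^sub>R g x)"
proof -
  note mem = W0_memLp[OF W] and [measurable] = W0_measurable[OF W]
  have b: "\<bar>smooth_ramp' k n t\<bar> \<le> 2" for n t using smooth_ramp'_bounds[of k n t] by simp
  have Wn: "W0 \<Omega> p (\<lambda>x. smooth_ramp k n (u x)) (\<lambda>x. smooth_ramp' k n (u x) *\<^sub>R g x)" for n
    by (rule W0_comp[OF W smooth_real_smooth_ramp smooth_ramp_0[OF k] DERIV_smooth_ramp b])
  note [measurable] = W0_measurable[OF Wn]
  show ?thesis
  proof (rule W0_limit[OF Wn])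
    show "memLp M p (\<lambda>x. max 0 (u x - k))"
      by (rule memLp_dominated(1)[OF _ mem(1) _ p_bounds(1)]) (use k in auto)
    show "memLp M p (\<lambda>x. (if u x > k then 1 else 0) *\<^sub>R g x)"
      by (rule memLp_dominated(1)[OF _ mem(2) _ p_bounds(1)]) auto
    show "(\<lambda>n. pint M p (\<lambda>x. smooth_ramp k n (u x) - max 0 (u x - k))) \<longlonglongrightarrow> 0"
    proof (rule pint_dominated_tendsto_0[OF _ memLp_scaleR(1)[OF mem(1), of 2] p_bounds(2)])
      show "AE x in M. norm (smooth_ramp k n (u x) - max 0 (u x - k)) \<le> norm (2 *\<^sub>R u x)" for n
      proof (intro AE_I2)
        fix x
        have "\<bar>smooth_ramp k n (u x) - max 0 (u x - k)\<bar> \<le> \<bar>u x\<bar>"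
          using smooth_ramp_bounds[OF k, of n "u x"] k by linarith
        thus "norm (smooth_ramp k n (u x) - max 0 (u x - k)) \<le> norm (2 *\<^sub>R u x)" by simp
      qed
      show "AE x in M. (\<lambda>n. smooth_ramp k n (u x) - max 0 (u x - k)) \<longlonglongrightarrow> 0"
        using LIM_zero[OF smooth_ramp_tendsto] by auto
    qed measurable
    show "(\<lambda>n. pint M p (\<lambda>x. smooth_ramp' k n (u x) *\<^sub>R g x - (if u x > k then 1 else 0) *\<^sub>R g x)) \<longlonglongrightarrow> 0"
    proof (rule pint_dominated_tendsto_0[OF _ memLp_scaleR(1)[OF mem(2), of 2] p_bounds(2)])
      have "\<bar>smooth_ramp' k n t - (if t > k then 1 else 0)\<bar> \<le> 2" for n t using smooth_ramp'_bounds[of k n t] by auto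
      hence "norm ((smooth_ramp' k n t - (if t > k then 1 else 0)) *\<^sub>R v) \<le> norm (2 *\<^sub>R v)" for n t and v :: "real ^ 'n"
        unfolding norm_scaleR by (intro mult_right_mono) simp_all
      thus "AE x in M. norm (smooth_ramp' k n (u x) *\<^sub>R g x - (if u x > k then 1 else 0) *\<^sub>R g x) \<le> norm (2 *\<^sub>R g x)" for n
        by (simp add: scaleR_diff_left[symmetric] del: norm_scaleR)
      show "AE x in M. (\<lambda>n. smooth_ramp' k n (u x) *\<^sub>R g x - (if u x > k then 1 else 0) *\<^sub>R g x) \<longlonglongrightarrow> 0"
        by (intro AE_I2 LIM_zero tendsto_scaleR tendsto_const smooth_ramp'_tendsto)
    qed measurable
  qed
qed

end

section \<open>Averages over cubes\<close>

text \<open>The \<open>L\<^sup>1\<close>-modulus of continuity is subadditive in the shift, so it is at most its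
  infinitesimal version, which is the \<open>L\<^sup>1\<close>-norm of the directional derivative.\<close>

lemma test_function_shift:
  assumes t: "test_function \<Omega> \<phi>" and \<Omega>: "bounded \<Omega>" "open \<Omega>"
  shows "(LINT x|lborel. \<bar>\<phi> (h + x) - \<phi> x\<bar>) \<le> norm h * (LINT x|lborel. norm (grad \<phi> x))"
proof -
  note [measurable] = test_function_measurable[OF t]
  have int: "integrable lborel \<phi>"
    using test_function_integrable[OF t \<Omega>, of fst] by (simp add: continuous_on_fst)
  have ig: "integrable lborel (\<lambda>x. norm (grad \<phi> x))"
    using test_function_integrable[OF t \<Omega>, of "\<lambda>z. norm (snd z)"] by (simp add: continuous_intros)
  have isd: "integrable lborel (\<lambda>x. \<bar>\<phi> (a + x) - \<phi> (b + x)\<bar>)" for a b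
    using lborel_integrable_shift[OF int] by auto
  have sub: "(LINT x|lborel. \<bar>\<phi> (real m *\<^sub>R k + x) - \<phi> x\<bar>) \<le> real m * (LINT x|lborel. \<bar>\<phi> (k + x) - \<phi> x\<bar>)" for m k
  proof (induction m)
    case (Suc m)
    have "(LINT x|lborel. \<bar>\<phi> (real (Suc m) *\<^sub>R k + x) - \<phi> x\<bar>) \<le>
      (LINT x|lborel. \<bar>\<phi> (k + (real m *\<^sub>R k + x)) - \<phi> (real m *\<^sub>R k + x)\<bar> + \<bar>\<phi> (real m *\<^sub>R k + x) - \<phi> x\<bar>)"
    proof (rule integral_mono)
      show "integrable lborel (\<lambda>x. \<bar>\<phi> (real (Suc m) *\<^sub>R k + x) - \<phi> x\<bar>)"
        using isd[of "real (Suc m) *\<^sub>R k" 0] by simp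
      show "integrable lborel (\<lambda>x. \<bar>\<phi> (k + (real m *\<^sub>R k + x)) - \<phi> (real m *\<^sub>R k + x)\<bar> + \<bar>\<phi> (real m *\<^sub>R k + x) - \<phi> x\<bar>)"
        using isd[of "k + real m *\<^sub>R k" "real m *\<^sub>R k"] isd[of "real m *\<^sub>R k" 0]
        by (intro Bochner_Integration.integrable_add) (simp_all add: add.assoc)
      fix x
      have e: "real (Suc m) *\<^sub>R k + x = k + (real m *\<^sub>R k + x)" by (simp add: algebra_simps)
      show "\<bar>\<phi> (real (Suc m) *\<^sub>R k + x) - \<phi> x\<bar> \<le>
          \<bar>\<phi> (k + (real m *\<^sub>R k + x)) - \<phi> (real m *\<^sub>R k + x)\<bar> + \<bar>\<phi> (real m *\<^sub>R k + x) - \<phi> x\<bar>" unfolding e by linarith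
    qed
    also have "\<dots> = (LINT x|lborel. \<bar>\<phi> (k + (real m *\<^sub>R k + x)) - \<phi> (real m *\<^sub>R k + x)\<bar>) + (LINT x|lborel. \<bar>\<phi> (real m *\<^sub>R k + x) - \<phi> x\<bar>)"
      using isd[of "k + real m *\<^sub>R k" "real m *\<^sub>R k"] isd[of "real m *\<^sub>R k" 0]
      by (intro Bochner_Integration.integral_add) (simp_all add: add.assoc)
    also have "(LINT x|lborel. \<bar>\<phi> (k + (real m *\<^sub>R k + x)) - \<phi> (real m *\<^sub>R k + x)\<bar>) = (LINT x|lborel. \<bar>\<phi> (k + x) - \<phi> x\<bar>)"
      by (rule lborel_integral_shift[of "\<lambda>x. \<bar>\<phi> (k + x) - \<phi> x\<bar>"]) measurable
    finally show ?case using Suc.IH by (simp add: algebra_simps)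
  qed simp
  obtain R C where C: "C \<ge> 0"
    "\<And>n x. \<bar>real (Suc n) * (\<phi> ((1 / real (Suc n)) *\<^sub>R h + x) - \<phi> x)\<bar> \<le> C * indicator (cball 0 R) x"
    by (rule test_function_quotient_bound[OF t], rule that, assumption+)
  have "(\<lambda>n. LINT x|lborel. \<bar>real (Suc n) * (\<phi> ((1 / real (Suc n)) *\<^sub>R h + x) - \<phi> x)\<bar>) \<longlonglongrightarrow>
      (LINT x|lborel. \<bar>grad \<phi> x \<bullet> h\<bar>)"
  proof (rule integral_dominated_convergence)
    show "integrable lborel (\<lambda>x. C * indicator (cball 0 R) x)"
      by (intro integrable_mult_right integrable_real_indicator emeasure_lborel_cball_finite) simp
    show "AE x in lborel. (\<lambda>n. \<bar>real (Suc n) * (\<phi> ((1 / real (Suc n)) *\<^sub>R h + x) - \<phi> x)\<bar>) \<longlonglongrightarrow> \<bar>grad \<phi> x \<bullet> h\<bar>"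
      by (intro AE_I2 tendsto_rabs test_function_quotient_tendsto[OF t])
    show "AE x in lborel. norm \<bar>real (Suc n) * (\<phi> ((1 / real (Suc n)) *\<^sub>R h + x) - \<phi> x)\<bar> \<le> C * indicator (cball 0 R) x" for n
      using C(2) by (simp del: of_nat_Suc)
  qed measurable
  moreover have "(LINT x|lborel. \<bar>\<phi> (h + x) - \<phi> x\<bar>) \<le> (LINT x|lborel. \<bar>real (Suc n) * (\<phi> ((1 / real (Suc n)) *\<^sub>R h + x) - \<phi> x)\<bar>)" for n
    using sub[of "Suc n" "(1 / real (Suc n)) *\<^sub>R h"] by (simp add: abs_mult del: of_nat_Suc)
  ultimately have "(LINT x|lborel. \<bar>\<phi> (h + x) - \<phi> x\<bar>) \<le> (LINT x|lborel. \<bar>grad \<phi> x \<bullet> h\<bar>)"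
    by (intro LIMSEQ_le_const) auto
  also have "\<dots> \<le> (LINT x|lborel. norm h * norm (grad \<phi> x))"
  proof (rule integral_mono)
    show "integrable lborel (\<lambda>x. \<bar>grad \<phi> x \<bullet> h\<bar>)"
      using test_function_integrable[OF t \<Omega>, of "\<lambda>z. \<bar>snd z \<bullet> h\<bar>"] by (simp add: continuous_intros)
    show "integrable lborel (\<lambda>x. norm h * norm (grad \<phi> x))" using ig by simp
    show "\<bar>grad \<phi> x \<bullet> h\<bar> \<le> norm h * norm (grad \<phi> x)" for x
      using Cauchy_Schwarz_ineq2[of "grad \<phi> x" h] by (simp add: mult.commute)
  qed
  finally show ?thesis using ig by simp
qed

definition cube :: "real \<Rightarrow> (real ^ 'n) \<Rightarrow> (real ^ 'n) set" where
  "cube \<rho> x = box x (x + (\<chi> i. \<rho>))"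

definition cube_avg :: "real \<Rightarrow> (real ^ 'n \<Rightarrow> real) \<Rightarrow> real ^ 'n \<Rightarrow> real" where
  "cube_avg \<rho> f x = (LINT z|lborel. indicator (cube \<rho> x) z * f z) / \<rho> ^ CARD('n)"

lemma cube_sets[measurable, simp]: "cube \<rho> x \<in> sets borel"
  by (simp add: cube_def)

lemma cube_shift: "x + y \<in> cube \<rho> x \<longleftrightarrow> y \<in> cube \<rho> 0"
  by (simp add: cube_def mem_box_cart)

lemma measure_cube:
  assumes "\<rho> > 0"
  shows "emeasure lborel (cube \<rho> (x :: real ^ 'n)) = ennreal (\<rho> ^ CARD('n))"
proof -
  have "(\<Prod>b\<in>Basis. ((x + (\<chi> i. \<rho>)) - x) \<bullet> b) = (\<Prod>b\<in>(Basis :: (real ^ 'n) set). \<rho>)"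
    by (rule prod.cong) (auto simp: Basis_vec_def inner_axis)
  also have "\<dots> = \<rho> ^ CARD('n)" by simp
  finally have "(\<Prod>b\<in>Basis. ((x + (\<chi> i. \<rho>)) - x) \<bullet> b) = \<rho> ^ CARD('n)" .
  moreover have "x \<bullet> b \<le> (x + (\<chi> i. \<rho>)) \<bullet> b" if "b \<in> Basis" for b
    using that assms by (auto simp: Basis_vec_def inner_axis)
  ultimately show ?thesis unfolding cube_def by (subst emeasure_lborel_box) auto
qed

lemma norm_cube_le:
  assumes "y \<in> cube \<rho> (0 :: real ^ 'n)"
  shows "norm y \<le> real CARD('n) * \<rho>"
proof -
  have "norm y \<le> (\<Sum>i\<in>UNIV. \<bar>y $ i\<bar>)" by (rule norm_le_l1_cart)
  also have "\<dots> \<le> (\<Sum>i\<in>(UNIV :: 'n set). \<rho>)"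
    using assms by (intro sum_mono) (auto simp: cube_def mem_box_cart abs_if less_imp_le dest: less_trans)
  finally show ?thesis by simp
qed

lemma cube_avg_alt:
  fixes f :: "real ^ 'n \<Rightarrow> real"
  assumes "f \<in> borel_measurable borel"
  shows "cube_avg \<rho> f x = (LINT y|lborel. indicator (cube \<rho> 0) y * f (x + y)) / \<rho> ^ CARD('n)"
proof -
  have "(LINT z|lborel. indicator (cube \<rho> x) z * f z) = (LINT y|lborel. indicator (cube \<rho> x) (x + y) * f (x + y))"
    by (rule lborel_integral_shift[symmetric, of "\<lambda>z. indicator (cube \<rho> x) z * f z"]) (use assms in measurable)
  thus ?thesis by (simp add: cube_avg_def indicator_def cube_shift)
qed

lemma cube_avg_bound:
  fixes f :: "real ^ 'n \<Rightarrow> real"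
  assumes "\<rho> > 0" "integrable lborel f"
  shows "\<bar>cube_avg \<rho> f x\<bar> \<le> (LINT z|lborel. \<bar>f z\<bar>) / \<rho> ^ CARD('n)"
proof -
  have "\<bar>LINT z|lborel. indicator (cube \<rho> x) z * f z\<bar> \<le> (LINT z|lborel. \<bar>indicator (cube \<rho> x) z * f z\<bar>)"
    by (rule integral_abs_bound)
  also have "\<dots> \<le> (LINT z|lborel. \<bar>f z\<bar>)"
    using assms(2) integrable_mult_indicator[OF _ assms(2), of "cube \<rho> x"]
    by (intro integral_mono) (auto simp: indicator_def)
  finally show ?thesis using assms(1) by (simp add: cube_avg_def divide_right_mono)
qed

lemma cube_avg_measurable:
  fixes f :: "real ^ 'n \<Rightarrow> real"
  assumes [measurable]: "f \<in> borel_measurable borel"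
  shows "cube_avg \<rho> f \<in> borel_measurable borel"
proof -
  have "(\<lambda>x. (LINT y|lborel. indicator (cube \<rho> 0) y * f (x + y)) / \<rho> ^ CARD('n)) \<in> borel_measurable borel"
    by (intro borel_measurable_divide lborel.borel_measurable_lebesgue_integral borel_measurable_const) measurable
  thus ?thesis using cube_avg_alt[OF assms] by (simp cong: measurable_cong)
qed

text \<open>An inequality of Poincare type: \<phi> minus its average is an average over y in the
  cube of differences between \<phi> and its shift by y. After exchanging the integrals,
  \<open>test_function_shift\<close> bounds each shift by norm y <= N \<rho>. Nonnegative integrals
  are used so that integrability comes out together with the bound.\<close>

lemma cube_avg_diff:
  fixes \<phi> :: "real ^ 'n \<Rightarrow> real"
  assumes t: "test_function \<Omega> \<phi>" and \<Omega>: "bounded \<Omega>" "open \<Omega>" and \<rho>: "\<rho> > 0"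
  shows "integrable lborel (\<lambda>x. \<phi> x - cube_avg \<rho> \<phi> x)"
    and "(LINT x|lborel. \<bar>\<phi> x - cube_avg \<rho> \<phi> x\<bar>) \<le> real CARD('n) * \<rho> * (LINT x|lborel. norm (grad \<phi> x))"
proof -
  define I where "I = (LINT x|lborel. norm (grad \<phi> x))"
  define V where "V = \<rho> ^ CARD('n)"
  have V: "V > 0" using \<rho> by (simp add: V_def)
  have I: "I \<ge> 0" by (simp add: I_def)
  note [measurable] = test_function_measurable[OF t]
  have [measurable]: "cube_avg \<rho> \<phi> \<in> borel_measurable borel" by (rule cube_avg_measurable) measurable
  have int: "integrable lborel \<phi>"
    using test_function_integrable[OF t \<Omega>, of fst] by (simp add: continuous_on_fst)
  have mQ: "emeasure lborel (cube \<rho> (0 :: real ^ 'n)) = ennreal V" using measure_cube[OF \<rho>] by (simp add: V_def)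
  have iQ: "integrable lborel (indicat_real (cube \<rho> (0 :: real ^ 'n)))"
    by (rule integrable_real_indicator) (simp_all add: mQ)
  have iQe: "(LINT y|lborel. indicat_real (cube \<rho> (0 :: real ^ 'n)) y) = V"
    using V by (simp add: mQ measure_def)
  have pt: "ennreal \<bar>\<phi> x - cube_avg \<rho> \<phi> x\<bar> \<le> (\<integral>\<^sup>+y. ennreal (indicator (cube \<rho> 0) y * \<bar>\<phi> (y + x) - \<phi> x\<bar> / V) \<partial>lborel)" for x
  proof -
    have i1: "integrable lborel (\<lambda>y. indicator (cube \<rho> 0) y * \<phi> (x + y))"
      using integrable_mult_indicator[OF _ lborel_integrable_shift[OF int, of x], of "cube \<rho> 0"] by simp
    have i2: "integrable lborel (\<lambda>y. indicator (cube \<rho> 0) y * \<bar>\<phi> (y + x) - \<phi> x\<bar> / V)"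
    proof -
      have "integrable lborel (\<lambda>y. \<bar>indicator (cube \<rho> 0) y * \<phi> (x + y) - indicator (cube \<rho> 0) y * \<phi> x\<bar> / V)"
        using i1 iQ by auto
      also have "(\<lambda>y. \<bar>indicator (cube \<rho> 0) y * \<phi> (x + y) - indicator (cube \<rho> 0) y * \<phi> x\<bar> / V)
          = (\<lambda>y. indicator (cube \<rho> 0) y * \<bar>\<phi> (y + x) - \<phi> x\<bar> / V)"
        by (auto simp: fun_eq_iff indicator_def add.commute)
      finally show ?thesis .
    qed
    have "\<phi> x - cube_avg \<rho> \<phi> x = (LINT y|lborel. indicator (cube \<rho> 0) y * \<phi> x - indicator (cube \<rho> 0) y * \<phi> (x + y)) / V"
      unfolding cube_avg_alt[OF test_function_measurable(1)[OF t]] V_def[symmetric]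
      using i1 iQ iQe V by (simp add: diff_divide_distrib)
    hence "\<bar>\<phi> x - cube_avg \<rho> \<phi> x\<bar> \<le> (LINT y|lborel. \<bar>indicator (cube \<rho> 0) y * \<phi> x - indicator (cube \<rho> 0) y * \<phi> (x + y)\<bar>) / V"
      using V by (simp add: divide_right_mono integral_abs_bound)
    also have "\<dots> = (LINT y|lborel. \<bar>indicator (cube \<rho> 0) y * \<phi> x - indicator (cube \<rho> 0) y * \<phi> (x + y)\<bar> / V)" by simp
    also have "\<dots> = (LINT y|lborel. indicator (cube \<rho> 0) y * \<bar>\<phi> (y + x) - \<phi> x\<bar> / V)"
      by (rule Bochner_Integration.integral_cong) (auto simp: indicator_def add.commute abs_minus_commute)
    finally show ?thesis
      using nn_integral_eq_integral[OF i2] V by (simp add: ennreal_leI)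
  qed
  have "(\<integral>\<^sup>+x. ennreal \<bar>\<phi> x - cube_avg \<rho> \<phi> x\<bar> \<partial>lborel)
      \<le> (\<integral>\<^sup>+x. (\<integral>\<^sup>+y. ennreal (indicator (cube \<rho> 0) y * \<bar>\<phi> (y + x) - \<phi> x\<bar> / V) \<partial>lborel) \<partial>lborel)"
    by (rule nn_integral_mono) (rule pt)
  also have "\<dots> = (\<integral>\<^sup>+y. (\<integral>\<^sup>+x. ennreal (indicator (cube \<rho> 0) y * \<bar>\<phi> (y + x) - \<phi> x\<bar> / V) \<partial>lborel) \<partial>lborel)"
    by (rule lborel_pair.Fubini') measurable
  also have "\<dots> \<le> (\<integral>\<^sup>+y. ennreal (real CARD('n) * \<rho> * I / V) * indicator (cube \<rho> (0 :: real ^ 'n)) y \<partial>lborel)"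
  proof (rule nn_integral_mono)
    fix y :: "real ^ 'n"
    show "(\<integral>\<^sup>+x. ennreal (indicator (cube \<rho> 0) y * \<bar>\<phi> (y + x) - \<phi> x\<bar> / V) \<partial>lborel)
        \<le> ennreal (real CARD('n) * \<rho> * I / V) * indicator (cube \<rho> 0) y"
    proof (cases "y \<in> cube \<rho> 0")
      case True
      have i: "integrable lborel (\<lambda>x. \<bar>\<phi> (y + x) - \<phi> x\<bar> / V)"
        using lborel_integrable_shift[OF int, of y] int by auto
      have "(LINT x|lborel. \<bar>\<phi> (y + x) - \<phi> x\<bar> / V) = (LINT x|lborel. \<bar>\<phi> (y + x) - \<phi> x\<bar>) / V" by simp
      also have "\<dots> \<le> (norm y * I) / V"
        using test_function_shift[OF t \<Omega>, of y] V unfolding I_def by (simp add: divide_right_mono)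
      also have "\<dots> \<le> (real CARD('n) * \<rho> * I) / V"
        using norm_cube_le[OF True] I V by (intro divide_right_mono mult_right_mono) auto
      finally have "(\<integral>\<^sup>+x. ennreal (\<bar>\<phi> (y + x) - \<phi> x\<bar> / V) \<partial>lborel) \<le> ennreal (real CARD('n) * \<rho> * I / V)"
        using nn_integral_eq_integral[OF i] V by (simp add: ennreal_leI)
      thus ?thesis using True by simp
    qed simp
  qed
  also have "\<dots> = ennreal (real CARD('n) * \<rho> * I / V) * ennreal V"
    by (subst nn_integral_cmult_indicator) (simp_all add: mQ)
  also have "\<dots> = ennreal (real CARD('n) * \<rho> * I)"
    using V I \<rho> by (simp add: ennreal_mult[symmetric])
  finally have le: "(\<integral>\<^sup>+x. ennreal \<bar>\<phi> x - cube_avg \<rho> \<phi> x\<bar> \<partial>lborel) \<le> ennreal (real CARD('n) * \<rho> * I)" .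
  show ig: "integrable lborel (\<lambda>x. \<phi> x - cube_avg \<rho> \<phi> x)"
    by (rule integrableI_bounded) (use le in \<open>auto simp: le_less_trans\<close>)
  have "integrable lborel (\<lambda>x. \<bar>\<phi> x - cube_avg \<rho> \<phi> x\<bar>)" using ig by auto
  from nn_integral_eq_integral[OF this]
  have "ennreal (LINT x|lborel. \<bar>\<phi> x - cube_avg \<rho> \<phi> x\<bar>) \<le> ennreal (real CARD('n) * \<rho> * I)" using le by simp
  thus "(LINT x|lborel. \<bar>\<phi> x - cube_avg \<rho> \<phi> x\<bar>) \<le> real CARD('n) * \<rho> * (LINT x|lborel. norm (grad \<phi> x))"
    using I \<rho> unfolding I_def[symmetric] by (simp add: ennreal_le_iff)
qed

section \<open>Functions of small support and compactness\<close>

context sobolev_domain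
begin

lemma integral_indicator_domain [simp]:
  "(LINT x|M. indicat_real \<Omega> x * f x) = (LINT x|M. f x)"
  by (rule Bochner_Integration.integral_cong) auto

lemma lborel_to_M:
  fixes f :: "real ^ 'n \<Rightarrow> real"
  assumes f: "integrable lborel f" and nn: "\<And>x. 0 \<le> f x"
  shows "integrable M f" "integral\<^sup>L M f \<le> integral\<^sup>L lborel f"
proof -
  have fl: "integrable lebesgue f" using f borel_measurable_integrable[OF f] by (simp add: integrable_completion)
  have si: "integrable lebesgue (\<lambda>x. indicator \<Omega> x *\<^sub>R f x)"
    by (rule integrable_mult_indicator[OF domain_sets fl])
  thus "integrable M f" using domain_sets by (simp add: integrable_restrict_space)
  have "integral\<^sup>L M f = (LINT x|lebesgue. indicator \<Omega> x *\<^sub>R f x)"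
    using domain_sets by (simp add: integral_restrict_space)
  also have "\<dots> \<le> (LINT x|lebesgue. f x)"
    by (rule integral_mono[OF si fl]) (use nn in \<open>auto simp: indicator_def\<close>)
  also have "\<dots> = integral\<^sup>L lborel f"
    using borel_measurable_integrable[OF f] by (simp add: integral_completion)
  finally show "integral\<^sup>L M f \<le> integral\<^sup>L lborel f" .
qed

lemma test_integral_eq:
  assumes t: "test_function \<Omega> \<phi>"
  shows "(LINT x|lborel. \<bar>\<phi> x\<bar>) = (LINT x|M. \<bar>\<phi> x\<bar>)" "(LINT x|lborel. norm (grad \<phi> x)) = (LINT x|M. norm (grad \<phi> x))"
    and "integrable lborel \<phi>"
proof -
  note [measurable] = test_function_measurable[OF t]
  show "(LINT x|lborel. \<bar>\<phi> x\<bar>) = (LINT x|M. \<bar>\<phi> x\<bar>)" "(LINT x|lborel. norm (grad \<phi> x)) = (LINT x|M. norm (grad \<phi> x))"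
    by (rule lebesgue_on_vanishing(1)[symmetric]; use test_function_vanish[OF t] domain_sets in simp)+
  show "integrable lborel \<phi>"
    using test_function_integrable[OF t bounded_domain open_domain, of fst] by (simp add: continuous_on_fst)
qed

lemma integral_norm_tendsto:
  fixes f :: "nat \<Rightarrow> real ^ 'n \<Rightarrow> 'b::{banach, second_countable_topology}"
  assumes f: "\<And>n. memLp M p (f n)" and g: "memLp M p g" and lim: "(\<lambda>n. pint M p (\<lambda>x. f n x - g x)) \<longlonglongrightarrow> 0"
    and S: "S \<in> sets M"
  shows "(\<lambda>n. LINT x|M. indicator S x * norm (f n x)) \<longlonglongrightarrow> (LINT x|M. indicator S x * norm (g x))"
proof -
  note [measurable] = memLp_measurable[OF f] memLp_measurable[OF g] S
  have nm: "memLp M p (\<lambda>x. norm (h x))" if "memLp M p h" for h :: "real ^ 'n \<Rightarrow> 'b"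
    using that by (auto simp: memLp_def)
  have "(\<lambda>n. LINT x|M. norm (f n x) * indicator S x) \<longlonglongrightarrow> (LINT x|M. norm (g x) * indicator S x)"
  proof (rule pairing_tendsto[OF nm[OF f] nm[OF g], where C = 1])
    show "(\<lambda>n. pint M p (\<lambda>x. norm (f n x) - norm (g x))) \<longlonglongrightarrow> 0"
    proof (rule tendsto_sandwich[OF _ _ tendsto_const lim])
      show "\<forall>\<^sub>F n in sequentially. pint M p (\<lambda>x. norm (f n x) - norm (g x)) \<le> pint M p (\<lambda>x. f n x - g x)"
      proof (intro always_eventually allI)
        fix n
        show "pint M p (\<lambda>x. norm (f n x) - norm (g x)) \<le> pint M p (\<lambda>x. f n x - g x)"
          by (rule memLp_dominated(2)[OF _ memLp_diff(1)[OF f g p_bounds(1)] _ p_bounds(1)]) (auto simp: norm_triangle_ineq3)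
      qed
    qed (simp add: pint_nonneg)
  qed (auto simp: indicator_def)
  thus ?thesis by (simp add: mult.commute)
qed

text \<open>The substitute for Sobolev's inequality: with \<open>\<rho> ^ N = 2 * measure M S\<close> and \<open>u\<close> supported in
  \<open>S\<close>, the last term is absorbed and the \<open>L\<^sup>1\<close> norm of \<open>u\<close> gains a factor \<open>measure M S powr (1 / N)\<close>.\<close>

lemma W0_small_support_gain:
  assumes W: "W0 \<Omega> p u g" and S: "S \<in> sets M" and \<rho>: "\<rho> > 0"
  shows "(LINT x|M. indicator S x * \<bar>u x\<bar>) \<le> real CARD('n) * \<rho> * (LINT x|M. norm (g x))
      + measure M S / \<rho> ^ CARD('n) * (LINT x|M. \<bar>u x\<bar>)"
proof -
  interpret finite_measure M by (rule finite_M)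
  \<comment> \<open>The factor \<open>indicator (space M)\<close> changes nothing; it brings all
    three integrals into the form in which \<open>integral_norm_tendsto\<close> passes to the
    limit.\<close>
  have test: "(LINT x|M. indicator S x * norm (\<phi> x)) \<le> real CARD('n) * \<rho> * (LINT x|M. indicator (space M) x * norm (grad \<phi> x))
      + measure M S / \<rho> ^ CARD('n) * (LINT x|M. indicator (space M) x * norm (\<phi> x))" if t: "test_function \<Omega> \<phi>" for \<phi>
  proof -
    note e = test_integral_eq[OF t] and cd = cube_avg_diff[OF t bounded_domain open_domain \<rho>]
    note [measurable] = test_function_measurable[OF t] S
    have [measurable]: "\<phi> \<in> borel_measurable M" by (rule borel_measurable_M) simp
    have i1: "integrable M (\<lambda>x. \<bar>\<phi> x - cube_avg \<rho> \<phi> x\<bar>)" "(LINT x|M. \<bar>\<phi> x - cube_avg \<rho> \<phi> x\<bar>) \<le> (LINT x|lborel. \<bar>\<phi> x - cube_avg \<rho> \<phi> x\<bar>)"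
      using lborel_to_M[of "\<lambda>x. \<bar>\<phi> x - cube_avg \<rho> \<phi> x\<bar>"] cd(1) by auto
    \<comment> \<open>Total mass divided by the volume of the cube, a pointwise bound for the
      average. On S the function is then at most its deviation from the average plus this
      constant.\<close>
    define A where "A = (LINT x|M. \<bar>\<phi> x\<bar>) / \<rho> ^ CARD('n)"
    have A: "\<bar>cube_avg \<rho> \<phi> x\<bar> \<le> A" for x
      using cube_avg_bound[OF \<rho> e(3), of x] by (simp add: A_def e)
    have iS: "integrable M (\<lambda>x. indicator S x * A)"
      by (intro integrable_mult_left integrable_real_indicator S) (simp add: emeasure_eq_measure)
    have "(LINT x|M. indicator S x * norm (\<phi> x)) \<le> (LINT x|M. \<bar>\<phi> x - cube_avg \<rho> \<phi> x\<bar> + indicator S x * A)"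
    proof (rule integral_mono[OF _ Bochner_Integration.integrable_add[OF i1(1) iS]])
      show "integrable M (\<lambda>x. indicat_real S x * norm (\<phi> x))"
        using integrable_mult_indicator[OF S integrable_norm[OF memLp_L1(1)[OF finite_M test_function_memLp(1)[OF t] p_bounds(3)]]] by simp
      fix x
      show "indicat_real S x * norm (\<phi> x) \<le> \<bar>\<phi> x - cube_avg \<rho> \<phi> x\<bar> + indicat_real S x * A"
        using A[of x] by (auto simp: indicator_def)
    qed
    also have "\<dots> = (LINT x|M. \<bar>\<phi> x - cube_avg \<rho> \<phi> x\<bar>) + measure M S * A"
      using i1(1) iS S sets.sets_into_space[OF S] by (simp add: Int_absorb2)
    also have "\<dots> \<le> real CARD('n) * \<rho> * (LINT x|M. norm (grad \<phi> x)) + measure M S * A"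
      using i1(2) cd(2) by (simp add: e)
    finally show ?thesis
      unfolding A_def by simp
  qed
  obtain \<phi> where \<phi>: "\<And>n. test_function \<Omega> (\<phi> n)"
    "(\<lambda>n. pint M p (\<lambda>x. u x - \<phi> n x)) \<longlonglongrightarrow> 0" "(\<lambda>n. pint M p (\<lambda>x. g x - grad (\<phi> n) x)) \<longlonglongrightarrow> 0"
    by (rule W0_seq[OF W], rule that, assumption+)
  note mem = W0_memLp[OF W] and tm = test_function_memLp[OF \<phi>(1)]
  have l: "(\<lambda>n. pint M p (\<lambda>x. \<phi> n x - u x)) \<longlonglongrightarrow> 0" "(\<lambda>n. pint M p (\<lambda>x. grad (\<phi> n) x - g x)) \<longlonglongrightarrow> 0"
    using \<phi>(2,3) by (simp_all add: pint_commute[of _ _ u] pint_commute[of _ _ g])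
  have "(LINT x|M. indicator S x * norm (u x)) \<le> real CARD('n) * \<rho> * (LINT x|M. indicator (space M) x * norm (g x))
      + measure M S / \<rho> ^ CARD('n) * (LINT x|M. indicator (space M) x * norm (u x))"
  proof (rule LIMSEQ_le)
    show "(\<lambda>n. LINT x|M. indicator S x * norm (\<phi> n x)) \<longlonglongrightarrow> (LINT x|M. indicator S x * norm (u x))"
      by (rule integral_norm_tendsto[OF tm(1) mem(1) l(1) S])
    show "(\<lambda>n. real CARD('n) * \<rho> * (LINT x|M. indicator (space M) x * norm (grad (\<phi> n) x))
      + measure M S / \<rho> ^ CARD('n) * (LINT x|M. indicator (space M) x * norm (\<phi> n x))) \<longlonglongrightarrow>
      real CARD('n) * \<rho> * (LINT x|M. indicator (space M) x * norm (g x))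
      + measure M S / \<rho> ^ CARD('n) * (LINT x|M. indicator (space M) x * norm (u x))"
      by (intro tendsto_add tendsto_mult tendsto_const integral_norm_tendsto[OF tm(1) mem(1) l(1) sets.top]
          integral_norm_tendsto[OF tm(2) mem(2) l(2) sets.top])
    show "\<exists>N. \<forall>n\<ge>N. (LINT x|M. indicator S x * norm (\<phi> n x)) \<le> real CARD('n) * \<rho> * (LINT x|M. indicator (space M) x * norm (grad (\<phi> n) x))
      + measure M S / \<rho> ^ CARD('n) * (LINT x|M. indicator (space M) x * norm (\<phi> n x))"
      using test[OF \<phi>(1)] by blast
  qed
  thus ?thesis by simp
qed

text \<open>A diagonal argument handles the countably many cubes with side 1/(k+1) and corner in a
  dense set. Because the functions are uniformly bounded, the integrals depend on the corner
  equicontinuously in n, which carries convergence to all corners.\<close>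

lemma cube_integral_subseq:
  fixes u :: "nat \<Rightarrow> real ^ 'n \<Rightarrow> real"
  assumes u: "\<And>n. u n \<in> borel_measurable M" and b: "\<And>n. AE x in M. \<bar>u n x\<bar> \<le> K"
  obtains r where "strict_mono (r :: nat \<Rightarrow> nat)"
    "\<And>k x. convergent (\<lambda>n. LINT z|M. indicator (cube (inverse (real (Suc k))) x) z * u (r n) z)"
proof -
  interpret finite_measure M by (rule finite_M)
  define F where "F n kd = (LINT z|M. indicator (cube (inverse (real (Suc (fst kd)))) (snd kd)) z * u n z)" for n kd
  have [measurable]: "u n \<in> borel_measurable M" for n by (rule u)
  have cM[measurable]: "cube \<rho> x \<inter> \<Omega> \<in> sets M" for \<rho> :: real and x
    using domain_sets by (auto simp: sets_restrict_space_iff)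
  have ind[measurable]: "indicat_real (cube \<rho> x) \<in> borel_measurable M" for \<rho> :: real and x
    by (rule borel_measurable_M) simp
  have iu: "integrable M (\<lambda>z. f z * u n z)" if [measurable]: "f \<in> borel_measurable M" and f: "\<And>z. \<bar>f z\<bar> \<le> 1" for f n
  proof (rule integrable_const_bound)
    show "AE x in M. norm (f x * u n x) \<le> K"
      using b[of n]
    proof eventually_elim
      case (elim x)
      thus ?case using f[of x] mult_left_le_one_le[of "\<bar>u n x\<bar>" "\<bar>f x\<bar>"] by (simp add: abs_mult)
    qed
  qed measurable
  have ii: "integrable M (\<lambda>z. indicat_real (cube \<rho> x) z * u n z)" for \<rho> :: real and x n
    by (rule iu[OF ind]) (simp add: indicator_def)
  have iind: "integrable M (indicat_real (cube \<rho> x))" for \<rho> :: real and x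
    by (rule integrable_const_bound[where B = 1, OF _ ind]) (simp add: indicator_def)
  obtain D :: "(real ^ 'n) set" where D: "countable D" "\<And>y. \<exists>d. (\<forall>j::nat. d j \<in> D) \<and> d \<longlonglongrightarrow> y"
    by (rule countable_dense_sequences, rule that, assumption+)
  have "countable (UNIV \<times> D :: (nat \<times> (real ^ 'n)) set)" using D(1) by simp
  moreover have "norm (F n kd) \<le> \<bar>K\<bar> * measure M (space M)" for n kd
  proof -
    have "norm (F n kd) \<le> (LINT z|M. norm (indicat_real (cube (inverse (real (Suc (fst kd)))) (snd kd)) z * u n z))"
      unfolding F_def by (rule integral_norm_bound)
    also have "\<dots> \<le> (LINT z|M. \<bar>K\<bar>)"
      by (rule integral_mono_AE[OF integrable_norm[OF ii]])
        (use b[of n] in \<open>auto simp: indicator_def abs_mult elim!: eventually_mono\<close>)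
    finally show ?thesis by (simp add: mult.commute)
  qed
  ultimately obtain r where r: "strict_mono (r :: nat \<Rightarrow> nat)" "\<And>kd. kd \<in> UNIV \<times> D \<Longrightarrow> \<exists>l. (\<lambda>n. F (r n) kd) \<longlonglongrightarrow> l"
    using function_convergent_subsequence[of "UNIV \<times> D" F "\<bar>K\<bar> * measure M (space M)"] by metis
  have "convergent (\<lambda>n. F (r n) (k, x))" for k x
  proof -
    define \<rho> where "\<rho> = inverse (real (Suc k))"
    obtain d where d: "\<And>j. d j \<in> D" and dx: "d \<longlonglongrightarrow> x" using D(2)[of x] by blast
    have bd: "AE z in M. z \<notin> cbox x (x + (\<chi> i. \<rho>)) - cube \<rho> x"
    proof -
      have "negligible (cbox x (x + (\<chi> i. \<rho>)) - cube \<rho> x)" unfolding cube_def by (metis negligible_frontier_interval)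
      hence "AE z in lebesgue. z \<notin> cbox x (x + (\<chi> i. \<rho>)) - cube \<rho> x"
        by (intro AE_not_in) (simp add: negligible_iff_null_sets)
      thus ?thesis using domain_sets by (auto simp: AE_restrict_space_iff elim!: eventually_mono)
    qed
    \<comment> \<open>Off the boundary of the limit cube, membership in the moving cubes is
      eventually constant, and that boundary is a null set.\<close>
    have lim: "(\<lambda>j. LINT z|M. \<bar>indicat_real (cube \<rho> (d j)) z - indicat_real (cube \<rho> x) z\<bar>) \<longlonglongrightarrow> (LINT z|M. 0)"
    proof (rule integral_dominated_convergence[where w = "\<lambda>_. 1"])
      show "AE z in M. (\<lambda>j. \<bar>indicat_real (cube \<rho> (d j)) z - indicat_real (cube \<rho> x) z\<bar>) \<longlonglongrightarrow> 0"
        using bd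
      proof eventually_elim
        case (elim z)
        have cj: "(\<lambda>j. d j $ i) \<longlonglongrightarrow> x $ i" for i using dx by (rule tendsto_vec_nth)
        consider "z \<in> cube \<rho> x" | "z \<notin> cbox x (x + (\<chi> i. \<rho>))" using elim by blast
        hence "\<forall>\<^sub>F j in sequentially. z \<in> cube \<rho> (d j) \<longleftrightarrow> z \<in> cube \<rho> x"
        proof cases
          case 1
          have "\<forall>\<^sub>F j in sequentially. \<forall>i. d j $ i < z $ i \<and> z $ i < d j $ i + \<rho>"
          proof (rule eventually_all_finite)
            fix i
            have "x $ i < z $ i" "z $ i < x $ i + \<rho>" using 1 by (auto simp: cube_def mem_box_cart)
            hence "\<forall>\<^sub>F j in sequentially. d j $ i < z $ i" "\<forall>\<^sub>F j in sequentially. z $ i - \<rho> < d j $ i"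
              by (intro order_tendstoD[OF cj]; simp)+
            thus "\<forall>\<^sub>F j in sequentially. d j $ i < z $ i \<and> z $ i < d j $ i + \<rho>"
              by eventually_elim auto
          qed
          thus ?thesis by eventually_elim (use 1 in \<open>auto simp: cube_def mem_box_cart\<close>)
        next
          case 2
          then obtain i where i: "z $ i < x $ i \<or> x $ i + \<rho> < z $ i"
            by (auto simp: mem_box_cart not_le)
          have n1: "z \<notin> cube \<rho> x" using 2 box_subset_cbox unfolding cube_def by blast
          from i show ?thesis
          proof
            assume "z $ i < x $ i"
            hence "\<forall>\<^sub>F j in sequentially. z $ i < d j $ i" by (intro order_tendstoD[OF cj])
            thus ?thesis
            proof eventually_elim
              case (elim j)
              hence "\<not> (d j $ i < z $ i \<and> z $ i < (d j + (\<chi> i. \<rho>)) $ i)" by auto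
              hence "z \<notin> cube \<rho> (d j)" unfolding cube_def mem_box_cart by blast
              thus ?case using n1 by simp
            qed
          next
            assume "x $ i + \<rho> < z $ i"
            hence "\<forall>\<^sub>F j in sequentially. d j $ i < z $ i - \<rho>" by (intro order_tendstoD[OF cj]) simp
            thus ?thesis
            proof eventually_elim
              case (elim j)
              hence "\<not> (d j $ i < z $ i \<and> z $ i < (d j + (\<chi> i. \<rho>)) $ i)" by auto
              hence "z \<notin> cube \<rho> (d j)" unfolding cube_def mem_box_cart by blast
              thus ?case using n1 by simp
            qed
          qed
        qed
        hence "\<forall>\<^sub>F j in sequentially. \<bar>indicat_real (cube \<rho> (d j)) z - indicat_real (cube \<rho> x) z\<bar> = 0"
          by eventually_elim (simp add: indicator_def)
        thus ?case by (rule tendsto_eventually)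
      qed
      show "(\<lambda>z. \<bar>indicat_real (cube \<rho> (d j)) z - indicat_real (cube \<rho> x) z\<bar>) \<in> borel_measurable M" for j
        by (intro borel_measurable_abs borel_measurable_diff ind)
    qed (simp_all add: indicator_def)
    have "Cauchy (\<lambda>n. F (r n) (k, x))"
    proof (rule metric_CauchyI)
      fix e :: real assume e: "e > 0"
      have "(\<lambda>j. \<bar>K\<bar> * (LINT z|M. \<bar>indicat_real (cube \<rho> (d j)) z - indicat_real (cube \<rho> x) z\<bar>)) \<longlonglongrightarrow> \<bar>K\<bar> * 0"
        using lim by (intro tendsto_intros) simp
      hence "\<forall>\<^sub>F j in sequentially. \<bar>K\<bar> * (LINT z|M. \<bar>indicat_real (cube \<rho> (d j)) z - indicat_real (cube \<rho> x) z\<bar>) < e / 3"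
        using e by (intro order_tendstoD(2)[of _ "\<bar>K\<bar> * 0"]) auto
      then obtain j where j: "\<bar>K\<bar> * (LINT z|M. \<bar>indicat_real (cube \<rho> (d j)) z - indicat_real (cube \<rho> x) z\<bar>) < e / 3"
        by (auto simp: eventually_sequentially)
      have near: "\<bar>F n (k, x) - F n (k, d j)\<bar> < e / 3" for n
      proof -
        have "F n (k, x) - F n (k, d j) = (LINT z|M. indicat_real (cube \<rho> x) z * u n z - indicat_real (cube \<rho> (d j)) z * u n z)"
          using ii by (simp add: F_def \<rho>_def)
        also have "\<bar>\<dots>\<bar> \<le> (LINT z|M. \<bar>indicat_real (cube \<rho> x) z * u n z - indicat_real (cube \<rho> (d j)) z * u n z\<bar>)"
          by (rule integral_abs_bound)
        also have "\<dots> \<le> (LINT z|M. \<bar>K\<bar> * \<bar>indicat_real (cube \<rho> (d j)) z - indicat_real (cube \<rho> x) z\<bar>)"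
        proof (rule integral_mono_AE)
          show "integrable M (\<lambda>z. \<bar>indicat_real (cube \<rho> x) z * u n z - indicat_real (cube \<rho> (d j)) z * u n z\<bar>)"
            using ii by auto
          show "integrable M (\<lambda>z. \<bar>K\<bar> * \<bar>indicat_real (cube \<rho> (d j)) z - indicat_real (cube \<rho> x) z\<bar>)"
            by (intro integrable_mult_right integrable_abs Bochner_Integration.integrable_diff iind)
          show "AE z in M. \<bar>indicat_real (cube \<rho> x) z * u n z - indicat_real (cube \<rho> (d j)) z * u n z\<bar>
              \<le> \<bar>K\<bar> * \<bar>indicat_real (cube \<rho> (d j)) z - indicat_real (cube \<rho> x) z\<bar>"
            using b[of n] by eventually_elim (auto simp: indicator_def)
        qed
        also have "\<dots> < e / 3" using j by simp
        finally show ?thesis .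
      qed
      have "Cauchy (\<lambda>n. F (r n) (k, d j))" using r(2)[of "(k, d j)"] d by (auto intro: LIMSEQ_imp_Cauchy)
      then obtain N where N: "\<forall>m\<ge>N. \<forall>n\<ge>N. dist (F (r m) (k, d j)) (F (r n) (k, d j)) < e / 3"
        using metric_CauchyD[of _ "e / 3"] e by (metis divide_pos_pos zero_less_numeral)
      have "dist (F (r m) (k, x)) (F (r n) (k, x)) < e" if "m \<ge> N" "n \<ge> N" for m n
      proof -
        have "\<bar>F (r m) (k, d j) - F (r n) (k, d j)\<bar> < e / 3" using N that by (simp add: dist_real_def)
        thus ?thesis using near[of "r m"] near[of "r n"] unfolding dist_real_def by linarith
      qed
      thus "\<exists>N. \<forall>m\<ge>N. \<forall>n\<ge>N. dist (F (r m) (k, x)) (F (r n) (k, x)) < e" by blast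
    qed
    thus ?thesis by (simp add: Cauchy_convergent_iff)
  qed
  thus thesis using r(1) that by (simp add: F_def)
qed

text \<open>Test functions within 1/(n+1) of the sequence are used, so the two share their limits.
  At a fixed scale \<rho> the cube averages converge pointwise and boundedly, hence in L^1, while
  the test functions differ from their averages by at most N \<rho> B in L^1, uniformly in n. They
  are therefore Cauchy in L^1.\<close>

lemma Rellich:
  assumes W: "\<And>n. W0 \<Omega> p (u n) (g n)" and b: "\<And>n. AE x in M. \<bar>u n x\<bar> \<le> K" and C: "\<And>n. pint M p (g n) \<le> C"
  obtains r v where "strict_mono (r :: nat \<Rightarrow> nat)" "v \<in> borel_measurable M" "AE x in M. \<bar>v x\<bar> \<le> K"
    "AE x in M. (\<lambda>n. u (r n) x) \<longlonglongrightarrow> v x"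
proof -
  interpret finite_measure M by (rule finite_M)
  note mem = W0_memLp[OF W]
  note [measurable] = W0_measurable[OF W]
  obtain r where r: "strict_mono (r :: nat \<Rightarrow> nat)"
    "\<And>k x. convergent (\<lambda>n. LINT z|M. indicator (cube (inverse (real (Suc k))) x) z * u (r n) z)"
    by (rule cube_integral_subseq[OF W0_measurable(1)[OF W] b], rule that, assumption+)
  have "\<exists>\<phi>. \<forall>n. test_function \<Omega> (\<phi> n) \<and> pint M p (\<lambda>x. u (r n) x - \<phi> n x) + pint M p (\<lambda>x. g (r n) x - grad (\<phi> n) x) < inverse (real (Suc n))"
    by (rule choice) (use W in \<open>auto simp: W0_def\<close>)
  then obtain \<phi> where \<phi>: "\<And>n. test_function \<Omega> (\<phi> n)"
    "\<And>n. pint M p (\<lambda>x. u (r n) x - \<phi> n x) + pint M p (\<lambda>x. g (r n) x - grad (\<phi> n) x) < inverse (real (Suc n))" by blast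
  note tm = test_function_memLp[OF \<phi>(1)] and te = test_integral_eq[OF \<phi>(1)]
  have le: "pint M p (\<lambda>x. u (r n) x - \<phi> n x) \<le> inverse (real (Suc n))"
    "pint M p (\<lambda>x. g (r n) x - grad (\<phi> n) x) \<le> inverse (real (Suc n))" for n
    using \<phi>(2)[of n] pint_nonneg[of M p "\<lambda>x. u (r n) x - \<phi> n x"] pint_nonneg[of M p "\<lambda>x. g (r n) x - grad (\<phi> n) x"]
    by linarith+
  have l0: "(\<lambda>n. pint M p (\<lambda>x. u (r n) x - \<phi> n x)) \<longlonglongrightarrow> 0"
    by (rule tendsto_sandwich[OF _ _ tendsto_const LIMSEQ_inverse_real_of_nat];
        intro always_eventually allI le pint_nonneg)
  have L1: "(\<lambda>n. LINT x|M. norm (u (r n) x - \<phi> n x)) \<longlonglongrightarrow> 0"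
    by (rule L1_norm_tendsto_0[OF finite_M memLp_diff(1)[OF mem(1) tm(1) p_bounds(1)] p_gt_1 l0])
  have int\<phi>: "integrable M (\<phi> n)" and intu: "integrable M (u n)" for n
    using memLp_L1(1)[OF finite_M _ p_bounds(3)] tm(1) mem(1) by auto
  have bnd: "\<exists>B\<ge>0. \<forall>n. (LINT x|M. norm (grad (\<phi> n) x)) \<le> B"
  proof (intro exI conjI allI)
    let ?B = "measure M (space M) + (2 powr p * (C + 1))"
    have C0: "C \<ge> 0" using C[of 0] pint_nonneg[of M p "g 0"] by linarith
    thus "?B \<ge> 0" by simp
    fix n
    have "pint M p (grad (\<phi> n)) = pint M p (\<lambda>x. g (r n) x - (g (r n) x - grad (\<phi> n) x))" by simp
    also have "\<dots> \<le> 2 powr p * (pint M p (g (r n)) + pint M p (\<lambda>x. g (r n) x - grad (\<phi> n) x))"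
      by (intro memLp_diff mem tm p_bounds)
    also have "\<dots> \<le> 2 powr p * (C + 1)"
    proof -
      have "inverse (real (Suc n)) \<le> 1" by (simp add: field_simps)
      thus ?thesis using C[of "r n"] le(2)[of n] by (intro mult_left_mono) auto
    qed
    finally have "pint M p (grad (\<phi> n)) \<le> 2 powr p * (C + 1)" .
    moreover have "(LINT x|M. norm (grad (\<phi> n) x)) = (LINT x|M. indicator (space M) x * norm (grad (\<phi> n) x))"
      by simp
    ultimately show "(LINT x|M. norm (grad (\<phi> n) x)) \<le> ?B"
      using memLp_L1(2)[OF finite_M tm(2) p_bounds(3) sets.top, of 1 n] by simp
  qed
  then obtain B where B: "B \<ge> 0" "\<And>n. (LINT x|M. norm (grad (\<phi> n) x)) \<le> B" by blast
  obtain B' where B': "\<And>n. (LINT x|M. \<bar>\<phi> n x\<bar>) \<le> B'"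
  proof -
    have "Bseq (\<lambda>n. LINT x|M. norm (u (r n) x - \<phi> n x))" using L1 by (intro convergent_imp_Bseq convergentI)
    then obtain b0 where b0: "norm (LINT x|M. norm (u (r n) x - \<phi> n x)) \<le> b0" for n
      unfolding Bseq_def by blast
    have "(LINT x|M. \<bar>\<phi> n x\<bar>) \<le> b0 + \<bar>K\<bar> * measure M (space M)" for n
    proof -
      have "(LINT x|M. \<bar>\<phi> n x\<bar>) \<le> (LINT x|M. norm (u (r n) x - \<phi> n x) + \<bar>u (r n) x\<bar>)"
        by (rule integral_mono) (use int\<phi> intu in auto)
      also have "\<dots> = (LINT x|M. norm (u (r n) x - \<phi> n x)) + (LINT x|M. \<bar>u (r n) x\<bar>)"
        using int\<phi> intu by (intro Bochner_Integration.integral_add) auto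
      also have "(LINT x|M. \<bar>u (r n) x\<bar>) \<le> (LINT x|M. \<bar>K\<bar>)"
        by (rule integral_mono_AE) (use intu b[of "r n"] in \<open>auto elim!: eventually_mono\<close>)
      finally show ?thesis using b0[of n] by (simp add: mult.commute)
    qed
    thus thesis by (rule that)
  qed
  have avg_conv: "convergent (\<lambda>n. cube_avg (inverse (real (Suc k))) (\<phi> n) x)" for k x
  proof -
    define \<rho> where "\<rho> = inverse (real (Suc k))"
    have indM: "indicat_real (cube \<rho> x) \<in> borel_measurable M" by (rule borel_measurable_M) simp
    obtain L where L: "(\<lambda>n. LINT z|M. indicator (cube \<rho> x) z * u (r n) z) \<longlonglongrightarrow> L"
      using r(2)[of k x] unfolding convergent_def \<rho>_def by blast
    have i: "integrable M (\<lambda>z. indicat_real (cube \<rho> x) z * f z)" if f: "integrable M f" for f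
      by (rule Bochner_Integration.integrable_bound[OF f borel_measurable_times[OF indM borel_measurable_integrable[OF f]]])
        (auto simp: indicator_def)
    have "(\<lambda>n. (LINT z|M. indicator (cube \<rho> x) z * u (r n) z) - (LINT z|M. indicator (cube \<rho> x) z * \<phi> n z)) \<longlonglongrightarrow> 0"
    proof (rule Lim_null_comparison[OF _ L1], intro always_eventually allI)
      fix n
      have "(LINT z|M. indicator (cube \<rho> x) z * u (r n) z) - (LINT z|M. indicator (cube \<rho> x) z * \<phi> n z)
          = (LINT z|M. indicator (cube \<rho> x) z * (u (r n) z - \<phi> n z))"
        using i[OF int\<phi>] i[OF intu] by (simp add: right_diff_distrib)
      also have "norm \<dots> \<le> (LINT z|M. norm (indicator (cube \<rho> x) z * (u (r n) z - \<phi> n z)))"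
        by (rule integral_norm_bound)
      also have "\<dots> \<le> (LINT z|M. norm (u (r n) z - \<phi> n z))"
        by (rule integral_mono) (use i[of "\<lambda>z. u (r n) z - \<phi> n z"] int\<phi> intu in \<open>auto simp: indicator_def\<close>)
      finally show "norm ((LINT z|M. indicator (cube \<rho> x) z * u (r n) z) - (LINT z|M. indicator (cube \<rho> x) z * \<phi> n z))
          \<le> (LINT z|M. norm (u (r n) z - \<phi> n z))" .
    qed
    from tendsto_diff[OF L this] have "(\<lambda>n. LINT z|M. indicator (cube \<rho> x) z * \<phi> n z) \<longlonglongrightarrow> L" by simp
    hence "(\<lambda>n. (LINT z|M. indicator (cube \<rho> x) z * \<phi> n z) / \<rho> ^ CARD('n)) \<longlonglongrightarrow> L / \<rho> ^ CARD('n)"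
      by (intro tendsto_divide tendsto_const) (simp_all add: \<rho>_def)
    moreover have "(LINT z|M. indicator (cube \<rho> x) z * \<phi> n z) = (LINT z|lborel. indicator (cube \<rho> x) z * \<phi> n z)" for n
      by (rule lebesgue_on_vanishing(1))
        (use test_function_vanish[OF \<phi>(1)] test_function_measurable[OF \<phi>(1)] domain_sets in auto)
    ultimately show ?thesis by (auto simp: convergent_def cube_avg_def \<rho>_def)
  qed
  have cauchy: "\<exists>N. \<forall>i\<ge>N. \<forall>j\<ge>N. (LINT x|M. norm (\<phi> i x - \<phi> j x)) < e" if e: "e > 0" for e
  proof -
    \<comment> \<open>The scale is fixed first: the averaging errors of two test functions together
      stay below e / 2. The other half is spent on two distances of e / 4 between averages and their
      limit.\<close>
    have "(\<lambda>k. 2 * (real CARD('n) * inverse (real (Suc k)) * B)) \<longlonglongrightarrow> 2 * (real CARD('n) * 0 * B)"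
      by (intro tendsto_mult tendsto_const LIMSEQ_inverse_real_of_nat)
    hence "\<forall>\<^sub>F k in sequentially. 2 * (real CARD('n) * inverse (real (Suc k)) * B) < e / 2"
      using e by (intro order_tendstoD(2)[of _ "2 * (real CARD('n) * 0 * B)"]) auto
    then obtain k where k: "2 * (real CARD('n) * inverse (real (Suc k)) * B) < e / 2"
      by (auto simp: eventually_sequentially)
    define \<rho> where "\<rho> = inverse (real (Suc k))"
    have \<rho>: "\<rho> > 0" by (simp add: \<rho>_def)
    have [measurable]: "cube_avg \<rho> (\<phi> n) \<in> borel_measurable M" for n
      by (intro borel_measurable_M cube_avg_measurable test_function_measurable[OF \<phi>(1)])
    have ab: "\<bar>cube_avg \<rho> (\<phi> n) x\<bar> \<le> B' / \<rho> ^ CARD('n)" for n x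
    proof -
      have "\<bar>cube_avg \<rho> (\<phi> n) x\<bar> \<le> (LINT x|M. \<bar>\<phi> n x\<bar>) / \<rho> ^ CARD('n)"
        using cube_avg_bound[OF \<rho> te(3)] by (simp add: te)
      also have "\<dots> \<le> B' / \<rho> ^ CARD('n)" using B' \<rho> by (intro divide_right_mono) auto
      finally show ?thesis .
    qed
    have ia: "integrable M (cube_avg \<rho> (\<phi> n))" for n
      by (rule integrable_const_bound[of _ "B' / \<rho> ^ CARD('n)"]) (use ab in auto)
    define a where "a x = lim (\<lambda>n. cube_avg \<rho> (\<phi> n) x)" for x
    have al: "(\<lambda>n. cube_avg \<rho> (\<phi> n) x) \<longlonglongrightarrow> a x" for x
      unfolding a_def using avg_conv[of k x] by (simp add: \<rho>_def convergent_LIMSEQ_iff)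
    have [measurable]: "a \<in> borel_measurable M" unfolding a_def by (rule borel_measurable_lim_metric) simp
    have aB: "\<bar>a x\<bar> \<le> B' / \<rho> ^ CARD('n)" for x
      by (rule LIMSEQ_le_const2[OF tendsto_rabs[OF al[of x]]]) (use ab in auto)
    have iaa: "integrable M a"
      by (rule integrable_const_bound[of _ "B' / \<rho> ^ CARD('n)"]) (use aB in auto)
    have "(\<lambda>n. LINT x|M. \<bar>cube_avg \<rho> (\<phi> n) x - a x\<bar>) \<longlonglongrightarrow> (LINT x|M. 0)"
    proof (rule integral_dominated_convergence[where w = "\<lambda>_. 2 * (B' / \<rho> ^ CARD('n))"])
      show "AE x in M. (\<lambda>n. \<bar>cube_avg \<rho> (\<phi> n) x - a x\<bar>) \<longlonglongrightarrow> 0"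
        by (intro AE_I2 tendsto_rabs_zero LIM_zero al)
      show "AE x in M. norm \<bar>cube_avg \<rho> (\<phi> n) x - a x\<bar> \<le> 2 * (B' / \<rho> ^ CARD('n))" for n
      proof (intro AE_I2)
        fix x
        show "norm \<bar>cube_avg \<rho> (\<phi> n) x - a x\<bar> \<le> 2 * (B' / \<rho> ^ CARD('n))"
          using ab[of n x] aB[of x] unfolding real_norm_def by linarith
      qed
    qed auto
    hence "\<forall>\<^sub>F n in sequentially. (LINT x|M. \<bar>cube_avg \<rho> (\<phi> n) x - a x\<bar>) < e / 4"
      using e by (intro order_tendstoD(2)[of _ 0]) auto
    then obtain N where N: "\<And>n. n \<ge> N \<Longrightarrow> (LINT x|M. \<bar>cube_avg \<rho> (\<phi> n) x - a x\<bar>) < e / 4"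
      by (auto simp: eventually_sequentially)
    have d: "integrable M (\<lambda>x. \<bar>\<phi> n x - cube_avg \<rho> (\<phi> n) x\<bar>)"
      "(LINT x|M. \<bar>\<phi> n x - cube_avg \<rho> (\<phi> n) x\<bar>) \<le> real CARD('n) * \<rho> * B" for n
    proof -
      note cd = cube_avg_diff[OF \<phi>(1)[of n] bounded_domain open_domain \<rho>]
      show "integrable M (\<lambda>x. \<bar>\<phi> n x - cube_avg \<rho> (\<phi> n) x\<bar>)" using int\<phi>[of n] ia[of n] by auto
      have "(LINT x|M. \<bar>\<phi> n x - cube_avg \<rho> (\<phi> n) x\<bar>) \<le> (LINT x|lborel. \<bar>\<phi> n x - cube_avg \<rho> (\<phi> n) x\<bar>)"
        using lborel_to_M(2)[of "\<lambda>x. \<bar>\<phi> n x - cube_avg \<rho> (\<phi> n) x\<bar>"] cd(1) by auto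
      also have "\<dots> \<le> real CARD('n) * \<rho> * (LINT x|M. norm (grad (\<phi> n) x))" using cd(2) by (simp add: te)
      also have "\<dots> \<le> real CARD('n) * \<rho> * B" using B(2)[of n] \<rho> by (intro mult_left_mono) auto
      finally show "(LINT x|M. \<bar>\<phi> n x - cube_avg \<rho> (\<phi> n) x\<bar>) \<le> real CARD('n) * \<rho> * B" .
    qed
    have "(LINT x|M. norm (\<phi> i x - \<phi> j x)) < e" if ij: "i \<ge> N" "j \<ge> N" for i j
    proof -
      have "(LINT x|M. norm (\<phi> i x - \<phi> j x)) \<le> (LINT x|M. (\<bar>\<phi> i x - cube_avg \<rho> (\<phi> i) x\<bar> + \<bar>\<phi> j x - cube_avg \<rho> (\<phi> j) x\<bar>)
          + (\<bar>cube_avg \<rho> (\<phi> i) x - a x\<bar> + \<bar>cube_avg \<rho> (\<phi> j) x - a x\<bar>))"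
        by (rule integral_mono) (use int\<phi> ia iaa in \<open>auto intro!: Bochner_Integration.integrable_add\<close>)
      also have "\<dots> = ((LINT x|M. \<bar>\<phi> i x - cube_avg \<rho> (\<phi> i) x\<bar>) + (LINT x|M. \<bar>\<phi> j x - cube_avg \<rho> (\<phi> j) x\<bar>))
          + ((LINT x|M. \<bar>cube_avg \<rho> (\<phi> i) x - a x\<bar>) + (LINT x|M. \<bar>cube_avg \<rho> (\<phi> j) x - a x\<bar>))"
        using d(1) ia iaa by simp
      also have "\<dots> < e" using d(2)[of i] d(2)[of j] N[OF ij(1)] N[OF ij(2)] k by (simp add: \<rho>_def)
      finally show ?thesis .
    qed
    thus ?thesis by blast
  qed
  obtain t where t: "strict_mono t" "AE x in M. Cauchy (\<lambda>i. \<phi> (t i) x)"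
    by (rule cauchy_L1_AE_cauchy_subseq[OF int\<phi> cauchy], assumption, rule that, assumption+)
  have "(\<lambda>n. LINT x|M. norm (u (r (t n)) x - \<phi> (t n) x)) \<longlonglongrightarrow> 0"
    using LIMSEQ_subseq_LIMSEQ[OF L1 t(1)] by (simp add: o_def)
  from tendsto_L1_AE_subseq[OF _ this]
  obtain q where q: "strict_mono q" "AE x in M. (\<lambda>n. u (r (t (q n))) x - \<phi> (t (q n)) x) \<longlonglongrightarrow> 0"
    using int\<phi> intu by blast
  define v where "v x = lim (\<lambda>n. u (r (t (q n))) x)" for x
  have cv: "AE x in M. (\<lambda>n. u (r (t (q n))) x) \<longlonglongrightarrow> v x"
    using t(2) q(2)
  proof eventually_elim
    case (elim x)
    then obtain l where l: "(\<lambda>i. \<phi> (t i) x) \<longlonglongrightarrow> l" by (auto simp: Cauchy_convergent_iff convergent_def)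
    have "(\<lambda>n. \<phi> (t (q n)) x) \<longlonglongrightarrow> l" using LIMSEQ_subseq_LIMSEQ[OF l q(1)] by (simp add: o_def)
    from tendsto_add[OF elim(2) this] have "(\<lambda>n. u (r (t (q n))) x) \<longlonglongrightarrow> l" by simp
    thus ?case unfolding v_def by (metis limI)
  qed
  have "AE x in M. \<forall>n. \<bar>u n x\<bar> \<le> K" using b by (simp add: AE_all_countable)
  hence vK: "AE x in M. \<bar>v x\<bar> \<le> K"
    using cv by eventually_elim (rule LIMSEQ_le_const2[OF tendsto_rabs], auto)
  show thesis
  proof (rule that[of "\<lambda>n. r (t (q n))" v])
    show "strict_mono (\<lambda>n. r (t (q n)))"
      using r(1) t(1) q(1) by (simp add: strict_mono_def)
    show "v \<in> borel_measurable M" unfolding v_def by (rule borel_measurable_lim_metric) simp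
  qed (use vK cv in auto)
qed

end

section \<open>Uniform convexity\<close>

text \<open>The mean value theorem on each half, with the strictly increasing derivative p x^(p-1).
  Differentiability is used only in the open intervals, which admits s = 0.\<close>

lemma powr_midpoint_strict:
  fixes s t p :: real
  assumes "0 \<le> s" "s < t" "1 < p"
  shows "((s + t) / 2) powr p < (s powr p + t powr p) / 2"
proof -
  define m where "m = (s + t) / 2"
  have m: "s < m" "m < t" using assms by (auto simp: m_def)
  have c: "continuous_on {a..b} (\<lambda>x. x powr p)" if "0 \<le> a" for a b :: real
    by (intro continuous_on_powr' continuous_intros) (use that assms in auto)
  have d: "((\<lambda>x. x powr p) has_real_derivative p * x powr (p - 1)) (at x)" if "x > 0" for x :: real
    using that by (auto intro!: derivative_eq_intros)
  have dd: "(\<lambda>x. x powr p) differentiable (at x)" if "x > 0" for x :: real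
    using d[OF that] unfolding real_differentiable_def by blast
  obtain x where x: "s < x" "x < m" "m powr p - s powr p = (m - s) * (p * x powr (p - 1))"
  proof -
    have "\<exists>l z. s < z \<and> z < m \<and> ((\<lambda>x. x powr p) has_real_derivative l) (at z) \<and> m powr p - s powr p = (m - s) * l"
      by (rule MVT[OF m(1) c[OF assms(1)]], rule dd) (use assms in simp)
    then obtain z l where z: "s < z" "z < m" "((\<lambda>x. x powr p) has_real_derivative l) (at z)" "m powr p - s powr p = (m - s) * l" by blast
    have "l = p * z powr (p - 1)" using DERIV_unique[OF z(3) d] z(1) assms by simp
    thus thesis using that z by blast
  qed
  obtain y where y: "m < y" "y < t" "t powr p - m powr p = (t - m) * (p * y powr (p - 1))"
  proof -
    have "\<exists>l z. m < z \<and> z < t \<and> ((\<lambda>x. x powr p) has_real_derivative l) (at z) \<and> t powr p - m powr p = (t - m) * l"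
      by (rule MVT[OF m(2) c dd]) (use assms m in simp_all)
    then obtain z l where z: "m < z" "z < t" "((\<lambda>x. x powr p) has_real_derivative l) (at z)" "t powr p - m powr p = (t - m) * l" by blast
    have "l = p * z powr (p - 1)" using DERIV_unique[OF z(3) d] z(1) m assms by simp
    thus thesis using that z by blast
  qed
  have "x powr (p - 1) < y powr (p - 1)" using x y assms by (intro powr_less_mono2) auto
  hence "(t - m) * (p * x powr (p - 1)) < (t - m) * (p * y powr (p - 1))"
    using m assms by (intro mult_strict_left_mono) auto
  moreover have e: "m - s = t - m" by (simp add: m_def field_simps)
  ultimately have "(m - s) * (p * x powr (p - 1)) < (t - m) * (p * y powr (p - 1))" by (simp only: e)
  thus ?thesis using x(3) y(3) by (simp add: m_def)
qed

text \<open>Strictness has two sources. For equal norms the parallelogram law makes the midpoint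
  strictly shorter; for different norms the scalar inequality is already strict.\<close>

lemma norm_powr_midpoint_strict:
  fixes a b :: "'a::real_inner"
  assumes "a \<noteq> b" "1 < p"
  shows "norm ((1/2) *\<^sub>R a + (1/2) *\<^sub>R b) powr p < (norm a powr p + norm b powr p) / 2"
proof (cases "norm a = norm b")
  case True
  have "(norm ((1/2) *\<^sub>R a + (1/2) *\<^sub>R b))\<^sup>2 = ((norm a)\<^sup>2 + (norm b)\<^sup>2) / 2 - (norm (a - b))\<^sup>2 / 4"
    by (simp add: power2_norm_eq_inner algebra_simps inner_commute) (simp add: field_simps)
  also have "\<dots> < (norm a)\<^sup>2" using True assms by simp
  finally have "norm ((1/2) *\<^sub>R a + (1/2) *\<^sub>R b) < norm a" by (simp add: power2_less_imp_less)
  hence "norm ((1/2) *\<^sub>R a + (1/2) *\<^sub>R b) powr p < norm a powr p" using assms by (intro powr_less_mono2) auto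
  thus ?thesis using True by simp
next
  case False
  have "norm ((1/2) *\<^sub>R a + (1/2) *\<^sub>R b) \<le> (norm a + norm b) / 2"
    using norm_triangle_ineq[of "(1/2) *\<^sub>R a" "(1/2) *\<^sub>R b"] by simp
  hence "norm ((1/2) *\<^sub>R a + (1/2) *\<^sub>R b) powr p \<le> ((norm a + norm b) / 2) powr p"
    using assms by (intro powr_mono2) auto
  also have "\<dots> < (norm a powr p + norm b powr p) / 2"
    using powr_midpoint_strict[of "norm a" "norm b" p] powr_midpoint_strict[of "norm b" "norm a" p] False assms
    by (cases "norm a < norm b") (auto simp: add.commute)
  finally show ?thesis .
qed

lemma norm_powr_midpoint:
  fixes a b :: "'a::real_inner"
  assumes "1 < p"
  shows "norm ((1/2) *\<^sub>R a + (1/2) *\<^sub>R b) powr p \<le> (norm a powr p + norm b powr p) / 2"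
proof (cases "a = b")
  case True
  have "(1/2) *\<^sub>R b + (1/2) *\<^sub>R b = b" by (simp add: scaleR_add_left[symmetric])
  thus ?thesis using True by simp
qed (rule less_imp_le[OF norm_powr_midpoint_strict[OF _ assms]])

text \<open>Compactness takes the place of Clarkson's inequalities. All terms are homogeneous of
  degree p, so N = 1 may be assumed; there the midpoint deficit D has a positive minimum on the
  pairs with norm (a - b)^p >= e, and for the remaining pairs the term with e suffices.\<close>

lemma norm_powr_uniformly_convex:
  assumes p: "1 < p" and e: "0 < e"
  obtains C where "C \<ge> 0" "\<And>a b :: 'a::euclidean_space. norm (a - b) powr p \<le>
    C * ((norm a powr p + norm b powr p) / 2 - norm ((1/2) *\<^sub>R a + (1/2) *\<^sub>R b) powr p) + e * (norm a powr p + norm b powr p)"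
proof -
  define N where "N z = norm (fst z) powr p + norm (snd z) powr p" for z :: "'a \<times> 'a"
  define D where "D z = N z / 2 - norm ((1/2) *\<^sub>R fst z + (1/2) *\<^sub>R snd z) powr p" for z :: "'a \<times> 'a"
  define S where "S = {z :: 'a \<times> 'a. N z = 1 \<and> e \<le> norm (fst z - snd z) powr p}"
  have cN: "continuous_on UNIV N" unfolding N_def
    by (intro continuous_intros continuous_on_powr') (use p in auto)
  have cD: "continuous_on UNIV D" unfolding D_def
    by (intro continuous_intros cN continuous_on_powr') (use p in auto)
  have cd: "continuous_on UNIV (\<lambda>z :: 'a \<times> 'a. norm (fst z - snd z) powr p)"
    by (intro continuous_intros continuous_on_powr') (use p in auto)
  have "closed {z. N z = 1}" using continuous_closed_preimage_constant[OF cN closed_UNIV, of 1] by simp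
  moreover have "closed {z :: 'a \<times> 'a. e \<le> norm (fst z - snd z) powr p}"
    using continuous_closed_vimage[of "{e..}", OF _ continuous_on_interior[OF cd]]
    by (simp add: vimage_def)
  ultimately have "closed S" unfolding S_def using closed_Collect_conj[of "\<lambda>z. N z = 1" "\<lambda>z. e \<le> norm (fst z - snd z) powr p"]
    by simp
  moreover have "bounded S"
  proof -
    have le1: "x \<le> 1" if "x powr p \<le> 1" "x \<ge> 0" for x :: real
    proof (rule ccontr)
      assume "\<not> x \<le> 1"
      hence "1 powr p < x powr p" using p by (intro powr_less_mono2) auto
      thus False using that by simp
    qed
    have "norm z \<le> 2" if "z \<in> S" for z
    proof -
      have "norm (fst z) powr p + norm (snd z) powr p = 1" using that by (simp add: S_def N_def)
      hence "norm (fst z) powr p \<le> 1" "norm (snd z) powr p \<le> 1"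
        using powr_ge_zero[of "norm (fst z)" p] powr_ge_zero[of "norm (snd z)" p] by linarith+
      hence "norm (fst z) \<le> 1" "norm (snd z) \<le> 1" using le1 by auto
      thus ?thesis using norm_Pair_le[of "fst z" "snd z"] by simp
    qed
    thus ?thesis by (rule boundedI)
  qed
  ultimately have S: "compact S" by (simp add: compact_eq_bounded_closed)
  have Dnn: "0 \<le> D z" for z
    using norm_powr_midpoint[OF p, of "fst z" "snd z"] by (simp add: D_def N_def)
  have Dpos: "0 < D z" if "z \<in> S" for z
  proof -
    have "fst z \<noteq> snd z" using that e p by (auto simp: S_def)
    thus ?thesis using norm_powr_midpoint_strict[of "fst z" "snd z" p] p by (simp add: D_def N_def)
  qed
  obtain c where c: "c > 0" "\<And>z. z \<in> S \<Longrightarrow> c \<le> D z"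
  proof (cases "S = {}")
    case False
    obtain z0 where "z0 \<in> S" "\<forall>z\<in>S. D z0 \<le> D z"
      using continuous_attains_inf[OF S False continuous_on_subset[OF cD]] by auto
    thus thesis using that[of "D z0"] Dpos by auto
  next
    case True
    show thesis by (rule that[of 1]) (use True in auto)
  qed
  \<comment> \<open>On S the left side is at most \<open>2 powr p\<close> while D is at least
    c.\<close>
  define C where "C = 2 powr p / c"
  have C: "C \<ge> 0" using c by (simp add: C_def)
  have unit: "norm (fst z - snd z) powr p \<le> C * D z + e" if z: "N z = 1" for z
  proof (cases "z \<in> S")
    case True
    have "norm (fst z - snd z) powr p \<le> 2 powr p * N z"
      using norm_add_powr_le[of p "fst z" "- snd z"] p by (simp add: N_def)
    also have "\<dots> = C * c" using z c by (simp add: C_def)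
    also have "\<dots> \<le> C * D z" using c(2)[OF True] C by (rule mult_left_mono)
    finally show ?thesis using e by linarith
  next
    case False
    hence "norm (fst z - snd z) powr p \<le> e" using z by (simp add: S_def)
    thus ?thesis using C Dnn[of z] by (simp add: add_increasing)
  qed
  have "norm (a - b) powr p \<le> C * D (a, b) + e * N (a, b)" for a b :: 'a
  proof (cases "N (a, b) = 0")
    case True
    hence "norm a powr p = 0" "norm b powr p = 0"
      using powr_ge_zero[of "norm a" p] powr_ge_zero[of "norm b" p] unfolding N_def fst_conv snd_conv by linarith+
    hence "a = 0" "b = 0" by auto
    thus ?thesis using p by (simp add: D_def N_def)
  next
    case False
    hence Np: "N (a, b) > 0"
      using add_nonneg_nonneg[OF powr_ge_zero[of "norm a" p] powr_ge_zero[of "norm b" p]]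
      by (simp add: N_def order_less_le del: add_nonneg_eq_0_iff add_eq_0_iff_both_eq_0)
    \<comment> \<open>Division by r normalises N to 1 and divides every term by N (a, b).\<close>
    define r where "r = N (a, b) powr (1 / p)"
    have r: "r > 0" "r powr p = N (a, b)" using Np p by (simp_all add: r_def powr_powr)
    have sc: "norm ((1 / r) *\<^sub>R x) powr p = norm x powr p / N (a, b)" for x :: 'a
      using r by (simp add: powr_divide)
    let ?z = "((1 / r) *\<^sub>R a, (1 / r) *\<^sub>R b)"
    have "N ?z = 1" using Np unfolding N_def fst_conv snd_conv sc by (simp add: add_divide_distrib[symmetric] N_def)
    from unit[OF this] have u: "norm ((1 / r) *\<^sub>R (a - b)) powr p \<le> C * D ?z + e"
      by (simp add: scaleR_diff_right del: norm_scaleR)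
    have "D ?z = 1 / 2 - norm ((1 / r) *\<^sub>R ((1/2) *\<^sub>R a + (1/2) *\<^sub>R b)) powr p"
      unfolding D_def \<open>N ?z = 1\<close> by (simp add: scaleR_add_right mult.commute del: norm_scaleR)
    also have "\<dots> = D (a, b) / N (a, b)"
      unfolding sc D_def using Np by (simp add: diff_divide_distrib)
    finally have "norm (a - b) powr p / N (a, b) \<le> C * (D (a, b) / N (a, b)) + e" using u unfolding sc by simp
    hence "norm (a - b) powr p / N (a, b) * N (a, b) \<le> (C * (D (a, b) / N (a, b)) + e) * N (a, b)"
      using Np by (intro mult_right_mono) auto
    thus ?thesis using Np by (simp add: distrib_right)
  qed
  thus thesis using that[OF C] by (simp add: D_def N_def)
qed

lemma pint_midpoint:
  fixes f g :: "'a \<Rightarrow> 'b::euclidean_space"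
  assumes "memLp M p f" "memLp M p g" "1 < p"
  shows "memLp M p (\<lambda>x. (1/2) *\<^sub>R f x + (1/2) *\<^sub>R g x)"
    "pint M p (\<lambda>x. (1/2) *\<^sub>R f x + (1/2) *\<^sub>R g x) \<le> (pint M p f + pint M p g) / 2"
proof -
  have p: "0 \<le> p" using assms by simp
  show m: "memLp M p (\<lambda>x. (1/2) *\<^sub>R f x + (1/2) *\<^sub>R g x)"
    by (intro memLp_add(1) memLp_scaleR(1) assms p)
  have "pint M p (\<lambda>x. (1/2) *\<^sub>R f x + (1/2) *\<^sub>R g x) \<le> (LINT x|M. (norm (f x) powr p + norm (g x) powr p) / 2)"
    unfolding pint_def using memLp_integrable[OF m] memLp_integrable[OF assms(1)] memLp_integrable[OF assms(2)]
    by (intro integral_mono norm_powr_midpoint assms) auto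
  thus "pint M p (\<lambda>x. (1/2) *\<^sub>R f x + (1/2) *\<^sub>R g x) \<le> (pint M p f + pint M p g) / 2"
    using memLp_integrable[OF assms(1)] memLp_integrable[OF assms(2)] by (simp add: pint_def)
qed

text \<open>A substitute for weak compactness: near-minimisers of the norm over shrinking midpoint-convex
  classes form a Cauchy sequence.\<close>

lemma midpoint_closed_Cauchy:
  fixes P :: "nat \<Rightarrow> ('a \<Rightarrow> 'b::euclidean_space) \<Rightarrow> bool"
  assumes p: "1 < p" and mem: "\<And>k h. P k h \<Longrightarrow> memLp M p h" and bd: "\<And>k h. P k h \<Longrightarrow> pint M p h \<le> K"
    and ne: "\<And>k. \<exists>h. P k h" and dec: "\<And>k k' h. k \<le> k' \<Longrightarrow> P k' h \<Longrightarrow> P k h"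
    and mid: "\<And>k h l. P k h \<Longrightarrow> P k l \<Longrightarrow> P k (\<lambda>x. (1/2) *\<^sub>R h x + (1/2) *\<^sub>R l x)"
  obtains h where "\<And>k. P k (h k)"
    "\<And>e. e > 0 \<Longrightarrow> \<exists>N. \<forall>m\<ge>N. \<forall>n\<ge>N. pint M p (\<lambda>x. h m x - h n x) < e"
proof -
  define F where "F k = Inf {pint M p h |h. P k h}" for k
  have bb: "bdd_below {pint M p h |h. P k h}" for k by (auto intro!: bdd_belowI[of _ 0] pint_nonneg)
  have Fle: "F k \<le> pint M p h" if "P k h" for k h
    unfolding F_def by (rule cInf_lower[OF _ bb]) (use that in blast)
  have "\<exists>h. P k h \<and> pint M p h < F k + inverse (real (Suc k))" for k
  proof -
    have "\<exists>y\<in>{pint M p h |h. P k h}. y < F k + inverse (real (Suc k))"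
      unfolding F_def by (rule cInf_lessD) (use ne in auto)
    thus ?thesis by blast
  qed
  hence "\<exists>h. \<forall>k. P k (h k) \<and> pint M p (h k) < F k + inverse (real (Suc k))" by (intro choice allI)
  then obtain h where h: "\<And>k. P k (h k)" "\<And>k. pint M p (h k) < F k + inverse (real (Suc k))" by blast
  have Fmono: "F k \<le> F k'" if "k \<le> k'" for k k'
    unfolding F_def
  proof (rule cInf_superset_mono[OF _ bb])
    show "{pint M p h |h. P k' h} \<noteq> {}" using ne[of k'] by blast
    show "{pint M p h |h. P k' h} \<subseteq> {pint M p h |h. P k h}" using dec[OF that] by blast
  qed
  have "F k \<le> K" for k using Fle[OF h(1)[of k]] bd[OF h(1)[of k]] by linarith
  moreover have "F 0 \<le> F k" for k by (rule Fmono) simp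
  ultimately have "norm (F k) \<le> \<bar>K\<bar> + \<bar>F 0\<bar>" for k
  proof -
    assume *: "\<And>k. F k \<le> K" "\<And>k. F 0 \<le> F k"
    show ?thesis using *(1)[of k] *(2)[of k] unfolding real_norm_def by linarith
  qed
  hence "Bseq F" by (rule BseqI')
  hence "convergent F" using Fmono by (intro Bseq_mono_convergent) auto
  then obtain L where L: "F \<longlonglongrightarrow> L" by (auto simp: convergent_def)
  have FL: "F k \<le> L" for k by (rule LIMSEQ_le_const[OF L]) (use Fmono in blast)
  have K: "K \<ge> 0" using bd[OF h(1)[of 0]] pint_nonneg[of M p "h 0"] by linarith
  have "\<exists>N. \<forall>m\<ge>N. \<forall>n\<ge>N. pint M p (\<lambda>x. h m x - h n x) < e" if e: "e > 0" for e
  proof -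
    \<comment> \<open>Makes the error term e' * 2 K at most e / 2; the summand 1 covers K =
      0.\<close>
    define e' where "e' = e / (4 * (K + 1))"
    have e': "e' > 0" "e' * (2 * K) \<le> e / 2" using e K by (auto simp: e'_def field_simps)
    obtain C where C: "C \<ge> 0" "\<And>a b :: 'b. norm (a - b) powr p \<le>
      C * ((norm a powr p + norm b powr p) / 2 - norm ((1/2) *\<^sub>R a + (1/2) *\<^sub>R b) powr p) + e' * (norm a powr p + norm b powr p)"
      by (rule norm_powr_uniformly_convex[OF p e'(1)], rule that, assumption+)
    \<comment> \<open>For m, n >= N both elements lie in class N, and so does their midpoint, whose
      \<open>pint\<close> is at least F N. Since each end has \<open>pint\<close> at most L +
      1/(N+1), the midpoint deficit is at most L + 1/(N+1) - F N, which tends to 0.\<close>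
    have "(\<lambda>N. C * (L + inverse (real (Suc N)) - F N)) \<longlonglongrightarrow> C * (L + 0 - L)"
      by (intro tendsto_intros L LIMSEQ_inverse_real_of_nat)
    hence "\<forall>\<^sub>F N in sequentially. C * (L + inverse (real (Suc N)) - F N) < e / 2"
      using e by (intro order_tendstoD(2)[of _ "C * (L + 0 - L)"]) auto
    then obtain N where N: "C * (L + inverse (real (Suc N)) - F N) < e / 2" by (auto simp: eventually_sequentially)
    have "pint M p (\<lambda>x. h m x - h n x) < e" if mn: "m \<ge> N" "n \<ge> N" for m n
    proof -
      have PN: "P N (h m)" "P N (h n)" using dec h(1) mn by blast+
      note mm = mem[OF PN(1)] mem[OF PN(2)] and md = pint_midpoint[OF mem[OF PN(1)] mem[OF PN(2)] p]
      note i = memLp_integrable[OF mm(1)] memLp_integrable[OF mm(2)] memLp_integrable[OF md(1)]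
      have pm: "pint M p (h j) \<le> L + inverse (real (Suc N))" if "j \<ge> N" for j
      proof -
        have "inverse (real (Suc j)) \<le> inverse (real (Suc N))" using that by (intro le_imp_inverse_le) auto
        thus ?thesis using h(2)[of j] FL[of j] by linarith
      qed
      have "pint M p (\<lambda>x. h m x - h n x) \<le> (LINT x|M.
          C * ((norm (h m x) powr p + norm (h n x) powr p) / 2 - norm ((1/2) *\<^sub>R h m x + (1/2) *\<^sub>R h n x) powr p)
          + e' * (norm (h m x) powr p + norm (h n x) powr p))"
        unfolding pint_def using i memLp_integrable[OF memLp_diff(1)[OF mm]] p
        by (intro integral_mono C(2)) auto
      also have "\<dots> = C * ((pint M p (h m) + pint M p (h n)) / 2 - pint M p (\<lambda>x. (1/2) *\<^sub>R h m x + (1/2) *\<^sub>R h n x))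
          + e' * (pint M p (h m) + pint M p (h n))"
        using i unfolding pint_def by simp
      also have "\<dots> \<le> C * (L + inverse (real (Suc N)) - F N) + e' * (2 * K)"
      proof (intro add_mono mult_left_mono)
        show "(pint M p (h m) + pint M p (h n)) / 2 - pint M p (\<lambda>x. (1/2) *\<^sub>R h m x + (1/2) *\<^sub>R h n x)
           \<le> L + inverse (real (Suc N)) - F N"
        proof (rule diff_mono)
          show "(pint M p (h m) + pint M p (h n)) / 2 \<le> L + inverse (real (Suc N))"
            using add_mono[OF pm[OF mn(1)] pm[OF mn(2)]] by simp
        qed (rule Fle[OF mid[OF PN]])
        show "pint M p (h m) + pint M p (h n) \<le> 2 * K" using bd[OF PN(1)] bd[OF PN(2)] by linarith
      qed (use C e' in auto)
      also have "\<dots> < e" using N e'(2) by linarith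
      finally show ?thesis .
    qed
    thus ?thesis by blast
  qed
  thus thesis using that h(1) by blast
qed

section \<open>Caratheodory functions\<close>

text \<open>Evaluating the joint derivative on (1, 0) and (0, h) identifies \<open>A_t\<close> and
  \<open>A_xi\<close>; their continuity is inherited from the operator-valued derivative.\<close>

lemma C1_partial_derivatives:
  fixes A :: "real ^ 'n \<Rightarrow> real \<Rightarrow> real ^ 'n \<Rightarrow> real"
  assumes "C1 (\<lambda>(t, \<xi>). A x t \<xi>)"
  shows "((\<lambda>z. A x (fst z) (snd z)) has_derivative
      (\<lambda>w. A_t A x (fst z) (snd z) * fst w + A_xi A x (fst z) (snd z) \<bullet> snd w)) (at z)"
    and "continuous_on UNIV (\<lambda>z. A_t A x (fst z) (snd z))"
    and "continuous_on UNIV (\<lambda>z. A_xi A x (fst z) (snd z))"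
proof -
  have e: "(\<lambda>(t, \<xi>). A x t \<xi>) = (\<lambda>z. A x (fst z) (snd z))" by (simp add: split_def)
  obtain f' where f': "\<And>z. ((\<lambda>z. A x (fst z) (snd z)) has_derivative blinfun_apply (f' z)) (at z)"
    "continuous_on UNIV f'"
    using assms unfolding C1_def e by blast
  have t: "A_t A x t \<xi> = f' (t, \<xi>) (1, 0)" for t \<xi>
  proof -
    have "((\<lambda>\<tau>. A x (fst (\<tau>, \<xi>)) (snd (\<tau>, \<xi>))) has_derivative (\<lambda>h. f' (t, \<xi>) (h, 0))) (at t)"
      by (rule has_derivative_compose[OF _ f'(1)]) (auto intro!: derivative_eq_intros)
    hence "((\<lambda>\<tau>. A x \<tau> \<xi>) has_real_derivative f' (t, \<xi>) (1, 0)) (at t)"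
      unfolding has_field_derivative_def
    proof (rule has_derivative_eq_rhs[OF back_subst[of "\<lambda>f. (f has_derivative _) _"]])
      show "(\<lambda>h. f' (t, \<xi>) (h, 0)) = (*) (f' (t, \<xi>) (1, 0))"
      proof
        fix h :: real
        have "f' (t, \<xi>) (h *\<^sub>R (1, 0)) = h *\<^sub>R f' (t, \<xi>) (1, 0)" by (rule blinfun.scaleR_right)
        thus "f' (t, \<xi>) (h, 0) = f' (t, \<xi>) (1, 0) * h" by (simp add: mult.commute)
      qed
    qed simp
    thus ?thesis by (simp add: A_t_def DERIV_imp_deriv)
  qed
  have snd_part: "f' (t, \<xi>) (0, h) = A_xi A x t \<xi> \<bullet> h" for t \<xi> h
  proof -
    have d: "((\<lambda>\<zeta>. A x (fst (t, \<zeta>)) (snd (t, \<zeta>))) has_derivative (\<lambda>h. f' (t, \<xi>) (0, h))) (at \<xi>)"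
      by (rule has_derivative_compose[OF _ f'(1)]) (auto intro!: derivative_eq_intros)
    hence d': "((\<lambda>\<zeta>. A x t \<zeta>) has_derivative (\<lambda>h. f' (t, \<xi>) (0, h))) (at \<xi>)" by simp
    have "((\<lambda>\<zeta>. A x t \<zeta>) has_derivative (\<lambda>h. A_xi A x t \<xi> \<bullet> h)) (at \<xi>)"
      unfolding A_xi_def by (rule has_derivative_grad) (use d' in \<open>auto simp: differentiable_def\<close>)
    from has_derivative_unique[OF d' this] show ?thesis by metis
  qed
  have "f' z w = A_t A x (fst z) (snd z) * fst w + A_xi A x (fst z) (snd z) \<bullet> snd w" for z w
  proof -
    have "f' z w = f' z (fst w *\<^sub>R (1, 0) + (0, snd w))" by (rule arg_cong) (simp add: prod_eq_iff)
    also have "\<dots> = fst w *\<^sub>R f' z (1, 0) + f' z (0, snd w)" by (simp only: blinfun.add_right blinfun.scaleR_right)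
    finally show ?thesis using t[of "fst z" "snd z"] snd_part[of "fst z" "snd z"] by simp
  qed
  hence "blinfun_apply (f' z) = (\<lambda>w. A_t A x (fst z) (snd z) * fst w + A_xi A x (fst z) (snd z) \<bullet> snd w)" for z by blast
  thus "((\<lambda>z. A x (fst z) (snd z)) has_derivative
      (\<lambda>w. A_t A x (fst z) (snd z) * fst w + A_xi A x (fst z) (snd z) \<bullet> snd w)) (at z)" using f'(1)[of z] by simp
  have ca: "continuous_on UNIV (\<lambda>z. blinfun_apply (f' z) w)" for w
    by (intro continuous_intros f'(2))
  show "continuous_on UNIV (\<lambda>z. A_t A x (fst z) (snd z))" using ca[of "(1, 0)"] by (simp add: t)
  have "A_xi A x (fst z) (snd z) $ i = f' z (0, axis i 1)" for z i
    using snd_part[of "fst z" "snd z" "axis i 1"] by (simp add: inner_axis)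
  hence "continuous_on UNIV (\<lambda>z. A_xi A x (fst z) (snd z) $ i)" for i using ca[of "(0, axis i 1)"] by simp
  thus "continuous_on UNIV (\<lambda>z. A_xi A x (fst z) (snd z))"
    using continuous_on_vec_lambda[of UNIV "\<lambda>i z. A_xi A x (fst z) (snd z) $ i"] by simp
qed

lemma borel_measurable_AE_limit:
  fixes f :: "nat \<Rightarrow> 'a::euclidean_space \<Rightarrow> 'b::{banach, second_countable_topology}"
  assumes "S \<in> sets lebesgue" "\<And>n. f n \<in> borel_measurable (lebesgue_on S)"
    "AE x in lebesgue_on S. (\<lambda>n. f n x) \<longlonglongrightarrow> g x"
  shows "g \<in> borel_measurable (lebesgue_on S)"
proof (rule borel_measurable_AE_cong_lebesgue_on[OF _ assms(1)])
  show "(\<lambda>x. lim (\<lambda>n. f n x)) \<in> borel_measurable (lebesgue_on S)"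
    using assms(2) by (rule borel_measurable_lim_metric)
  show "AE x in lebesgue_on S. lim (\<lambda>n. f n x) = g x"
    using assms(3) by eventually_elim (rule limI)
qed

text \<open>For a simple function in place of w the composition is pieced together from finitely
  many measurable sections. Continuity in z carries this to the limit, and completeness absorbs the
  points where continuity fails.\<close>

lemma caratheodory_measurable:
  fixes f :: "'a::euclidean_space \<Rightarrow> 'z::{metric_space, second_countable_topology}
      \<Rightarrow> 'b::{banach, second_countable_topology}"
  assumes S: "S \<in> sets lebesgue" and f: "\<And>z. (\<lambda>x. f x z) \<in> borel_measurable (lebesgue_on S)"
    and c: "AE x in lebesgue_on S. continuous_on UNIV (f x)" and w: "w \<in> borel_measurable (lebesgue_on S)"
  shows "(\<lambda>x. f x (w x)) \<in> borel_measurable (lebesgue_on S)"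
proof -
  let ?M = "lebesgue_on S"
  obtain F where F: "\<And>i. simple_function ?M (F i)" "\<And>x. x \<in> space ?M \<Longrightarrow> (\<lambda>i. F i x) \<longlonglongrightarrow> w x"
    using borel_measurable_implies_sequence_metric[OF w] by metis
  show ?thesis
  proof (rule borel_measurable_AE_limit[OF S])
    fix i
    have finite_M: "finite (F i ` space ?M)" using F(1) by (rule simple_functionD(1))
    show "(\<lambda>x. f x (F i x)) \<in> borel_measurable ?M"
    proof (rule measurableI)
      fix B :: "'b set" assume B: "B \<in> sets borel"
      have "(\<lambda>x. f x (F i x)) -` B \<inter> space ?M =
        (\<Union>z\<in>F i ` space ?M. ((\<lambda>x. f x z) -` B \<inter> space ?M) \<inter> (F i -` {z} \<inter> space ?M))" by auto
      also have "\<dots> \<in> sets ?M"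
        by (intro sets.finite_UN finite_M sets.Int measurable_sets[OF f B] simple_functionD(2)[OF F(1)])
      finally show "(\<lambda>x. f x (F i x)) -` B \<inter> space ?M \<in> sets ?M" .
    qed simp
  next
    show "AE x in ?M. (\<lambda>n. f x (F n x)) \<longlonglongrightarrow> f x (w x)"
      using c AE_space
    proof eventually_elim
      case (elim x)
      show ?case using continuous_on_tendsto_compose[OF elim(1) F(2)[OF elim(2)]] by simp
    qed
  qed
qed

section \<open>The energy functional and its minimisers\<close>

text \<open>\<open>growth\<close> is (H1) with its continuous coefficients replaced by constants on
  each range |t| <= R. Condition (H5) stays outside and enters with
  \<open>negative_energy\<close>.\<close>

locale quasilinear = sobolev_domain \<Omega> p for \<Omega> :: "(real ^ 'n) set" and p :: real +
  fixes A :: "real ^ 'n \<Rightarrow> real \<Rightarrow> real ^ 'n \<Rightarrow> real"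
    and \<alpha>1 \<alpha>2 \<eta>1 :: real
  assumes A_measurable: "\<And>t \<xi>. (\<lambda>x. A x t \<xi>) \<in> borel_measurable M"
    and A_C1: "AE x in M. C1 (\<lambda>(t, \<xi>). A x t \<xi>)"
    and growth: "\<And>R. \<exists>C\<ge>0. AE x in M. \<forall>t \<xi>. \<bar>t\<bar> \<le> R \<longrightarrow>
        \<bar>A_t A x t \<xi>\<bar> \<le> C * (1 + norm \<xi> powr p) \<and> norm (A_xi A x t \<xi>) \<le> C * (1 + norm \<xi> powr (p - 1))"
    and \<alpha>1_pos: "\<alpha>1 > 0" and A_lower: "AE x in M. \<forall>t \<xi>. A x t \<xi> \<ge> \<alpha>1 * norm \<xi> powr p"
    and \<eta>1_pos: "\<eta>1 > 0" and A_upper: "AE x in M. \<forall>t \<xi>. A x t \<xi> \<le> \<eta>1 * (A_xi A x t \<xi> \<bullet> \<xi>)"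
    and \<alpha>2_pos: "\<alpha>2 > 0" and A_sign: "AE x in M. \<forall>t \<xi>.
        A_xi A x t \<xi> \<bullet> \<xi> + A_t A x t \<xi> * t \<ge> \<alpha>2 * (A_xi A x t \<xi> \<bullet> \<xi>)"
    and A_monotone: "\<And>\<xi> \<xi>'. \<xi> \<noteq> \<xi>' \<Longrightarrow>
        AE x in M. \<forall>t. (A_xi A x t \<xi> - A_xi A x t \<xi>') \<bullet> (\<xi> - \<xi>') > 0"
begin

lemma A_nonneg: "AE x in M. \<forall>t \<xi>. 0 \<le> A x t \<xi>"
  using A_lower
proof eventually_elim
  case (elim x)
  show ?case
  proof (intro allI)
    fix t :: real and \<xi> :: "real ^ 'n"
    have "0 \<le> \<alpha>1 * norm \<xi> powr p" using \<alpha>1_pos by simp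
    thus "0 \<le> A x t \<xi>" using elim order_trans by blast
  qed
qed

lemma C1_partials: "AE x in M. (\<forall>z. ((\<lambda>z. A x (fst z) (snd z)) has_derivative
      (\<lambda>w. A_t A x (fst z) (snd z) * fst w + A_xi A x (fst z) (snd z) \<bullet> snd w)) (at z)) \<and>
    continuous_on UNIV (\<lambda>z. A_t A x (fst z) (snd z)) \<and> continuous_on UNIV (\<lambda>z. A_xi A x (fst z) (snd z))"
  using A_C1 by eventually_elim (use C1_partial_derivatives in blast)

text \<open>Difference quotients of A are measurable in x, and their limit in the direction (\<tau>,
  \<zeta>) yields \<open>A_t\<close> for (1, 0) and the components of \<open>A_xi\<close> for (0,
  \<zeta>).\<close>

lemma partials_measurable:
  "(\<lambda>x. A_t A x t \<xi>) \<in> borel_measurable M" "(\<lambda>x. A_xi A x t \<xi>) \<in> borel_measurable M"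
proof -
  note [measurable] = A_measurable
  have d: "(\<lambda>x. A_t A x t \<xi> * \<tau> + A_xi A x t \<xi> \<bullet> \<zeta>) \<in> borel_measurable M" for \<tau> \<zeta>
  proof (rule borel_measurable_AE_limit[OF domain_sets])
    fix n
    show "(\<lambda>x. real (Suc n) * (A x (t + 1 / real (Suc n) * \<tau>) (\<xi> + (1 / real (Suc n)) *\<^sub>R \<zeta>) - A x t \<xi>)) \<in> borel_measurable M"
      by measurable
  next
    show "AE x in M. (\<lambda>n. real (Suc n) * (A x (t + 1 / real (Suc n) * \<tau>) (\<xi> + (1 / real (Suc n)) *\<^sub>R \<zeta>) - A x t \<xi>))
        \<longlonglongrightarrow> A_t A x t \<xi> * \<tau> + A_xi A x t \<xi> \<bullet> \<zeta>"
      using C1_partials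
    proof eventually_elim
      case (elim x)
      show ?case using derivative_sequence[OF elim[THEN conjunct1, rule_format], of "(t, \<xi>)" "(\<tau>, \<zeta>)"] by simp
    qed
  qed
  show "(\<lambda>x. A_t A x t \<xi>) \<in> borel_measurable M" using d[of 1 0] by simp
  show "(\<lambda>x. A_xi A x t \<xi>) \<in> borel_measurable M"
    unfolding borel_measurable_euclidean_space[of "\<lambda>x. A_xi A x t \<xi>"] using d[of 0] by simp
qed

lemma A_comp_measurable:
  assumes "u \<in> borel_measurable M" "g \<in> borel_measurable M"
  shows "(\<lambda>x. A x (u x) (g x)) \<in> borel_measurable M"
    "(\<lambda>x. A_t A x (u x) (g x)) \<in> borel_measurable M" "(\<lambda>x. A_xi A x (u x) (g x)) \<in> borel_measurable M"
proof -
  have w: "(\<lambda>x. (u x, g x)) \<in> borel_measurable M" using assms by (rule borel_measurable_Pair)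
  have "AE x in M. continuous_on UNIV (\<lambda>z. A x (fst z) (snd z))"
    using C1_partials
    by eventually_elim (auto intro!: continuous_at_imp_continuous_on has_derivative_continuous)
  from caratheodory_measurable[OF domain_sets A_measurable this w]
  show "(\<lambda>x. A x (u x) (g x)) \<in> borel_measurable M" by simp
  have "AE x in M. continuous_on UNIV (\<lambda>z. A_t A x (fst z) (snd z))" using C1_partials by eventually_elim simp
  from caratheodory_measurable[OF domain_sets partials_measurable(1) this w]
  show "(\<lambda>x. A_t A x (u x) (g x)) \<in> borel_measurable M" by simp
  have "AE x in M. continuous_on UNIV (\<lambda>z. A_xi A x (fst z) (snd z))" using C1_partials by eventually_elim simp
  from caratheodory_measurable[OF domain_sets partials_measurable(2) this w]
  show "(\<lambda>x. A_xi A x (u x) (g x)) \<in> borel_measurable M" by simp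
qed

lemma powr_le_one_plus:
  fixes a :: real
  assumes "0 \<le> a" "0 \<le> r" "r \<le> s"
  shows "a powr r \<le> 1 + a powr s"
proof (cases "a \<le> 1")
  case True
  hence "a powr r \<le> 1 powr r" using assms by (intro powr_mono2) auto
  thus ?thesis by (simp add: add_increasing2)
next
  case False
  hence "a powr r \<le> a powr s" using assms by (intro powr_mono) auto
  thus ?thesis by simp
qed

text \<open>(H3) bounds A by a multiple of a dot \<xi>, so the growth condition on the gradient a
  also controls A from above.\<close>

lemma A_bound: "\<exists>C\<ge>0. AE x in M. \<forall>t \<xi>. \<bar>t\<bar> \<le> R \<longrightarrow> A x t \<xi> \<le> C * (1 + norm \<xi> powr p)"
proof -
  obtain C where C: "C \<ge> 0" "AE x in M. \<forall>t \<xi>. \<bar>t\<bar> \<le> R \<longrightarrow>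
        \<bar>A_t A x t \<xi>\<bar> \<le> C * (1 + norm \<xi> powr p) \<and> norm (A_xi A x t \<xi>) \<le> C * (1 + norm \<xi> powr (p - 1))"
    using growth[of R] by blast
  have "AE x in M. \<forall>t \<xi>. \<bar>t\<bar> \<le> R \<longrightarrow> A x t \<xi> \<le> (2 * \<eta>1 * C) * (1 + norm \<xi> powr p)"
    using C(2) A_upper
  proof eventually_elim
    case (elim x)
    show ?case
    proof (intro allI impI)
      fix t :: real and \<xi> :: "real ^ 'n" assume t: "\<bar>t\<bar> \<le> R"
      have "A_xi A x t \<xi> \<bullet> \<xi> \<le> norm (A_xi A x t \<xi>) * norm \<xi>" by (rule norm_cauchy_schwarz)
      also have "\<dots> \<le> (C * (1 + norm \<xi> powr (p - 1))) * norm \<xi>"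
        using elim(1) t by (intro mult_right_mono) auto
      also have "\<dots> = C * (norm \<xi> + norm \<xi> powr p)"
      proof (cases "\<xi> = 0")
        case False
        hence "norm \<xi> powr p = norm \<xi> powr (p - 1) * norm \<xi>" by (simp add: powr_diff)
        thus ?thesis by (simp add: algebra_simps)
      qed simp
      also have "\<dots> \<le> C * (2 * (1 + norm \<xi> powr p))"
        using powr_le_one_plus[of "norm \<xi>" 1 p] p_gt_1 C(1) powr_ge_zero[of "norm \<xi>" p]
        by (intro mult_left_mono) (auto simp del: powr_ge_zero)
      finally have "A_xi A x t \<xi> \<bullet> \<xi> \<le> C * (2 * (1 + norm \<xi> powr p))" .
      hence "\<eta>1 * (A_xi A x t \<xi> \<bullet> \<xi>) \<le> \<eta>1 * (C * (2 * (1 + norm \<xi> powr p)))" using \<eta>1_pos by simp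
      thus "A x t \<xi> \<le> (2 * \<eta>1 * C) * (1 + norm \<xi> powr p)"
        using elim(2)[rule_format, of t \<xi>] by (simp add: algebra_simps)
    qed
  qed
  thus ?thesis using C(1) \<eta>1_pos by (intro exI[of _ "2 * \<eta>1 * C"]) auto
qed

lemma one_plus_integrable:
  assumes "memLp M p (g :: real ^ 'n \<Rightarrow> real ^ 'n)"
  shows "integrable M (\<lambda>x. C * (1 + norm (g x) powr p))"
proof -
  interpret finite_measure M by (rule finite_M)
  show ?thesis using memLp_integrable[OF assms] by simp
qed

lemma A_comp_integrable:
  assumes "u \<in> borel_measurable M" "AE x in M. \<bar>u x\<bar> \<le> R" "memLp M p g"
  shows "integrable M (\<lambda>x. A x (u x) (g x))"
proof -
  obtain C where C: "C \<ge> 0" "AE x in M. \<forall>t \<xi>. \<bar>t\<bar> \<le> R \<longrightarrow> A x t \<xi> \<le> C * (1 + norm \<xi> powr p)"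
    using A_bound by blast
  show ?thesis
  proof (rule Bochner_Integration.integrable_bound[OF one_plus_integrable[OF assms(3)]])
    show "(\<lambda>x. A x (u x) (g x)) \<in> borel_measurable M"
      by (rule A_comp_measurable(1)[OF assms(1) memLp_measurable[OF assms(3)]])
    show "AE x in M. norm (A x (u x) (g x)) \<le> norm (C * (1 + norm (g x) powr p))"
      using C(2) assms(2) A_nonneg
    proof eventually_elim
      case (elim x)
      have "0 \<le> A x (u x) (g x)" "A x (u x) (g x) \<le> C * (1 + norm (g x) powr p)" using elim by auto
      thus ?case by auto
    qed
  qed
qed

lemma A_Lipschitz: "\<exists>C\<ge>0. AE x in M. \<forall>s t \<xi>. \<bar>s\<bar> \<le> R \<longrightarrow> \<bar>t\<bar> \<le> R \<longrightarrow>
    \<bar>A x s \<xi> - A x t \<xi>\<bar> \<le> C * (1 + norm \<xi> powr p) * \<bar>s - t\<bar>"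
proof -
  obtain C where C: "C \<ge> 0" "AE x in M. \<forall>t \<xi>. \<bar>t\<bar> \<le> R \<longrightarrow>
        \<bar>A_t A x t \<xi>\<bar> \<le> C * (1 + norm \<xi> powr p) \<and> norm (A_xi A x t \<xi>) \<le> C * (1 + norm \<xi> powr (p - 1))"
    using growth[of R] by blast
  have "AE x in M. \<forall>s t \<xi>. \<bar>s\<bar> \<le> R \<longrightarrow> \<bar>t\<bar> \<le> R \<longrightarrow>
    \<bar>A x s \<xi> - A x t \<xi>\<bar> \<le> C * (1 + norm \<xi> powr p) * \<bar>s - t\<bar>"
    using C(2) C1_partials
  proof eventually_elim
    case (elim x)
    show ?case
    proof (intro allI impI)
      fix s t :: real and \<xi> :: "real ^ 'n" assume st: "\<bar>s\<bar> \<le> R" "\<bar>t\<bar> \<le> R"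
      have d: "((\<lambda>\<tau>. A x \<tau> \<xi>) has_real_derivative A_t A x \<tau> \<xi>) (at \<tau>)" for \<tau>
      proof -
        have "((\<lambda>\<tau>. A x (fst (\<tau>, \<xi>)) (snd (\<tau>, \<xi>))) has_derivative
           (\<lambda>h. A_t A x (fst (\<tau>, \<xi>)) (snd (\<tau>, \<xi>)) * fst (h, 0 :: real ^ 'n) + A_xi A x (fst (\<tau>, \<xi>)) (snd (\<tau>, \<xi>)) \<bullet> snd (h, 0 :: real ^ 'n))) (at \<tau>)"
          by (rule has_derivative_compose[of "\<lambda>\<tau>. (\<tau>, \<xi>)" "\<lambda>h. (h, 0 :: real ^ 'n)", OF _ elim(2)[THEN conjunct1, rule_format]])
            (auto intro!: derivative_eq_intros)
        thus ?thesis unfolding has_field_derivative_def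
          by (auto elim!: has_derivative_eq_rhs simp: fun_eq_iff)
      qed
      have "norm (A x s \<xi> - A x t \<xi>) \<le> C * (1 + norm \<xi> powr p) * norm (s - t)"
      proof (rule field_differentiable_bound[of "{-R..R}" "\<lambda>\<tau>. A x \<tau> \<xi>" "\<lambda>\<tau>. A_t A x \<tau> \<xi>"])
        show "norm (A_t A x z \<xi>) \<le> C * (1 + norm \<xi> powr p)" if "z \<in> {- R..R}" for z
          using elim(1) that by (auto simp: abs_le_iff)
      qed (use d st in \<open>auto intro: DERIV_subset simp: abs_le_iff\<close>)
      thus "\<bar>A x s \<xi> - A x t \<xi>\<bar> \<le> C * (1 + norm \<xi> powr p) * \<bar>s - t\<bar>" by simp
    qed
  qed
  thus ?thesis using C(1) by blast
qed

text \<open>The exceptional null set in the monotonicity assumption depends on the pair of gradients, so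
  monotonicity is first obtained on a countable dense set and then extended by continuity.\<close>

lemma A_gradient_monotone: "AE x in M. \<forall>t \<xi> \<xi>'. (A_xi A x t \<xi> - A_xi A x t \<xi>') \<bullet> (\<xi> - \<xi>') \<ge> 0"
proof -
  obtain D :: "(real ^ 'n) set" where D: "countable D" "\<And>y. \<exists>d. (\<forall>j::nat. d j \<in> D) \<and> d \<longlonglongrightarrow> y"
    by (rule countable_dense_sequences, rule that, assumption+)
  have "AE x in M. \<forall>\<xi>\<in>D. \<forall>\<xi>'\<in>D. \<forall>t. (A_xi A x t \<xi> - A_xi A x t \<xi>') \<bullet> (\<xi> - \<xi>') \<ge> 0"
    unfolding AE_ball_countable[OF D(1)]
  proof (intro ballI)
    fix \<xi> \<xi>'
    show "AE x in M. \<forall>t. (A_xi A x t \<xi> - A_xi A x t \<xi>') \<bullet> (\<xi> - \<xi>') \<ge> 0"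
    proof (cases "\<xi> = \<xi>'")
      case False
      from A_monotone[OF this] show ?thesis by eventually_elim (auto simp: less_imp_le)
    qed simp
  qed
  thus ?thesis using C1_partials
  proof eventually_elim
    case (elim x)
    have c: "continuous_on UNIV (\<lambda>z. A_xi A x (fst z) (snd z))" using elim(2) by simp
    show ?case
    proof (intro allI)
      fix t :: real and \<xi> \<xi>' :: "real ^ 'n"
      obtain d where d: "\<And>j. d j \<in> D" "d \<longlonglongrightarrow> \<xi>" using D(2) by blast
      obtain d' where d': "\<And>j. d' j \<in> D" "d' \<longlonglongrightarrow> \<xi>'" using D(2) by blast
      have ax: "(\<lambda>j. A_xi A x t (e j)) \<longlonglongrightarrow> A_xi A x t y" if "e \<longlonglongrightarrow> y" for e y
        using continuous_on_tendsto_compose[OF c tendsto_Pair[OF tendsto_const that, of t]] by simp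
      have "(\<lambda>j. (A_xi A x t (d j) - A_xi A x t (d' j)) \<bullet> (d j - d' j)) \<longlonglongrightarrow> (A_xi A x t \<xi> - A_xi A x t \<xi>') \<bullet> (\<xi> - \<xi>')"
        by (intro tendsto_intros ax d d')
      thus "(A_xi A x t \<xi> - A_xi A x t \<xi>') \<bullet> (\<xi> - \<xi>') \<ge> 0"
        by (rule LIMSEQ_le_const) (use elim(1) d(1) d'(1) in blast)
    qed
  qed
qed

text \<open>A monotone gradient puts A above its tangent plane at the midpoint. Adding the tangent
  inequalities for h and -h cancels the linear term.\<close>

lemma A_midpoint_convex: "AE x in M. \<forall>t \<xi> \<zeta>. A x t ((1/2) *\<^sub>R \<xi> + (1/2) *\<^sub>R \<zeta>) \<le> (A x t \<xi> + A x t \<zeta>) / 2"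
  using A_gradient_monotone C1_partials
proof eventually_elim
  case (elim x)
  show ?case
  proof (intro allI)
    fix t :: real and \<xi> \<zeta> :: "real ^ 'n"
    define m where "m = (1/2) *\<^sub>R \<xi> + (1/2) *\<^sub>R \<zeta>"
    have below: "A x t m + A_xi A x t m \<bullet> h \<le> A x t (m + h)" for h
    proof -
      define \<psi> where "\<psi> s = A x t (m + s *\<^sub>R h)" for s
      have d: "(\<psi> has_real_derivative A_xi A x t (m + s *\<^sub>R h) \<bullet> h) (at s)" for s
      proof -
        have "((\<lambda>s. A x (fst (t, m + s *\<^sub>R h)) (snd (t, m + s *\<^sub>R h))) has_derivative
           (\<lambda>k. A_t A x (fst (t, m + s *\<^sub>R h)) (snd (t, m + s *\<^sub>R h)) * fst (0 :: real, k *\<^sub>R h)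
             + A_xi A x (fst (t, m + s *\<^sub>R h)) (snd (t, m + s *\<^sub>R h)) \<bullet> snd (0 :: real, k *\<^sub>R h))) (at s)"
          by (rule has_derivative_compose[of "\<lambda>s. (t, m + s *\<^sub>R h)" "\<lambda>k. (0, k *\<^sub>R h)", OF _ elim(2)[THEN conjunct1, rule_format]])
            (auto intro!: derivative_eq_intros)
        thus ?thesis unfolding has_field_derivative_def \<psi>_def
          by (auto elim!: has_derivative_eq_rhs simp: fun_eq_iff mult.commute)
      qed
      obtain z where z: "0 < z" "z < 1" "\<psi> 1 - \<psi> 0 = (1 - 0) * (A_xi A x t (m + z *\<^sub>R h) \<bullet> h)"
        using MVT2[of 0 1 \<psi> "\<lambda>s. A_xi A x t (m + s *\<^sub>R h) \<bullet> h"] d by auto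
      have "0 \<le> (A_xi A x t (m + z *\<^sub>R h) - A_xi A x t m) \<bullet> (m + z *\<^sub>R h - m)" using elim(1) by blast
      hence "0 \<le> z * ((A_xi A x t (m + z *\<^sub>R h) - A_xi A x t m) \<bullet> h)" by simp
      hence "A_xi A x t m \<bullet> h \<le> A_xi A x t (m + z *\<^sub>R h) \<bullet> h"
        using z(1) by (simp add: zero_le_mult_iff inner_diff_left)
      thus ?thesis using z(3) by (simp add: \<psi>_def)
    qed
    define h where "h = (1/2) *\<^sub>R (\<xi> - \<zeta>)"
    have half: "(1/2) *\<^sub>R v + (1/2) *\<^sub>R v = v" for v :: "real ^ 'n" by (simp add: scaleR_add_left[symmetric])
    have e: "m + h = \<xi>" "m + - h = \<zeta>"
      using half[of \<xi>] half[of \<zeta>] by (simp_all add: m_def h_def scaleR_diff_right)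
    show "A x t ((1/2) *\<^sub>R \<xi> + (1/2) *\<^sub>R \<zeta>) \<le> (A x t \<xi> + A x t \<zeta>) / 2"
      using below[of h] below[of "- h"] unfolding e m_def[symmetric] by simp
  qed
qed

section \<open>Lower semicontinuity and existence of minimisers\<close>

definition energy :: "(real \<Rightarrow> real) \<Rightarrow> (real ^ 'n \<Rightarrow> real) \<Rightarrow> (real ^ 'n \<Rightarrow> real ^ 'n) \<Rightarrow> real" where
  "energy B u g = (LINT x|M. A x (u x) (g x)) - (LINT x|M. B (u x))"

text \<open>Dyadic convex combinations of the tail from index k on, formed with the same weights for
  functions and gradients so that each pair stays in \<open>W0\<close>. Being generated by
  midpoints, the hull fits both \<open>A_midpoint_convex\<close> and the uniform convexity
  argument.\<close>

inductive midpoint_hull :: "(nat \<Rightarrow> real ^ 'n \<Rightarrow> real) \<Rightarrow> (nat \<Rightarrow> real ^ 'n \<Rightarrow> real ^ 'n) \<Rightarrow> nat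
    \<Rightarrow> (real ^ 'n \<Rightarrow> real) \<Rightarrow> (real ^ 'n \<Rightarrow> real ^ 'n) \<Rightarrow> bool"
  for U G k where
  base: "i \<ge> k \<Longrightarrow> midpoint_hull U G k (U i) (G i)"
| mid: "midpoint_hull U G k v h \<Longrightarrow> midpoint_hull U G k w l \<Longrightarrow>
    midpoint_hull U G k (\<lambda>x. (1/2) * v x + (1/2) * w x) (\<lambda>x. (1/2) *\<^sub>R h x + (1/2) *\<^sub>R l x)"

lemma midpoint_hull_mono: "midpoint_hull U G k' v h \<Longrightarrow> k \<le> k' \<Longrightarrow> midpoint_hull U G k v h"
proof (induction rule: midpoint_hull.induct)
  case (base i)
  thus ?case by (intro midpoint_hull.base) simp
next
  case (mid v h w l)
  thus ?case by (intro midpoint_hull.mid) blast+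
qed

lemma bounded_comp_integrable:
  fixes K :: real
  assumes B: "continuous_on UNIV B" and u: "u \<in> borel_measurable M" "AE x in M. \<bar>u x\<bar> \<le> K"
  shows "integrable M (\<lambda>x. B (u x) :: real)"
proof -
  interpret finite_measure M by (rule finite_M)
  obtain b where b: "\<And>t. \<bar>t\<bar> \<le> K \<Longrightarrow> \<bar>B t\<bar> \<le> b"
    by (rule continuous_bounded_on_interval[OF B], rule that, assumption+)
  have [measurable]: "B \<in> borel_measurable borel" by (rule borel_measurable_continuous_onI[OF B])
  show ?thesis
  proof (rule integrable_const_bound)
    show "AE x in M. norm (B (u x)) \<le> b"
      using u(2) by eventually_elim (use b in simp)
  qed (use u(1) in measurable)
qed

text \<open>Lower semicontinuity along midpoint convex combinations: on the sets where the functions are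
  uniformly close to their limit, the energy density can be frozen at the limit function and is
  then convex in the gradient.\<close>

lemma energy_limit_le:
  assumes W: "\<And>n. W0 \<Omega> p (U n) (G n)" and b: "\<And>n. AE x in M. \<bar>U n x\<bar> \<le> K"
    and u: "u \<in> borel_measurable M" "AE x in M. \<bar>u x\<bar> \<le> K" "AE x in M. (\<lambda>n. U n x) \<longlonglongrightarrow> u x"
    and C: "\<And>n. pint M p (G n) \<le> C" and ev: "\<And>n. n \<ge> n0 \<Longrightarrow> (LINT x|M. A x (U n x) (G n x)) \<le> \<beta>"
    and hull: "\<And>k. midpoint_hull U G k (v k) (h k)" and hg: "(\<lambda>n. pint M p (\<lambda>x. h n x - g x)) \<longlonglongrightarrow> 0" and g: "memLp M p g"
  shows "(LINT x|M. A x (u x) (g x)) \<le> \<beta>"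
proof -
  interpret finite_measure M by (rule finite_M)
  note mem = W0_memLp[OF W] and [measurable] = W0_measurable[OF W] u(1)
  obtain L where L: "L \<ge> 0" "AE x in M. \<forall>s t \<xi>. \<bar>s\<bar> \<le> K \<longrightarrow> \<bar>t\<bar> \<le> K \<longrightarrow>
    \<bar>A x s \<xi> - A x t \<xi>\<bar> \<le> L * (1 + norm \<xi> powr p) * \<bar>s - t\<bar>" using A_Lipschitz by blast
  define C' where "C' = L * (measure M (space M) + C)"
  have C0: "C \<ge> 0" using C[of 0] pint_nonneg[of M p "G 0"] by linarith
  have C': "C' \<ge> 0" using L C0 by (simp add: C'_def)
  have hull_mem: "memLp M p l" if "midpoint_hull U G k w l" for k w l
    using that
  proof (induction rule: midpoint_hull.induct)
    case (base i) show ?case by (rule mem)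
  next
    case (mid v h w l) show ?case by (rule pint_midpoint(1)[OF mid(3,4) p_gt_1])
  qed
  have main: "(LINT x|M. A x (u x) (g x)) \<le> \<beta> + e * C'" if e: "e > 0" for e
  proof -
    \<comment> \<open>On E k every U i with i >= k is within e of u, so a single set serves all
      generators of the hull. Freezing the function at u costs at most e * C' and is done for the
      generators only; midpoints then use convexity in the gradient at the fixed u.\<close>
    define E where "E k = {x \<in> space M. \<forall>i\<ge>k. \<bar>U i x - u x\<bar> \<le> e}" for k
    have E[measurable]: "E k \<in> sets M" for k unfolding E_def by measurable
    have iE: "integrable M (\<lambda>x. indicat_real (E k) x * A x (u x) (l x))" if "memLp M p l" for k l
      using integrable_mult_indicator[OF E A_comp_integrable[OF u(1,2) that]] by simp
    have hullE: "(LINT x|M. indicat_real (E k) x * A x (u x) (l x)) \<le> \<beta> + e * C'"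
      if k: "k \<ge> n0" and "midpoint_hull U G k w l" for k w l
      using that(2)
    proof (induction rule: midpoint_hull.induct)
      case (base i)
      have iA: "integrable M (\<lambda>x. A x (U i x) (G i x))" by (rule A_comp_integrable[OF W0_measurable(1)[OF W] b mem(2)])
      have "(LINT x|M. indicat_real (E k) x * A x (u x) (G i x)) \<le>
          (LINT x|M. A x (U i x) (G i x) + (L * e) * (1 + norm (G i x) powr p))"
      proof (rule integral_mono_AE[OF iE[OF mem(2)] Bochner_Integration.integrable_add[OF iA one_plus_integrable[OF mem(2)]]])
        show "AE x in M. indicat_real (E k) x * A x (u x) (G i x) \<le> A x (U i x) (G i x) + (L * e) * (1 + norm (G i x) powr p)"
          using L(2) b[of i] u(2) A_nonneg
        proof eventually_elim
          case (elim x)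
          have A0: "0 \<le> A x (U i x) (G i x)" using elim(4) by blast
          have n0: "0 \<le> L * (1 + norm (G i x) powr p)" using L(1) by simp
          show ?case
          proof (cases "x \<in> E k")
            case True
            have "\<bar>U i x - u x\<bar> \<le> e" using True base by (auto simp: E_def)
            have "A x (u x) (G i x) - A x (U i x) (G i x) \<le> L * (1 + norm (G i x) powr p) * \<bar>u x - U i x\<bar>"
              using elim(1)[rule_format, of "u x" "U i x" "G i x"] elim(2,3) by linarith
            also have "\<dots> \<le> L * (1 + norm (G i x) powr p) * e"
              using \<open>\<bar>U i x - u x\<bar> \<le> e\<close> n0 by (intro mult_left_mono) (auto simp: abs_minus_commute)
            finally show ?thesis using True by (simp add: algebra_simps)
          next
            case False
            have "0 \<le> (L * e) * (1 + norm (G i x) powr p)" using L(1) e by simp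
            thus ?thesis using False A0 by simp
          qed
        qed
      qed
      also have "\<dots> = (LINT x|M. A x (U i x) (G i x)) + (LINT x|M. (L * e) * (1 + norm (G i x) powr p))"
        by (rule Bochner_Integration.integral_add[OF iA one_plus_integrable[OF mem(2)]])
      also have "(LINT x|M. (L * e) * (1 + norm (G i x) powr p)) = L * e * (measure M (space M) + pint M p (G i))"
        using memLp_integrable[OF mem(2)] by (simp add: pint_def)
      also have "\<dots> \<le> e * C'"
      proof -
        have "L * e * (measure M (space M) + pint M p (G i)) \<le> L * e * (measure M (space M) + C)"
          using C[of i] L(1) e by (intro mult_left_mono) auto
        thus ?thesis by (simp add: C'_def algebra_simps)
      qed
      also have "(LINT x|M. A x (U i x) (G i x)) \<le> \<beta>" using ev base k by simp
      finally show ?case by simp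
    next
      case (mid v h w l)
      note hm = hull_mem[OF mid(1)] hull_mem[OF mid(2)]
      have "(LINT x|M. indicat_real (E k) x * A x (u x) ((1/2) *\<^sub>R h x + (1/2) *\<^sub>R l x)) \<le>
          (LINT x|M. (indicat_real (E k) x * A x (u x) (h x) + indicat_real (E k) x * A x (u x) (l x)) / 2)"
      proof (rule integral_mono_AE)
        show "integrable M (\<lambda>x. indicat_real (E k) x * A x (u x) ((1/2) *\<^sub>R h x + (1/2) *\<^sub>R l x))"
          by (rule iE[OF pint_midpoint(1)[OF hm p_gt_1]])
        show "integrable M (\<lambda>x. (indicat_real (E k) x * A x (u x) (h x) + indicat_real (E k) x * A x (u x) (l x)) / 2)"
          using iE[OF hm(1)] iE[OF hm(2)] by simp
        show "AE x in M. indicat_real (E k) x * A x (u x) ((1/2) *\<^sub>R h x + (1/2) *\<^sub>R l x) \<le>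
            (indicat_real (E k) x * A x (u x) (h x) + indicat_real (E k) x * A x (u x) (l x)) / 2"
          using A_midpoint_convex
        proof eventually_elim
          case (elim x)
          show ?case using elim[rule_format, of "u x" "h x" "l x"] by (cases "x \<in> E k") simp_all
        qed
      qed
      also have "\<dots> = ((LINT x|M. indicat_real (E k) x * A x (u x) (h x)) + (LINT x|M. indicat_real (E k) x * A x (u x) (l x))) / 2"
        using iE[OF hm(1)] iE[OF hm(2)] by simp
      also have "\<dots> \<le> \<beta> + e * C'" using add_mono[OF mid(3,4)] by (simp add: field_simps)
      finally show ?case .
    qed
    obtain q where q: "strict_mono q" "AE x in M. (\<lambda>n. h (q n) x - g x) \<longlonglongrightarrow> 0"
      by (rule pint_tendsto_0_AE_subseq[OF memLp_diff(1)[OF hull_mem[OF hull] g p_bounds(1)] hg p_bounds(2)], rule that, assumption+)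
    \<comment> \<open>Along q the gradients h converge almost everywhere, and Fatou's lemma carries
      the bound to g. The shift by k keeps the indices in the hull of the tail from k.\<close>
    have onE: "(LINT x|M. indicat_real (E k) x * A x (u x) (g x)) \<le> \<beta> + e * C'" if k: "k \<ge> n0" for k
    proof (rule Fatou_real(2)[where f = "\<lambda>n x. indicat_real (E k) x * A x (u x) (h (q (n + k)) x)"])
      have qk: "k \<le> q (n + k)" for n using seq_suble[OF q(1), of "n + k"] by simp
      show "integrable M (\<lambda>x. indicat_real (E k) x * A x (u x) (h (q (n + k)) x))" for n
        by (rule iE[OF hull_mem[OF hull]])
      show "AE x in M. 0 \<le> indicat_real (E k) x * A x (u x) (h (q (n + k)) x)" for n
        using A_nonneg by eventually_elim simp
      show "(LINT x|M. indicat_real (E k) x * A x (u x) (h (q (n + k)) x)) \<le> \<beta> + e * C'" for n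
        by (rule hullE[OF k midpoint_hull_mono[OF hull qk]])
      show "(\<lambda>x. indicat_real (E k) x * A x (u x) (g x)) \<in> borel_measurable M"
        using iE[OF g] by (rule borel_measurable_integrable)
      show "AE x in M. (\<lambda>n. indicat_real (E k) x * A x (u x) (h (q (n + k)) x)) \<longlonglongrightarrow> indicat_real (E k) x * A x (u x) (g x)"
        using q(2) C1_partials
      proof eventually_elim
        case (elim x)
        have "(\<lambda>n. h (q n) x) \<longlonglongrightarrow> g x" using elim(1) by (rule LIM_zero_cancel)
        hence hq: "(\<lambda>n. h (q (n + k)) x) \<longlonglongrightarrow> g x" by (rule LIMSEQ_ignore_initial_segment)
        have "isCont (\<lambda>z. A x (fst z) (snd z)) (u x, g x)" using elim(2) has_derivative_continuous by blast
        from isCont_tendsto_compose[OF this tendsto_Pair[OF tendsto_const hq]]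
        show ?case by (intro tendsto_mult tendsto_const) simp
      qed
    qed
    \<comment> \<open>Since U i converges to u almost everywhere, almost every point lies in E k
      from some k on.\<close>
    have "(\<lambda>k. LINT x|M. indicat_real (E k) x * A x (u x) (g x)) \<longlonglongrightarrow> (LINT x|M. A x (u x) (g x))"
    proof (rule integral_dominated_convergence[where w = "\<lambda>x. A x (u x) (g x)"])
      show iAg: "integrable M (\<lambda>x. A x (u x) (g x))" by (rule A_comp_integrable[OF u(1,2) g])
      thus "(\<lambda>x. A x (u x) (g x)) \<in> borel_measurable M" by (rule borel_measurable_integrable)
      show "(\<lambda>x. indicat_real (E k) x * A x (u x) (g x)) \<in> borel_measurable M" for k
        using iE[OF g] by (rule borel_measurable_integrable)
      show "AE x in M. norm (indicat_real (E k) x * A x (u x) (g x)) \<le> A x (u x) (g x)" for k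
        using A_nonneg by eventually_elim (auto simp: indicator_def)
      show "AE x in M. (\<lambda>k. indicat_real (E k) x * A x (u x) (g x)) \<longlonglongrightarrow> A x (u x) (g x)"
        using u(3) AE_space
      proof eventually_elim
        case (elim x)
        have "\<forall>\<^sub>F i in sequentially. dist (U i x) (u x) < e" using elim(1) e by (rule tendstoD)
        then obtain N where N: "\<And>i. i \<ge> N \<Longrightarrow> \<bar>U i x - u x\<bar> \<le> e"
          by (auto simp: eventually_sequentially dist_real_def intro: less_imp_le)
        have "x \<in> E k" if "k \<ge> N" for k using N that elim(2) by (auto simp: E_def)
        hence "\<forall>\<^sub>F k in sequentially. indicat_real (E k) x * A x (u x) (g x) = A x (u x) (g x)"
          by (auto simp: eventually_sequentially intro!: exI[of _ N])
        thus ?case by (rule tendsto_eventually)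
      qed
    qed
    thus ?thesis by (rule LIMSEQ_le_const2) (use onE in blast)
  qed
  show ?thesis
  proof (rule field_le_epsilon)
    fix e :: real assume e: "e > 0"
    have "(LINT x|M. A x (u x) (g x)) \<le> \<beta> + (e / (C' + 1)) * C'" by (rule main) (use e C' in simp)
    also have "(e / (C' + 1)) * C' \<le> e" using e C' by (simp add: field_simps)
    finally show "(LINT x|M. A x (u x) (g x)) \<le> \<beta> + e" by simp
  qed
qed

text \<open>The direct method with the two components of the limit found separately:
  \<open>Rellich\<close> yields the function u, and near-minimisers of the gradient norm in the
  midpoint hulls yield a strongly convergent sequence of gradients. The constraint makes the source
  term continuous along the sequence.\<close>

lemma energy_minimizer_exists:
  assumes B: "continuous_on UNIV B" and K: "K \<ge> 0"
  obtains u g where "W0 \<Omega> p u g" "AE x in M. \<bar>u x\<bar> \<le> K"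
    "\<And>v h. W0 \<Omega> p v h \<Longrightarrow> AE x in M. \<bar>v x\<bar> \<le> K \<Longrightarrow> energy B u g \<le> energy B v h"
proof -
  interpret finite_measure M by (rule finite_M)
  define adm where "adm v h \<longleftrightarrow> W0 \<Omega> p v h \<and> (AE x in M. \<bar>v x\<bar> \<le> K)" for v h
  obtain b where b: "\<And>t. \<bar>t\<bar> \<le> K \<Longrightarrow> \<bar>B t\<bar> \<le> b"
    by (rule continuous_bounded_on_interval[OF B], rule that, assumption+)
  have iB: "integrable M (\<lambda>x. B (v x))" and Bb: "(LINT x|M. B (v x)) \<le> b * measure M (space M)"
    and iA: "integrable M (\<lambda>x. A x (v x) (h x))" and co: "\<alpha>1 * pint M p h \<le> (LINT x|M. A x (v x) (h x))"
    if "adm v h" for v h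
  proof -
    have W: "W0 \<Omega> p v h" and vK: "AE x in M. \<bar>v x\<bar> \<le> K" using that by (auto simp: adm_def)
    note m = W0_measurable[OF W] and mem = W0_memLp[OF W]
    show iB: "integrable M (\<lambda>x. B (v x))" by (rule bounded_comp_integrable[OF B m(1) vK])
    have "(LINT x|M. B (v x)) \<le> (LINT x|M. b)"
    proof (rule integral_mono_AE[OF iB])
      show "AE x in M. B (v x) \<le> b"
        using vK by eventually_elim (use b abs_le_D1 in blast)
    qed simp
    thus "(LINT x|M. B (v x)) \<le> b * measure M (space M)" by (simp add: mult.commute)
    show iA: "integrable M (\<lambda>x. A x (v x) (h x))" by (rule A_comp_integrable[OF m(1) vK mem(2)])
    have "(LINT x|M. \<alpha>1 * norm (h x) powr p) \<le> (LINT x|M. A x (v x) (h x))"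
      by (rule integral_mono_AE) (use iA memLp_integrable[OF mem(2)] A_lower in \<open>auto elim!: eventually_mono\<close>)
    thus "\<alpha>1 * pint M p h \<le> (LINT x|M. A x (v x) (h x))" by (simp add: pint_def)
  qed
  define V where "V = {energy B v h |v h. adm v h}"
  have lower: "- (b * measure M (space M)) \<le> energy B v h" if "adm v h" for v h
    using Bb[OF that] co[OF that] \<alpha>1_pos mult_nonneg_nonneg[OF less_imp_le[OF \<alpha>1_pos] pint_nonneg[of M p h]]
    unfolding energy_def by linarith
  have bb: "bdd_below V" unfolding V_def by (rule bdd_belowI[of _ "- (b * measure M (space M))"]) (use lower in auto)
  have "adm (\<lambda>x. 0) (\<lambda>x. 0)" using W0_zero K by (simp add: adm_def)
  hence Vne: "V \<noteq> {}" by (auto simp: V_def)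
  define m where "m = Inf V"
  have mle: "m \<le> energy B v h" if "adm v h" for v h
    unfolding m_def by (rule cInf_lower[OF _ bb]) (use that in \<open>auto simp: V_def\<close>)
  have "\<exists>z. adm (fst z) (snd z) \<and> energy B (fst z) (snd z) < m + inverse (real (Suc n))" for n
  proof -
    have "\<exists>y\<in>V. y < m + inverse (real (Suc n))" unfolding m_def by (rule cInf_lessD[OF Vne]) simp
    thus ?thesis by (auto simp: V_def)
  qed
  hence "\<exists>z. \<forall>n. adm (fst (z n)) (snd (z n)) \<and> energy B (fst (z n)) (snd (z n)) < m + inverse (real (Suc n))"
    by (intro choice allI)
  then obtain z where z: "\<And>n. adm (fst (z n)) (snd (z n))" "\<And>n. energy B (fst (z n)) (snd (z n)) < m + inverse (real (Suc n))" by blast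
  \<comment> \<open>From \<alpha>1 * \<open>pint\<close> <= integral of A = energy + integral of B,
    where the energies are below m + 1 and B is at most b.\<close>
  define C where "C = (m + 1 + b * measure M (space M)) / \<alpha>1"
  have zC: "pint M p (snd (z n)) \<le> C" for n
  proof -
    have "inverse (real (Suc n)) \<le> 1" by (simp add: field_simps)
    hence "\<alpha>1 * pint M p (snd (z n)) \<le> m + 1 + b * measure M (space M)"
      using co[OF z(1)[of n]] z(2)[of n] Bb[OF z(1)[of n]] unfolding energy_def by linarith
    thus ?thesis using \<alpha>1_pos by (simp add: C_def field_simps)
  qed
  have zW: "W0 \<Omega> p (fst (z n)) (snd (z n))" "AE x in M. \<bar>fst (z n) x\<bar> \<le> K" for n using z(1)[of n] by (auto simp: adm_def)
  obtain r u where r: "strict_mono (r :: nat \<Rightarrow> nat)" and u: "u \<in> borel_measurable M" "AE x in M. \<bar>u x\<bar> \<le> K"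
    "AE x in M. (\<lambda>n. fst (z (r n)) x) \<longlonglongrightarrow> u x"
    by (rule Rellich[OF zW zC], rule that, assumption+)
  define U where "U n = fst (z (r n))" for n
  define G where "G n = snd (z (r n))" for n
  have UW: "W0 \<Omega> p (U n) (G n)" "AE x in M. \<bar>U n x\<bar> \<le> K" and adU: "adm (U n) (G n)" and GC: "pint M p (G n) \<le> C" for n
    using zW z(1) zC by (auto simp: U_def G_def)
  have Ulim: "AE x in M. (\<lambda>n. U n x) \<longlonglongrightarrow> u x" using u(3) by (simp add: U_def)
  note [measurable] = W0_measurable[OF UW(1)] u(1)
  have mu: "memLp M p u" by (rule memLp_bounded[OF finite_M u(1) _ p_bounds(1), of K]) (use u(2) in simp)
  have UAE: "AE x in M. \<forall>n. \<bar>U n x\<bar> \<le> K" using UW(2) by (simp add: AE_all_countable)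
  have Up: "(\<lambda>n. pint M p (\<lambda>x. U n x - u x)) \<longlonglongrightarrow> 0"
  proof (rule pint_dominated_tendsto_0[where w = "\<lambda>_. 2 * K"])
    show "memLp M p (\<lambda>_. 2 * K)" by (simp add: memLp_def)
    show "AE x in M. norm (U n x - u x) \<le> norm (2 * K)" for n
      using UW(2)[of n] u(2) by eventually_elim (use K in auto)
    show "AE x in M. (\<lambda>n. U n x - u x) \<longlonglongrightarrow> 0" using Ulim by eventually_elim (rule LIM_zero)
  qed (use p_bounds in auto)
  have hull_W: "W0 \<Omega> p v h" if "midpoint_hull U G k v h" for k v h
    using that
  proof (induction rule: midpoint_hull.induct)
    case (mid v h w l) show ?case by (rule W0_lincomb[OF mid(3,4)])
  qed (rule UW)
  have hull_C: "pint M p h \<le> C" if "midpoint_hull U G k v h" for k v h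
    using that
  proof (induction rule: midpoint_hull.induct)
    case (mid v h w l)
    show ?case
      by (rule order_trans[OF pint_midpoint(2)[OF W0_memLp(2)[OF hull_W[OF mid(1)]] W0_memLp(2)[OF hull_W[OF mid(2)]] p_gt_1]])
        (use add_mono[OF mid(3,4)] in simp)
  qed (rule GC)
  \<comment> \<open>Balls around u are midpoint convex, so the hull of a tail is as close to u as
    the tail itself.\<close>
  have hull_u: "pint M p (\<lambda>x. v x - u x) \<le> e" if "midpoint_hull U G k v h" "\<And>n. n \<ge> k \<Longrightarrow> pint M p (\<lambda>x. U n x - u x) \<le> e" for k v h e
    using that(1)
  proof (induction rule: midpoint_hull.induct)
    case (mid v h w l)
    note mm = memLp_diff(1)[OF W0_memLp(1)[OF hull_W[OF mid(1)]] mu p_bounds(1)] memLp_diff(1)[OF W0_memLp(1)[OF hull_W[OF mid(2)]] mu p_bounds(1)]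
    have "pint M p (\<lambda>x. (1/2) * v x + (1/2) * w x - u x) = pint M p (\<lambda>x. (1/2) *\<^sub>R (v x - u x) + (1/2) *\<^sub>R (w x - u x))"
      by (rule arg_cong[of _ _ "pint M p"]) (auto simp: fun_eq_iff field_simps)
    also have "\<dots> \<le> e"
      by (rule order_trans[OF pint_midpoint(2)[OF mm p_gt_1]]) (use add_mono[OF mid(3,4)] in simp)
    finally show ?case .
  qed (use that(2) in simp)
  define P where "P k h \<longleftrightarrow> (\<exists>v. midpoint_hull U G k v h)" for k h
  obtain h where h: "\<And>k. P k (h k)" "\<And>e. e > 0 \<Longrightarrow> \<exists>N. \<forall>m\<ge>N. \<forall>n\<ge>N. pint M p (\<lambda>x. h m x - h n x) < e"
  proof (rule midpoint_closed_Cauchy[OF p_gt_1, of P M C])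
    show "memLp M p h" if "P k h" for k h using that hull_W W0_memLp(2) unfolding P_def by blast
    show "pint M p h \<le> C" if "P k h" for k h using that hull_C unfolding P_def by blast
    show "\<exists>h. P k h" for k unfolding P_def using midpoint_hull.base[of k k U G] by blast
    show "P k h" if "k \<le> k'" "P k' h" for k k' h using that midpoint_hull_mono unfolding P_def by blast
    show "P k (\<lambda>x. (1/2) *\<^sub>R h x + (1/2) *\<^sub>R l x)" if "P k h" "P k l" for k h l
      using that midpoint_hull.mid unfolding P_def by blast
  qed (rule that, assumption+)
  from h(1) have "\<exists>v. \<forall>k. midpoint_hull U G k (v k) (h k)" unfolding P_def by (intro choice allI)
  then obtain v where v: "\<And>k. midpoint_hull U G k (v k) (h k)" by blast
  obtain g where g: "memLp M p g" "(\<lambda>n. pint M p (\<lambda>x. h n x - g x)) \<longlonglongrightarrow> 0"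
    by (rule memLp_complete[OF finite_M W0_memLp(2)[OF hull_W[OF v]] p_gt_1 h(2)], assumption, rule that, assumption+)
  have vu: "(\<lambda>n. pint M p (\<lambda>x. v n x - u x)) \<longlonglongrightarrow> 0"
  proof (rule LIMSEQ_I)
    fix e :: real assume e: "e > 0"
    have "\<forall>\<^sub>F n in sequentially. pint M p (\<lambda>x. U n x - u x) < e / 2" by (rule order_tendstoD(2)[OF Up]) (use e in simp)
    then obtain N where N: "\<And>n. n \<ge> N \<Longrightarrow> pint M p (\<lambda>x. U n x - u x) \<le> e / 2"
      by (auto simp: eventually_sequentially intro: less_imp_le)
    have "norm (pint M p (\<lambda>x. v n x - u x) - 0) < e" if "n \<ge> N" for n
    proof -
      have "pint M p (\<lambda>x. v n x - u x) \<le> e / 2" by (rule hull_u[OF v]) (use N that in simp)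
      thus ?thesis using e pint_nonneg[of M p "\<lambda>x. v n x - u x"] by simp
    qed
    thus "\<exists>no. \<forall>n\<ge>no. norm (pint M p (\<lambda>x. v n x - u x) - 0) < e" by blast
  qed
  \<comment> \<open>The hull elements v n tend to u and their gradients h n tend to g; closedness of
    \<open>W0\<close> ties the two separately found limits together.\<close>
  have Wug: "W0 \<Omega> p u g" by (rule W0_limit[OF hull_W[OF v] mu g(1) vu g(2)])
  have "(\<lambda>n. LINT x|M. B (U n x)) \<longlonglongrightarrow> (LINT x|M. B (u x))"
  proof (rule integral_dominated_convergence[where w = "\<lambda>_. b"])
    have [measurable]: "B \<in> borel_measurable borel" by (rule borel_measurable_continuous_onI[OF B])
    show "(\<lambda>x. B (u x)) \<in> borel_measurable M" "(\<lambda>x. B (U n x)) \<in> borel_measurable M" for n by measurable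
    show "AE x in M. (\<lambda>n. B (U n x)) \<longlonglongrightarrow> B (u x)"
      using Ulim by eventually_elim (use continuous_on_tendsto_compose[OF B] in simp)
    show "AE x in M. norm (B (U n x)) \<le> b" for n
      using UW(2)[of n] by eventually_elim (use b in simp)
  qed simp
  hence Blim: "(\<lambda>n. LINT x|M. B (U n x)) \<longlonglongrightarrow> (LINT x|M. B (u x))" .
  \<comment> \<open>The integrals of B converge, so those of A along the minimising sequence are
    eventually at most m plus the limiting integral of B plus e; \<open>energy_limit_le\<close>
    transfers this bound to (u, g).\<close>
  have min: "energy B u g \<le> m"
  proof (rule field_le_epsilon)
    fix e :: real assume e: "e > 0"
    have "(\<lambda>n. m + inverse (real (Suc n)) + (LINT x|M. B (U n x))) \<longlonglongrightarrow> m + 0 + (LINT x|M. B (u x))"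
      by (intro tendsto_intros LIMSEQ_inverse_real_of_nat Blim)
    hence "\<forall>\<^sub>F n in sequentially. m + inverse (real (Suc n)) + (LINT x|M. B (U n x)) < m + (LINT x|M. B (u x)) + e"
      using e by (intro order_tendstoD(2)[of _ "m + 0 + (LINT x|M. B (u x))"]) auto
    then obtain N where N: "\<And>n. n \<ge> N \<Longrightarrow> m + inverse (real (Suc n)) + (LINT x|M. B (U n x)) < m + (LINT x|M. B (u x)) + e"
      by (auto simp: eventually_sequentially)
    have "(LINT x|M. A x (u x) (g x)) \<le> m + (LINT x|M. B (u x)) + e"
    proof (rule energy_limit_le[OF UW u(1,2) Ulim GC _ v g(2,1)])
      fix n assume n: "n \<ge> N"
      have "inverse (real (Suc (r n))) \<le> inverse (real (Suc n))"
        using seq_suble[OF r, of n] by (intro le_imp_inverse_le) auto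
      thus "(LINT x|M. A x (U n x) (G n x)) \<le> m + (LINT x|M. B (u x)) + e"
        using z(2)[of "r n"] N[OF n] unfolding energy_def U_def[symmetric] G_def[symmetric] by linarith
    qed
    thus "energy B u g \<le> m + e" by (simp add: energy_def)
  qed
  show thesis
  proof (rule that[OF Wug u(2)])
    fix v h assume "W0 \<Omega> p v h" "AE x in M. \<bar>v x\<bar> \<le> K"
    thus "energy B u g \<le> energy B v h" using mle[of v h] min by (simp add: adm_def)
  qed
qed

end

section \<open>First variation\<close>

context quasilinear
begin

definition variation :: "(real \<Rightarrow> real) \<Rightarrow> (real ^ 'n \<Rightarrow> real) \<Rightarrow> (real ^ 'n \<Rightarrow> real ^ 'n)
    \<Rightarrow> (real ^ 'n \<Rightarrow> real) \<Rightarrow> (real ^ 'n \<Rightarrow> real ^ 'n) \<Rightarrow> real" where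
  "variation b u g v h = (LINT x|M. A_xi A x (u x) (g x) \<bullet> h x) + (LINT x|M. A_t A x (u x) (g x) * v x)
     - (LINT x|M. b (u x) * v x)"

text \<open>Bounds both summands of the derivative of s |-> A x (t + s \<tau>) (\<xi> + s \<zeta>)
  on [0, 1] independently of s, which dominates all difference quotients at once. The bound on
  \<tau> is essential, since \<open>A_t\<close> alone already uses up the p-th power of the
  gradient.\<close>

definition segment_bound :: "real \<Rightarrow> real \<Rightarrow> real \<Rightarrow> real ^ 'n \<Rightarrow> bool" where
  "segment_bound C K R x \<longleftrightarrow> (\<forall>t \<xi> \<tau> \<zeta> s. \<bar>t\<bar> \<le> K \<longrightarrow> \<bar>\<tau>\<bar> \<le> R \<longrightarrow> 0 \<le> s \<longrightarrow> s \<le> 1 \<longrightarrow>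
      \<bar>A_t A x (t + s * \<tau>) (\<xi> + s *\<^sub>R \<zeta>) * \<tau>\<bar> \<le> C * (1 + (norm \<xi> + norm \<zeta>) powr p) \<and>
      \<bar>A_xi A x (t + s * \<tau>) (\<xi> + s *\<^sub>R \<zeta>) \<bullet> \<zeta>\<bar> \<le> C * (1 + (norm \<xi> + norm \<zeta>) powr p))"

lemma A_bound_along_segment:
  fixes K R :: real
  obtains C where "C \<ge> 0" "AE x in M. segment_bound C K R x"
proof -
  obtain C where C: "C \<ge> 0" "AE x in M. \<forall>t \<xi>. \<bar>t\<bar> \<le> K + R \<longrightarrow>
        \<bar>A_t A x t \<xi>\<bar> \<le> C * (1 + norm \<xi> powr p) \<and> norm (A_xi A x t \<xi>) \<le> C * (1 + norm \<xi> powr (p - 1))"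
    using growth[of "K + R"] by blast
  \<comment> \<open>The part |R| covers the product with \<tau>; the 2 comes from (1 + S^(p-1)) S <=
    2 (1 + S^p) in the gradient term.\<close>
  define D where "D = C * (2 + \<bar>R\<bar>)"
  have D: "D \<ge> 0" using C by (simp add: D_def)
  have "AE x in M. segment_bound D K R x"
    using C(2)
  proof eventually_elim
    case (elim x)
    show ?case
      unfolding segment_bound_def
    proof (intro allI impI)
      fix t \<tau> s :: real and \<xi> \<zeta> :: "real ^ 'n"
      assume a: "\<bar>t\<bar> \<le> K" "\<bar>\<tau>\<bar> \<le> R" "0 \<le> s" "s \<le> 1"
      define S where "S = norm \<xi> + norm \<zeta>"
      have S: "S \<ge> 0" "norm \<zeta> \<le> S" by (simp_all add: S_def)
      have "\<bar>s * \<tau>\<bar> \<le> \<bar>\<tau>\<bar>" using a(3,4) by (simp add: abs_mult mult_left_le_one_le)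
      hence tb: "\<bar>t + s * \<tau>\<bar> \<le> K + R" using a(1,2) by linarith
      have "norm (s *\<^sub>R \<zeta>) \<le> norm \<zeta>" using a(3,4) by (simp add: mult_left_le_one_le)
      hence xb: "norm (\<xi> + s *\<^sub>R \<zeta>) \<le> S" using norm_triangle_ineq[of \<xi> "s *\<^sub>R \<zeta>"] unfolding S_def by linarith
      have pS: "0 \<le> S powr p" by simp
      have 1: "\<bar>A_t A x (t + s * \<tau>) (\<xi> + s *\<^sub>R \<zeta>)\<bar> \<le> C * (1 + S powr p)"
      proof -
        have "\<bar>A_t A x (t + s * \<tau>) (\<xi> + s *\<^sub>R \<zeta>)\<bar> \<le> C * (1 + norm (\<xi> + s *\<^sub>R \<zeta>) powr p)" using elim tb by blast
        also have "\<dots> \<le> C * (1 + S powr p)" using C(1) xb p_bounds by (intro mult_left_mono add_left_mono powr_mono2) auto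
        finally show ?thesis .
      qed
      have 2: "norm (A_xi A x (t + s * \<tau>) (\<xi> + s *\<^sub>R \<zeta>)) \<le> C * (1 + S powr (p - 1))"
      proof -
        have "norm (A_xi A x (t + s * \<tau>) (\<xi> + s *\<^sub>R \<zeta>)) \<le> C * (1 + norm (\<xi> + s *\<^sub>R \<zeta>) powr (p - 1))" using elim tb by blast
        also have "\<dots> \<le> C * (1 + S powr (p - 1))" using C(1) xb p_gt_1 by (intro mult_left_mono add_left_mono powr_mono2) auto
        finally show ?thesis .
      qed
      have n: "C * (1 + S powr p) \<ge> 0" using C(1) pS by simp
      have "\<bar>A_t A x (t + s * \<tau>) (\<xi> + s *\<^sub>R \<zeta>) * \<tau>\<bar> \<le> (C * (1 + S powr p)) * \<bar>R\<bar>"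
        unfolding abs_mult using 1 a(2) n by (intro mult_mono) auto
      also have "\<dots> \<le> D * (1 + S powr p)"
      proof -
        have "D * (1 + S powr p) - (C * (1 + S powr p)) * \<bar>R\<bar> = 2 * (C * (1 + S powr p))" by (simp add: D_def algebra_simps)
        thus ?thesis using n by linarith
      qed
      finally have A: "\<bar>A_t A x (t + s * \<tau>) (\<xi> + s *\<^sub>R \<zeta>) * \<tau>\<bar> \<le> D * (1 + S powr p)" .
      have "S powr (p - 1) * S = S powr p"
        using S(1) by (cases "S = 0") (auto simp: powr_diff)
      moreover have "S \<le> 1 + S powr p" using powr_le_one_plus[of S 1 p] S(1) p_gt_1 by simp
      ultimately have q: "(1 + S powr (p - 1)) * S \<le> 2 * (1 + S powr p)"
      proof -
        assume e: "S powr (p - 1) * S = S powr p" and "S \<le> 1 + S powr p"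
        have "(1 + S powr (p - 1)) * S = S + S powr p" by (simp add: distrib_right e)
        also have "\<dots> \<le> (1 + S powr p) + (1 + S powr p)" using \<open>S \<le> 1 + S powr p\<close> by (intro add_mono) auto
        finally show ?thesis by simp
      qed
      have "\<bar>A_xi A x (t + s * \<tau>) (\<xi> + s *\<^sub>R \<zeta>) \<bullet> \<zeta>\<bar> \<le> norm (A_xi A x (t + s * \<tau>) (\<xi> + s *\<^sub>R \<zeta>)) * norm \<zeta>"
        by (rule Cauchy_Schwarz_ineq2)
      also have "\<dots> \<le> (C * (1 + S powr (p - 1))) * S" using 2 S C(1) by (intro mult_mono) auto
      also have "\<dots> \<le> C * (2 * (1 + S powr p))" using mult_left_mono[OF q C(1)] by (simp add: mult.assoc)
      also have "\<dots> \<le> D * (1 + S powr p)"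
      proof -
        have "D * (1 + S powr p) - C * (2 * (1 + S powr p)) = \<bar>R\<bar> * (C * (1 + S powr p))" by (simp add: D_def algebra_simps)
        moreover have "0 \<le> \<bar>R\<bar> * (C * (1 + S powr p))" using n by simp
        ultimately show ?thesis by linarith
      qed
      finally show "\<bar>A_t A x (t + s * \<tau>) (\<xi> + s *\<^sub>R \<zeta>) * \<tau>\<bar> \<le> D * (1 + (norm \<xi> + norm \<zeta>) powr p) \<and>
          \<bar>A_xi A x (t + s * \<tau>) (\<xi> + s *\<^sub>R \<zeta>) \<bullet> \<zeta>\<bar> \<le> D * (1 + (norm \<xi> + norm \<zeta>) powr p)"
        using A unfolding S_def by blast
    qed
  qed
  thus thesis using that[OF D] by blast
qed

lemma sum_norm_integrable:
  assumes "memLp M p (g :: real ^ 'n \<Rightarrow> real ^ 'n)" "memLp M p (h :: real ^ 'n \<Rightarrow> real ^ 'n)"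
  shows "integrable M (\<lambda>x. C * (1 + (norm (g x) + norm (h x)) powr p))"
proof -
  interpret finite_measure M by (rule finite_M)
  have n: "memLp M p (\<lambda>x. norm (f x))" if "memLp M p f" for f :: "real ^ 'n \<Rightarrow> real ^ 'n"
    using that by (auto simp: memLp_def)
  have "integrable M (\<lambda>x. norm (norm (g x) + norm (h x)) powr p)"
    by (rule memLp_integrable[OF memLp_add(1)[OF n[OF assms(1)] n[OF assms(2)] p_bounds(1)]])
  thus ?thesis by simp
qed

lemma variation_integrable:
  assumes u: "W0 \<Omega> p u g" "AE x in M. \<bar>u x\<bar> \<le> K" and v: "W0 \<Omega> p v h" "AE x in M. \<bar>v x\<bar> \<le> R"
  shows "integrable M (\<lambda>x. A_xi A x (u x) (g x) \<bullet> h x)" "integrable M (\<lambda>x. A_t A x (u x) (g x) * v x)"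
proof -
  note m = W0_measurable[OF u(1)] W0_measurable[OF v(1)] and mem = W0_memLp[OF u(1)] W0_memLp[OF v(1)]
  note [measurable] = m A_comp_measurable[OF m(1,2)]
  obtain C where C: "C \<ge> 0" "AE x in M. segment_bound C K R x"
    by (rule A_bound_along_segment, rule that, assumption+)
  have bd: "AE x in M. \<bar>A_t A x (u x) (g x) * v x\<bar> \<le> C * (1 + (norm (g x) + norm (h x)) powr p) \<and>
      \<bar>A_xi A x (u x) (g x) \<bullet> h x\<bar> \<le> C * (1 + (norm (g x) + norm (h x)) powr p)"
    using C(2) u(2) v(2)
  proof eventually_elim
    case (elim x)
    show ?case using elim(1)[unfolded segment_bound_def, rule_format, of "u x" "v x" 0 "g x" "h x"] elim(2,3) by simp
  qed
  have bd1: "AE x in M. norm (A_t A x (u x) (g x) * v x) \<le> norm (C * (1 + (norm (g x) + norm (h x)) powr p))"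
    using bd by eventually_elim (unfold real_norm_def, rule order_trans[OF _ abs_ge_self], blast)
  have bd2: "AE x in M. norm (A_xi A x (u x) (g x) \<bullet> h x) \<le> norm (C * (1 + (norm (g x) + norm (h x)) powr p))"
    using bd by eventually_elim (unfold real_norm_def, rule order_trans[OF _ abs_ge_self], blast)
  show "integrable M (\<lambda>x. A_xi A x (u x) (g x) \<bullet> h x)"
    by (rule Bochner_Integration.integrable_bound[OF sum_norm_integrable[OF mem(2,4), of C]])
      (use bd2 in simp_all)
  show "integrable M (\<lambda>x. A_t A x (u x) (g x) * v x)"
    by (rule Bochner_Integration.integrable_bound[OF sum_norm_integrable[OF mem(2,4), of C]])
      (use bd1 in simp_all)
qed

text \<open>Dominated convergence: the derivative along the segment bounds every difference
  quotient, and its two summands account for the factor 2 in the dominating function.\<close>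

lemma principal_part_variation:
  assumes u: "W0 \<Omega> p u g" "AE x in M. \<bar>u x\<bar> \<le> K" and v: "W0 \<Omega> p v h" "AE x in M. \<bar>v x\<bar> \<le> R" and R: "R \<ge> 0"
  shows "(\<lambda>n. real (Suc n) * ((LINT x|M. A x (u x + (1 / real (Suc n)) * v x) (g x + (1 / real (Suc n)) *\<^sub>R h x))
      - (LINT x|M. A x (u x) (g x)))) \<longlonglongrightarrow> (LINT x|M. A_xi A x (u x) (g x) \<bullet> h x) + (LINT x|M. A_t A x (u x) (g x) * v x)"
proof -
  note m = W0_measurable[OF u(1)] W0_measurable[OF v(1)] and mem = W0_memLp[OF u(1)] W0_memLp[OF v(1)]
  note [measurable] = m A_comp_measurable[OF m(1,2)]
  define \<epsilon> where "\<epsilon> n = 1 / real (Suc n)" for n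
  have \<epsilon>: "0 < \<epsilon> n" "\<epsilon> n \<le> 1" "real (Suc n) * \<epsilon> n = 1" for n by (auto simp: \<epsilon>_def)
  define F where "F n x = real (Suc n) * (A x (u x + \<epsilon> n * v x) (g x + \<epsilon> n *\<^sub>R h x) - A x (u x) (g x))" for n x
  note W = W0_add[OF u(1) v(1)]
  have iA: "integrable M (\<lambda>x. A x (u x) (g x))" by (rule A_comp_integrable[OF m(1) u(2) mem(2)])
  have iAn: "integrable M (\<lambda>x. A x (u x + \<epsilon> n * v x) (g x + \<epsilon> n *\<^sub>R h x))" for n
  proof (rule A_comp_integrable[where R = "K + R", OF W0_measurable(1)[OF W] _ W0_memLp(2)[OF W]])
    show "AE x in M. \<bar>u x + \<epsilon> n * v x\<bar> \<le> K + R"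
      using u(2) v(2)
    proof eventually_elim
      case (elim x)
      have "\<bar>\<epsilon> n * v x\<bar> \<le> \<bar>v x\<bar>" using \<epsilon>[of n] by (simp add: abs_mult mult_left_le_one_le)
      thus ?case using elim by linarith
    qed
  qed
  note iv = variation_integrable[OF u v]
  obtain C where C: "C \<ge> 0" "AE x in M. segment_bound C K R x"
    by (rule A_bound_along_segment, rule that, assumption+)
  have "(\<lambda>n. LINT x|M. F n x) \<longlonglongrightarrow> (LINT x|M. A_t A x (u x) (g x) * v x + A_xi A x (u x) (g x) \<bullet> h x)"
  proof (rule integral_dominated_convergence[where w = "\<lambda>x. 2 * C * (1 + (norm (g x) + norm (h x)) powr p)"])
    show "integrable M (\<lambda>x. 2 * C * (1 + (norm (g x) + norm (h x)) powr p))" by (rule sum_norm_integrable[OF mem(2,4)])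
    show "F n \<in> borel_measurable M" for n
      unfolding F_def[abs_def] using borel_measurable_integrable[OF iA] borel_measurable_integrable[OF iAn] by simp
    show "(\<lambda>x. A_t A x (u x) (g x) * v x + A_xi A x (u x) (g x) \<bullet> h x) \<in> borel_measurable M" by measurable
    show "AE x in M. (\<lambda>n. F n x) \<longlonglongrightarrow> A_t A x (u x) (g x) * v x + A_xi A x (u x) (g x) \<bullet> h x"
      using C1_partials
    proof eventually_elim
      case (elim x)
      show ?case using derivative_sequence[OF elim[THEN conjunct1, rule_format], of "(u x, g x)" "(v x, h x)"]
        by (simp add: F_def \<epsilon>_def)
    qed
    fix n
    show "AE x in M. norm (F n x) \<le> 2 * C * (1 + (norm (g x) + norm (h x)) powr p)"
      using C1_partials C(2) u(2) v(2)
    proof eventually_elim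
      case (elim x)
      define D where "D = 2 * C * (1 + (norm (g x) + norm (h x)) powr p)"
      define \<psi> where "\<psi> s = A x (u x + s * v x) (g x + s *\<^sub>R h x)" for s
      define \<psi>' where "\<psi>' s = A_t A x (u x + s * v x) (g x + s *\<^sub>R h x) * v x + A_xi A x (u x + s * v x) (g x + s *\<^sub>R h x) \<bullet> h x" for s
      have d: "(\<psi> has_real_derivative \<psi>' s) (at s)" for s
      proof -
        let ?z = "\<lambda>s. (u x + s * v x, g x + s *\<^sub>R h x)"
        have "((\<lambda>s. A x (fst (?z s)) (snd (?z s))) has_derivative
           (\<lambda>k. A_t A x (fst (?z s)) (snd (?z s)) * fst (k * v x, k *\<^sub>R h x)
             + A_xi A x (fst (?z s)) (snd (?z s)) \<bullet> snd (k * v x, k *\<^sub>R h x))) (at s)"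
          by (rule has_derivative_compose[of ?z "\<lambda>k. (k * v x, k *\<^sub>R h x)", OF _ elim(1)[THEN conjunct1, rule_format]])
            (auto intro!: derivative_eq_intros)
        thus ?thesis unfolding has_field_derivative_def \<psi>_def \<psi>'_def
          by (auto elim!: has_derivative_eq_rhs simp: fun_eq_iff algebra_simps)
      qed
      have bd: "\<bar>\<psi>' s\<bar> \<le> D" if "0 \<le> s" "s \<le> 1" for s
      proof -
        have "\<bar>A_t A x (u x + s * v x) (g x + s *\<^sub>R h x) * v x\<bar> \<le> C * (1 + (norm (g x) + norm (h x)) powr p)"
          "\<bar>A_xi A x (u x + s * v x) (g x + s *\<^sub>R h x) \<bullet> h x\<bar> \<le> C * (1 + (norm (g x) + norm (h x)) powr p)"
          using elim(2)[unfolded segment_bound_def, rule_format, of "u x" "v x" s "g x" "h x"] elim(3,4) that by blast+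
        thus ?thesis unfolding \<psi>'_def D_def by linarith
      qed
      have "norm (\<psi> (\<epsilon> n) - \<psi> 0) \<le> D * norm (\<epsilon> n - 0)"
        by (rule field_differentiable_bound[of "{0..1}" \<psi> \<psi>'])
          (use d bd \<epsilon>[of n] in \<open>auto intro: DERIV_subset\<close>)
      hence "real (Suc n) * \<bar>\<psi> (\<epsilon> n) - \<psi> 0\<bar> \<le> real (Suc n) * (D * \<epsilon> n)"
        using \<epsilon>(1)[of n] by (intro mult_left_mono) auto
      also have "\<dots> = D" using \<epsilon>(3)[of n] by (simp add: algebra_simps)
      finally show ?case unfolding F_def \<psi>_def D_def by (simp add: abs_mult)
    qed
  qed
  moreover have "(LINT x|M. F n x) = real (Suc n) * ((LINT x|M. A x (u x + (1 / real (Suc n)) * v x) (g x + (1 / real (Suc n)) *\<^sub>R h x))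
      - (LINT x|M. A x (u x) (g x)))" for n
    unfolding F_def using iA iAn[of n] by (simp add: \<epsilon>_def del: of_nat_Suc)
  ultimately show ?thesis using iv by (simp add: add.commute del: of_nat_Suc)
qed

lemma lower_order_variation:
  fixes B b :: "real \<Rightarrow> real"
  assumes B: "\<And>t. (B has_real_derivative b t) (at t)" and b: "continuous_on UNIV b"
    and u: "u \<in> borel_measurable M" "AE x in M. \<bar>u x\<bar> \<le> K" and v: "v \<in> borel_measurable M" "AE x in M. \<bar>v x\<bar> \<le> R"
  shows "integrable M (\<lambda>x. b (u x) * v x)"
    and "(\<lambda>n. real (Suc n) * ((LINT x|M. B (u x + (1 / real (Suc n)) * v x)) - (LINT x|M. B (u x))))
      \<longlonglongrightarrow> (LINT x|M. b (u x) * v x)"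
proof -
  interpret finite_measure M by (rule finite_M)
  have Bc: "continuous_on UNIV B" using B DERIV_isCont by (auto intro!: continuous_at_imp_continuous_on)
  have [measurable]: "B \<in> borel_measurable borel" "b \<in> borel_measurable borel" using Bc b by (auto intro: borel_measurable_continuous_onI)
  note [measurable] = u(1) v(1)
  obtain c where c0: "c \<ge> 0" and c: "\<And>t. \<bar>t\<bar> \<le> K + R \<Longrightarrow> \<bar>b t\<bar> \<le> c"
    by (rule continuous_bounded_on_interval[OF b], rule that, assumption+)
  have seg: "\<bar>t + s * \<tau>\<bar> \<le> K + R" if "\<bar>t\<bar> \<le> K" "\<bar>\<tau>\<bar> \<le> R" "0 \<le> s" "s \<le> 1" for t \<tau> s :: real
  proof -
    have "\<bar>s * \<tau>\<bar> \<le> \<bar>\<tau>\<bar>" using that by (simp add: abs_mult mult_left_le_one_le)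
    thus ?thesis using that by linarith
  qed
  show "integrable M (\<lambda>x. b (u x) * v x)"
  proof (rule integrable_const_bound)
    show "AE x in M. norm (b (u x) * v x) \<le> c * R"
      using u(2) v(2)
    proof eventually_elim
      case (elim x)
      have "\<bar>b (u x)\<bar> \<le> c" using c[of "u x"] seg[OF elim(1,2), of 0] by simp
      thus ?case using elim by (auto simp: abs_mult intro!: mult_mono)
    qed
  qed measurable
  define \<epsilon> where "\<epsilon> n = 1 / real (Suc n)" for n
  have \<epsilon>: "0 < \<epsilon> n" "\<epsilon> n \<le> 1" "real (Suc n) * \<epsilon> n = 1" for n by (auto simp: \<epsilon>_def)
  have "(\<lambda>n. LINT x|M. real (Suc n) * (B (u x + \<epsilon> n * v x) - B (u x))) \<longlonglongrightarrow> (LINT x|M. b (u x) * v x)"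
  proof (rule integral_dominated_convergence[where w = "\<lambda>_. c * R"])
    show "AE x in M. (\<lambda>n. real (Suc n) * (B (u x + \<epsilon> n * v x) - B (u x))) \<longlonglongrightarrow> b (u x) * v x"
    proof (intro AE_I2)
      fix x
      show "(\<lambda>n. real (Suc n) * (B (u x + \<epsilon> n * v x) - B (u x))) \<longlonglongrightarrow> b (u x) * v x"
        using derivative_sequence[OF B[of "u x", unfolded has_field_derivative_def], of "v x"] by (simp add: \<epsilon>_def)
    qed
    fix n
    show "AE x in M. norm (real (Suc n) * (B (u x + \<epsilon> n * v x) - B (u x))) \<le> c * R"
      using u(2) v(2)
    proof eventually_elim
      case (elim x)
      have uK: "\<bar>u x + \<epsilon> n * v x\<bar> \<le> K + R" "\<bar>u x\<bar> \<le> K + R"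
        using seg[OF elim(1,2), of "\<epsilon> n"] seg[OF elim(1,2), of 0] \<epsilon>[of n] by auto
      have "norm (B (u x + \<epsilon> n * v x) - B (u x)) \<le> c * norm (u x + \<epsilon> n * v x - u x)"
        by (rule field_differentiable_bound[of "{-(K+R)..K+R}" B b])
          (use B c uK in \<open>auto intro: DERIV_subset simp: abs_le_iff\<close>)
      also have "\<dots> = c * (\<epsilon> n * \<bar>v x\<bar>)" using \<epsilon>(1)[of n] by (simp add: abs_mult)
      also have "\<dots> \<le> c * (\<epsilon> n * R)" using \<epsilon>(1)[of n] elim(2) c0 by (intro mult_left_mono) auto
      finally have "real (Suc n) * norm (B (u x + \<epsilon> n * v x) - B (u x)) \<le> real (Suc n) * (c * (\<epsilon> n * R))"
        by (intro mult_left_mono) auto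
      also have "\<dots> = (real (Suc n) * \<epsilon> n) * (c * R)" by (simp add: mult_ac)
      finally show ?case unfolding \<epsilon>(3) by (simp add: abs_mult)
    qed
    show "(\<lambda>x. real (Suc n) * (B (u x + \<epsilon> n * v x) - B (u x))) \<in> borel_measurable M" by measurable
  next
    show "(\<lambda>x. b (u x) * v x) \<in> borel_measurable M" by measurable
  qed simp
  moreover have "(LINT x|M. real (Suc n) * (B (u x + \<epsilon> n * v x) - B (u x))) =
      real (Suc n) * ((LINT x|M. B (u x + (1 / real (Suc n)) * v x)) - (LINT x|M. B (u x)))" for n
  proof -
    have "AE x in M. \<bar>u x + \<epsilon> n * v x\<bar> \<le> K + R" using u(2) v(2) by eventually_elim (use seg \<epsilon>[of n] in auto)
    hence "integrable M (\<lambda>x. B (u x + \<epsilon> n * v x))" by (intro bounded_comp_integrable[OF Bc]) measurable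
    moreover have "integrable M (\<lambda>x. B (u x))" by (rule bounded_comp_integrable[OF Bc u])
    ultimately show ?thesis by (simp add: \<epsilon>_def del: of_nat_Suc)
  qed
  ultimately show "(\<lambda>n. real (Suc n) * ((LINT x|M. B (u x + (1 / real (Suc n)) * v x)) - (LINT x|M. B (u x))))
      \<longlonglongrightarrow> (LINT x|M. b (u x) * v x)" by (simp del: of_nat_Suc)
qed

text \<open>Admissibility is asked only for the steps 1/(n+1) from some index on. This covers inward
  directions while the constraint may be active, and every bounded direction once it is
  inactive.\<close>

lemma variational_inequality:
  fixes B b :: "real \<Rightarrow> real"
  assumes B: "\<And>t. (B has_real_derivative b t) (at t)" and b: "continuous_on UNIV b"
    and u: "W0 \<Omega> p u g" "AE x in M. \<bar>u x\<bar> \<le> K"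
    and min: "\<And>v h. W0 \<Omega> p v h \<Longrightarrow> AE x in M. \<bar>v x\<bar> \<le> K \<Longrightarrow> energy B u g \<le> energy B v h"
    and v: "W0 \<Omega> p v h" "AE x in M. \<bar>v x\<bar> \<le> R" and R: "R \<ge> 0"
    and adm: "\<And>n. n \<ge> N \<Longrightarrow> AE x in M. \<bar>u x + (1 / real (Suc n)) * v x\<bar> \<le> K"
  shows "0 \<le> variation b u g v h"
proof -
  define E where "E n = real (Suc n) * (energy B (\<lambda>x. u x + (1 / real (Suc n)) * v x) (\<lambda>x. g x + (1 / real (Suc n)) *\<^sub>R h x) - energy B u g)" for n
  have "E = (\<lambda>n. real (Suc n) * ((LINT x|M. A x (u x + (1 / real (Suc n)) * v x) (g x + (1 / real (Suc n)) *\<^sub>R h x))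
      - (LINT x|M. A x (u x) (g x)))
      - real (Suc n) * ((LINT x|M. B (u x + (1 / real (Suc n)) * v x)) - (LINT x|M. B (u x))))"
    by (simp add: fun_eq_iff E_def energy_def algebra_simps del: of_nat_Suc)
  hence "E \<longlonglongrightarrow> variation b u g v h"
    using tendsto_diff[OF principal_part_variation[OF u v R]
        lower_order_variation(2)[OF B b W0_measurable(1)[OF u(1)] u(2) W0_measurable(1)[OF v(1)] v(2)]]
    by (simp only: variation_def)
  moreover have "0 \<le> E n" if "n \<ge> N" for n
    unfolding E_def using min[OF W0_add[OF u(1) v(1)] adm[OF that]] by (intro mult_nonneg_nonneg) auto
  ultimately show ?thesis by (intro LIMSEQ_le_const[of E]) auto
qed

lemma variation_uminus: "variation b u g (\<lambda>x. - v x) (\<lambda>x. - h x) = - variation b u g v h"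
  by (simp add: variation_def)

end

section \<open>A priori estimates\<close>

text \<open>Along the levels d (1 - 2^(-j)), which increase to d, induction gives m <= \<mu> r^j.
  The loss 2^(j+1) / d from the shrinking gaps is offset by (r^j)^\<gamma> = 2^(-j), and d is chosen
  so that d r = 2 C \<mu>^\<gamma>, which closes the induction.\<close>

lemma Stampacchia:
  fixes m :: "real \<Rightarrow> real"
  assumes nn: "\<And>k. 0 \<le> m k" and anti: "\<And>h k. k \<le> h \<Longrightarrow> m h \<le> m k"
    and step: "\<And>h k. 0 \<le> k \<Longrightarrow> k < h \<Longrightarrow> (h - k) * m h \<le> C * m k powr (1 + \<gamma>)"
    and C: "C > 0" and \<gamma>: "\<gamma> > 0" and \<mu>: "\<mu> > 0" "m 0 \<le> \<mu>"
  shows "m (2 * C * \<mu> powr \<gamma> * 2 powr (1 / \<gamma>)) = 0"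
proof -
  define d where "d = 2 * C * \<mu> powr \<gamma> * 2 powr (1 / \<gamma>)"
  \<comment> \<open>The ratio for which r^\<gamma> = 1/2, matching the halving of the gaps between
    levels.\<close>
  define r where "r = (2 :: real) powr (- 1 / \<gamma>)"
  have d: "d > 0" using C \<mu> by (simp add: d_def)
  have r: "0 < r" "r < 1" using \<gamma> powr_less_mono[of "- 1 / \<gamma>" 0 2] by (auto simp: r_def)
  have rg: "r powr \<gamma> = 1 / 2" 
  proof -
    have "r powr \<gamma> = 2 powr ((- 1 / \<gamma>) * \<gamma>)" by (simp only: r_def powr_powr)
    also have "(- 1 / \<gamma>) * \<gamma> = - 1" using \<gamma> by simp
    finally show ?thesis by (simp add: powr_minus_divide)
  qed
  have dr: "d * r = 2 * C * \<mu> powr \<gamma>"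
  proof -
    have "2 powr (1 / \<gamma>) * r = 1" by (simp add: r_def powr_add[symmetric])
    thus ?thesis by (simp add: d_def mult.assoc)
  qed
  have main: "m (d * (1 - 1 / 2 ^ j)) \<le> \<mu> * r ^ j" for j
  proof (induction j)
    case (Suc j)
    define k where "k = d * (1 - 1 / 2 ^ j)"
    define h where "h = d * (1 - 1 / 2 ^ Suc j)"
    have hk: "h - k = d / 2 ^ Suc j" by (simp add: h_def k_def field_simps)
    have p2: "(1 :: real) \<le> 2 ^ j" by simp
    have k0: "0 \<le> k" unfolding k_def using d p2 by (intro mult_nonneg_nonneg) auto
    have kh: "k < h" using hk d by (metis diff_gt_0_iff_gt divide_pos_pos zero_less_numeral zero_less_power)
    have "(h - k) * m h \<le> C * m k powr (1 + \<gamma>)" by (rule step[OF k0 kh])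
    also have "\<dots> \<le> C * (\<mu> * r ^ j) powr (1 + \<gamma>)"
      using Suc.IH C \<gamma> nn unfolding k_def by (intro mult_left_mono powr_mono2) auto
    also have "(\<mu> * r ^ j) powr (1 + \<gamma>) = (\<mu> * r ^ j) * (\<mu> powr \<gamma> * (1 / 2 ^ j))"
    proof -
      have "(r ^ j) powr \<gamma> = (r powr \<gamma>) ^ j" using r by (simp add: powr_realpow[symmetric] powr_powr mult.commute)
      hence "(r ^ j) powr \<gamma> = 1 / 2 ^ j" by (simp add: rg power_divide)
      thus ?thesis using \<mu> r by (simp add: powr_add powr_mult)
    qed
    finally have "d / 2 ^ Suc j * m h \<le> C * ((\<mu> * r ^ j) * (\<mu> powr \<gamma> * (1 / 2 ^ j)))" unfolding hk .
    hence "2 ^ Suc j * (d / 2 ^ Suc j * m h) \<le> 2 ^ Suc j * (C * ((\<mu> * r ^ j) * (\<mu> powr \<gamma> * (1 / 2 ^ j))))"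
      by (intro mult_left_mono) auto
    hence "d * m h \<le> (2 * C * \<mu> powr \<gamma>) * (\<mu> * r ^ j)" by (simp add: field_simps)
    also have "\<dots> = d * (\<mu> * r ^ Suc j)" unfolding dr[symmetric] by simp
    finally show ?case using d unfolding h_def by simp
  qed (use \<mu> in simp)
  have "m d \<le> \<mu> * r ^ j" for j
  proof -
    have "d * (1 - 1 / 2 ^ j) \<le> d * 1" using d by (intro mult_left_mono) auto
    thus ?thesis using anti[of "d * (1 - 1 / 2 ^ j)" d] main[of j] by simp
  qed
  moreover have "(\<lambda>j. \<mu> * r ^ j) \<longlonglongrightarrow> \<mu> * 0" by (intro tendsto_intros LIMSEQ_realpow_zero) (use r in auto)
  ultimately have "m d \<le> 0" using LIMSEQ_le_const[of "\<lambda>j. \<mu> * r ^ j" 0 "m d"] by auto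
  thus ?thesis using nn[of d] unfolding d_def by simp
qed

text \<open>Only t = 0 takes an argument: the difference quotient there is at most |h|^(r-1), and r
  > 1.\<close>

lemma DERIV_pos_part_powr:
  fixes r :: real
  assumes "1 < r"
  shows "((\<lambda>t. max 0 t powr r) has_real_derivative r * max 0 t powr (r - 1)) (at t)"
proof -
  consider "t > 0" | "t < 0" | "t = 0" by linarith
  thus ?thesis
  proof cases
    case 1
    have "((\<lambda>t. t powr r) has_real_derivative r * max 0 t powr (r - 1)) (at t)"
      using 1 by (auto intro!: derivative_eq_intros)
    thus ?thesis
      by (rule has_field_derivative_transform_within_open[of _ _ _ "{0<..}"]) (use 1 in auto)
  next
    case 2
    have "((\<lambda>_. 0) has_real_derivative r * max 0 t powr (r - 1)) (at t)" using 2 by simp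
    thus ?thesis
      by (rule has_field_derivative_transform_within_open[of _ _ _ "{..<0}"]) (use 2 in auto)
  next
    case 3
    have "((\<lambda>h. max 0 h powr r / h) \<longlongrightarrow> 0) (at 0)"
    proof (rule Lim_null_comparison)
      have "norm (max 0 h powr r / h) \<le> \<bar>h\<bar> powr (r - 1)" for h :: real
      proof (cases "h > 0")
        case True
        thus ?thesis by (simp add: powr_diff)
      qed simp
      thus "\<forall>\<^sub>F h in at 0. norm (max 0 h powr r / h) \<le> \<bar>h\<bar> powr (r - 1)" by simp
      have "((\<lambda>h::real. \<bar>h\<bar> powr (r - 1)) \<longlongrightarrow> \<bar>0\<bar> powr (r - 1)) (at 0)"
        by (intro tendsto_powr' tendsto_intros) (use assms in auto)
      thus "((\<lambda>h::real. \<bar>h\<bar> powr (r - 1)) \<longlongrightarrow> 0) (at 0)" by simp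
    qed
    thus ?thesis using 3 by (simp add: DERIV_def)
  qed
qed

context quasilinear
begin

text \<open>The factor \<alpha>1 / \<eta>1 is the lower bound for a dot \<xi> obtained from (H2) and
  (H3); \<open>min 1 \<alpha>2\<close> is the share left after adding any fraction of the
  \<open>A_t\<close> term.\<close>

definition coercivity :: real where
  "coercivity = min 1 \<alpha>2 * (\<alpha>1 / \<eta>1)"

lemma coercivity_pos: "coercivity > 0"
  using \<alpha>1_pos \<alpha>2_pos \<eta>1_pos by (simp add: coercivity_def)

text \<open>The right side is affine in \<theta>, so the endpoints decide: \<theta> = 0 leaves a dot
  \<xi>, and \<theta> = 1 is (H4).\<close>

lemma A_coercive: "AE x in M. \<forall>t \<xi> \<theta>. 0 \<le> \<theta> \<longrightarrow> \<theta> \<le> 1 \<longrightarrow>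
    coercivity * norm \<xi> powr p \<le> A_xi A x t \<xi> \<bullet> \<xi> + \<theta> * (A_t A x t \<xi> * t)"
  using A_lower A_upper A_sign
proof eventually_elim
  case (elim x)
  show ?case
  proof (intro allI impI)
    fix t \<theta> :: real and \<xi> :: "real ^ 'n" assume \<theta>: "0 \<le> \<theta>" "\<theta> \<le> 1"
    define a where "a = A_xi A x t \<xi> \<bullet> \<xi>"
    define T where "T = A_t A x t \<xi> * t"
    have "\<alpha>1 * norm \<xi> powr p \<le> \<eta>1 * a" using elim(1,2) order_trans unfolding a_def by blast
    hence lb: "(\<alpha>1 / \<eta>1) * norm \<xi> powr p \<le> a" using \<eta>1_pos by (simp add: field_simps)
    have "0 \<le> (\<alpha>1 / \<eta>1) * norm \<xi> powr p" using \<alpha>1_pos \<eta>1_pos by simp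
    hence a0: "0 \<le> a" using lb by linarith
    have "a + T \<ge> \<alpha>2 * a" using elim(3) by (simp add: a_def T_def)
    moreover have "min 1 \<alpha>2 * a \<le> \<alpha>2 * a" "min 1 \<alpha>2 * a \<le> 1 * a" using a0 by (intro mult_right_mono; simp)+
    moreover have "\<theta> * T \<ge> T \<or> \<theta> * T \<ge> 0"
    proof (cases "T \<ge> 0")
      case False
      hence "\<theta> * T \<ge> 1 * T" using \<theta> by (intro mult_right_mono_neg) auto
      thus ?thesis by simp
    qed (use \<theta> in simp)
    ultimately have "min 1 \<alpha>2 * a \<le> a + \<theta> * T" by linarith
    moreover have "coercivity * norm \<xi> powr p \<le> min 1 \<alpha>2 * a"
      unfolding coercivity_def mult.assoc using lb \<alpha>2_pos by (intro mult_left_mono) auto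
    ultimately show "coercivity * norm \<xi> powr p \<le> A_xi A x t \<xi> \<bullet> \<xi> + \<theta> * (A_t A x t \<xi> * t)"
      by (simp add: a_def T_def)
  qed
qed

text \<open>With zero gradient, \<open>W0_small_support_gain\<close> on the whole domain bounds the
  L^1 norm by \<mu> / \<rho>^N times itself. The side \<rho> = 2 \<mu> + 1 is at least 1, hence
  \<rho>^N >= \<rho> > 2 \<mu>, and the factor is at most 1/2.\<close>

lemma W0_zero_gradient:
  assumes W: "W0 \<Omega> p v h" and h: "AE x in M. h x = 0"
  shows "AE x in M. v x = 0"
proof -
  interpret finite_measure M by (rule finite_M)
  define \<mu> where "\<mu> = measure M (space M)"
  define \<rho> where "\<rho> = 2 * \<mu> + 1"
  have \<mu>: "\<mu> \<ge> 0" by (simp add: \<mu>_def)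
  have \<rho>: "\<rho> \<ge> 1" using \<mu> by (simp add: \<rho>_def)
  have "\<rho> ^ 1 \<le> \<rho> ^ CARD('n)" using \<rho> by (intro power_increasing) auto
  hence \<rho>N: "\<mu> / \<rho> ^ CARD('n) \<le> 1 / 2" using \<mu> \<rho> by (simp add: divide_le_eq \<rho>_def)
  have iv: "integrable M v" by (rule memLp_L1(1)[OF finite_M W0_memLp(1)[OF W] p_bounds(3)])
  have "(LINT x|M. norm (h x)) = (LINT x|M. 0)"
    by (rule integral_cong_AE) (use W0_measurable(2)[OF W] h in auto)
  hence "(LINT x|M. \<bar>v x\<bar>) \<le> \<mu> / \<rho> ^ CARD('n) * (LINT x|M. \<bar>v x\<bar>)"
    using W0_small_support_gain[OF W sets.top, of \<rho>] \<rho> by (simp add: \<mu>_def)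
  also have "\<dots> \<le> 1 / 2 * (LINT x|M. \<bar>v x\<bar>)" by (rule mult_right_mono[OF \<rho>N]) simp
  finally have "(LINT x|M. \<bar>v x\<bar>) \<le> 0" by simp
  moreover have "0 \<le> (LINT x|M. \<bar>v x\<bar>)" by simp
  ultimately have "(LINT x|M. \<bar>v x\<bar>) = 0" by (rule antisym)
  thus ?thesis using integral_nonneg_eq_0_iff_AE[of M "\<lambda>x. \<bar>v x\<bar>"] iv by auto
qed

text \<open>The direction -\<sigma> (\<sigma> u - k)^+ lowers |u|, so it is admissible even where
  |u| = K. The sign \<sigma> lets one proof treat truncations from above and from below.\<close>

lemma truncation_estimate:
  fixes B b :: "real \<Rightarrow> real"
  assumes B: "\<And>t. (B has_real_derivative b t) (at t)" and b: "continuous_on UNIV b"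
    and u: "W0 \<Omega> p u g" "AE x in M. \<bar>u x\<bar> \<le> K"
    and min: "\<And>v h. W0 \<Omega> p v h \<Longrightarrow> AE x in M. \<bar>v x\<bar> \<le> K \<Longrightarrow> energy B u g \<le> energy B v h"
    and \<sigma>: "\<sigma> = 1 \<or> \<sigma> = -1" and k: "k \<ge> 0"
    and F: "\<And>t. \<bar>t\<bar> \<le> K \<Longrightarrow> 0 < \<sigma> * t \<Longrightarrow> \<sigma> * b t \<le> F"
  shows "coercivity * pint M p (\<lambda>x. (if \<sigma> * u x > k then 1 else 0) *\<^sub>R g x) \<le> F * (LINT x|M. max 0 (\<sigma> * u x - k))"
proof -
  define w where "w x = max 0 (\<sigma> * u x - k)" for x
  define G where "G x = (if \<sigma> * u x > k then 1 else 0 :: real) *\<^sub>R g x" for x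
  have ss: "\<sigma> * \<sigma> = 1" "\<bar>\<sigma>\<bar> = 1" using \<sigma> by auto
  have "W0 \<Omega> p (\<lambda>x. \<sigma> * u x) (\<lambda>x. \<sigma> *\<^sub>R g x)" using W0_lincomb[OF u(1) W0_zero, of \<sigma> 0] by simp
  from W0_pos_part[OF this k] have W1: "W0 \<Omega> p w (\<lambda>x. (if \<sigma> * u x > k then 1 else 0) *\<^sub>R (\<sigma> *\<^sub>R g x))"
    unfolding w_def .
  have Ww: "W0 \<Omega> p (\<lambda>x. - \<sigma> * w x) (\<lambda>x. - G x)"
  proof -
    have "(- \<sigma>) *\<^sub>R ((if \<sigma> * u x > k then 1 else 0) *\<^sub>R (\<sigma> *\<^sub>R g x)) = - G x" for x
      using ss by (simp add: G_def)
    thus ?thesis using W0_lincomb[OF W1 W0_zero, of "- \<sigma>" 0] by simp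
  qed
  have wb: "\<bar>w x\<bar> \<le> \<bar>u x\<bar>" for x using k \<sigma> by (auto simp: w_def abs_if max_def)
  have K0: "AE x in M. \<bar>- \<sigma> * w x\<bar> \<le> \<bar>K\<bar>"
    using u(2) by eventually_elim (use wb ss in \<open>simp add: abs_mult\<close>, meson abs_ge_self order_trans)
  have adm: "AE x in M. \<bar>u x + (1 / real (Suc n)) * (- \<sigma> * w x)\<bar> \<le> K" for n
    using u(2)
  proof eventually_elim
    case (elim x)
    have n: "0 \<le> (1 / real (Suc n)) * w x" "(1 / real (Suc n)) * w x \<le> w x"
    proof -
      have w0: "0 \<le> w x" by (simp add: w_def)
      thus "0 \<le> (1 / real (Suc n)) * w x" by simp
      show "(1 / real (Suc n)) * w x \<le> w x" by (rule mult_left_le_one_le[OF w0]) auto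
    qed
    have "\<bar>u x + (1 / real (Suc n)) * (- \<sigma> * w x)\<bar> \<le> \<bar>u x\<bar>"
    proof (cases "\<sigma> * u x > k")
      case True
      hence w: "w x \<le> \<sigma> * u x" using k by (simp add: w_def)
      from \<sigma> show ?thesis using n w by (auto simp: abs_if)
    qed (simp add: w_def)
    thus ?case using elim by linarith
  qed
  have "0 \<le> variation b u g (\<lambda>x. - \<sigma> * w x) (\<lambda>x. - G x)"
    by (rule variational_inequality[OF B b u min Ww K0 _ adm]) auto
  hence vi: "variation b u g (\<lambda>x. \<sigma> * w x) G \<le> 0"
    using variation_uminus[of b u g "\<lambda>x. \<sigma> * w x" G] by simp
  have Wp: "W0 \<Omega> p (\<lambda>x. \<sigma> * w x) G" using W0_uminus[OF Ww] by simp
  have Kp: "AE x in M. \<bar>\<sigma> * w x\<bar> \<le> \<bar>K\<bar>" using K0 by simp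
  note iv = variation_integrable[OF u Wp Kp]
    and ib = lower_order_variation(1)[OF B b W0_measurable(1)[OF u(1)] u(2) W0_measurable(1)[OF Wp] Kp]
  have iw: "integrable M w" by (rule memLp_L1(1)[OF finite_M W0_memLp(1)[OF W1] p_bounds(3)])
  have "coercivity * pint M p G = (LINT x|M. coercivity * norm (G x) powr p)" by (simp add: pint_def)
  also have "\<dots> \<le> (LINT x|M. A_xi A x (u x) (g x) \<bullet> G x + A_t A x (u x) (g x) * (\<sigma> * w x))"
  proof (rule integral_mono_AE)
    show "integrable M (\<lambda>x. coercivity * norm (G x) powr p)" using memLp_integrable[OF W0_memLp(2)[OF Wp]] by simp
    show "integrable M (\<lambda>x. A_xi A x (u x) (g x) \<bullet> G x + A_t A x (u x) (g x) * (\<sigma> * w x))" using iv by simp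
    show "AE x in M. coercivity * norm (G x) powr p \<le> A_xi A x (u x) (g x) \<bullet> G x + A_t A x (u x) (g x) * (\<sigma> * w x)"
      using A_coercive
    proof eventually_elim
      case (elim x)
      show ?case
      proof (cases "\<sigma> * u x > k")
        case True
        \<comment> \<open>On this set the truncation direction is \<theta> u with 0 <= \<theta> <=
          1, which is where the weight in \<open>A_coercive\<close> comes from.\<close>
        define \<theta> where "\<theta> = (\<sigma> * u x - k) / (\<sigma> * u x)"
        have pos: "\<sigma> * u x > 0" using True k by linarith
        have \<theta>: "0 \<le> \<theta>" "\<theta> \<le> 1" using True k pos by (auto simp: \<theta>_def divide_le_eq)
        have "c \<noteq> 0 \<Longrightarrow> a / c * c = a" for a c :: real by simp
        from this[of "\<sigma> * u x" "\<sigma> * u x - k"] have "\<theta> * (\<sigma> * u x) = w x"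
          using pos True unfolding \<theta>_def w_def by linarith
        hence "\<sigma> * w x = (\<sigma> * \<sigma>) * (\<theta> * u x)" by (simp add: mult_ac)
        hence "\<sigma> * w x = \<theta> * u x" by (simp add: ss)
        moreover have "G x = g x" using True by (simp add: G_def)
        ultimately show ?thesis using elim[rule_format, OF \<theta>, of "g x" "u x"] by (simp add: mult_ac)
      next
        case False
        thus ?thesis using p_bounds by (simp add: G_def w_def)
      qed
    qed
  qed
  also have "\<dots> \<le> (LINT x|M. b (u x) * (\<sigma> * w x))"
    using vi iv unfolding variation_def by simp
  also have "\<dots> \<le> (LINT x|M. F * w x)"
  proof (rule integral_mono_AE[OF ib])
    show "integrable M (\<lambda>x. F * w x)" using iw by simp
    show "AE x in M. b (u x) * (\<sigma> * w x) \<le> F * w x"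
      using u(2)
    proof eventually_elim
      case (elim x)
      show ?case
      proof (cases "\<sigma> * u x > k")
        case True
        hence "(\<sigma> * b (u x)) * w x \<le> F * w x" using k F[OF elim] by (intro mult_right_mono) (auto simp: w_def)
        thus ?thesis by (simp add: mult_ac)
      qed (simp add: w_def)
    qed
  qed
  also have "\<dots> = F * (LINT x|M. w x)" by simp
  finally show ?thesis unfolding G_def w_def .
qed

text \<open>The constant is uniform in w, g and F, as the later choice of K requires. With m the
  measure of {w > k} and y the integral of (w - k)^+, the estimate has the form y <= 4 N \<rho> c m,
  where \<rho> scales like m^(1/N) and c like (\<rho> F)^(1/(p-1)). The resulting power of m exceeds
  1, which is what \<open>Stampacchia\<close> needs.\<close>

lemma sup_bound:
  "\<exists>C>0. \<forall>w g F. W0 \<Omega> p w g \<longrightarrow> F > 0 \<longrightarrow>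
    (\<forall>k\<ge>0. coercivity * pint M p (\<lambda>x. (if w x > k then 1 else 0) *\<^sub>R g x) \<le> F * (LINT x|M. max 0 (w x - k)))
    \<longrightarrow> (AE x in M. w x \<le> C * F powr (1 / (p - 1)))"
proof -
  interpret finite_measure M by (rule finite_M)
  define N where "N = real CARD('n)"
  define \<mu> where "\<mu> = measure M (space M) + 1"
  \<comment> \<open>The conjugate exponent p / (p - 1): one power of \<rho> comes from the gain and
    1 / (p - 1) from the threshold c.\<close>
  define \<beta> where "\<beta> = 1 + 1 / (p - 1)"
  define \<gamma> where "\<gamma> = \<beta> / N"
  define C1 where "C1 = (4 * N) powr \<beta> * 2 powr \<gamma> * coercivity powr (- (1 / (p - 1)))"
  \<comment> \<open>The level in \<open>Stampacchia\<close> is linear in its constant, here C1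
    F^(1/(p-1)), so the power of F factors out.\<close>
  define C where "C = 2 * C1 * \<mu> powr \<gamma> * 2 powr (1 / \<gamma>)"
  have N: "N > 0" by (simp add: N_def)
  have \<mu>: "\<mu> > 0" by (simp add: \<mu>_def add_nonneg_pos)
  have \<beta>: "\<beta> > 0" using p_gt_1 by (simp add: \<beta>_def add_pos_pos)
  have \<gamma>: "\<gamma> > 0" using \<beta> N by (simp add: \<gamma>_def)
  have C1: "C1 > 0" using N coercivity_pos by (simp add: C1_def)
  have C: "C > 0" using C1 \<mu> by (simp add: C_def)
  show ?thesis
  proof (intro exI[of _ C] conjI allI impI C)
    fix w :: "real ^ 'n \<Rightarrow> real" and g F
    assume W: "W0 \<Omega> p w g" and F: "F > 0"
      and "\<forall>k\<ge>0. coercivity * pint M p (\<lambda>x. (if w x > k then 1 else 0) *\<^sub>R g x) \<le> F * (LINT x|M. max 0 (w x - k))"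
    hence est: "coercivity * pint M p (\<lambda>x. (if w x > k then 1 else 0) *\<^sub>R g x) \<le> F * (LINT x|M. max 0 (w x - k))"
      if "k \<ge> 0" for k using that by blast
    note [measurable] = W0_measurable[OF W]
    define S where "S k = {x \<in> space M. w x > k}" for k
    have S[measurable]: "S k \<in> sets M" for k unfolding S_def by measurable
    define m where "m k = measure M (S k)" for k
    define y where "y k = (LINT x|M. max 0 (w x - k))" for k
    define Kc where "Kc = C1 * F powr (1 / (p - 1))"
    have Kc: "Kc > 0" using C1 F by (simp add: Kc_def)
    have iy: "integrable M (\<lambda>x. max 0 (w x - k))" if "k \<ge> 0" for k
      by (rule memLp_L1(1)[OF finite_M W0_memLp(1)[OF W0_pos_part[OF W that]] p_bounds(3)])
    have key: "y k \<le> Kc * m k powr (1 + \<gamma>)" if k: "k \<ge> 0" for k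
    proof -
      define G where "G x = (if w x > k then 1 else 0 :: real) *\<^sub>R g x" for x
      have Wk: "W0 \<Omega> p (\<lambda>x. max 0 (w x - k)) G" unfolding G_def by (rule W0_pos_part[OF W k])
      have y0: "y k \<ge> 0" by (simp add: y_def)
      show ?thesis
      proof (cases "m k = 0")
        \<comment> \<open>Treated apart because the side \<rho> of the cubes must be
          positive.\<close>
        case True
        hence "AE x in M. x \<notin> S k" by (intro AE_not_in) (simp add: m_def null_sets_def emeasure_eq_measure)
        hence "AE x in M. max 0 (w x - k) = 0" using AE_space by eventually_elim (auto simp: S_def)
        hence "y k = (LINT x|M. 0)" unfolding y_def by (intro integral_cong_AE) auto
        thus ?thesis using Kc by simp
      next
        case False
        hence mp: "m k > 0" using measure_nonneg[of M "S k"] unfolding m_def by linarith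
        \<comment> \<open>The side for which \<rho>^N = 2 m k, so that half of y k is
          absorbed.\<close>
        define \<rho> where "\<rho> = (2 * m k) powr (1 / N)"
        have \<rho>: "\<rho> > 0" using mp by (simp add: \<rho>_def)
        have \<rho>N: "\<rho> ^ CARD('n) = 2 * m k"
          using \<rho> mp by (simp add: \<rho>_def powr_realpow[symmetric] powr_powr N_def)
        \<comment> \<open>Determined by the requirement that the gradient term contribute exactly y
          k / 4 when c^(1-p) = 1 / Z. Together with the absorbed half, a quarter of y k is
          left.\<close>
        define Z where "Z = 4 * N * \<rho> * F / coercivity"
        have Z: "Z > 0" using N \<rho> F coercivity_pos by (simp add: Z_def)
        define c where "c = Z powr (1 / (p - 1))"
        have c: "c > 0" using Z by (simp add: c_def)
        have cp: "c powr (1 - p) = 1 / Z"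
        proof -
          have "1 / (p - 1) * (1 - p) = -1" using p_gt_1 by (simp add: field_simps)
          thus ?thesis using Z by (simp add: c_def powr_powr powr_minus_divide)
        qed
        have "(LINT x|M. indicator (S k) x * \<bar>max 0 (w x - k)\<bar>) = y k"
          unfolding y_def by (rule Bochner_Integration.integral_cong) (auto simp: S_def indicator_def)
        hence gain: "y k \<le> N * \<rho> * (LINT x|M. norm (G x)) + m k / \<rho> ^ CARD('n) * y k"
          using W0_small_support_gain[OF Wk S \<rho>, of k] by (simp add: N_def m_def y_def)
        have "(LINT x|M. norm (G x)) = (LINT x|M. indicator (S k) x * norm (G x))"
          by (rule Bochner_Integration.integral_cong) (auto simp: S_def indicator_def G_def)
        also have "\<dots> \<le> c * m k + c powr (1 - p) * pint M p G"
          using memLp_L1(2)[OF finite_M W0_memLp(2)[OF Wk] p_bounds(3) S c] by (simp add: m_def)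
        also have "\<dots> \<le> c * m k + 1 / Z * (F / coercivity * y k)"
        proof -
          have "pint M p G \<le> F / coercivity * y k"
            using est[OF k] coercivity_pos unfolding G_def[symmetric] y_def[symmetric] by (simp add: field_simps)
          thus ?thesis unfolding cp using Z by (intro add_left_mono mult_left_mono) auto
        qed
        finally have "N * \<rho> * (LINT x|M. norm (G x)) \<le> N * \<rho> * (c * m k + 1 / Z * (F / coercivity * y k))"
          using N \<rho> by (intro mult_left_mono) auto
        also have "\<dots> = N * \<rho> * c * m k + y k / 4"
          using N \<rho> F coercivity_pos by (simp add: Z_def field_simps)
        finally have "y k \<le> N * \<rho> * c * m k + y k / 4 + y k / 2"
          using gain mp unfolding \<rho>N by simp
        hence "y k \<le> 4 * N * \<rho> * c * m k" by (simp add: field_simps)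
        also have "4 * N * \<rho> * c = (4 * N * \<rho>) powr \<beta> * (F / coercivity) powr (1 / (p - 1))"
        proof -
          have Ze: "Z = (4 * N * \<rho>) * (F / coercivity)" by (simp add: Z_def)
          have "c = (4 * N * \<rho>) powr (1 / (p - 1)) * (F / coercivity) powr (1 / (p - 1))"
            unfolding c_def Ze using N \<rho> F coercivity_pos by (subst powr_mult) auto
          moreover have "(4 * N * \<rho>) powr \<beta> = 4 * N * \<rho> * (4 * N * \<rho>) powr (1 / (p - 1))"
            using N \<rho> by (simp add: \<beta>_def powr_add)
          ultimately show ?thesis by simp
        qed
        also have "(4 * N * \<rho>) powr \<beta> = (4 * N) powr \<beta> * (2 powr \<gamma> * m k powr \<gamma>)"
          using N \<rho> mp by (simp add: powr_mult \<rho>_def powr_powr \<gamma>_def)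
        also have "(F / coercivity) powr (1 / (p - 1)) = F powr (1 / (p - 1)) * coercivity powr (- (1 / (p - 1)))"
          using F coercivity_pos by (simp add: powr_divide powr_minus_divide)
        also have "(4 * N) powr \<beta> * (2 powr \<gamma> * m k powr \<gamma>) * (F powr (1 / (p - 1)) * coercivity powr (- (1 / (p - 1)))) * m k
            = Kc * m k powr (1 + \<gamma>)"
          using mp by (simp add: Kc_def C1_def powr_add mult_ac)
        finally show ?thesis .
      qed
    qed
    have "m (2 * Kc * \<mu> powr \<gamma> * 2 powr (1 / \<gamma>)) = 0"
    proof (rule Stampacchia[OF _ _ _ Kc \<gamma> \<mu>])
      show "0 \<le> m k" for k by (simp add: m_def)
      show "m h \<le> m k" if "k \<le> h" for h k
        unfolding m_def by (rule finite_measure_mono[OF _ S]) (use that in \<open>auto simp: S_def\<close>)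
      have "m 0 \<le> measure M (space M)" unfolding m_def by (rule bounded_measure)
      thus "m 0 \<le> \<mu>" by (simp add: \<mu>_def)
      fix h k :: real assume k: "0 \<le> k" "k < h"
      \<comment> \<open>Chebyshev's inequality: on {w > h} the function (w - k)^+ is at least h -
        k.\<close>
      have "(h - k) * m h = (LINT x|M. (h - k) * indicator (S h) x)"
        using sets.sets_into_space[OF S[of h]] by (simp add: m_def Int_absorb2)
      also have "\<dots> \<le> y k"
        unfolding y_def
      proof (rule integral_mono[OF _ iy[OF k(1)]])
        show "integrable M (\<lambda>x. (h - k) * indicat_real (S h) x)"
          by (intro integrable_mult_right integrable_real_indicator S) (simp add: emeasure_eq_measure)
        show "(h - k) * indicat_real (S h) x \<le> max 0 (w x - k)" for x
          using k by (auto simp: S_def indicator_def)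
      qed
      also have "\<dots> \<le> Kc * m k powr (1 + \<gamma>)" by (rule key[OF k(1)])
      finally show "(h - k) * m h \<le> Kc * m k powr (1 + \<gamma>)" .
    qed
    moreover have "2 * Kc * \<mu> powr \<gamma> * 2 powr (1 / \<gamma>) = C * F powr (1 / (p - 1))"
      by (simp add: C_def Kc_def mult_ac)
    ultimately have "m (C * F powr (1 / (p - 1))) = 0" by simp
    hence "AE x in M. x \<notin> S (C * F powr (1 / (p - 1)))"
      by (intro AE_not_in) (simp add: m_def null_sets_def emeasure_eq_measure)
    thus "AE x in M. w x \<le> C * F powr (1 / (p - 1))"
      using AE_space by eventually_elim (auto simp: S_def)
  qed
qed

end

section \<open>Solutions of a prescribed sign\<close>

text \<open>The reaction term switched off on the half-line \<sigma> t <= 0, so that a minimiser is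
  pushed to the sign \<sigma>. The outer factor \<sigma> makes the case -1 the odd reflection of the
  case 1.\<close>

definition source :: "real \<Rightarrow> real \<Rightarrow> real \<Rightarrow> real \<Rightarrow> real \<Rightarrow> real" where
  "source lam q s \<sigma> t = \<sigma> * (lam * max 0 (\<sigma> * t) powr (q - 1) + max 0 (\<sigma> * t) powr (s - 1))"

definition source_potential :: "real \<Rightarrow> real \<Rightarrow> real \<Rightarrow> real \<Rightarrow> real \<Rightarrow> real" where
  "source_potential lam q s \<sigma> t = lam / q * max 0 (\<sigma> * t) powr q + max 0 (\<sigma> * t) powr s / s"

lemma DERIV_source_potential:
  assumes "1 < q" "1 < s"
  shows "(source_potential lam q s \<sigma> has_real_derivative source lam q s \<sigma> t) (at t)"
proof -
  have d: "((\<lambda>t. max 0 (\<sigma> * t) powr r) has_real_derivative (r * max 0 (\<sigma> * t) powr (r - 1)) * \<sigma>) (at t)" if "1 < r" for r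
    by (rule DERIV_chain2[OF DERIV_pos_part_powr[OF that]]) (auto intro!: derivative_eq_intros)
  show ?thesis
    unfolding source_potential_def[abs_def]
    by (rule derivative_eq_intros d assms refl | use assms in \<open>simp add: source_def field_simps\<close>)+
qed

lemma continuous_source: "1 < q \<Longrightarrow> 1 < s \<Longrightarrow> continuous_on UNIV (source lam q s \<sigma>)"
  unfolding source_def[abs_def] by (intro continuous_intros continuous_on_powr') auto

lemma source_eq:
  assumes "\<sigma> = 1 \<or> \<sigma> = -1" "0 \<le> \<sigma> * t"
  shows "source lam q s \<sigma> t = lam * (\<bar>t\<bar> powr (q - 2) * t) + \<bar>t\<bar> powr (s - 2) * t"
proof (cases "t = 0")
  case False
  have a: "\<sigma> * t = \<bar>t\<bar>" "\<sigma> * \<bar>t\<bar> = t" using assms by auto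
  have "\<bar>t\<bar> powr (r - 1) = \<bar>t\<bar> powr (r - 2) * \<bar>t\<bar>" for r
    using False powr_add[of "\<bar>t\<bar>" "r - 2" 1] by simp
  hence "source lam q s \<sigma> t = lam * (\<bar>t\<bar> powr (q - 2) * (\<sigma> * \<bar>t\<bar>)) + \<bar>t\<bar> powr (s - 2) * (\<sigma> * \<bar>t\<bar>)"
    by (simp add: source_def a(1) algebra_simps)
  thus ?thesis unfolding a(2) .
qed (simp add: source_def)

lemma source_bound:
  assumes "\<sigma> = 1 \<or> \<sigma> = -1" "\<bar>t\<bar> \<le> K" "1 < q" "1 < s" "lam > 0"
  shows "\<sigma> * source lam q s \<sigma> t \<le> lam * K powr (q - 1) + K powr (s - 1)"
proof -
  have m: "0 \<le> max 0 (\<sigma> * t)" "max 0 (\<sigma> * t) \<le> K" using assms by auto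
  have "\<sigma> * source lam q s \<sigma> t = (\<sigma> * \<sigma>) * (lam * max 0 (\<sigma> * t) powr (q - 1) + max 0 (\<sigma> * t) powr (s - 1))"
    by (simp add: source_def mult.assoc)
  also have "\<dots> = lam * max 0 (\<sigma> * t) powr (q - 1) + max 0 (\<sigma> * t) powr (s - 1)" using assms(1) by auto
  also have "\<dots> \<le> lam * K powr (q - 1) + K powr (s - 1)"
    using m assms by (intro add_mono mult_left_mono powr_mono2) auto
  finally show ?thesis .
qed

context quasilinear
begin

text \<open>On a bump of height at most \<epsilon>, (H5) bounds the principal part by \<eta>2 P
  \<epsilon>^p, while the q-part of the potential already contributes L \<epsilon>^q. For small
  \<epsilon> the lower power wins.\<close>

lemma negative_energy:
  assumes ne: "\<Omega> \<noteq> {}" and exps: "1 < q" "q < p" "1 < s" and lam: "lam > 0" and K: "K > 0" and \<sigma>: "\<sigma> = 1 \<or> \<sigma> = -1"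
    and H5: "\<eta>2 > 0" "\<delta> > 0" "AE x in M. \<forall>t \<xi>. \<bar>t\<bar> \<le> \<delta> \<longrightarrow> A x t \<xi> \<le> \<eta>2 * norm \<xi> powr p"
  obtains v h where "W0 \<Omega> p v h" "AE x in M. \<bar>v x\<bar> \<le> K" "energy (source_potential lam q s \<sigma>) v h < 0"
proof -
  interpret finite_measure M by (rule finite_M)
  obtain c where "c \<in> \<Omega>" using ne by blast
  then obtain a b where ab: "cbox a b \<subseteq> \<Omega>" "c \<in> box a b"
    by (rule open_contains_cbox[OF open_domain]) (rule that)
  define \<phi> where "\<phi> = box_bump a b 0"
  have t: "test_function \<Omega> \<phi>"
    unfolding \<phi>_def by (rule test_function_box_bump[OF subset_trans[OF closure_minimal[OF box_subset_cbox closed_cbox] ab(1)]])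
  have \<phi>b: "0 \<le> \<phi> x" "\<phi> x \<le> 1" for x using box_bump_bounds[of a b 0 x] by (auto simp: \<phi>_def)
  note tm = test_function_memLp[OF t]
  note [measurable] = memLp_measurable[OF tm(1)] memLp_measurable[OF tm(2)]
  define P where "P = pint M p (grad \<phi>)"
  define Q where "Q = (LINT x|M. \<phi> x powr q)"
  have P: "P \<ge> 0" unfolding P_def by (rule pint_nonneg)
  have iQ: "integrable M (\<lambda>x. \<phi> x powr r)" if "r > 0" for r
    by (rule integrable_const_bound[of _ 1]) (use \<phi>b that in \<open>auto intro!: AE_I2 powr_le1\<close>)
  have Q: "Q > 0"
  proof (rule ccontr)
    assume "\<not> Q > 0"
    moreover have "Q \<ge> 0" by (simp add: Q_def)
    ultimately have "Q = 0" by simp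
    hence "AE x in M. \<phi> x powr q = 0"
      using integral_nonneg_eq_0_iff_AE[OF iQ[of q]] exps(1) by (simp add: Q_def)
    hence "AE x in M. x \<notin> box a b"
      by eventually_elim (use box_bump_nonzero_iff[of a b 0] in \<open>auto simp: \<phi>_def\<close>)
    hence "AE x in lebesgue. x \<in> \<Omega> \<longrightarrow> x \<notin> box a b" using domain_sets by (simp add: AE_restrict_space_iff)
    hence "AE x in lebesgue. x \<notin> box a b" by eventually_elim (use ab(1) box_subset_cbox in blast)
    hence "negligible (box a b)" by (simp add: negligible_iff_null_sets completion.AE_iff_null_sets)
    thus False using open_not_negligible[of "box a b"] ab(2) by auto
  qed
  define L where "L = lam / q * Q"
  have L: "L > 0" using lam Q exps by (simp add: L_def)
  \<comment> \<open>The bounds K and \<delta> give admissibility and access to (H5); the last entry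
    forces (\<eta>2 P + 1) \<epsilon>^(p-q) <= L / 2.\<close>
  define \<epsilon> where "\<epsilon> = min (min K \<delta>) (min 1 ((L / (2 * (\<eta>2 * P + 1))) powr (1 / (p - q))))"
  have D: "\<eta>2 * P + 1 > 0" using H5(1) P by (simp add: add_nonneg_pos)
  have \<epsilon>: "\<epsilon> > 0" "\<epsilon> \<le> K" "\<epsilon> \<le> \<delta>" using K H5(2) L D by (auto simp: \<epsilon>_def)
  have small: "\<eta>2 * P * \<epsilon> powr (p - q) < L"
  proof -
    have "\<epsilon> powr (p - q) \<le> ((L / (2 * (\<eta>2 * P + 1))) powr (1 / (p - q))) powr (p - q)"
      using \<epsilon>(1) exps by (intro powr_mono2) (auto simp: \<epsilon>_def)
    also have "\<dots> = L / (2 * (\<eta>2 * P + 1))" using L D exps by (simp add: powr_powr)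
    finally have "(\<eta>2 * P + 1) * \<epsilon> powr (p - q) \<le> (\<eta>2 * P + 1) * (L / (2 * (\<eta>2 * P + 1)))"
      using D by (intro mult_left_mono) auto
    also have "\<dots> = L / 2"
    proof -
      have "a \<noteq> 0 \<Longrightarrow> a * (L / (2 * a)) = L / 2" for a by simp
      thus ?thesis using D by (metis less_irrefl)
    qed
    finally have "\<eta>2 * P * \<epsilon> powr (p - q) + \<epsilon> powr (p - q) \<le> L / 2" by (simp add: distrib_right)
    moreover have "\<epsilon> powr (p - q) > 0" using \<epsilon> by simp
    moreover have "L / 2 < L" using L by simp
    ultimately show ?thesis by linarith
  qed
  define v where "v x = (\<epsilon> * \<sigma>) * \<phi> x" for x
  define h where "h x = (\<epsilon> * \<sigma>) *\<^sub>R grad \<phi> x" for x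
  have W: "W0 \<Omega> p v h" using W0_lincomb[OF W0_test[OF t] W0_zero, of "\<epsilon> * \<sigma>" 0] by (simp add: v_def[abs_def] h_def[abs_def])
  have sv: "\<sigma> * v x = \<epsilon> * \<phi> x" for x using \<sigma> by (auto simp: v_def)
  have av: "\<bar>v x\<bar> = \<epsilon> * \<phi> x" for x using \<sigma> \<epsilon>(1) \<phi>b[of x] by (auto simp: v_def abs_mult)
  have ve: "\<bar>v x\<bar> \<le> \<epsilon>" for x unfolding av using \<epsilon>(1) \<phi>b[of x] by (simp add: mult_left_le)
  have vK: "AE x in M. \<bar>v x\<bar> \<le> K" using ve \<epsilon>(2) order_trans by (intro AE_I2) blast
  have "(LINT x|M. A x (v x) (h x)) \<le> (LINT x|M. \<eta>2 * \<epsilon> powr p * norm (grad \<phi> x) powr p)"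
  proof (rule integral_mono_AE[OF A_comp_integrable[OF W0_measurable(1)[OF W] vK W0_memLp(2)[OF W]]])
    show "integrable M (\<lambda>x. \<eta>2 * \<epsilon> powr p * norm (grad \<phi> x) powr p)" using memLp_integrable[OF tm(2)] by simp
    show "AE x in M. A x (v x) (h x) \<le> \<eta>2 * \<epsilon> powr p * norm (grad \<phi> x) powr p"
      using H5(3)
    proof eventually_elim
      case (elim x)
      have "\<bar>v x\<bar> \<le> \<delta>" using ve[of x] \<epsilon>(3) by linarith
      hence "A x (v x) (h x) \<le> \<eta>2 * norm (h x) powr p" using elim by blast
      also have "norm (h x) = \<epsilon> * norm (grad \<phi> x)" using \<sigma> \<epsilon>(1) by (auto simp: h_def abs_mult)
      finally show ?case using \<epsilon>(1) by (simp add: powr_mult mult.assoc)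
    qed
  qed
  also have "\<dots> = \<eta>2 * P * \<epsilon> powr p" by (simp add: P_def pint_def)
  finally have upper: "(LINT x|M. A x (v x) (h x)) \<le> \<eta>2 * P * \<epsilon> powr p" .
  have spot: "source_potential lam q s \<sigma> (v x) = (lam / q * \<epsilon> powr q) * \<phi> x powr q + (\<epsilon> powr s / s) * \<phi> x powr s" for x
    using \<epsilon>(1) \<phi>b[of x] by (simp add: source_potential_def sv powr_mult)
  have "L * \<epsilon> powr q = (LINT x|M. (lam / q * \<epsilon> powr q) * \<phi> x powr q)" by (simp add: L_def Q_def)
  also have "\<dots> \<le> (LINT x|M. source_potential lam q s \<sigma> (v x))"
    unfolding spot using iQ[of q] iQ[of s] exps \<epsilon>(1) by (intro integral_mono) auto
  finally have lower: "L * \<epsilon> powr q \<le> (LINT x|M. source_potential lam q s \<sigma> (v x))" .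
  have "\<eta>2 * P * \<epsilon> powr p = (\<eta>2 * P * \<epsilon> powr (p - q)) * \<epsilon> powr q" using \<epsilon>(1) by (simp add: powr_add[symmetric])
  also have "\<dots> < L * \<epsilon> powr q" using small \<epsilon>(1) by (intro mult_strict_right_mono) auto
  finally have "energy (source_potential lam q s \<sigma>) v h < 0" using upper lower unfolding energy_def by linarith
  thus thesis using that[OF W vK] by blast
qed

lemma energy_cong:
  assumes "W0 \<Omega> p u g" "W0 \<Omega> p u h" "AE x in M. g x = h x"
  shows "energy B u g = energy B u h"
proof -
  have "(LINT x|M. A x (u x) (g x)) = (LINT x|M. A x (u x) (h x))"
    by (rule integral_cong_AE)
      (use assms(3) A_comp_measurable(1)[OF W0_measurable[OF assms(1)]] A_comp_measurable(1)[OF W0_measurable[OF assms(2)]]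
        in \<open>auto elim!: eventually_mono\<close>)
  thus ?thesis by (simp add: energy_def)
qed

text \<open>The hypothesis \<open>sup\<close> is the a priori bound specialised to the size of the
  source on |t| <= K; the gap K' < K is the room in which variations of both signs become
  admissible.\<close>

lemma signed_minimizer:
  assumes ne: "\<Omega> \<noteq> {}" and exps: "1 < q" "q < p" "1 < s" and lam: "lam > 0" and K: "K > 0" "K' < K" and \<sigma>: "\<sigma> = 1 \<or> \<sigma> = -1"
    and H5: "\<eta>2 > 0" "\<delta> > 0" "AE x in M. \<forall>t \<xi>. \<bar>t\<bar> \<le> \<delta> \<longrightarrow> A x t \<xi> \<le> \<eta>2 * norm \<xi> powr p"
    and sup: "\<And>w g. W0 \<Omega> p w g \<Longrightarrow>
      (\<And>k. k \<ge> 0 \<Longrightarrow> coercivity * pint M p (\<lambda>x. (if w x > k then 1 else 0) *\<^sub>R g x)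
          \<le> (lam * K powr (q - 1) + K powr (s - 1)) * (LINT x|M. max 0 (w x - k)))
      \<Longrightarrow> AE x in M. w x \<le> K'"
  shows "\<exists>u. W0 \<Omega> p u (weak_grad \<Omega> u) \<and> (AE x in M. \<bar>u x\<bar> \<le> K) \<and> (AE x in M. 0 \<le> \<sigma> * u x) \<and> \<not> (AE x in M. u x = 0) \<and>
    (\<forall>v h R. W0 \<Omega> p v h \<longrightarrow> (AE x in M. \<bar>v x\<bar> \<le> R) \<longrightarrow> variation (source lam q s \<sigma>) u (weak_grad \<Omega> u) v h = 0)"
proof -
  let ?B = "source_potential lam q s \<sigma>" and ?b = "source lam q s \<sigma>"
  note B = DERIV_source_potential[OF exps(1,3)] and b = continuous_source[OF exps(1,3)]
  have Bc: "continuous_on UNIV ?B"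
    using DERIV_isCont[OF B] by (auto intro!: continuous_at_imp_continuous_on)
  obtain u g where u0: "W0 \<Omega> p u g" "AE x in M. \<bar>u x\<bar> \<le> K"
    and min0: "\<And>v h. W0 \<Omega> p v h \<Longrightarrow> AE x in M. \<bar>v x\<bar> \<le> K \<Longrightarrow> energy ?B u g \<le> energy ?B v h"
    by (rule energy_minimizer_exists[OF Bc less_imp_le[OF K(1)]], rule that, assumption+)
  \<comment> \<open>The notion of solution refers to \<open>weak_grad\<close>. It agrees with g
    almost everywhere, so energy and minimality carry over.\<close>
  define G where "G = weak_grad \<Omega> u"
  have u: "W0 \<Omega> p u G" unfolding G_def by (rule W1p_0_imp_W0[OF W0_imp_W1p_0[OF u0(1)]])
  have eG: "energy ?B u G = energy ?B u g"
    by (rule energy_cong[OF u u0(1)]) (use W0_weak_grad[OF u0(1)] in \<open>simp add: G_def\<close>)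
  have min: "energy ?B u G \<le> energy ?B v h" if "W0 \<Omega> p v h" "AE x in M. \<bar>v x\<bar> \<le> K" for v h
    using min0[OF that] eG by simp
  have ss: "\<sigma> * \<sigma> = 1" using \<sigma> by auto
  have Wu: "W0 \<Omega> p (\<lambda>x. \<tau> * u x) (\<lambda>x. \<tau> *\<^sub>R G x)" for \<tau> using W0_lincomb[OF u W0_zero, of \<tau> 0] by simp
  have upper: "AE x in M. \<sigma> * u x \<le> K'"
  proof (rule sup[OF Wu])
    fix k :: real assume k: "k \<ge> 0"
    have "coercivity * pint M p (\<lambda>x. (if \<sigma> * u x > k then 1 else 0) *\<^sub>R G x)
        \<le> (lam * K powr (q - 1) + K powr (s - 1)) * (LINT x|M. max 0 (\<sigma> * u x - k))"
      by (rule truncation_estimate[OF B b u u0(2) min \<sigma> k]) (use source_bound[OF \<sigma> _ exps(1,3) lam] in auto)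
    moreover have "pint M p (\<lambda>x. (if \<sigma> * u x > k then 1 else 0) *\<^sub>R (\<sigma> *\<^sub>R G x)) = pint M p (\<lambda>x. (if \<sigma> * u x > k then 1 else 0) *\<^sub>R G x)"
      unfolding pint_def using \<sigma> by auto
    ultimately show "coercivity * pint M p (\<lambda>x. (if \<sigma> * u x > k then 1 else 0) *\<^sub>R (\<sigma> *\<^sub>R G x))
        \<le> (lam * K powr (q - 1) + K powr (s - 1)) * (LINT x|M. max 0 (\<sigma> * u x - k))" by simp
  qed
  \<comment> \<open>The truncation estimate with -\<sigma> at level 0: the source vanishes on that
    side, so F = 0 is allowed. The part of the wrong sign then has zero gradient and
    vanishes.\<close>
  have sign: "AE x in M. 0 \<le> \<sigma> * u x"
  proof -
    define H where "H x = (if - \<sigma> * u x > 0 then 1 else 0) *\<^sub>R ((- \<sigma>) *\<^sub>R G x)" for x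
    have W: "W0 \<Omega> p (\<lambda>x. max 0 (- \<sigma> * u x - 0)) H"
      unfolding H_def by (rule W0_pos_part[OF Wu]) simp
    have "coercivity * pint M p (\<lambda>x. (if - \<sigma> * u x > 0 then 1 else 0) *\<^sub>R G x) \<le> 0 * (LINT x|M. max 0 (- \<sigma> * u x - 0))"
    proof (rule truncation_estimate[OF B b u u0(2) min])
      fix t :: real assume "0 < - \<sigma> * t"
      hence "max 0 (\<sigma> * t) = 0" by simp
      thus "- \<sigma> * ?b t \<le> 0" by (simp add: source_def)
    qed (use \<sigma> in auto)
    moreover have "pint M p H = pint M p (\<lambda>x. (if - \<sigma> * u x > 0 then 1 else 0) *\<^sub>R G x)"
      unfolding pint_def H_def using \<sigma> by auto
    ultimately have "coercivity * pint M p H \<le> 0" by simp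
    hence "pint M p H \<le> 0" using coercivity_pos by (simp add: mult_le_0_iff)
    hence "pint M p H = 0" using pint_nonneg[of M p H] by simp
    hence "AE x in M. norm (H x) powr p = 0"
      using integral_nonneg_eq_0_iff_AE[OF memLp_integrable[OF W0_memLp(2)[OF W]]] by (simp add: pint_def)
    hence "AE x in M. H x = 0" by eventually_elim simp
    from W0_zero_gradient[OF W this] show ?thesis
    proof eventually_elim
      case (elim x)
      thus ?case using max.cobounded2[of "- \<sigma> * u x - 0" 0] by simp
    qed
  qed
  \<comment> \<open>At u = 0 the potential vanishes and A is nonnegative, so the energy could not be
    negative.\<close>
  have nontrivial: "\<not> (AE x in M. u x = 0)"
  proof
    assume z: "AE x in M. u x = 0"
    obtain v h where v: "W0 \<Omega> p v h" "AE x in M. \<bar>v x\<bar> \<le> K" "energy ?B v h < 0"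
      by (rule negative_energy[OF ne exps lam K(1) \<sigma> H5], rule that, assumption+)
    have "energy ?B u G < 0" using min[OF v(1,2)] v(3) by linarith
    moreover have "(LINT x|M. ?B (u x)) = (LINT x|M. 0)"
    proof (rule integral_cong_AE)
      show "(\<lambda>x. ?B (u x)) \<in> borel_measurable M"
        using bounded_comp_integrable[OF Bc W0_measurable(1)[OF u] u0(2)] by (rule borel_measurable_integrable)
      show "AE x in M. ?B (u x) = 0" using z by eventually_elim (simp add: source_potential_def)
    qed simp
    moreover have "0 \<le> (LINT x|M. A x (u x) (G x))"
      by (rule integral_nonneg_AE) (use A_nonneg in \<open>auto elim!: eventually_mono\<close>)
    ultimately show False by (simp add: energy_def)
  qed
  have vi: "0 \<le> variation ?b u G v h" if W: "W0 \<Omega> p v h" and R: "AE x in M. \<bar>v x\<bar> \<le> R" for v h R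
  proof -
    have R': "AE x in M. \<bar>v x\<bar> \<le> \<bar>R\<bar>" using R by eventually_elim simp
    \<comment> \<open>By the upper bound and the sign, |u| <= max 0 K'. Steps of size at most d in a
      direction bounded by |R| use up no more than the remaining room; the summand 1 covers R =
      0.\<close>
    define d where "d = (K - max 0 K') / (\<bar>R\<bar> + 1)"
    have d: "d > 0" using K by (auto simp: d_def intro!: divide_pos_pos)
    obtain N where N: "inverse (real (Suc N)) < d" using reals_Archimedean[OF d] by blast
    show ?thesis
    proof (rule variational_inequality[OF B b u u0(2) min W R', of N])
      fix n assume n: "n \<ge> N"
      have nd: "1 / real (Suc n) \<le> d"
      proof -
        have "1 / real (Suc n) \<le> inverse (real (Suc N))" using n by (simp add: inverse_eq_divide frac_le)
        thus ?thesis using N by linarith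
      qed
      show "AE x in M. \<bar>u x + 1 / real (Suc n) * v x\<bar> \<le> K"
        using upper sign R'
      proof eventually_elim
        case (elim x)
        have au: "\<bar>u x\<bar> \<le> max 0 K'" using elim(1,2) \<sigma> by auto
        have "\<bar>1 / real (Suc n) * v x\<bar> = 1 / real (Suc n) * \<bar>v x\<bar>" by (simp add: abs_mult)
        also have "\<dots> \<le> d * (\<bar>R\<bar> + 1)" using nd elim(3) less_imp_le[OF d] by (intro mult_mono) auto
        also have "\<dots> = K - max 0 K'" by (simp add: d_def add_nonneg_pos less_imp_neq[symmetric])
        finally show ?case using au by linarith
      qed
    qed (assumption | rule abs_ge_zero)+
  qed
  have "variation ?b u G v h = 0" if W: "W0 \<Omega> p v h" and R: "AE x in M. \<bar>v x\<bar> \<le> R" for v h R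
  proof (rule antisym)
    have "0 \<le> variation ?b u G (\<lambda>x. - v x) (\<lambda>x. - h x)" by (rule vi[OF W0_uminus[OF W], of R]) (use R in simp)
    thus "variation ?b u G v h \<le> 0" by (simp add: variation_uminus)
  qed (rule vi[OF W R])
  thus ?thesis using u u0(2) sign nontrivial unfolding G_def by blast
qed

lemma weak_bounded_solution_if_variation_zero:
  assumes u: "W0 \<Omega> p u (weak_grad \<Omega> u)" "AE x in M. \<bar>u x\<bar> \<le> K" and \<sigma>: "\<sigma> = 1 \<or> \<sigma> = -1" and sign: "AE x in M. 0 \<le> \<sigma> * u x"
    and exps: "1 < q" "1 < s"
    and var: "\<And>v h R. W0 \<Omega> p v h \<Longrightarrow> AE x in M. \<bar>v x\<bar> \<le> R \<Longrightarrow> variation (source lam q s \<sigma>) u (weak_grad \<Omega> u) v h = 0"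
  shows "weak_bounded_solution \<Omega> p q s A lam u"
  unfolding weak_bounded_solution_def
proof (intro conjI ballI)
  interpret finite_measure M by (rule finite_M)
  note [measurable] = W0_measurable[OF u(1)]
  show "u \<in> X_space \<Omega> p"
    using W0_imp_W1p_0[OF u(1)] W0_measurable(1)[OF u(1)] u(2) by (auto simp: X_space_def L_infty_def)
  fix v assume "v \<in> X_space \<Omega> p"
  then obtain R where v: "v \<in> W1p_0 \<Omega> p" and R: "AE x in M. \<bar>v x\<bar> \<le> R"
    by (auto simp: X_space_def L_infty_def)
  note W = W1p_0_imp_W0[OF v]
  note [measurable] = W0_measurable[OF W]
  show i1: "integrable M (\<lambda>x. A_xi A x (u x) (weak_grad \<Omega> u x) \<bullet> weak_grad \<Omega> v x)"
    and i2: "integrable M (\<lambda>x. A_t A x (u x) (weak_grad \<Omega> u x) * v x)"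
    using variation_integrable[OF u W R] by auto
  \<comment> \<open>For r < 2 the factor |u|^(r-2) is singular near u = 0, but times |u| it is
    |u|^(r-1), which is bounded; at u = 0 the product is 0.\<close>
  have ip: "integrable M (\<lambda>x. \<bar>u x\<bar> powr (r - 2) * u x * v x)" if r: "1 < r" for r
  proof (rule integrable_const_bound)
    show "AE x in M. norm (\<bar>u x\<bar> powr (r - 2) * u x * v x) \<le> K powr (r - 1) * R"
      using u(2) R
    proof eventually_elim
      case (elim x)
      have "\<bar>u x\<bar> powr (r - 2) * \<bar>u x\<bar> = \<bar>u x\<bar> powr (r - 1)"
        using powr_add[of "\<bar>u x\<bar>" "r - 2" 1] by (cases "u x = 0") auto
      also have "\<dots> \<le> K powr (r - 1)" using elim r by (intro powr_mono2) auto
      finally have "\<bar>u x\<bar> powr (r - 2) * \<bar>u x\<bar> \<le> K powr (r - 1)" .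
      thus ?case using elim(2) unfolding real_norm_def abs_mult by (intro mult_mono) auto
    qed
  qed measurable
  show i3: "integrable M (\<lambda>x. \<bar>u x\<bar> powr (q - 2) * u x * v x)" by (rule ip[OF exps(1)])
  show i4: "integrable M (\<lambda>x. \<bar>u x\<bar> powr (s - 2) * u x * v x)" by (rule ip[OF exps(2)])
  have "(LINT x|M. source lam q s \<sigma> (u x) * v x) =
      (LINT x|M. lam * (\<bar>u x\<bar> powr (q - 2) * u x * v x) + \<bar>u x\<bar> powr (s - 2) * u x * v x)"
  proof (rule integral_cong_AE)
    have [measurable]: "source lam q s \<sigma> \<in> borel_measurable borel"
      by (rule borel_measurable_continuous_onI[OF continuous_source[OF exps]])
    show "(\<lambda>x. source lam q s \<sigma> (u x) * v x) \<in> borel_measurable M" by measurable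
    show "AE x in M. source lam q s \<sigma> (u x) * v x = lam * (\<bar>u x\<bar> powr (q - 2) * u x * v x) + \<bar>u x\<bar> powr (s - 2) * u x * v x"
      using sign by eventually_elim (simp add: source_eq[OF \<sigma>] algebra_simps)
  qed measurable
  also have "\<dots> = lam * (LINT x|M. \<bar>u x\<bar> powr (q - 2) * u x * v x) + (LINT x|M. \<bar>u x\<bar> powr (s - 2) * u x * v x)"
    using i3 i4 by simp
  finally show "(LINT x|M. A_xi A x (u x) (weak_grad \<Omega> u x) \<bullet> weak_grad \<Omega> v x)
        + (LINT x|M. A_t A x (u x) (weak_grad \<Omega> u x) * v x)
        - lam * (LINT x|M. \<bar>u x\<bar> powr (q - 2) * u x * v x)
        - (LINT x|M. \<bar>u x\<bar> powr (s - 2) * u x * v x) = 0"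
    using var[OF W R] unfolding variation_def by simp
qed

text \<open>The constraint is inactive as soon as C F^(1/(p-1)) < K, that is F < (K/C)^(p-1).
  Neither K nor \<open>lam1\<close> depends on \<sigma> or on the individual \<lambda>, so one range
  of \<lambda> serves both signs.\<close>

lemma signed_solution_exists:
  assumes ne: "\<Omega> \<noteq> {}" and exps: "1 < q" "q < p" "p < s"
    and H5: "\<eta>2 > 0" "\<delta> > 0" "AE x in M. \<forall>t \<xi>. \<bar>t\<bar> \<le> \<delta> \<longrightarrow> A x t \<xi> \<le> \<eta>2 * norm \<xi> powr p"
  shows "\<exists>lam1>0. \<forall>lam\<in>{0<..lam1}. \<forall>\<sigma>. \<sigma> = 1 \<or> \<sigma> = -1 \<longrightarrow>
    (\<exists>u. weak_bounded_solution \<Omega> p q s A lam u \<and> (AE x in M. 0 \<le> \<sigma> * u x) \<and> \<not> (AE x in M. u x = 0))"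
proof -
  obtain C where C: "C > 0" and bound: "\<forall>w g F. W0 \<Omega> p w g \<longrightarrow> F > 0 \<longrightarrow>
    (\<forall>k\<ge>0. coercivity * pint M p (\<lambda>x. (if w x > k then 1 else 0) *\<^sub>R g x) \<le> F * (LINT x|M. max 0 (w x - k)))
    \<longrightarrow> (AE x in M. w x \<le> C * F powr (1 / (p - 1)))"
    using sup_bound by blast
  \<comment> \<open>D K^(p-1) is a quarter of (K/C)^(p-1). The choice K^(s-p) = D makes the s-term
    of F equal to it, and \<lambda> <= D K^(p-q) keeps the q-term below it, so F is at most half of
    what is allowed.\<close>
  define D where "D = C powr (1 - p) / 4"
  have D: "D > 0" using C by (simp add: D_def)
  define K where "K = D powr (1 / (s - p))"
  define lam1 where "lam1 = D * K powr (p - q)"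
  have K: "K > 0" using D by (simp add: K_def)
  have s1: "1 < s" using exps by simp
  have Ks: "K powr (s - 1) = D * K powr (p - 1)"
  proof -
    have "K powr (s - p) = D" using D exps by (simp add: K_def powr_powr)
    moreover have "K powr (s - 1) = K powr (s - p) * K powr (p - 1)" by (simp add: powr_add[symmetric])
    ultimately show ?thesis by simp
  qed
  have main: "\<exists>u. weak_bounded_solution \<Omega> p q s A lam u \<and> (AE x in M. 0 \<le> \<sigma> * u x) \<and> \<not> (AE x in M. u x = 0)"
    if lam: "0 < lam" "lam \<le> lam1" and \<sigma>: "\<sigma> = 1 \<or> \<sigma> = -1" for lam \<sigma>
  proof -
    define F where "F = lam * K powr (q - 1) + K powr (s - 1)"
    have F: "F > 0" using lam K by (simp add: F_def add_pos_pos)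
    define K' where "K' = C * F powr (1 / (p - 1))"
    have "lam * K powr (q - 1) \<le> lam1 * K powr (q - 1)" using lam by (intro mult_right_mono) auto
    also have "\<dots> = D * K powr (p - 1)" by (simp add: lam1_def mult.assoc powr_add[symmetric])
    finally have "F \<le> 2 * D * K powr (p - 1)" unfolding F_def Ks by simp
    also have "\<dots> = (K / C) powr (p - 1) / 2"
      using K C by (simp add: D_def powr_divide powr_minus_divide powr_diff field_simps)
    also have "\<dots> < (K / C) powr (p - 1)" using K C by simp
    finally have "F powr (1 / (p - 1)) < ((K / C) powr (p - 1)) powr (1 / (p - 1))"
      using F p_gt_1 by (intro powr_less_mono2) auto
    also have "\<dots> = K / C" using K C p_gt_1 by (simp add: powr_powr)
    finally have K': "K' < K" using C by (simp add: K'_def field_simps)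
    have "\<exists>u. W0 \<Omega> p u (weak_grad \<Omega> u) \<and> (AE x in M. \<bar>u x\<bar> \<le> K) \<and> (AE x in M. 0 \<le> \<sigma> * u x) \<and> \<not> (AE x in M. u x = 0) \<and>
      (\<forall>v h R. W0 \<Omega> p v h \<longrightarrow> (AE x in M. \<bar>v x\<bar> \<le> R) \<longrightarrow> variation (source lam q s \<sigma>) u (weak_grad \<Omega> u) v h = 0)"
    proof (rule signed_minimizer[OF ne exps(1,2) s1 lam(1) K K' \<sigma> H5])
      fix w g assume w: "W0 \<Omega> p w g" "\<And>k. k \<ge> 0 \<Longrightarrow> coercivity * pint M p (\<lambda>x. (if w x > k then 1 else 0) *\<^sub>R g x)
          \<le> (lam * K powr (q - 1) + K powr (s - 1)) * (LINT x|M. max 0 (w x - k))"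
      show "AE x in M. w x \<le> K'" unfolding K'_def by (rule bound[rule_format, OF w(1) F]) (use w(2) in \<open>simp add: F_def\<close>)
    qed
    then obtain u where u: "W0 \<Omega> p u (weak_grad \<Omega> u)" "AE x in M. \<bar>u x\<bar> \<le> K" "AE x in M. 0 \<le> \<sigma> * u x" "\<not> (AE x in M. u x = 0)"
      and var: "\<forall>v h R. W0 \<Omega> p v h \<longrightarrow> (AE x in M. \<bar>v x\<bar> \<le> R) \<longrightarrow> variation (source lam q s \<sigma>) u (weak_grad \<Omega> u) v h = 0"
      by (elim exE conjE)
    have "weak_bounded_solution \<Omega> p q s A lam u"
      by (rule weak_bounded_solution_if_variation_zero[OF u(1,2) \<sigma> u(3) exps(1) s1]) (use var in blast)
    thus ?thesis using u(3,4) by blast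
  qed
  have "lam1 > 0" using D K by (simp add: lam1_def)
  thus ?thesis using main by (intro exI[of _ lam1]) auto
qed

end

section \<open>The positive and the negative solution\<close>

theorem theorem2p6:
  fixes \<Omega> :: "(real ^ 'n) set"
    and A :: "real ^ 'n \<Rightarrow> real \<Rightarrow> real ^ 'n \<Rightarrow> real"
    and p q s :: real
  assumes dim: "CARD('n) \<ge> 2"
    and domain: "open \<Omega>" "connected \<Omega>" "bounded \<Omega>" "\<Omega> \<noteq> {}"
    and exponents: "1 < q" "q < p" "p < s" "ereal s < critical_exponent CARD('n) p"
    and H0: "\<And>t \<xi>. (\<lambda>x. A x t \<xi>) \<in> borel_measurable (lebesgue_on \<Omega>)"
            "AE x in lebesgue_on \<Omega>. C1 (\<lambda>(t, \<xi>). A x t \<xi>)"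
    and H1: "\<exists>\<Phi>1 \<phi>1 \<Phi>2 \<phi>2 :: real \<Rightarrow> real.
              continuous_on UNIV \<Phi>1 \<and> continuous_on UNIV \<phi>1 \<and>
              continuous_on UNIV \<Phi>2 \<and> continuous_on UNIV \<phi>2 \<and>
              (\<forall>t. \<Phi>1 t > 0 \<and> \<phi>1 t > 0 \<and> \<Phi>2 t > 0 \<and> \<phi>2 t > 0) \<and>
              (AE x in lebesgue_on \<Omega>. \<forall>t \<xi>.
                 \<bar>A_t A x t \<xi>\<bar> \<le> \<Phi>1 t + \<phi>1 t * norm \<xi> powr p \<and>
                 norm (A_xi A x t \<xi>) \<le> \<Phi>2 t + \<phi>2 t * norm \<xi> powr (p - 1))"
    and H2: "\<exists>\<alpha>1>0. AE x in lebesgue_on \<Omega>. \<forall>t \<xi>. A x t \<xi> \<ge> \<alpha>1 * norm \<xi> powr p"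
    and H3: "\<exists>\<eta>1>0. AE x in lebesgue_on \<Omega>. \<forall>t \<xi>. A x t \<xi> \<le> \<eta>1 * (A_xi A x t \<xi> \<bullet> \<xi>)"
    and H4: "\<exists>\<alpha>2>0. AE x in lebesgue_on \<Omega>. \<forall>t \<xi>.
               A_xi A x t \<xi> \<bullet> \<xi> + A_t A x t \<xi> * t \<ge> \<alpha>2 * (A_xi A x t \<xi> \<bullet> \<xi>)"
    and H5: "\<exists>\<eta>2>0. \<exists>\<delta>>0. AE x in lebesgue_on \<Omega>. \<forall>t \<xi>.
               \<bar>t\<bar> \<le> \<delta> \<longrightarrow> A x t \<xi> \<le> \<eta>2 * norm \<xi> powr p"
    and H6: "\<And>\<xi> \<xi>'. \<xi> \<noteq> \<xi>' \<Longrightarrow>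
               AE x in lebesgue_on \<Omega>. \<forall>t. (A_xi A x t \<xi> - A_xi A x t \<xi>') \<bullet> (\<xi> - \<xi>') > 0"
  shows "\<exists>lam1>0. \<forall>lam\<in>{0<..lam1}. \<exists>u v.
           weak_bounded_solution \<Omega> p q s A lam u \<and> positive_on \<Omega> u \<and>
           weak_bounded_solution \<Omega> p q s A lam v \<and> negative_on \<Omega> v \<and>
           \<not> (AE x in lebesgue_on \<Omega>. u x = v x)"
proof -
  obtain \<alpha>1 where \<alpha>1: "\<alpha>1 > 0" "AE x in lebesgue_on \<Omega>. \<forall>t \<xi>. A x t \<xi> \<ge> \<alpha>1 * norm \<xi> powr p" using H2 by blast
  obtain \<eta>1 where \<eta>1: "\<eta>1 > 0" "AE x in lebesgue_on \<Omega>. \<forall>t \<xi>. A x t \<xi> \<le> \<eta>1 * (A_xi A x t \<xi> \<bullet> \<xi>)" using H3 by blast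
  obtain \<alpha>2 where \<alpha>2: "\<alpha>2 > 0" "AE x in lebesgue_on \<Omega>. \<forall>t \<xi>.
    A_xi A x t \<xi> \<bullet> \<xi> + A_t A x t \<xi> * t \<ge> \<alpha>2 * (A_xi A x t \<xi> \<bullet> \<xi>)" using H4 by blast
  obtain \<eta>2 \<delta> where \<delta>: "\<eta>2 > 0" "\<delta> > 0" "AE x in lebesgue_on \<Omega>. \<forall>t \<xi>.
               \<bar>t\<bar> \<le> \<delta> \<longrightarrow> A x t \<xi> \<le> \<eta>2 * norm \<xi> powr p" using H5 by blast
  obtain \<Phi>1 \<phi>1 \<Phi>2 \<phi>2 :: "real \<Rightarrow> real" where cont: "continuous_on UNIV \<Phi>1" "continuous_on UNIV \<phi>1"
      "continuous_on UNIV \<Phi>2" "continuous_on UNIV \<phi>2"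
    and gr: "AE x in lebesgue_on \<Omega>. \<forall>t \<xi>.
                 \<bar>A_t A x t \<xi>\<bar> \<le> \<Phi>1 t + \<phi>1 t * norm \<xi> powr p \<and>
                 norm (A_xi A x t \<xi>) \<le> \<Phi>2 t + \<phi>2 t * norm \<xi> powr (p - 1)" using H1 by (elim exE conjE)
  interpret quasilinear \<Omega> p A \<alpha>1 \<alpha>2 \<eta>1
  proof unfold_locales
    \<comment> \<open>The continuous coefficients of (H1) are bounded on [-R, R], and the sum of the
      four bounds serves as the constant in \<open>growth\<close>.\<close>
    fix R :: real
    obtain c1 where c1: "c1 \<ge> 0" "\<And>t. \<bar>t\<bar> \<le> R \<Longrightarrow> \<bar>\<Phi>1 t\<bar> \<le> c1"
      by (rule continuous_bounded_on_interval[OF cont(1)], rule that, assumption+)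
    obtain c2 where c2: "c2 \<ge> 0" "\<And>t. \<bar>t\<bar> \<le> R \<Longrightarrow> \<bar>\<phi>1 t\<bar> \<le> c2"
      by (rule continuous_bounded_on_interval[OF cont(2)], rule that, assumption+)
    obtain c3 where c3: "c3 \<ge> 0" "\<And>t. \<bar>t\<bar> \<le> R \<Longrightarrow> \<bar>\<Phi>2 t\<bar> \<le> c3"
      by (rule continuous_bounded_on_interval[OF cont(3)], rule that, assumption+)
    obtain c4 where c4: "c4 \<ge> 0" "\<And>t. \<bar>t\<bar> \<le> R \<Longrightarrow> \<bar>\<phi>2 t\<bar> \<le> c4"
      by (rule continuous_bounded_on_interval[OF cont(4)], rule that, assumption+)
    define C where "C = c1 + c2 + c3 + c4"
    have C: "c1 \<le> C" "c2 \<le> C" "c3 \<le> C" "c4 \<le> C" "0 \<le> C" using c1 c2 c3 c4 by (auto simp: C_def)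
    have "AE x in lebesgue_on \<Omega>. \<forall>t \<xi>. \<bar>t\<bar> \<le> R \<longrightarrow>
        \<bar>A_t A x t \<xi>\<bar> \<le> C * (1 + norm \<xi> powr p) \<and> norm (A_xi A x t \<xi>) \<le> C * (1 + norm \<xi> powr (p - 1))"
      using gr
    proof eventually_elim
      case (elim x)
      show ?case
      proof (intro allI impI)
        fix t :: real and \<xi> :: "real ^ 'n" assume t: "\<bar>t\<bar> \<le> R"
        have "\<Phi>1 t + \<phi>1 t * norm \<xi> powr p \<le> C + C * norm \<xi> powr p"
          using c1(2)[OF t, THEN abs_le_D1] c2(2)[OF t, THEN abs_le_D1] C by (intro add_mono mult_right_mono) auto
        moreover have "\<Phi>2 t + \<phi>2 t * norm \<xi> powr (p - 1) \<le> C + C * norm \<xi> powr (p - 1)"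
          using c3(2)[OF t, THEN abs_le_D1] c4(2)[OF t, THEN abs_le_D1] C by (intro add_mono mult_right_mono) auto
        ultimately show "\<bar>A_t A x t \<xi>\<bar> \<le> C * (1 + norm \<xi> powr p) \<and> norm (A_xi A x t \<xi>) \<le> C * (1 + norm \<xi> powr (p - 1))"
          using elim[rule_format, of t \<xi>] unfolding distrib_left mult_1_right by linarith
      qed
    qed
    thus "\<exists>C\<ge>0. AE x in lebesgue_on \<Omega>. \<forall>t \<xi>. \<bar>t\<bar> \<le> R \<longrightarrow>
        \<bar>A_t A x t \<xi>\<bar> \<le> C * (1 + norm \<xi> powr p) \<and> norm (A_xi A x t \<xi>) \<le> C * (1 + norm \<xi> powr (p - 1))"
      using C(5) by blast
  qed (use domain exponents H0 \<alpha>1 \<eta>1 \<alpha>2 H6 in auto)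
  obtain lam1 where lam1: "lam1 > 0" and sol: "\<And>lam \<sigma>. lam \<in> {0<..lam1} \<Longrightarrow> \<sigma> = 1 \<or> \<sigma> = -1 \<Longrightarrow>
    \<exists>u. weak_bounded_solution \<Omega> p q s A lam u \<and> (AE x in M. 0 \<le> \<sigma> * u x) \<and> \<not> (AE x in M. u x = 0)"
    using signed_solution_exists[OF domain(4) exponents(1-3) \<delta>] by blast
  show ?thesis
  proof (intro exI[of _ lam1] conjI lam1 ballI)
    fix lam assume lam: "lam \<in> {0<..lam1}"
    obtain u where u: "weak_bounded_solution \<Omega> p q s A lam u" "AE x in M. 0 \<le> 1 * u x" "\<not> (AE x in M. u x = 0)"
      using sol[OF lam, of 1] by blast
    obtain v where v: "weak_bounded_solution \<Omega> p q s A lam v" "AE x in M. 0 \<le> -1 * v x" "\<not> (AE x in M. v x = 0)"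
      using sol[OF lam, of "-1"] by blast
    have "\<not> (AE x in M. u x = v x)"
    proof
      assume "AE x in M. u x = v x"
      hence "AE x in M. u x = 0" using u(2) v(2) by eventually_elim simp
      thus False using u(3) by contradiction
    qed
    thus "\<exists>u v. weak_bounded_solution \<Omega> p q s A lam u \<and> positive_on \<Omega> u \<and>
           weak_bounded_solution \<Omega> p q s A lam v \<and> negative_on \<Omega> v \<and> \<not> (AE x in M. u x = v x)"
      using u v unfolding positive_on_def negative_on_def by (intro exI[of _ u] exI[of _ v]) auto
  qed
qed

end
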